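(* Let $V$ and $W$ be cyclotomic-free representations of $G_K$ and let $f\colon V\to W$ be a morphism of $G_{K_\infty}$-representations (i.e. an $\overline{\mathbb{F}}_p$-linear $G_{K_\infty}$-equivariant map). Then $f$ is $G_K$-equivariant.
   Context: $p$ is a prime, $K/\mathbb{Q}_p$ is a finite extension with absolute Galois group $G_K$, $\pi\in K$ is a uniformiser, and $(\pi^{1/p^n})_{n\ge 0}$ is a fixed compatible system of $p^n$-th roots of $\pi$ in an algebraic closure ($(\pi^{1/p^{n+1}})^p=\pi^{1/p^n}$). Put $K_\infty=\bigcup_n K(\pi^{1/p^n})$, with absolute Galois group $G_{K_\infty}\subset G_K$. For a topological group $G$, $\operatorname{Rep}(G)$ is the category of continuous representations of $G$ on finite dimensional $\overline{\mathbb{F}}_p$-vector spaces. $\overline{\mathbb{F}}_p(1)$ is the one-dimensional representation on which $G_K$ acts by the mod $p$ cyclotomic character. $V\in\operatorname{Rep}(G_K)$ is cyclotomic-free if it admits a composition series $0=V_n\subset\dots\subset V_0=V$ such that, for every $i$, $V_i/V_{i+1}\otimes\overline{\mathbb{F}}_p(1)$ is not a Jordan--Hölder factor of $V_{i+1}$. *)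

theory Defs
  imports
    "HOL-Analysis.Product_Topology"
    "HOL-Library.Set_Algebras"
    "HOL-Computational_Algebra.Computational_Algebra"
    "Berlekamp_Zassenhaus.Finite_Field"
begin

section \<open>The field of p-adic numbers\<close>

text \<open>
  The ring of p-adic integers is the inverse limit of the rings of integers modulo \<open>p ^ n\<close>,
  each represented by \<open>{0..<p ^ n}\<close>; the prime \<open>p\<close> is the cardinality of the type \<open>'p\<close>.
\<close>

abbreviation pint :: "'p itself \<Rightarrow> int" where
  "pint (_ :: 'p itself) \<equiv> int CARD('p)"

lemma pint_gt_1: "pint TYPE('p::prime_card) > 1"
  using prime_card prime_gt_1_nat by (metis of_nat_1 of_nat_less_iff)

definition coherent :: "'p itself \<Rightarrow> (nat \<Rightarrow> int) \<Rightarrow> bool" where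
  "coherent p x \<longleftrightarrow> (\<forall>n. 0 \<le> x n \<and> x n < pint p ^ n \<and> x (Suc n) mod pint p ^ n = x n)"

typedef (overloaded) 'p padic_int = "{x. coherent TYPE('p::prime_card) x}"
proof (rule exI)
  show "(\<lambda>_. 0) \<in> {x. coherent TYPE('p) x}"
    using pint_gt_1[where ?'p = 'p] by (simp add: coherent_def)
qed

setup_lifting type_definition_padic_int

lemma coherent_reduce:
  assumes "\<And>n. f (Suc n) mod pint TYPE('p) ^ n = f n mod pint TYPE('p) ^ n"
  shows "coherent TYPE('p::prime_card) (\<lambda>n. f n mod pint TYPE('p) ^ n)"
proof -
  have "pint TYPE('p) ^ n > 0" for n
    using pint_gt_1[where ?'p = 'p] by simp
  moreover have "f (Suc n) mod pint TYPE('p) ^ Suc n mod pint TYPE('p) ^ n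
      = f n mod pint TYPE('p) ^ n" for n
    using assms[of n] by (simp add: mod_mod_cancel)
  ultimately show ?thesis
    unfolding coherent_def by auto
qed

lemma coherent_mod_Suc:
  assumes "coherent TYPE('p::prime_card) x"
  shows "x (Suc n) mod pint TYPE('p) ^ n = x n mod pint TYPE('p) ^ n"
  using assms by (auto simp: coherent_def)

lemma coherent_mod_self:
  assumes "coherent TYPE('p::prime_card) x"
  shows "x n mod pint TYPE('p) ^ n = x n"
  using assms by (auto simp: coherent_def)

instantiation padic_int :: (prime_card) comm_ring_1
begin

lift_definition zero_padic_int :: "'a padic_int" is "\<lambda>n. 0 mod pint TYPE('a) ^ n"
  by (rule coherent_reduce) simp

lift_definition one_padic_int :: "'a padic_int" is "\<lambda>n. 1 mod pint TYPE('a) ^ n"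
  by (rule coherent_reduce) simp

lift_definition plus_padic_int :: "'a padic_int \<Rightarrow> 'a padic_int \<Rightarrow> 'a padic_int"
  is "\<lambda>x y n. (x n + y n) mod pint TYPE('a) ^ n"
  by (rule coherent_reduce) (intro mod_add_cong coherent_mod_Suc)

lift_definition uminus_padic_int :: "'a padic_int \<Rightarrow> 'a padic_int"
  is "\<lambda>x n. (- x n) mod pint TYPE('a) ^ n"
  by (rule coherent_reduce) (intro mod_minus_cong coherent_mod_Suc)

lift_definition minus_padic_int :: "'a padic_int \<Rightarrow> 'a padic_int \<Rightarrow> 'a padic_int"
  is "\<lambda>x y n. (x n - y n) mod pint TYPE('a) ^ n"
  by (rule coherent_reduce) (intro mod_diff_cong coherent_mod_Suc)

lift_definition times_padic_int :: "'a padic_int \<Rightarrow> 'a padic_int \<Rightarrow> 'a padic_int"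
  is "\<lambda>x y n. (x n * y n) mod pint TYPE('a) ^ n"
  by (rule coherent_reduce) (intro mod_mult_cong coherent_mod_Suc)

instance
proof
  fix a b c :: "'a padic_int"
  show "a * b * c = a * (b * c)"
    by transfer (simp add: mod_simps mult.assoc)
  show "a * b = b * a"
    by transfer (simp add: mult.commute)
  show "1 * a = a"
    by transfer (simp add: mod_simps coherent_mod_self)
  show "a + b + c = a + (b + c)"
    by transfer (simp add: mod_simps add.assoc)
  show "a + b = b + a"
    by transfer (simp add: add.commute)
  show "0 + a = a"
    by transfer (simp add: mod_simps coherent_mod_self)
  show "- a + a = 0"
    by transfer (simp add: mod_simps)
  show "a - b = a + - b"
    by transfer (simp add: mod_simps)
  show "(a + b) * c = a * c + b * c"
    by transfer (simp add: mod_simps distrib_right)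
  show "(0 :: 'a padic_int) \<noteq> 1"
  proof
    assume "(0 :: 'a padic_int) = 1"
    then have "(\<lambda>n. 0 mod pint TYPE('a) ^ n) = (\<lambda>n. 1 mod pint TYPE('a) ^ n)"
      by transfer
    then have "0 mod pint TYPE('a) ^ 1 = 1 mod pint TYPE('a) ^ 1"
      by (rule fun_cong)
    then show False
      using pint_gt_1[where ?'p = 'a] by simp
  qed
qed

end

lemma coherent_mod_add:
  assumes "coherent TYPE('p::prime_card) x"
  shows "x (m + k) mod pint TYPE('p) ^ m = x m"
proof (induction k)
  case 0
  then show ?case using coherent_mod_self[OF assms] by simp
next
  case (Suc k)
  have "x (Suc (m + k)) mod pint TYPE('p) ^ m
      = x (Suc (m + k)) mod pint TYPE('p) ^ (m + k) mod pint TYPE('p) ^ m"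
    by (simp add: mod_mod_cancel power_add)
  also have "\<dots> = x (m + k) mod pint TYPE('p) ^ m"
    using assms by (simp add: coherent_def)
  finally show ?case using Suc by simp
qed

lemma coherent_mult_eq_0:
  assumes x: "coherent TYPE('p::prime_card) x" and y: "coherent TYPE('p) y"
    and "\<And>n. (x n * y n) mod pint TYPE('p) ^ n = 0" and "x m \<noteq> 0" and "y k \<noteq> 0"
  shows False
proof -
  have 1: "\<not> pint TYPE('p) ^ m dvd x (m + k)"
    using coherent_mod_add[OF x, of m k] assms(4) by (simp add: dvd_eq_mod_eq_0)
  have 2: "\<not> pint TYPE('p) ^ k dvd y (m + k)"
    using coherent_mod_add[OF y, of k m] assms(5) by (simp add: dvd_eq_mod_eq_0 add.commute)
  have "pint TYPE('p) ^ (m + k) dvd x (m + k) * y (m + k)"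
    using assms(3) by (simp add: dvd_eq_mod_eq_0)
  moreover have "prime_elem (pint TYPE('p))"
    using prime_card_int by blast
  ultimately obtain a b where ab: "a + b = m + k"
      "pint TYPE('p) ^ a dvd x (m + k)" "pint TYPE('p) ^ b dvd y (m + k)"
    using prime_elem_power_dvd_prod by blast
  have "\<not> m \<le> a"
    using 1 ab(2) by (meson dvd_trans le_imp_power_dvd)
  moreover have "\<not> k \<le> b"
    using 2 ab(3) by (meson dvd_trans le_imp_power_dvd)
  ultimately show False
    using ab(1) by linarith
qed

instance padic_int :: (prime_card) idom
proof
  fix a b :: "'a padic_int"
  assume "a \<noteq> 0" and "b \<noteq> 0"
  then show "a * b \<noteq> 0"
  proof transfer
    fix x y
    assume xy: "coherent TYPE('a) x" "x \<noteq> (\<lambda>n. 0 mod pint TYPE('a) ^ n)"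
      "coherent TYPE('a) y" "y \<noteq> (\<lambda>n. 0 mod pint TYPE('a) ^ n)"
    then obtain m k where "x m \<noteq> 0" "y k \<noteq> 0"
      by (auto simp: fun_eq_iff)
    then show "(\<lambda>n. x n * y n mod pint TYPE('a) ^ n) \<noteq> (\<lambda>n. 0 mod pint TYPE('a) ^ n)"
      using coherent_mult_eq_0[OF xy(1) xy(3)] by (auto simp: fun_eq_iff)
  qed
qed

type_synonym 'p padic = "'p padic_int fract"

section \<open>Subfields and Galois groups\<close>

definition subfield_set :: "'a::field set \<Rightarrow> bool" where
  "subfield_set F \<longleftrightarrow> 0 \<in> F \<and> 1 \<in> F \<and> (\<forall>x\<in>F. \<forall>y\<in>F. x + y \<in> F \<and> x * y \<in> F) \<and>
     (\<forall>x\<in>F. - x \<in> F \<and> inverse x \<in> F)"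

definition finite_ext :: "'a::field set \<Rightarrow> 'a set \<Rightarrow> bool" where
  "finite_ext F L \<longleftrightarrow> subfield_set F \<and> subfield_set L \<and> F \<subseteq> L \<and>
     (\<exists>B. finite B \<and> B \<subseteq> L \<and> (\<forall>x\<in>L. \<exists>c. (\<forall>b\<in>B. c b \<in> F) \<and> x = (\<Sum>b\<in>B. c b * b)))"

definition algebraic_over :: "'a::field set \<Rightarrow> 'a \<Rightarrow> bool" where
  "algebraic_over F x \<longleftrightarrow> (\<exists>q. q \<noteq> 0 \<and> (\<forall>i. poly.coeff q i \<in> F) \<and> poly q x = 0)"

text \<open>The whole type \<open>'a\<close> is an algebraic closure of its subfield \<open>F\<close>.\<close>

definition alg_closure_of :: "'a::alg_closed_field set \<Rightarrow> bool" where
  "alg_closure_of F \<longleftrightarrow> subfield_set F \<and> (\<forall>x. algebraic_over F x)"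

definition integral_over :: "'a::field set \<Rightarrow> 'a \<Rightarrow> bool" where
  "integral_over R x \<longleftrightarrow> (\<exists>q. lead_coeff q = 1 \<and> (\<forall>i. poly.coeff q i \<in> R) \<and> poly q x = 0)"

text \<open>
  The ring of integers of \<open>K\<close> is the integral closure in \<open>K\<close> of the ring of p-adic integers,
  where \<open>\<iota>\<close> is the embedding of the p-adic numbers. It is a local ring, so its maximal ideal
  is the set of its non-units, and a uniformiser is a generator of that ideal.
\<close>

definition integers :: "('p::prime_card padic \<Rightarrow> 'a::field) \<Rightarrow> 'a set \<Rightarrow> 'a set" where
  "integers \<iota> K = {x \<in> K. integral_over (range (\<lambda>a. \<iota> (Fract a 1))) x}"

definition uniformiser :: "'a::field set \<Rightarrow> 'a \<Rightarrow> bool" where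
  "uniformiser R t \<longleftrightarrow> t \<in> R \<and> t \<noteq> 0 \<and> {x \<in> R. \<not> (\<exists>y\<in>R. x * y = 1)} = {t * y | y. y \<in> R}"

definition adjoin :: "'a::field set \<Rightarrow> 'a \<Rightarrow> 'a set" where
  "adjoin F x = subfield_set hull (insert x F)"

definition K_infinity :: "'a::field set \<Rightarrow> (nat \<Rightarrow> 'a) \<Rightarrow> 'a set" where
  "K_infinity K r = (\<Union>n. adjoin K (r n))"

text \<open>When the type \<open>'a\<close> is an algebraic closure of \<open>F\<close>, this is the absolute Galois group
  of \<open>F\<close> (in characteristic 0), with composition of functions as multiplication.\<close>

definition Gal :: "'a::field set \<Rightarrow> ('a \<Rightarrow> 'a) set" where
  "Gal F = {\<sigma>. field_hom \<sigma> \<and> bij \<sigma> \<and> (\<forall>x\<in>F. \<sigma> x = x)}"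

definition krull_topology :: "'a::field set \<Rightarrow> ('a \<Rightarrow> 'a) topology" where
  "krull_topology F =
     topology_generated_by {(\<lambda>\<tau>. \<sigma> \<circ> \<tau>) ` Gal L | \<sigma> L. \<sigma> \<in> Gal F \<and> finite_ext F L}"

text \<open>
  The mod \<open>p\<close> cyclotomic character: the action on \<open>p\<close>-th roots of unity is raising to a power
  that is unique modulo \<open>p\<close>.
\<close>

definition cyclotomic_char :: "nat \<Rightarrow> ('a::field \<Rightarrow> 'a) \<Rightarrow> 'f::field" where
  "cyclotomic_char p \<sigma> = of_nat (THE a. a < p \<and> (\<forall>\<zeta>. \<zeta> ^ p = 1 \<longrightarrow> \<sigma> \<zeta> = \<zeta> ^ a))"

section \<open>Representations\<close>

text \<open>
  Vector spaces with an action of a group (a set of elements of \<open>'g\<close>) whose addition is that of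
  the type \<open>'v\<close>. For a quotient, \<open>'v\<close> is a type of sets, whose addition is the elementwise
  one; on cosets this is the usual addition, but the zero vector is not the \<open>0\<close> of the type.
\<close>

record ('g, 'f, 'v) rep =
  space :: "'v set"
  null :: 'v
  scal :: "'f \<Rightarrow> 'v \<Rightarrow> 'v"
  act :: "'g \<Rightarrow> 'v \<Rightarrow> 'v"

definition rep_hom ::
  "'g set \<Rightarrow> ('g, 'f, 'v::plus) rep \<Rightarrow> ('g, 'f, 'w::plus) rep \<Rightarrow> ('v \<Rightarrow> 'w) \<Rightarrow> bool" where
  "rep_hom G V W f \<longleftrightarrow> f ` space V \<subseteq> space W \<and>
     (\<forall>x\<in>space V. \<forall>y\<in>space V. f (x + y) = f x + f y) \<and>
     (\<forall>c. \<forall>x\<in>space V. f (scal V c x) = scal W c (f x)) \<and>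
     (\<forall>g\<in>G. \<forall>x\<in>space V. f (act V g x) = act W g (f x))"

definition rep_iso ::
  "'g set \<Rightarrow> ('g, 'f, 'v::plus) rep \<Rightarrow> ('g, 'f, 'w::plus) rep \<Rightarrow> bool" where
  "rep_iso G V W \<longleftrightarrow> (\<exists>f. rep_hom G V W f \<and> bij_betw f (space V) (space W))"

definition subrep :: "'g set \<Rightarrow> ('g, 'f, 'v::plus) rep \<Rightarrow> 'v set \<Rightarrow> bool" where
  "subrep G V A \<longleftrightarrow> A \<subseteq> space V \<and> null V \<in> A \<and> (\<forall>x\<in>A. \<forall>y\<in>A. x + y \<in> A) \<and>
     (\<forall>c. \<forall>x\<in>A. scal V c x \<in> A) \<and> (\<forall>g\<in>G. \<forall>x\<in>A. act V g x \<in> A)"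

definition restrict_rep :: "('g, 'f, 'v) rep \<Rightarrow> 'v set \<Rightarrow> ('g, 'f, 'v) rep" where
  "restrict_rep V A = V\<lparr>space := A\<rparr>"

text \<open>In \<open>quot_rep\<close>, adding \<open>B\<close> turns the image of a coset into the full coset it lies in
  (scaling by 0 gives a single vector).\<close>

definition quot_rep :: "('g, 'f, 'v::plus) rep \<Rightarrow> 'v set \<Rightarrow> ('g, 'f, 'v set) rep" where
  "quot_rep V B = \<lparr>space = (\<lambda>x. x +o B) ` space V, null = B,
     scal = (\<lambda>c X. scal V c ` X + B), act = (\<lambda>g X. act V g ` X + B)\<rparr>"

text \<open>The tensor product with the one-dimensional representation given by the character \<open>\<chi>\<close>.\<close>

definition twist :: "('g \<Rightarrow> 'f) \<Rightarrow> ('g, 'f, 'v) rep \<Rightarrow> ('g, 'f, 'v) rep" where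
  "twist \<chi> V = V\<lparr>act := (\<lambda>g x. scal V (\<chi> g) (act V g x))\<rparr>"

definition irreducible_rep :: "'g set \<Rightarrow> ('g, 'f, 'v::plus) rep \<Rightarrow> bool" where
  "irreducible_rep G V \<longleftrightarrow> space V \<noteq> {null V} \<and>
     (\<forall>A. subrep G V A \<longrightarrow> A = {null V} \<or> A = space V)"

definition composition_series ::
  "'g set \<Rightarrow> ('g, 'f, 'v::plus) rep \<Rightarrow> nat \<Rightarrow> (nat \<Rightarrow> 'v set) \<Rightarrow> bool" where
  "composition_series G V n F \<longleftrightarrow> F 0 = space V \<and> F n = {null V} \<and>
     (\<forall>i\<le>n. subrep G V (F i)) \<and>
     (\<forall>i<n. F (Suc i) \<subseteq> F i \<and> irreducible_rep G (quot_rep (restrict_rep V (F i)) (F (Suc i))))"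

definition JH_factor ::
  "'g set \<Rightarrow> ('g, 'f, 'u::plus) rep \<Rightarrow> ('g, 'f, 'v::plus) rep \<Rightarrow> bool" where
  "JH_factor G U V \<longleftrightarrow> (\<exists>n F. composition_series G V n F \<and>
     (\<exists>i<n. rep_iso G U (quot_rep (restrict_rep V (F i)) (F (Suc i)))))"

definition cyclotomic_free ::
  "nat \<Rightarrow> 'a::field set \<Rightarrow> ('a \<Rightarrow> 'a, 'f::field, 'v::plus) rep \<Rightarrow> bool" where
  "cyclotomic_free p K V \<longleftrightarrow> (\<exists>n F. composition_series (Gal K) V n F \<and>
     (\<forall>i<n. \<not> JH_factor (Gal K)
        (twist (cyclotomic_char p) (quot_rep (restrict_rep V (F i)) (F (Suc i))))
        (restrict_rep V (F (Suc i)))))"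

text \<open>Continuous finite-dimensional representations of the absolute Galois group of \<open>K\<close>;
  the coefficient field, and hence \<open>V\<close>, carries the discrete topology.\<close>

definition Rep_Gal ::
  "'a::field set \<Rightarrow> ('a \<Rightarrow> 'a, 'f::field, 'v::ab_group_add) rep \<Rightarrow> bool" where
  "Rep_Gal K V \<longleftrightarrow> space V = UNIV \<and> null V = 0 \<and>
     (\<exists>B. finite_dimensional_vector_space (scal V) B) \<and>
     (\<forall>g\<in>Gal K. Vector_Spaces.linear (scal V) (scal V) (act V g)) \<and>
     act V id = id \<and>
     (\<forall>g\<in>Gal K. \<forall>h\<in>Gal K. act V (g \<circ> h) = act V g \<circ> act V h) \<and>
     continuous_map (prod_topology (krull_topology K) (discrete_topology UNIV))
       (discrete_topology UNIV) (\<lambda>(g, v). act V g v)"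

end

theory Submission
  imports Defs "Jordan_Normal_Form.Char_Poly" "HOL-Algebra.Sylow" "HOL-Algebra.Group_Action"
    "HOL-Algebra.Multiplicative_Group"
begin

text \<open>
  If \<open>f\<close> is not equivariant, choose a minimal subrepresentation \<open>A\<close> of \<open>V\<close> and a maximal
  subrepresentation \<open>D\<close> of \<open>W\<close> such that \<open>f\<close> is not equivariant as a map from \<open>A\<close> to \<open>W / D\<close>. Then
  \<open>A\<close> has a largest proper subrepresentation \<open>A1\<close> and \<open>W / D\<close> has a smallest nonzero one \<open>S / D\<close>, both
  \<open>A / A1\<close> and \<open>S / D\<close> are irreducible, and \<open>g \<mapsto> g\<^sup>-\<^sup>1 f g - f\<close> is a cocycle with values in
  \<open>Hom(A / A1, S / D)\<close> that vanishes on the Galois group \<open>H\<close> of \<open>K\<^sub>\<infinity>\<close>.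

  Let \<open>N\<close> be the subgroup acting trivially on \<open>A / A1\<close>, on \<open>S / D\<close> and on the \<open>p\<close>-th roots of unity.
  Wild inertia acts trivially on irreducible representations, so the fixed field of \<open>N\<close> is tamely
  ramified over \<open>K\<close>. Hence \<open>N\<close> permutes the roots of \<open>x ^ (p ^ n) = \<pi>\<close> transitively, \<open>H N\<close> is the whole
  Galois group, and by Kummer theory the cocycle restricted to \<open>N\<close> factors through the action on
  the \<open>p\<close>-th roots of \<open>\<pi>\<close>. It is therefore given by a single map \<open>\<xi>\<close>, and conjugation by \<open>H\<close> shows that \<open>\<xi>\<close>
  identifies \<open>S / D\<close> with the cyclotomic twist of \<open>A / A1\<close>.

  If \<open>f\<close> does not map \<open>A1\<close> into \<open>D\<close>, then it lifts \<open>S / D\<close> to a section of \<open>A1\<close>, so the twist of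
  \<open>A / A1\<close> occurs below \<open>A / A1\<close> in \<open>V\<close>. Otherwise \<open>f\<close> embeds \<open>A / A1\<close> into \<open>W / S\<close>, and the twist occurs below
  it in \<open>W\<close>. Either contradicts cyclotomic freeness.

  All the arithmetic is phrased in terms of the valuation ring of the algebraic closure, without a
  value group. That the integral elements form a valuation ring follows from Hensel's lemma.
\<close>

section \<open>The p-adic integers\<close>

text \<open>The extension \<open>K_infinity\<close> of K is not Galois, so \<open>H\<close> is not
  normal and restriction to it cannot be studied through a quotient group. The normal group
  \<open>N\<close> takes over: tameness of its fixed field keeps the roots of \<pi> independent of
  that field, which gives both \<open>G = H N\<close> and control of the cocycle by a single \<tau>
  in \<open>N\<close> with \<open>\<tau> (r 1) = \<zeta> * r 1\<close>. That level 1 decides,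
  although roots of all levels are adjoined, is a valuation count: the target is killed by p, so
  each class comes from a radical of exponent p, whose valuation is incompatible with a contribution
  from a root of higher level. The twist is cyclotomic because
  \<open>h \<circ> \<tau> \<circ> finv h\<close> multiplies \<open>r 1\<close> by
  \<open>h \<zeta>\<close>. The coefficient field is infinite, so counting is done on spans over the
  prime field, and vector-valued homomorphisms are tested by characters into the p-th roots of
  unity. As \<open>JH_factor\<close> asks for some composition series, each contradiction has to
  exhibit a series through a prescribed section.\<close>

abbreviation unif :: "'p::prime_card padic_int" where
  "unif \<equiv> of_nat CARD('p)"

lemma pint_power_pos: "pint TYPE('p::prime_card) ^ n > 0"
  using pint_gt_1[where ?'p = 'p] by simp

lemma Rep_coherent: "coherent TYPE('p::prime_card) (Rep_padic_int (a :: 'p padic_int))"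
  using Rep_padic_int[of a] by simp

lemma Rep_of_nat: "Rep_padic_int (of_nat k :: 'p::prime_card padic_int) n = int k mod pint TYPE('p) ^ n"
  by (induction k) (simp_all add: zero_padic_int.rep_eq one_padic_int.rep_eq plus_padic_int.rep_eq mod_simps)

lemma Rep_of_int: "Rep_padic_int (of_int k :: 'p::prime_card padic_int) n = k mod pint TYPE('p) ^ n"
proof (cases k)
  case (nonneg m)
  then show ?thesis by (simp add: Rep_of_nat)
next
  case (neg m)
  have "of_int k = (- of_nat (Suc m) :: 'p padic_int)"
    using neg by simp
  then show ?thesis
    using neg by (simp only: uminus_padic_int.rep_eq Rep_of_nat mod_simps)
qed

text \<open>Division by p^n shifts levels: the quotient has at level k the entry at level n + k
  divided by p^n. The equivalence turns divisibility into equality of entries, the form in which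
  limits are taken.\<close>

lemma unif_power_dvd_iff:
  fixes a :: "'p::prime_card padic_int"
  shows "unif ^ n dvd a \<longleftrightarrow> Rep_padic_int a n = 0"
proof
  assume "unif ^ n dvd a"
  then obtain b where "a = of_nat (CARD('p) ^ n) * b"
    by auto
  then show "Rep_padic_int a n = 0"
    by (simp only: times_padic_int.rep_eq Rep_of_nat) simp
next
  assume 0: "Rep_padic_int a n = 0"
  let ?P = "pint TYPE('p)" and ?x = "Rep_padic_int a"
  have coh: "0 \<le> ?x k" "?x k < ?P ^ k" "?x (Suc k) mod ?P ^ k = ?x k" for k
    using Rep_coherent[of a] by (auto simp: coherent_def)
  have "coherent TYPE('p) (\<lambda>k. ?x (n + k) div ?P ^ n)"
    unfolding coherent_def
  proof (intro allI conjI)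
    fix k
    show "0 \<le> ?x (n + k) div ?P ^ n"
      using coh(1) pint_power_pos[where ?'p = 'p, of n] by (simp add: pos_imp_zdiv_nonneg_iff)
    show "?x (n + k) div ?P ^ n < ?P ^ k"
    proof -
      have "?x (n + k) div ?P ^ n * ?P ^ n \<le> ?x (n + k)"
        using pint_power_pos[where ?'p = 'p, of n] by (simp add: minus_mod_eq_div_mult[symmetric])
      also have "\<dots> < ?P ^ k * ?P ^ n"
        using coh(2)[of "n + k"] by (simp add: power_add mult.commute)
      finally show ?thesis
        using pint_power_pos[where ?'p = 'p, of n] by (simp add: mult_less_cancel_right)
    qed
    have "?x (n + k) = ?x (Suc (n + k)) mod (?P ^ n * ?P ^ k)"
      using coh(3)[of "n + k"] by (simp add: power_add)
    \<comment> \<open>The residue modulo p^(n+k) is split into quotient and remainder by p^n, so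
      that coherence survives the division.\<close>
    also have "\<dots> = ?P ^ n * (?x (Suc (n + k)) div ?P ^ n mod ?P ^ k) + ?x (Suc (n + k)) mod ?P ^ n"
      using pint_power_pos[where ?'p = 'p, of k] by (intro zmod_zmult2_eq) simp
    finally have "?x (n + k) div ?P ^ n = ?x (Suc (n + k)) div ?P ^ n mod ?P ^ k"
      using pint_power_pos[where ?'p = 'p, of n] by (simp add: div_add1_eq)
    then show "?x (n + Suc k) div ?P ^ n mod ?P ^ k = ?x (n + k) div ?P ^ n"
      by simp
  qed
  moreover define b :: "'p padic_int" where "b = Abs_padic_int (\<lambda>k. ?x (n + k) div ?P ^ n)"
  ultimately have rep: "Rep_padic_int b = (\<lambda>k. ?x (n + k) div ?P ^ n)"
    by (simp add: Abs_padic_int_inverse)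
  have "a = of_nat (CARD('p) ^ n) * b"
  proof (subst Rep_padic_int_inject[symmetric], rule ext)
    fix k
    have "?x (n + k) mod ?P ^ n = 0"
      using coherent_mod_add[OF Rep_coherent[of a], of n k] 0 by simp
    then have "?P ^ n * (?x (n + k) div ?P ^ n) = ?x (n + k)"
      by auto
    then show "?x k = Rep_padic_int (of_nat (CARD('p) ^ n) * b) k"
      using coherent_mod_add[OF Rep_coherent[of a], of k n]
      by (simp only: times_padic_int.rep_eq Rep_of_nat rep mod_simps) (simp add: add.commute)
  qed
  then show "unif ^ n dvd a"
    by (metis dvd_triv_left of_nat_power)
qed

lemma unif_power_dvd_diff_iff:
  fixes a b :: "'p::prime_card padic_int"
  shows "unif ^ n dvd a - b \<longleftrightarrow> Rep_padic_int a n = Rep_padic_int b n"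
  unfolding unif_power_dvd_iff minus_padic_int.rep_eq
  using coherent_mod_self[OF Rep_coherent[of a], of n] coherent_mod_self[OF Rep_coherent[of b], of n]
  by (metis mod_eq_dvd_iff mod_0_imp_dvd dvd_imp_mod_0)

lemma padic_int_eqI:
  fixes a b :: "'p::prime_card padic_int"
  assumes "\<And>n. unif ^ n dvd a - b"
  shows "a = b"
  using assms unfolding unif_power_dvd_diff_iff Rep_padic_int_inject[symmetric] by (rule ext)

text \<open>Completeness: the diagonal of the representing sequences is coherent. The rate of
  convergence is prescribed, so faster sequences are weakened to it before use.\<close>

lemma padic_int_limit:
  fixes x :: "nat \<Rightarrow> 'p::prime_card padic_int"
  assumes "\<And>n. unif ^ n dvd x (Suc n) - x n"
  obtains y where "\<And>n. unif ^ n dvd y - x n"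
proof -
  have "coherent TYPE('p) (\<lambda>n. Rep_padic_int (x n) n)"
    unfolding coherent_def
  proof (intro allI conjI)
    fix n
    show "0 \<le> Rep_padic_int (x n) n" "Rep_padic_int (x n) n < pint TYPE('p) ^ n"
      using Rep_coherent[of "x n"] by (auto simp: coherent_def)
    show "Rep_padic_int (x (Suc n)) (Suc n) mod pint TYPE('p) ^ n = Rep_padic_int (x n) n"
      using assms[of n] Rep_coherent[of "x (Suc n)"]
      unfolding unif_power_dvd_diff_iff coherent_def by metis
  qed
  then have "Rep_padic_int (Abs_padic_int (\<lambda>n. Rep_padic_int (x n) n) :: 'p padic_int) n
      = Rep_padic_int (x n) n" for n
    by (simp add: Abs_padic_int_inverse)
  then show ?thesis
    by (intro that[of "Abs_padic_int (\<lambda>n. Rep_padic_int (x n) n)"]) (simp add: unif_power_dvd_diff_iff)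
qed

text \<open>Bezout gives an inverse at every level n; inverses modulo p^n are unique, so these are
  compatible and converge to an inverse.\<close>

lemma padic_int_dvd_1:
  fixes a :: "'p::prime_card padic_int"
  assumes "\<not> unif dvd a"
  shows "a dvd 1"
proof -
  let ?P = "pint TYPE('p)" and ?x = "Rep_padic_int a"
  have P: "prime ?P"
    using prime_card_int by blast
  have 1: "?x 1 \<noteq> 0"
    using assms unif_power_dvd_iff[of 1 a] by simp
  have cop: "coprime (?x n) (?P ^ n)" for n
  proof (cases n)
    case (Suc k)
    have "?x n mod ?P = ?x 1"
      using coherent_mod_add[OF Rep_coherent[of a], of 1 k] Suc by simp
    then have "\<not> ?P dvd ?x n"
      using 1 by auto
    then show ?thesis
      using prime_imp_coprime[OF P] by (metis coprime_commute coprime_power_right_iff)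
  qed simp
  have "\<exists>b. ?P ^ n dvd ?x n * b - 1" for n
  proof -
    obtain b c where "b * ?x n + c * ?P ^ n = 1"
      using bezout_int[of "?x n" "?P ^ n"] cop[of n] by auto
    then have "?x n * b - 1 = ?P ^ n * (- c)"
      by (simp add: algebra_simps)
    then show ?thesis by (metis dvd_triv_left)
  qed
  then obtain b where b: "\<And>n. ?P ^ n dvd ?x n * b n - 1"
    by metis
  have "unif ^ n dvd (of_int (b (Suc n)) :: 'p padic_int) - of_int (b n)" for n
  proof -
    have "?P ^ n dvd ?x (Suc n) * b (Suc n) - 1"
      using b[of "Suc n"] by (rule dvd_trans[rotated]) simp
    moreover have "?P ^ n dvd ?x (Suc n) - ?x n"
      using coherent_mod_Suc[OF Rep_coherent[of a], of n] by (simp only: mod_eq_dvd_iff)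
    \<comment> \<open>The combination equals \<open>?x n * (b (Suc n) - b n)\<close>, from which the
      unit \<open>?x n\<close> is cancelled.\<close>
    ultimately have "?P ^ n dvd (?x (Suc n) * b (Suc n) - 1) - (?x n * b n - 1)
        - (?x (Suc n) - ?x n) * b (Suc n)"
      using b[of n] by (meson dvd_diff dvd_mult2)
    then have "?P ^ n dvd ?x n * (b (Suc n) - b n)"
      by (simp add: algebra_simps)
    then have "?P ^ n dvd b (Suc n) - b n"
      using cop[of n] by (simp add: coprime_commute coprime_dvd_mult_right_iff)
    then show ?thesis
      by (simp add: unif_power_dvd_diff_iff Rep_of_int mod_eq_dvd_iff)
  qed
  then obtain y :: "'p padic_int" where y: "\<And>n. unif ^ n dvd y - of_int (b n)"
    using padic_int_limit[of "\<lambda>n. of_int (b n)"] by blast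
  have "a * y = 1"
  proof (rule padic_int_eqI)
    fix n
    have "Rep_padic_int a n = Rep_padic_int (of_int (?x n) :: 'p padic_int) n"
      using coherent_mod_self[OF Rep_coherent[of a], of n] by (simp add: Rep_of_int)
    then have "unif ^ n dvd a - of_int (?x n)"
      by (simp add: unif_power_dvd_diff_iff)
    moreover have "unif ^ n dvd (of_int (?x n * b n - 1) :: 'p padic_int)"
    proof -
      have "(?x n * b n - 1) mod ?P ^ n = 0"
        using b[of n] dvd_imp_mod_0 by blast
      then show ?thesis
        using Rep_of_int[where ?'p = 'p, of "?x n * b n - 1" n]
          unif_power_dvd_iff[where ?'p = 'p, of n "of_int (?x n * b n - 1)"] by metis
    qed
    ultimately have "unif ^ n dvd (a - of_int (?x n)) * of_int (b n) + of_int (?x n * b n - 1)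
        + a * (y - of_int (b n))"
      using y[of n] by (meson dvd_add dvd_mult dvd_mult2)
    then show "unif ^ n dvd a * y - 1"
      by (simp add: algebra_simps)
  qed
  then show ?thesis by (metis dvd_triv_left)
qed

lemma unif_nonzero: "(unif :: 'p::prime_card padic_int) \<noteq> 0"
proof
  assume "(unif :: 'p padic_int) = 0"
  then have "Rep_padic_int (unif :: 'p padic_int) 2 = Rep_padic_int (0 :: 'p padic_int) 2"
    by simp
  then show False
    using pint_gt_1[where ?'p = 'p]
    by (simp only: Rep_of_nat zero_padic_int.rep_eq) (simp add: power2_eq_square)
qed

lemma unif_not_unit: "\<not> (unif :: 'p::prime_card padic_int) dvd 1"
  using unif_power_dvd_iff[of 1 "1 :: 'p padic_int"] pint_gt_1[where ?'p = 'p]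
  by (simp add: one_padic_int.rep_eq)

text \<open>The p-adic valuation k is finite because a nonzero element has a nonzero entry at some
  level.\<close>

lemma padic_int_decomp:
  fixes a :: "'p::prime_card padic_int"
  assumes "a \<noteq> 0"
  obtains k u where "u dvd 1" "a = unif ^ k * u"
proof -
  have "Rep_padic_int a \<noteq> Rep_padic_int (0 :: 'p padic_int)"
    using assms by (simp add: Rep_padic_int_inject)
  then obtain n where n: "Rep_padic_int a n \<noteq> Rep_padic_int (0 :: 'p padic_int) n"
    by blast
  then have "\<not> unif ^ n dvd a"
    using unif_power_dvd_iff[of n a] by (simp add: zero_padic_int.rep_eq)
  then obtain k where k: "\<not> unif ^ Suc k dvd a" "unif ^ k dvd a"
    using ex_least_nat_less[of "\<lambda>k. \<not> unif ^ k dvd a" n] by (metis less_or_eq_imp_le order.refl one_dvd power_0)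
  then obtain u where u: "a = unif ^ k * u" by blast
  then have "\<not> unif dvd u"
    using k(1) by (auto simp: mult.commute mult_dvd_mono)
  then show ?thesis
    using u that padic_int_dvd_1 by blast
qed

section \<open>Hensel's lemma\<close>

text \<open>Pseudo-division scales the dividend by a power of the leading coefficient; when that is
  1 it is division with remainder over a domain.\<close>

lemma monic_division:
  fixes e g :: "'a::idom poly"
  assumes "lead_coeff g = 1"
  obtains b s where "e = b * g + s" "s = 0 \<or> degree s < degree g"
proof -
  have "g \<noteq> 0" using assms by auto
  moreover obtain b s where "pseudo_divmod e g = (b, s)"
    by fastforce
  ultimately show ?thesis
    using pseudo_divmod[of g e b s] assms that[of b s] by (simp add: mult.commute)
qed

text \<open>The Newton step of Hensel's lemma for a factorisation whose second factor is constant modulo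
  the uniformiser, so that correcting the first factor only requires division by a monic polynomial.\<close>

lemma hensel_step:
  fixes f g h :: "'a::idom poly" and P u :: 'a
  assumes P: "P \<noteq> 0" and u: "u dvd 1"
    and g: "lead_coeff g = 1" and h: "[:P:] dvd h - [:u:]"
    and deg: "degree f \<le> degree g + d" "degree h \<le> d"
    and fgh: "[:P ^ Suc n:] dvd f - g * h"
  obtains g' h' where "lead_coeff g' = 1" "degree g' = degree g" "[:P:] dvd h' - [:u:]"
    "degree h' \<le> d" "[:P ^ Suc (Suc n):] dvd f - g' * h'"
    "[:P ^ Suc n:] dvd g' - g" "[:P ^ Suc n:] dvd h' - h"
proof -
  obtain e where e: "f - g * h = [:P ^ Suc n:] * e"
    using fgh by blast
  obtain b s where bs: "e = b * g + s" "s = 0 \<or> degree s < degree g"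
    using monic_division[OF g] .
  obtain v where v: "u * v = 1"
    using u by (metis dvdE)
  obtain k where k: "h - [:u:] = [:P:] * k"
    using h by blast
  let ?Q = "[:P ^ Suc n:]"
  have g0: "g \<noteq> 0" using g by auto
  have "degree (f - g * h) \<le> degree g + d"
    using deg degree_mult_le[of g h] by (intro degree_diff_le) auto
  then have dege: "degree e \<le> degree g + d"
    using P unfolding e by (cases "e = 0") (auto simp: degree_mult_eq)
  have degb: "degree b \<le> d"
  proof (cases "b = 0")
    case False
    have "degree (b * g) \<le> degree g + d"
    proof -
      have "b * g = e - s" using bs(1) by simp
      then show ?thesis
        using dege bs(2) by (auto intro!: degree_diff_le)
    qed
    then show ?thesis
      using False g0 by (simp add: degree_mult_eq)
  qed simp
  \<comment> \<open>The error is Q e with e = b g + s. Adding Q b to h accounts for b g, and adding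
    Q v s to g accounts for s, because v h is 1 modulo P. Only s, of degree below that of g, enters
    g, so g stays monic.\<close>
  let ?g = "g + ?Q * Polynomial.smult v s" and ?h = "h + ?Q * b"
  have deg_s: "?Q * Polynomial.smult v s = 0 \<or> degree (?Q * Polynomial.smult v s) < degree g"
  proof (cases "s = 0")
    case False
    have "degree (?Q * Polynomial.smult v s) \<le> degree ?Q + degree (Polynomial.smult v s)"
      by (rule degree_mult_le)
    also have "\<dots> \<le> degree s" using degree_smult_le[of v s] by simp
    finally show ?thesis using False bs(2) by auto
  qed simp
  then have 1: "degree ?g = degree g"
    by (metis add.right_neutral degree_add_eq_left)
  moreover have "lead_coeff ?g = 1"
    using deg_s g by (metis 1 add.right_neutral coeff_add coeff_eq_0)
  moreover have "[:P:] dvd ?h - [:u:]"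
  proof -
    have "?h - [:u:] = [:P:] * (k + [:P ^ n:] * b)"
      using k by (simp add: algebra_simps)
    then show ?thesis by (metis dvd_triv_left)
  qed
  moreover have "degree ?h \<le> d"
    using deg(2) degb degree_mult_le[of ?Q b] by (intro degree_add_le) auto
  moreover have "[:P ^ Suc (Suc n):] dvd f - ?g * ?h"
  proof -
    have hk: "h = [:u:] + [:P:] * k" using k by (simp add: algebra_simps)
    have uv: "[:u:] * [:v:] = (1 :: 'a poly)" using v by (simp add: one_pCons mult.commute)
    have QP: "[:P ^ Suc (Suc n):] = ?Q * [:P:]" by simp
    \<comment> \<open>The product of the two corrections has order 2 (n + 1), which is at least n +
      2.\<close>
    have Q2: "?Q * ?Q = ?Q * [:P:] * [:P ^ n:]" by simp
    have "f - (g + Q * (v' * s)) * (h + Q * b) = Q * p * (- v' * s * k) - Q * Q * (v' * s) * b"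
      if "f - g * h = Q * e" "h = u' + p * k" "u' * v' = 1" for Q u' v' p :: "'a poly"
    proof -
      have "f - (g + Q * (v' * s)) * (h + Q * b)
          = Q * e - Q * b * g - Q * (v' * s) * h - Q * Q * (v' * s) * b"
        using that(1) by (simp add: algebra_simps)
      also have "\<dots> = Q * (s - (u' * v') * s - v' * s * p * k) - Q * Q * (v' * s) * b"
        unfolding that(2) bs(1) by (simp add: algebra_simps)
      finally show ?thesis
        unfolding that(3) by (simp add: algebra_simps)
    qed
    from this[OF e hk uv]
    have "f - ?g * ?h = ?Q * [:P:] * (- [:v:] * s * k) - ?Q * ?Q * ([:v:] * s) * b"
      by simp
    also have "\<dots> = ?Q * [:P:] * (- [:v:] * s * k - [:P ^ n:] * ([:v:] * s) * b)"
      unfolding Q2 by (simp only: algebra_simps)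
    finally show ?thesis
      unfolding QP by (metis dvd_triv_left)
  qed
  moreover have "?Q dvd ?g - g" "?Q dvd ?h - h"
    by (metis add_diff_cancel_left' dvd_triv_left)+
  ultimately show ?thesis
    using that by blast
qed

lemma const_poly_dvd_diff_iff:
  fixes p q :: "'a::idom poly"
  shows "[:c:] dvd p - q \<longleftrightarrow> (\<forall>i. c dvd poly.coeff p i - poly.coeff q i)"
  by (simp add: const_poly_dvd_iff)

lemma padic_int_poly_limit:
  fixes x :: "nat \<Rightarrow> 'p::prime_card padic_int poly"
  assumes step: "\<And>n. [:unif ^ n:] dvd x (Suc n) - x n" and deg: "\<And>n. degree (x n) \<le> d"
  obtains y where "\<And>n. [:unif ^ n:] dvd y - x n" "degree y \<le> d"
proof -
  have "\<exists>y. \<forall>n. unif ^ n dvd y - poly.coeff (x n) i" for i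
  proof -
    have "unif ^ n dvd poly.coeff (x (Suc n)) i - poly.coeff (x n) i" for n
      using step[of n] by (simp add: const_poly_dvd_diff_iff)
    then show ?thesis
      using padic_int_limit[of "\<lambda>n. poly.coeff (x n) i"] by metis
  qed
  then obtain Y where Y: "\<And>i n. unif ^ n dvd Y i - poly.coeff (x n) i"
    by metis
  have "Y i = 0" if "i > d" for i
    using Y[of _ i] deg that by (intro padic_int_eqI) (metis coeff_eq_0 le_less_trans)
  then have Y0: "\<forall>i>d. Y i = 0" by blast
  define y where "y = Abs_poly Y"
  have "poly.coeff y = Y"
    unfolding y_def using Y0 coeff_Abs_poly[of d Y] by blast
  then show ?thesis
    using Y Y0 by (intro that[of y]) (auto simp: const_poly_dvd_diff_iff intro: degree_le)
qed

text \<open>The coefficient of degree \<open>j\<close> is the last one that is a unit, so modulo the uniformiser the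
  polynomial has degree \<open>j\<close>, and the factorisation into it and a constant is lifted.\<close>

lemma hensel_factor:
  fixes f :: "'p::prime_card padic_int poly"
  assumes unit: "poly.coeff f j dvd 1" and high: "\<And>i. i > j \<Longrightarrow> unif dvd poly.coeff f i"
  obtains g h where "f = g * h" "degree g = j"
proof -
  define u where "u = poly.coeff f j"
  obtain v where v: "u * v = 1"
    using unit unfolding u_def by (metis dvdE)
  \<comment> \<open>The part of f up to degree j, scaled to be monic; modulo p it leaves the
    constant cofactor u.\<close>
  define g0 where "g0 = Polynomial.smult v (Poly (map (poly.coeff f) [0..<Suc j]))"
  have g0: "poly.coeff g0 i = (if i \<le> j then v * poly.coeff f i else 0)" for i
    by (simp add: g0_def nth_default_def nth_append)
  have "poly.coeff g0 j = 1"
    using v by (simp add: g0 u_def mult.commute)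
  then have deg_g0: "degree g0 = j"
    by (intro antisym degree_le le_degree) (auto simp: g0)
  have jf: "j \<le> degree f"
    using unit by (intro le_degree) auto
  \<comment> \<open>A uniform degree bound for the cofactors makes their coefficientwise limit a
    polynomial.\<close>
  define d where "d = degree f - j"
  define Q where "Q = (\<lambda>n (g, h). lead_coeff g = 1 \<and> degree g = j \<and> [:unif:] dvd h - [:u:] \<and>
    degree h \<le> d \<and> [:unif ^ Suc n:] dvd f - g * (h :: 'p padic_int poly))"
  define R where "R = (\<lambda>n (g, h) (g', h' :: 'p padic_int poly).
    [:unif ^ Suc n:] dvd g' - (g :: 'p padic_int poly) \<and> [:unif ^ Suc n:] dvd h' - h)"
  have "\<exists>s. \<forall>n. Q n (s n) \<and> R n (s n) (s (Suc n))"
  proof (rule dependent_nat_choice)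
    have "unif dvd poly.coeff f i - poly.coeff (g0 * [:u:]) i" for i
      using v high[of i] by (cases "i \<le> j") (simp_all add: g0 mult.assoc[symmetric])
    then have "[:unif ^ Suc 0:] dvd f - g0 * [:u:]"
      by (simp add: const_poly_dvd_diff_iff)
    then show "\<exists>x. Q 0 x"
      using \<open>poly.coeff g0 j = 1\<close> deg_g0 by (intro exI[of _ "(g0, [:u:])"]) (simp add: Q_def)
  next
    fix n and x :: "'p padic_int poly \<times> 'p padic_int poly"
    assume "Q n x"
    then obtain g h where x: "x = (g, h)" and gh: "lead_coeff g = 1" "degree g = j"
        "[:unif:] dvd h - [:u:]" "degree h \<le> d" "[:unif ^ Suc n:] dvd f - g * h"
      unfolding Q_def by (cases x) auto
    have "degree f \<le> degree g + d"
      using gh(2) jf by (simp add: d_def)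
    from hensel_step[OF unif_nonzero _ gh(1,3) this gh(4,5)] unit
    obtain g' h' where "lead_coeff g' = 1" "degree g' = degree g" "[:unif:] dvd h' - [:u:]"
      "degree h' \<le> d" "[:unif ^ Suc (Suc n):] dvd f - g' * h'"
      "[:unif ^ Suc n:] dvd g' - g" "[:unif ^ Suc n:] dvd h' - h"
      unfolding u_def by blast
    then show "\<exists>y. Q (Suc n) y \<and> R n x y"
      using gh(2) x by (intro exI[of _ "(g', h')"]) (simp add: Q_def R_def)
  qed
  then obtain s where s: "\<And>n. Q n (s n)" "\<And>n. R n (s n) (s (Suc n))"
    by blast
  have Q: "lead_coeff (fst (s n)) = 1" "degree (fst (s n)) = j" "degree (snd (s n)) \<le> d"
     "[:unif ^ Suc n:] dvd f - fst (s n) * snd (s n)" for n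
    using s(1)[of n] by (auto simp: Q_def split: prod.splits)
  \<comment> \<open>Step n is correct modulo p^(n+1), one power more than
    \<open>padic_int_poly_limit\<close> asks for.\<close>
  have weaken: "[:unif ^ n:] dvd x" if "[:unif ^ Suc n:] dvd x" for n and x :: "'p padic_int poly"
    using that by (rule dvd_trans[rotated]) (simp add: const_poly_dvd)
  have R: "[:unif ^ n:] dvd fst (s (Suc n)) - fst (s n)" "[:unif ^ n:] dvd snd (s (Suc n)) - snd (s n)" for n
    using s(2)[of n] weaken by (auto simp: R_def split: prod.splits)
  obtain g where g: "\<And>n. [:unif ^ n:] dvd g - fst (s n)" "degree g \<le> j"
    using padic_int_poly_limit[of "\<lambda>n. fst (s n)" j] R(1) Q(2) by (metis order_refl)
  obtain h where h: "\<And>n. [:unif ^ n:] dvd h - snd (s n)"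
    using padic_int_poly_limit[of "\<lambda>n. snd (s n)" d] R(2) Q(3) by metis
  have "poly.coeff g j = 1"
  proof (rule padic_int_eqI)
    fix n
    show "unif ^ n dvd poly.coeff g j - 1"
      using g(1)[of n] Q(1,2)[of n] unfolding const_poly_dvd_diff_iff by metis
  qed
  then have "degree g = j"
    using g(2) by (intro antisym le_degree) auto
  moreover have "f = g * h"
  proof (rule poly_eqI, rule padic_int_eqI)
    fix i n
    have "[:unif ^ n:] dvd (f - fst (s n) * snd (s n)) - ((g - fst (s n)) * h + fst (s n) * (h - snd (s n)))"
      using weaken[OF Q(4)[of n]] g(1)[of n] h[of n] by (meson dvd_diff dvd_add dvd_mult dvd_mult2)
    then have "[:unif ^ n:] dvd f - g * h"
      by (simp add: algebra_simps)
    then show "unif ^ n dvd poly.coeff f i - poly.coeff (g * h) i"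
      by (simp add: const_poly_dvd_diff_iff)
  qed
  ultimately show ?thesis using that by blast
qed

text \<open>Divide by the content and let j be the last index whose coefficient is a unit. If j is
  the degree, the relation becomes monic for x; if j = 0, the reversed one becomes monic for
  \<open>inverse x\<close>. Otherwise Hensel's lemma splits off a factor of degree j, and one of two
  factors of smaller degree vanishes at x.\<close>

lemma valuation_poly:
  fixes hom :: "'p::prime_card padic_int \<Rightarrow> 'a::field"
  assumes hom: "inj_idom_hom hom" and f: "f \<noteq> 0" and root: "poly (map_poly hom f) x = 0"
  shows "integral_over (range hom) x \<or> integral_over (range hom) (inverse x)"
  using f root
proof (induction "degree f" arbitrary: f rule: less_induct)
  case (less f)
  interpret inj_idom_hom hom by (rule hom)
  interpret mp: map_poly_inj_idom_hom hom ..
  show ?case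
  proof (cases "x = 0")
    case True
    then have "integral_over (range hom) x"
      unfolding integral_over_def
      by (intro exI[of _ "[:0, 1:]"]) (auto simp: coeff_pCons split: nat.splits intro: range_eqI[of _ _ 0] range_eqI[of _ _ 1])
    then show ?thesis ..
  next
    case x: False
    obtain k where k: "[:unif ^ k:] dvd f" "\<not> [:unif ^ Suc k:] dvd f"
    proof -
      obtain i where i: "poly.coeff f i \<noteq> 0"
        using less(2) by (meson leading_coeff_neq_0)
      then obtain n where "\<not> unif ^ n dvd poly.coeff f i"
        using padic_int_eqI[of "poly.coeff f i" 0] by auto
      then have "\<not> [:unif ^ n:] dvd f"
        by (auto simp: const_poly_dvd_iff)
      then show ?thesis
        using ex_least_nat_less[of "\<lambda>k. \<not> [:unif ^ k:] dvd f" n] that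
        by (metis less_or_eq_imp_le one_dvd order.refl power_0 one_pCons)
    qed
    then obtain f1 where f1: "f = [:unif ^ k:] * f1" by blast
    have f1_0: "f1 \<noteq> 0" using f1 less(2) by auto
    have f1_root: "poly (map_poly hom f1) x = 0"
    proof -
      have "of_nat CARD('p) \<noteq> (0 :: 'a)"
        using unif_nonzero[where ?'p = 'p] hom_of_nat[of "CARD('p)"] hom_0_iff by metis
      then show ?thesis
        using less(3) unfolding f1 by (simp add: hom_distribs)
    qed
    have deg_f1: "degree f1 = degree f"
      unfolding f1 using unif_nonzero[where ?'p = 'p] f1_0 by (simp add: degree_mult_eq)
    have "\<not> (\<forall>i. unif dvd poly.coeff f1 i)"
    proof
      assume "\<forall>i. unif dvd poly.coeff f1 i"
      then have "[:unif:] dvd f1" by (simp add: const_poly_dvd_iff)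
      then have "[:unif ^ k:] * [:unif:] dvd f" unfolding f1 by (rule mult_dvd_mono[OF dvd_refl])
      then show False using k(2) by (simp add: mult.commute)
    qed
    then obtain i0 where i0: "\<not> unif dvd poly.coeff f1 i0" by blast
    define j where "j = (GREATEST i. \<not> unif dvd poly.coeff f1 i)"
    have bound: "i \<le> degree f1" if "\<not> unif dvd poly.coeff f1 i" for i
      using that by (intro le_degree) auto
    have j: "\<not> unif dvd poly.coeff f1 j"
      unfolding j_def using i0 bound by (rule GreatestI_nat)
    have high: "unif dvd poly.coeff f1 i" if "i > j" for i
      using Greatest_le_nat[of "\<lambda>i. \<not> unif dvd poly.coeff f1 i" i "degree f1"] bound that
      unfolding j_def by fastforce
    have unit: "poly.coeff f1 j dvd 1"
      using j by (rule padic_int_dvd_1)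
    then obtain v where v: "poly.coeff f1 j * v = 1"
      by (metis dvdE)
    have homv: "hom v * hom (poly.coeff f1 j) = 1"
      using v by (metis hom_mult hom_one mult.commute)
    consider "j = degree f1" | "j = 0" | "0 < j" "j < degree f1"
      using bound[OF j] by linarith
    then show ?thesis
    proof cases
      case 1
      let ?q = "Polynomial.smult (hom v) (map_poly hom f1)"
      have "lead_coeff ?q = 1"
        using homv 1 by (auto simp: lead_coeff_smult)
      moreover have "poly.coeff ?q i \<in> range hom" for i
        by (simp add: hom_mult[symmetric] del: hom_mult)
      moreover have "poly ?q x = 0" using f1_root by simp
      ultimately show ?thesis unfolding integral_over_def by blast
    next
      case 2
      let ?q = "Polynomial.smult (hom v) (reflect_poly (map_poly hom f1))"
      have "poly.coeff (map_poly hom f1) 0 \<noteq> 0"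
        using homv 2 by auto
      then have "lead_coeff ?q = 1"
        using homv 2 by (auto simp: lead_coeff_smult coeff_reflect_poly)
      moreover have "poly.coeff ?q i \<in> range hom" for i
        by (cases "i \<le> degree f1") (auto simp: coeff_reflect_poly hom_mult[symmetric] simp del: hom_mult intro: range_eqI[of _ _ 0])
      moreover have "poly ?q (inverse x) = 0"
        using f1_root x by (simp add: poly_reflect_poly_nz)
      ultimately show ?thesis unfolding integral_over_def by blast
    next
      case 3
      obtain g h where gh: "f1 = g * h" "degree g = j"
        using hensel_factor[OF unit high] by blast
      then have "g \<noteq> 0" "h \<noteq> 0" using f1_0 by auto
      then have "degree f1 = degree g + degree h"
        using gh(1) by (simp add: degree_mult_eq)
      then have "degree g < degree f" "degree h < degree f"
        using 3 gh(2) deg_f1 by auto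
      moreover have "poly (map_poly hom g) x = 0 \<or> poly (map_poly hom h) x = 0"
        using f1_root unfolding gh(1) by (simp add: hom_distribs)
      ultimately show ?thesis
        using less(1) \<open>g \<noteq> 0\<close> \<open>h \<noteq> 0\<close> by blast
    qed
  qed
qed

section \<open>Integral closure\<close>

definition subring_set :: "'a::comm_ring_1 set \<Rightarrow> bool" where
  "subring_set R \<longleftrightarrow> 0 \<in> R \<and> 1 \<in> R \<and> (\<forall>x\<in>R. \<forall>y\<in>R. x + y \<in> R \<and> x * y \<in> R) \<and> (\<forall>x\<in>R. - x \<in> R)"

lemma subring_setD:
  assumes "subring_set R"
  shows "0 \<in> R" "1 \<in> R" "\<And>x y. x \<in> R \<Longrightarrow> y \<in> R \<Longrightarrow> x + y \<in> R"
    "\<And>x y. x \<in> R \<Longrightarrow> y \<in> R \<Longrightarrow> x * y \<in> R" "\<And>x. x \<in> R \<Longrightarrow> - x \<in> R"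
    "\<And>x y. x \<in> R \<Longrightarrow> y \<in> R \<Longrightarrow> x - y \<in> R"
  using assms unfolding subring_set_def by (auto simp: diff_conv_add_uminus simp del: add_uminus_conv_diff)

lemma subring_set_sum:
  assumes "subring_set R" "\<And>i. i \<in> I \<Longrightarrow> g i \<in> R"
  shows "sum g I \<in> R"
  using assms(2) by (induction I rule: infinite_finite_induct) (simp_all add: subring_setD[OF assms(1)])

lemma subring_set_prod:
  assumes "subring_set R" "\<And>i. i \<in> I \<Longrightarrow> g i \<in> R"
  shows "prod g I \<in> R"
  using assms(2) by (induction I rule: infinite_finite_induct) (simp_all add: subring_setD[OF assms(1)])

lemma subring_set_power:
  assumes "subring_set R" "x \<in> R"
  shows "x ^ n \<in> R"
  by (induction n) (simp_all add: assms(2) subring_setD[OF assms(1)])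

lemma subring_set_polys:
  fixes R :: "'a::comm_ring_1 set"
  assumes "subring_set R"
  shows "subring_set {q. \<forall>i. poly.coeff q i \<in> R}"
  unfolding subring_set_def
proof (intro conjI ballI)
  show "0 \<in> {q. \<forall>i. poly.coeff q i \<in> R}" "1 \<in> {q. \<forall>i. poly.coeff q i \<in> R}"
    by (auto simp: subring_setD[OF assms])
  fix x y :: "'a poly"
  assume xy: "x \<in> {q. \<forall>i. poly.coeff q i \<in> R}" "y \<in> {q. \<forall>i. poly.coeff q i \<in> R}"
  show "x + y \<in> {q. \<forall>i. poly.coeff q i \<in> R}"
    using xy by (auto simp: subring_setD[OF assms])
  show "x * y \<in> {q. \<forall>i. poly.coeff q i \<in> R}"
    using xy by (auto simp: coeff_mult subring_setD[OF assms] intro!: subring_set_sum[OF assms])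
qed (auto simp: subring_setD[OF assms])

text \<open>In the Leibniz formula every entry of the characteristic matrix has coefficients in R,
  and such polynomials form a ring.\<close>

lemma char_poly_in_subring:
  assumes R: "subring_set R" and M: "M \<in> carrier_mat n n"
    and entries: "\<And>i j. i < n \<Longrightarrow> j < n \<Longrightarrow> M $$ (i, j) \<in> R"
  shows "poly.coeff (char_poly M) k \<in> R"
proof -
  define X where "X = {q. \<forall>i. poly.coeff q i \<in> R}"
  have X: "subring_set X"
    unfolding X_def by (rule subring_set_polys[OF R])
  have entry: "char_poly_matrix M $$ (i, j) \<in> X" if "i < n" "j < n" for i j
  proof -
    have "char_poly_matrix M $$ (i, j) = (if i = j then [:0, 1:] else 0) + [:- (M $$ (i, j)):]"
      using that M by (auto simp: char_poly_matrix_def)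
    then show ?thesis
      using entries[OF that] by (auto simp: X_def coeff_pCons subring_setD[OF R] split: nat.splits)
  qed
  have "signof \<sigma> * (\<Prod>i = 0..<n. char_poly_matrix M $$ (i, \<sigma> i)) \<in> X"
    if \<sigma>: "\<sigma> permutes {0..<n}" for \<sigma>
  proof (rule subring_setD(4)[OF X])
    show "signof \<sigma> \<in> X"
    proof (rule sign_cases[of \<sigma>])
      assume "sign \<sigma> = 1"
      then show "signof \<sigma> \<in> X" by (simp add: subring_setD(2)[OF X])
    next
      assume "sign \<sigma> = - 1"
      then show "signof \<sigma> \<in> X" by (simp add: subring_setD(2,5)[OF X])
    qed
    show "(\<Prod>i = 0..<n. char_poly_matrix M $$ (i, \<sigma> i)) \<in> X"
    proof (rule subring_set_prod[OF X])
      fix i assume "i \<in> {0..<n}"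
      then show "char_poly_matrix M $$ (i, \<sigma> i) \<in> X"
        using permutes_in_image[OF \<sigma>, of i] by (intro entry) simp_all
    qed
  qed
  then have "det (char_poly_matrix M) \<in> X"
    unfolding det_def'[OF char_poly_matrix_closed[OF M]]
    by (intro subring_set_sum[OF X]) simp
  then show ?thesis
    by (simp add: char_poly_def X_def)
qed

text \<open>Multiplication by \<open>z\<close> has the vector of the generators as an eigenvector, so \<open>z\<close> is a root of
  the characteristic polynomial of its matrix.\<close>

lemma integral_over_of_module:
  fixes z :: "'a::field"
  assumes R: "subring_set R" and B: "finite B" "b0 \<in> B" "b0 \<noteq> 0"
    and stable: "\<And>b. b \<in> B \<Longrightarrow> \<exists>c. (\<forall>b'\<in>B. c b' \<in> R) \<and> z * b = (\<Sum>b'\<in>B. c b' * b')"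
  shows "integral_over R z"
proof -
  obtain c where c: "\<And>b b'. b \<in> B \<Longrightarrow> b' \<in> B \<Longrightarrow> c b b' \<in> R"
      "\<And>b. b \<in> B \<Longrightarrow> z * b = (\<Sum>b'\<in>B. c b b' * b')"
    using stable by metis
  define n where "n = card B"
  obtain e where e: "bij_betw e {0..<n} B"
    using ex_bij_betw_nat_finite[OF B(1)] unfolding n_def by blast
  define M where "M = mat n n (\<lambda>(i, j). c (e i) (e j))"
  define v where "v = vec n e"
  have M: "M \<in> carrier_mat n n" unfolding M_def by simp
  have eB: "e i \<in> B" if "i < n" for i
    using e that by (auto simp: bij_betw_def)
  have "M *\<^sub>v v = z \<cdot>\<^sub>v v"
  proof (rule eq_vecI)
    fix i assume "i < dim_vec (z \<cdot>\<^sub>v v)"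
    then have i: "i < n" by (simp add: v_def)
    have "(M *\<^sub>v v) $ i = (\<Sum>j\<in>{0..<n}. c (e i) (e j) * e j)"
      using i by (simp add: M_def v_def scalar_prod_def)
    also have "\<dots> = (\<Sum>b'\<in>B. c (e i) b' * b')"
      by (rule sum.reindex_bij_betw[OF e])
    also have "\<dots> = z * e i"
      using c(2)[OF eB[OF i]] by simp
    finally show "(M *\<^sub>v v) $ i = (z \<cdot>\<^sub>v v) $ i"
      using i by (simp add: v_def)
  qed (simp add: M_def v_def)
  moreover have "v \<noteq> 0\<^sub>v n"
  proof -
    obtain i where "i < n" "e i = b0"
      using e B(2) by (auto simp: bij_betw_def)
    then have "v $ i \<noteq> 0\<^sub>v n $ i"
      using B(3) by (simp add: v_def)
    then show ?thesis by auto
  qed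
  moreover have "v \<in> carrier_vec (dim_row M)" "dim_row M = n"
    by (simp_all add: v_def M_def)
  ultimately have "eigenvalue M z"
    unfolding eigenvalue_def eigenvector_def by metis
  then have "poly (char_poly M) z = 0"
    using eigenvalue_root_char_poly[OF M] by blast
  moreover have "lead_coeff (char_poly M) = 1"
    using degree_monic_char_poly[OF M] by auto
  moreover have "poly.coeff (char_poly M) k \<in> R" for k
    using char_poly_in_subring[OF R M] c(1) eB by (simp add: M_def)
  ultimately show ?thesis
    unfolding integral_over_def by blast
qed

definition span_over :: "'a::comm_ring_1 set \<Rightarrow> 'a set \<Rightarrow> 'a set" where
  "span_over R B = {x. \<exists>c. (\<forall>b\<in>B. c b \<in> R) \<and> x = (\<Sum>b\<in>B. c b * b)}"

lemma span_over_add: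
  assumes "subring_set R" "x \<in> span_over R B" "y \<in> span_over R B"
  shows "x + y \<in> span_over R B"
proof -
  obtain c d where "\<forall>b\<in>B. c b \<in> R" "x = (\<Sum>b\<in>B. c b * b)" "\<forall>b\<in>B. d b \<in> R" "y = (\<Sum>b\<in>B. d b * b)"
    using assms(2,3) unfolding span_over_def by auto
  then show ?thesis
    unfolding span_over_def
    by (intro CollectI exI[of _ "\<lambda>b. c b + d b"]) (auto simp: subring_setD[OF assms(1)] algebra_simps sum.distrib)
qed

lemma span_over_smult:
  assumes "subring_set R" "a \<in> R" "x \<in> span_over R B"
  shows "a * x \<in> span_over R B"
proof -
  obtain c where "\<forall>b\<in>B. c b \<in> R" "x = (\<Sum>b\<in>B. c b * b)"
    using assms(3) unfolding span_over_def by auto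
  then show ?thesis
    unfolding span_over_def
    by (intro CollectI exI[of _ "\<lambda>b. a * c b"])
       (auto simp: subring_setD[OF assms(1)] assms(2) sum_distrib_left mult.assoc)
qed

lemma span_over_0: "subring_set R \<Longrightarrow> 0 \<in> span_over R B"
  unfolding span_over_def by (intro CollectI exI[of _ "\<lambda>_. 0"]) (auto simp: subring_setD)

lemma span_over_sum:
  assumes "subring_set R" "\<And>i. i \<in> I \<Longrightarrow> g i \<in> span_over R B"
  shows "sum g I \<in> span_over R B"
  using assms(2)
  by (induction I rule: infinite_finite_induct) (auto intro: span_over_0[OF assms(1)] span_over_add[OF assms(1)])

lemma span_over_base:
  assumes "subring_set R" "finite B" "b \<in> B"
  shows "b \<in> span_over R B"
  unfolding span_over_def
proof (intro CollectI exI[of _ "\<lambda>b'. if b' = b then 1 else 0"] conjI)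
  show "b = (\<Sum>b'\<in>B. (if b' = b then 1 else 0) * b')"
    using assms(2,3) by (simp add: if_distrib[of "\<lambda>x. x * _"] sum.delta cong: if_cong)
qed (auto simp: subring_setD[OF assms(1)])

lemma span_over_mult_stable:
  assumes R: "subring_set R" and "\<And>b. b \<in> B \<Longrightarrow> z * b \<in> span_over R B" and x: "x \<in> span_over R B"
  shows "z * x \<in> span_over R B"
proof -
  obtain c where "\<forall>b\<in>B. c b \<in> R" "x = (\<Sum>b\<in>B. c b * b)"
    using x unfolding span_over_def by auto
  moreover have "(\<Sum>b\<in>B. c b * (z * b)) \<in> span_over R B" if "\<forall>b\<in>B. c b \<in> R" for c
    using that assms(2) by (intro span_over_sum[OF R] span_over_smult[OF R, of "c _"]) auto
  ultimately show ?thesis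
    by (simp add: sum_distrib_left mult.left_commute)
qed

lemma integral_over_span:
  assumes "subring_set R" "finite B" "b0 \<in> B" "b0 \<noteq> 0"
    and "\<And>b. b \<in> B \<Longrightarrow> z * b \<in> span_over R B"
  shows "integral_over R z"
  using integral_over_of_module[OF assms(1-4), of z] assms(5) unfolding span_over_def by blast

lemma integral_power_relation:
  assumes R: "subring_set R" and x: "integral_over R x"
  obtains m c where "0 < m" "\<And>i. i < m \<Longrightarrow> c i \<in> R" "x ^ m = (\<Sum>i<m. c i * x ^ i)"
proof -
  obtain q where q: "lead_coeff q = 1" "\<And>i. poly.coeff q i \<in> R" "poly q x = 0"
    using x unfolding integral_over_def by auto
  have "degree q \<noteq> 0"
  proof
    assume "degree q = 0"
    then obtain a where "q = [:a:]" by (rule degree_eq_zeroE)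
    then show False using q by simp
  qed
  moreover have "x ^ degree q = (\<Sum>i<degree q. - poly.coeff q i * x ^ i)"
    using q(1,3) unfolding poly_altdef lessThan_Suc_atMost[symmetric]
    by (simp add: sum_negf eq_neg_iff_add_eq_0 add.commute)
  ultimately show ?thesis
    using q(2) by (intro that[of "degree q" "\<lambda>i. - poly.coeff q i"]) (auto simp: subring_setD[OF R])
qed

text \<open>The monomials of bounded degree in x and y generate one module stable under both, so it
  serves for the sum and the product alike.\<close>

lemma integral_over_two:
  fixes x y :: "'a::field"
  assumes R: "subring_set R" and "integral_over R x" "integral_over R y"
  obtains B where "finite B" "1 \<in> B" "\<And>b. b \<in> B \<Longrightarrow> x * b \<in> span_over R B"
    "\<And>b. b \<in> B \<Longrightarrow> y * b \<in> span_over R B"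
proof -
  obtain m c where m: "0 < m" "\<And>i. i < m \<Longrightarrow> c i \<in> R" "x ^ m = (\<Sum>i<m. c i * x ^ i)"
    using integral_power_relation[OF R assms(2)] by blast
  obtain n d where n: "0 < n" "\<And>i. i < n \<Longrightarrow> d i \<in> R" "y ^ n = (\<Sum>i<n. d i * y ^ i)"
    using integral_power_relation[OF R assms(3)] by blast
  define B where "B = (\<lambda>(i, j). x ^ i * y ^ j) ` ({..<m} \<times> {..<n})"
  have fin: "finite B" unfolding B_def by simp
  have base: "x ^ i * y ^ j \<in> span_over R B" if "i < m" "j < n" for i j
    using that by (intro span_over_base[OF R fin]) (auto simp: B_def)
  have "x * b \<in> span_over R B" if b: "b \<in> B" for b
  proof -
    obtain i j where ij: "i < m" "j < n" "b = x ^ i * y ^ j"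
      using b unfolding B_def by auto
    show ?thesis
    proof (cases "Suc i < m")
      case True
      then show ?thesis using base[of "Suc i" j] ij by (simp add: mult.assoc)
    next
      case False
      \<comment> \<open>At the top exponent the relation for x brings the degree down again.\<close>
      then have "Suc i = m" using ij(1) by simp
      then have "x * b = (\<Sum>i<m. c i * x ^ i) * y ^ j"
        using ij(3) m(3) by (metis mult.assoc power_Suc)
      also have "\<dots> = (\<Sum>i<m. c i * (x ^ i * y ^ j))"
        by (simp add: sum_distrib_right mult.assoc)
      also have "\<dots> \<in> span_over R B"
        using m(2) base ij(2) by (intro span_over_sum[OF R] span_over_smult[OF R, of "c _"]) auto
      finally show ?thesis .
    qed
  qed
  moreover have "y * b \<in> span_over R B" if b: "b \<in> B" for b
  proof -
    obtain i j where ij: "i < m" "j < n" "b = x ^ i * y ^ j"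
      using b unfolding B_def by auto
    show ?thesis
    proof (cases "Suc j < n")
      case True
      then show ?thesis using base[of i "Suc j"] ij by (simp add: mult.left_commute)
    next
      case False
      then have "Suc j = n" using ij(2) by simp
      then have "y * b = (\<Sum>j<n. d j * y ^ j) * x ^ i"
        using ij(3) n(3) by (metis mult.assoc mult.commute power_Suc)
      also have "\<dots> = (\<Sum>j<n. d j * (x ^ i * y ^ j))"
        by (simp add: sum_distrib_left mult_ac)
      also have "\<dots> \<in> span_over R B"
        using n(2) base ij(1) by (intro span_over_sum[OF R] span_over_smult[OF R, of "d _"]) auto
      finally show ?thesis .
    qed
  qed
  moreover have "1 \<in> B"
    unfolding B_def using m(1) n(1) by (intro image_eqI[of _ _ "(0, 0)"]) auto
  ultimately show ?thesis using fin that by blast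
qed

lemma integral_over_add_mult:
  fixes x y :: "'a::field"
  assumes R: "subring_set R" and "integral_over R x" "integral_over R y"
  shows "integral_over R (x + y)" "integral_over R (x * y)"
proof -
  obtain B where B: "finite B" "1 \<in> B" "\<And>b. b \<in> B \<Longrightarrow> x * b \<in> span_over R B"
    "\<And>b. b \<in> B \<Longrightarrow> y * b \<in> span_over R B"
    by (rule integral_over_two[OF assms]) (rule that)
  show "integral_over R (x + y)"
    using B by (intro integral_over_span[OF R B(1,2)]) (auto simp: distrib_right intro: span_over_add[OF R])
  show "integral_over R (x * y)"
    using B by (intro integral_over_span[OF R B(1,2)])
      (auto simp: mult.assoc intro: span_over_mult_stable[OF R B(3)])
qed

lemma integral_over_base:
  assumes "subring_set R" "x \<in> R"
  shows "integral_over R x"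
  unfolding integral_over_def
  by (intro exI[of _ "[:- x, 1:]"]) (auto simp: coeff_pCons subring_setD[OF assms(1)] assms(2) split: nat.splits)

lemma subring_integral_closure:
  fixes R :: "'a::field set"
  assumes "subring_set R"
  shows "subring_set {x. integral_over R x}"
proof -
  have "integral_over R (- 1)"
    using assms by (intro integral_over_base) (auto simp: subring_setD)
  then have "integral_over R (- x)" if "integral_over R x" for x
    using integral_over_add_mult(2)[OF assms _ that] by fastforce
  then show ?thesis
    unfolding subring_set_def
    using integral_over_add_mult[OF assms] integral_over_base[OF assms] subring_setD[OF assms] by auto
qed

lemma subfield_imp_subring: "subfield_set F \<Longrightarrow> subring_set F"
  unfolding subfield_set_def subring_set_def by auto

lemma algebraic_over_imp_integral_over:
  assumes F: "subfield_set F" and x: "algebraic_over F x"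
  shows "integral_over F x"
proof -
  obtain q where q: "q \<noteq> 0" "\<forall>i. poly.coeff q i \<in> F" "poly q x = 0"
    using x unfolding algebraic_over_def by auto
  show ?thesis
    unfolding integral_over_def
    using q F by (intro exI[of _ "Polynomial.smult (inverse (lead_coeff q)) q"])
      (auto simp: subfield_set_def)
qed

text \<open>Transitivity of integrality: generators of L over F, times the powers of z below the
  degree of a relation over L, span an F-module stable under z.\<close>

lemma integral_over_finite_ext:
  fixes F :: "'a::field set"
  assumes ext: "finite_ext F L" and z: "algebraic_over L z"
  shows "integral_over F z"
proof -
  have F: "subring_set F" and L: "subfield_set L"
    using ext subfield_imp_subring unfolding finite_ext_def by auto
  have L1: "1 \<in> L" using L unfolding subfield_set_def by auto
  have Lr: "subring_set L" using L by (rule subfield_imp_subring)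
  obtain B where B: "finite B" "B \<subseteq> L" "\<And>x. x \<in> L \<Longrightarrow> x \<in> span_over F B"
    using ext unfolding finite_ext_def span_over_def by blast
  obtain m c where m: "0 < m" "\<And>i. i < m \<Longrightarrow> c i \<in> L" "z ^ m = (\<Sum>i<m. c i * z ^ i)"
    using integral_power_relation[OF Lr algebraic_over_imp_integral_over[OF L z]] by blast
  define C where "C = (\<lambda>(b, i). b * z ^ i) ` (B \<times> {..<m})"
  have fin: "finite C" unfolding C_def using B(1) by simp
  have base: "x * z ^ i \<in> span_over F C" if x: "x \<in> L" and i: "i < m" for x i
  proof -
    obtain a where a: "\<forall>b\<in>B. a b \<in> F" "x = (\<Sum>b\<in>B. a b * b)"
      using B(3)[OF x] unfolding span_over_def by auto
    have "b * z ^ i \<in> span_over F C" if "b \<in> B" for b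
      using that i by (intro span_over_base[OF F fin]) (auto simp: C_def)
    then have "(\<Sum>b\<in>B. a b * (b * z ^ i)) \<in> span_over F C"
      using a(1) by (intro span_over_sum[OF F] span_over_smult[OF F, of "a _"]) auto
    then show ?thesis
      using a(2) by (simp add: sum_distrib_right mult.assoc)
  qed
  have stable: "z * b \<in> span_over F C" if b: "b \<in> C" for b
  proof -
    obtain b' i where bi: "b' \<in> B" "i < m" "b = b' * z ^ i"
      using b unfolding C_def by auto
    then have b': "b' \<in> L" using B(2) by auto
    show ?thesis
    proof (cases "Suc i < m")
      case True
      then show ?thesis using base[OF b' True] bi by (simp add: mult.left_commute)
    next
      case False
      then have "Suc i = m" using bi(2) by simp
      then have "z * b = b' * (\<Sum>i<m. c i * z ^ i)"
        using bi(3) m(3) by (metis mult.left_commute power_Suc)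
      also have "\<dots> = (\<Sum>i<m. (b' * c i) * z ^ i)"
        by (simp add: sum_distrib_left mult.assoc)
      also have "\<dots> \<in> span_over F C"
        using m(2) b' by (intro span_over_sum[OF F] base) (auto simp: subring_setD[OF Lr])
      finally show ?thesis .
    qed
  qed
  \<comment> \<open>An eigenvector must be nonzero: the generators span 1, so they cannot all
    vanish.\<close>
  have "\<not> C \<subseteq> {0}"
  proof
    assume "C \<subseteq> {0}"
    then have "b * b' = 0" if "b' \<in> C" for b b' :: 'a
      using that by auto
    then have "span_over F C \<subseteq> {0}"
      unfolding span_over_def by (auto intro!: sum.neutral)
    then show False
      using base[OF L1 m(1)] by auto
  qed
  then obtain b0 where "b0 \<in> C" "b0 \<noteq> 0" by blast
  then show ?thesis
    using stable by (intro integral_over_span[OF F fin]) auto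
qed

section \<open>Extension of homomorphisms\<close>

text \<open>A ring homomorphism from a subring containing \<open>K\<close> that is the identity on \<open>K\<close>, as a graph.\<close>

definition partial_hom :: "'a::comm_ring_1 set \<Rightarrow> ('a \<times> 'a) set \<Rightarrow> bool" where
  "partial_hom K S \<longleftrightarrow> (\<forall>k\<in>K. (k, k) \<in> S) \<and>
     (\<forall>x y x' y'. (x, y) \<in> S \<longrightarrow> (x', y') \<in> S \<longrightarrow> (x + x', y + y') \<in> S \<and> (x * x', y * y') \<in> S) \<and>
     (\<forall>y. (0, y) \<in> S \<longrightarrow> y = 0)"

lemma partial_homD:
  assumes "partial_hom K S"
  shows "\<And>k. k \<in> K \<Longrightarrow> (k, k) \<in> S"
    "\<And>x y x' y'. (x, y) \<in> S \<Longrightarrow> (x', y') \<in> S \<Longrightarrow> (x + x', y + y') \<in> S"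
    "\<And>x y x' y'. (x, y) \<in> S \<Longrightarrow> (x', y') \<in> S \<Longrightarrow> (x * x', y * y') \<in> S"
    "\<And>y. (0, y) \<in> S \<Longrightarrow> y = 0"
  using assms unfolding partial_hom_def by blast+

context
  fixes K :: "'a::alg_closed_field set" and S :: "('a \<times> 'a) set"
  assumes K: "alg_closure_of K" and S: "partial_hom K S"
begin

lemma subfield_K: "0 \<in> K" "1 \<in> K" "- 1 \<in> K" "x \<in> K \<Longrightarrow> inverse x \<in> K" "x \<in> K \<Longrightarrow> - x \<in> K"
    "x \<in> K \<Longrightarrow> y \<in> K \<Longrightarrow> x * y \<in> K" "x \<in> K \<Longrightarrow> y \<in> K \<Longrightarrow> x + y \<in> K"
  using K unfolding alg_closure_of_def subfield_set_def by auto

lemma partial_hom_uminus: "(x, y) \<in> S \<Longrightarrow> (- x, - y) \<in> S"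
  using partial_homD(3)[OF S partial_homD(1)[OF S subfield_K(3)]] by fastforce

lemma partial_hom_diff: "(x, y) \<in> S \<Longrightarrow> (x', y') \<in> S \<Longrightarrow> (x - x', y - y') \<in> S"
  using partial_homD(2)[OF S _ partial_hom_uminus] by fastforce

lemma partial_hom_unique: "(x, y) \<in> S \<Longrightarrow> (x, y') \<in> S \<Longrightarrow> y = y'"
  using partial_hom_diff[of x y x y'] partial_homD(4)[OF S] by fastforce

lemma partial_hom_sum:
  assumes "\<And>i. i \<in> I \<Longrightarrow> (g i, h i) \<in> S"
  shows "(sum g I, sum h I) \<in> S"
  using assms by (induction I rule: infinite_finite_induct)
    (auto simp: partial_homD(1)[OF S subfield_K(1)] intro: partial_homD(2)[OF S])

lemma partial_hom_power: "(x, y) \<in> S \<Longrightarrow> (x ^ n, y ^ n) \<in> S"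
  by (induction n) (auto simp: partial_homD(1)[OF S subfield_K(2)] intro: partial_homD(3)[OF S])

lemma nonzero_const_relation:
  assumes "z \<noteq> 0"
  obtains q where "\<And>i. poly.coeff q i \<in> K" "poly.coeff q 0 \<noteq> 0" "poly q z = 0"
proof -
  have "\<exists>q. q \<noteq> 0 \<and> (\<forall>i. poly.coeff q i \<in> K) \<and> poly q z = 0"
    using K unfolding alg_closure_of_def algebraic_over_def by blast
  then obtain q where q: "q \<noteq> 0" "\<forall>i. poly.coeff q i \<in> K" "poly q z = 0"
    by blast
  obtain k where k: "[:0, 1:] ^ k dvd q" "\<not> [:0, 1:] ^ Suc k dvd q"
    using q(1) order[of q 0] by (metis minus_zero)
  then obtain q' where q': "q = [:0, 1:] ^ k * q'" by blast
  then have "\<not> [:0, 1:] dvd q'"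
    using k(2) by (metis dvd_refl mult_dvd_mono power_Suc2)
  then have "poly.coeff q' 0 \<noteq> 0"
    using poly_eq_0_iff_dvd[of q' 0] by (simp add: poly_0_coeff_0)
  moreover have "poly.coeff q' i \<in> K" for i
  proof -
    have "q = Polynomial.monom 1 k * q'"
      using q' by (simp add: monom_altdef)
    then have "poly.coeff q (i + k) = poly.coeff q' i"
      by (simp add: coeff_monom_mult)
    then show ?thesis using q(2) by metis
  qed
  moreover have "poly q' z = 0"
    using q(3) assms unfolding q' by simp
  ultimately show ?thesis using that by blast
qed

text \<open>A relation for z over K with nonzero constant term writes \<open>inverse z\<close> as a
  polynomial in z over K. Hence the domain of a partial homomorphism is closed under inverses,
  although only sums and products are demanded of it.\<close>

lemma partial_hom_inverse:
  assumes "(z, w) \<in> S" "z \<noteq> 0"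
  obtains w' where "(inverse z, w') \<in> S"
proof -
  obtain q where q: "\<And>i. poly.coeff q i \<in> K" "poly.coeff q 0 \<noteq> 0" "poly q z = 0"
    using nonzero_const_relation assms(2) by blast
  obtain a q' where aq: "q = pCons a q'"
    by (cases q) auto
  have a: "a \<in> K" "a \<noteq> 0" and q': "\<And>i. poly.coeff q' i \<in> K"
    using q(1)[of 0] q(2) q(1)[of "Suc _"] unfolding aq by auto
  have "(\<Sum>i\<le>degree q'. poly.coeff q' i * z ^ i, \<Sum>i\<le>degree q'. poly.coeff q' i * w ^ i) \<in> S"
    using q' assms(1) by (intro partial_hom_sum partial_homD(3)[OF S] partial_homD(1)[OF S] partial_hom_power)
  then have "(poly q' z, poly q' w) \<in> S"
    by (simp add: poly_altdef)
  then have "(- inverse a * poly q' z, - inverse a * poly q' w) \<in> S"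
    using a by (intro partial_homD(3)[OF S] partial_homD(1)[OF S]) (auto simp: subfield_K)
  moreover have "- inverse a * poly q' z = inverse z"
    using q(3) a(2) assms(2) unfolding aq by (simp add: field_simps) (metis neg_eq_iff_add_eq_0 add.commute)
  ultimately show ?thesis using that by auto
qed

definition hom_polys :: "('a poly \<times> 'a poly) set" where
  "hom_polys = {(f, f'). \<forall>i. (poly.coeff f i, poly.coeff f' i) \<in> S}"

lemma hom_polys_add: "(f, f') \<in> hom_polys \<Longrightarrow> (g, g') \<in> hom_polys \<Longrightarrow> (f + g, f' + g') \<in> hom_polys"
  unfolding hom_polys_def by (auto intro: partial_homD(2)[OF S])

lemma hom_polys_diff: "(f, f') \<in> hom_polys \<Longrightarrow> (g, g') \<in> hom_polys \<Longrightarrow> (f - g, f' - g') \<in> hom_polys"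
  unfolding hom_polys_def by (auto intro: partial_hom_diff)

lemma hom_polys_mult: "(f, f') \<in> hom_polys \<Longrightarrow> (g, g') \<in> hom_polys \<Longrightarrow> (f * g, f' * g') \<in> hom_polys"
  unfolding hom_polys_def by (auto simp: coeff_mult intro!: partial_hom_sum partial_homD(3)[OF S])

lemma hom_polys_const: "(a, b) \<in> S \<Longrightarrow> ([:a:], [:b:]) \<in> hom_polys"
  unfolding hom_polys_def
  by (auto simp: coeff_pCons partial_homD(1)[OF S subfield_K(1)] split: nat.splits)

lemma hom_polys_monom: "(a, b) \<in> S \<Longrightarrow> (Polynomial.monom a n, Polynomial.monom b n) \<in> hom_polys"
  unfolding hom_polys_def
  by (auto simp: partial_homD(1)[OF S subfield_K(1)])

lemma hom_polys_zero: "(0, f') \<in> hom_polys \<Longrightarrow> f' = 0"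
  unfolding hom_polys_def by (auto intro!: poly_eqI partial_homD(4)[OF S])

text \<open>The pair \<open>(f0, f0')\<close> is the minimal polynomial of \<open>x\<close> over the domain of the homomorphism,
  and its image.\<close>

lemma minimal_pair:
  obtains f0 f0' where "(f0, f0') \<in> hom_polys" "lead_coeff f0 = 1" "lead_coeff f0' = 1"
    "degree f0' = degree f0" "0 < degree f0" "poly f0 x = 0"
    "\<forall>f f'. (f, f') \<in> hom_polys \<longrightarrow> poly f x = 0 \<longrightarrow> f = 0 \<or> degree f0 \<le> degree f"
proof -
  let ?P = "\<lambda>f. f \<noteq> 0 \<and> poly f x = 0 \<and> (\<exists>f'. (f, f') \<in> hom_polys)"
  have "\<exists>q. q \<noteq> 0 \<and> (\<forall>i. poly.coeff q i \<in> K) \<and> poly q x = 0"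
    using K unfolding alg_closure_of_def algebraic_over_def by blast
  then obtain q where "q \<noteq> 0" "\<forall>i. poly.coeff q i \<in> K" "poly q x = 0" by blast
  then have "?P q"
    unfolding hom_polys_def using partial_homD(1)[OF S] by blast
  then have "\<exists>f. ?P f \<and> (\<forall>g. ?P g \<longrightarrow> degree f \<le> degree g)"
    by (rule ex_has_least_nat)
  then obtain f where f: "?P f" "\<And>g. ?P g \<Longrightarrow> degree f \<le> degree g"
    by blast
  then obtain f' where f': "(f, f') \<in> hom_polys" by blast
  have lc: "(lead_coeff f, poly.coeff f' (degree f)) \<in> S"
    using f' unfolding hom_polys_def by blast
  have "lead_coeff f \<noteq> 0" using f(1) by simp
  \<comment> \<open>Scaling by the inverse leading coefficient and by its image w makes the
    polynomial and its image monic at once.\<close>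
  then obtain w where w: "(inverse (lead_coeff f), w) \<in> S"
    using partial_hom_inverse[OF lc] by blast
  let ?g = "[:inverse (lead_coeff f):] * f" and ?g' = "[:w:] * f'"
  have g: "(?g, ?g') \<in> hom_polys"
    by (rule hom_polys_mult[OF hom_polys_const[OF w] f'])
  have "(inverse (lead_coeff f) * lead_coeff f, w * poly.coeff f' (degree f)) \<in> S"
    by (rule partial_homD(3)[OF S w lc])
  then have "(1, w * poly.coeff f' (degree f)) \<in> S"
    using \<open>lead_coeff f \<noteq> 0\<close> by simp
  from partial_hom_unique[OF this partial_homD(1)[OF S subfield_K(2)]]
  have 1: "w * poly.coeff f' (degree f) = 1" .
  have "degree f' \<le> degree f"
  proof (rule degree_le, intro allI impI)
    fix i assume "degree f < i"
    then have "poly.coeff f i = 0" by (rule coeff_eq_0)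
    moreover have "(poly.coeff f i, poly.coeff f' i) \<in> S"
      using f' unfolding hom_polys_def by blast
    ultimately show "poly.coeff f' i = 0"
      using partial_homD(4)[OF S] by simp
  qed
  moreover have "degree f \<le> degree f'"
    using 1 by (intro le_degree) auto
  ultimately have deg: "degree f' = degree f" by simp
  have deg_g: "degree ?g = degree f"
    using \<open>lead_coeff f \<noteq> 0\<close> by simp
  have "w \<noteq> 0" using 1 by auto
  then have deg_g': "degree ?g' = degree f"
    using deg by simp
  have "degree f \<noteq> 0"
  proof
    assume "degree f = 0"
    then obtain a where "f = [:a:]" by (rule degree_eq_zeroE)
    then show False using f(1) by auto
  qed
  show ?thesis
  proof (rule that[OF g])
    show "lead_coeff ?g = 1" using \<open>lead_coeff f \<noteq> 0\<close> by (simp add: lead_coeff_smult)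
    show "lead_coeff ?g' = 1" using 1 deg_g' by simp
    show "poly ?g x = 0" using f(1) by simp
    show "degree ?g' = degree ?g" "0 < degree ?g"
      using deg_g deg_g' \<open>degree f \<noteq> 0\<close> by simp_all
    show "\<forall>h h'. (h, h') \<in> hom_polys \<longrightarrow> poly h x = 0 \<longrightarrow> h = 0 \<or> degree ?g \<le> degree h"
    proof (intro allI impI)
      fix h h' assume h: "(h, h') \<in> hom_polys" "poly h x = 0"
      show "h = 0 \<or> degree ?g \<le> degree h"
      proof (cases "h = 0")
        case False
        then have "?P h" using h by blast
        then show ?thesis using f(2)[of h] deg_g by (simp only: simp_thms)
      qed simp
    qed
  qed
qed

text \<open>Evaluation at x is sent to evaluation of the image polynomial at y. This is well defined
  because a polynomial vanishing at x is reduced to 0 by subtracting multiples of the minimal one,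
  whose image vanishes at y.\<close>

lemma extend_partial_hom:
  assumes f0: "(f0, f0') \<in> hom_polys" "lead_coeff f0 = 1" "lead_coeff f0' = 1"
    "degree f0' = degree f0" "poly f0 x = 0"
    and min: "\<And>f f'. (f, f') \<in> hom_polys \<Longrightarrow> poly f x = 0 \<Longrightarrow> f = 0 \<or> degree f0 \<le> degree f"
    and y: "poly f0' y = 0"
  obtains S' where "partial_hom K S'" "S \<subseteq> S'" "(x, y) \<in> S'"
proof -
  define S' where "S' = (\<lambda>(f, f'). (poly f x, poly f' y)) ` hom_polys"
  have zero: "poly f' y = 0" if "(f, f') \<in> hom_polys" "poly f x = 0" for f f'
    using that
  \<comment> \<open>The zero polynomial gets a measure below that of the constants, so that a
    vanishing remainder always counts as smaller.\<close>
  proof (induction "if f = 0 then 0 else Suc (degree f)" arbitrary: f f' rule: less_induct)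
    case less
    show ?case
    proof (cases "f = 0")
      case True
      then show ?thesis using hom_polys_zero less(2) by fastforce
    next
      case False
      then have le: "degree f0 \<le> degree f" using min less(2,3) by blast
      have lc: "(lead_coeff f, poly.coeff f' (degree f)) \<in> S"
        using less(2) unfolding hom_polys_def by blast
      let ?k = "degree f - degree f0"
      let ?g = "f - Polynomial.monom (lead_coeff f) ?k * f0" and ?g' = "f' - Polynomial.monom (poly.coeff f' (degree f)) ?k * f0'"
      have "(?g, ?g') \<in> hom_polys"
        by (intro hom_polys_diff hom_polys_mult hom_polys_monom less(2) f0 lc)
      moreover have "poly ?g x = 0" using less(3) f0 by simp
      moreover have "?g = 0 \<or> degree ?g < degree f"
      proof (rule disjCI)
        assume "\<not> degree ?g < degree f"
        have le': "degree ?g \<le> degree f"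
          using degree_mult_le[of "Polynomial.monom (lead_coeff f) ?k" f0] le degree_monom_le[of "lead_coeff f" ?k]
          by (intro degree_diff_le) auto
        have "poly.coeff ?g (degree f) = 0"
          using le f0(2) by (simp add: coeff_monom_mult)
        moreover have "degree ?g = degree f"
          using le' \<open>\<not> degree ?g < degree f\<close> by simp
        ultimately show "?g = 0" by (metis leading_coeff_0_iff)
      qed
      ultimately have "poly ?g' y = 0"
        using False by (intro less(1)[of ?g]) auto
      then show ?thesis using y by simp
    qed
  qed
  have "partial_hom K S'"
    unfolding partial_hom_def
  proof (intro conjI ballI allI impI)
    fix k assume "k \<in> K"
    then show "(k, k) \<in> S'"
      unfolding S'_def using hom_polys_const[OF partial_homD(1)[OF S]]
      by (intro image_eqI[of _ _ "([:k:], [:k:])"]) auto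
  next
    fix a b a' b' assume "(a, b) \<in> S'" "(a', b') \<in> S'"
    then obtain f f' g g' where *: "(f, f') \<in> hom_polys" "(g, g') \<in> hom_polys"
        "a = poly f x" "b = poly f' y" "a' = poly g x" "b' = poly g' y"
      unfolding S'_def by auto
    show "(a + a', b + b') \<in> S'"
      unfolding S'_def using hom_polys_add[OF *(1,2)] *(3-6)
      by (intro image_eqI[of _ _ "(f + g, f' + g')"]) simp_all
    show "(a * a', b * b') \<in> S'"
      unfolding S'_def using hom_polys_mult[OF *(1,2)] *(3-6)
      by (intro image_eqI[of _ _ "(f * g, f' * g')"]) simp_all
  next
    fix b assume "(0, b) \<in> S'"
    then show "b = 0" unfolding S'_def using zero by auto
  qed
  moreover have "S \<subseteq> S'"
  proof clarify
    fix a b assume "(a, b) \<in> S"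
    then show "(a, b) \<in> S'"
      unfolding S'_def by (intro image_eqI[of _ _ "([:a:], [:b:])"] hom_polys_const) simp_all
  qed
  moreover have "(x, y) \<in> S'"
  proof -
    have "([:0, 1:], [:0, 1:]) \<in> hom_polys"
      unfolding hom_polys_def
      by (auto simp: coeff_pCons partial_homD(1)[OF S] subfield_K split: nat.splits)
    then show ?thesis
      unfolding S'_def by (intro image_eqI[of _ _ "([:0, 1:], [:0, 1:])"]) simp_all
  qed
  ultimately show ?thesis using that by blast
qed

lemma exists_extension:
  obtains S' y where "partial_hom K S'" "S \<subseteq> S'" "(x, y) \<in> S'"
proof -
  obtain f0 f0' where f0: "(f0, f0') \<in> hom_polys" "lead_coeff f0 = 1" "lead_coeff f0' = 1"
    "degree f0' = degree f0" "0 < degree f0" "poly f0 x = 0"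
    "\<forall>f f'. (f, f') \<in> hom_polys \<longrightarrow> poly f x = 0 \<longrightarrow> f = 0 \<or> degree f0 \<le> degree f"
    using minimal_pair[of x] by blast
  obtain y where y: "poly f0' y = 0"
    using alg_closed_imp_poly_has_root[of f0'] f0(4,5) by auto
  show ?thesis
  proof (rule extend_partial_hom[OF f0(1-4,6) _ y])
    show "f = 0 \<or> degree f0 \<le> degree f" if "(f, f') \<in> hom_polys" "poly f x = 0" for f f'
      using f0(7)[rule_format, OF that] .
  qed (rule that)
qed

end

text \<open>Injectivity is automatic for fields. For surjectivity, a relation of y over K is
  preserved by \<sigma>, which therefore permutes its finitely many roots.\<close>

lemma total_partial_hom_in_Gal:
  fixes K :: "'a::alg_closed_field set"
  assumes K: "alg_closure_of K" and S: "partial_hom K S" and total: "\<And>x. \<exists>y. (x, y) \<in> S"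
  obtains \<sigma> where "\<sigma> \<in> Gal K" "\<And>x y. (x, y) \<in> S \<Longrightarrow> \<sigma> x = y"
proof -
  obtain \<sigma> where \<sigma>: "\<And>x. (x, \<sigma> x) \<in> S"
    using total by metis
  have eq: "\<sigma> x = y" if "(x, y) \<in> S" for x y
    using partial_hom_unique[OF K S \<sigma> that] .
  have "field_hom \<sigma>"
    by unfold_locales (auto intro!: eq partial_homD(2,3)[OF S \<sigma> \<sigma>] partial_homD(1)[OF S] subfield_K[OF K S])
  then interpret field_hom \<sigma> .
  have fixK: "\<sigma> x = x" if "x \<in> K" for x
    using eq partial_homD(1)[OF S that] by blast
  have inj: "inj \<sigma>"
    using inj_f by blast
  have "\<exists>x. y = \<sigma> x" for y
  proof -
    obtain q where q: "q \<noteq> 0" "\<forall>i. poly.coeff q i \<in> K" "poly q y = 0"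
      using K unfolding alg_closure_of_def algebraic_over_def by blast
    let ?Z = "{x. poly q x = 0}"
    have "\<sigma> ` ?Z \<subseteq> ?Z"
    proof safe
      fix x assume "poly q x = 0"
      then have "\<sigma> (poly q x) = 0" by simp
      then show "poly q (\<sigma> x) = 0"
        using q(2) fixK by (simp add: poly_altdef hom_distribs)
    qed
    moreover have "finite ?Z" using q(1) by (rule poly_roots_finite)
    ultimately have "\<sigma> ` ?Z = ?Z"
      using inj by (intro endo_inj_surj) (auto intro: inj_on_subset)
    then show ?thesis using q(3) by blast
  qed
  then have "surj \<sigma>" by (simp add: surj_def)
  then have "\<sigma> \<in> Gal K"
    unfolding Gal_def using inj fixK \<open>field_hom \<sigma>\<close> by (simp add: bij_def)
  then show ?thesis using eq that by blast
qed

text \<open>Zorn's lemma gives a maximal extension, and by \<open>exists_extension\<close> its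
  domain is everything.\<close>

lemma partial_hom_extends_to_Gal:
  fixes K :: "'a::alg_closed_field set"
  assumes K: "alg_closure_of K" and S: "partial_hom K S"
  obtains \<sigma> where "\<sigma> \<in> Gal K" "\<And>x y. (x, y) \<in> S \<Longrightarrow> \<sigma> x = y"
proof -
  let ?A = "{S'. partial_hom K S' \<and> S \<subseteq> S'}"
  have Zorn: "\<exists>M\<in>?A. \<forall>X\<in>?A. M \<subseteq> X \<longrightarrow> X = M"
  proof (rule subset_Zorn_nonempty)
    show "?A \<noteq> {}" using S by blast
    fix C assume C: "C \<noteq> {}" "subset.chain ?A C"
    have "\<exists>X\<in>C. s \<in> X \<and> t \<in> X" if "s \<in> \<Union>C" "t \<in> \<Union>C" for s t
      using C(2) that unfolding subset_chain_def by blast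
    moreover have "partial_hom K X" "S \<subseteq> X" if "X \<in> C" for X
      using that C(2) unfolding subset_chain_def by auto
    ultimately have mem: "\<exists>X. partial_hom K X \<and> X \<subseteq> \<Union>C \<and> s \<in> X \<and> t \<in> X"
      if "s \<in> \<Union>C" "t \<in> \<Union>C" for s t
      using that by blast
    have "partial_hom K (\<Union>C)"
      unfolding partial_hom_def
    proof (intro conjI ballI allI impI)
      fix k assume "k \<in> K"
      then show "(k, k) \<in> \<Union>C"
        using C(1) \<open>\<And>X. X \<in> C \<Longrightarrow> partial_hom K X\<close> partial_homD(1) by blast
    next
      fix x y x' y' assume "(x, y) \<in> \<Union>C" "(x', y') \<in> \<Union>C"
      from mem[OF this] show "(x + x', y + y') \<in> \<Union>C" "(x * x', y * y') \<in> \<Union>C"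
        using partial_homD(2,3) by (meson subsetD)+
    next
      fix y assume "(0, y) \<in> \<Union>C"
      from mem[OF this this] show "y = 0"
        using partial_homD(4) by blast
    qed
    then show "\<Union>C \<in> ?A"
      using C(1) \<open>\<And>X. X \<in> C \<Longrightarrow> S \<subseteq> X\<close> by blast
  qed
  then obtain M where M: "partial_hom K M" "S \<subseteq> M" and "\<forall>X\<in>?A. M \<subseteq> X \<longrightarrow> X = M"
    by blast
  then have max: "X = M" if "partial_hom K X" "M \<subseteq> X" for X
    using that by blast
  have "\<exists>y. (x, y) \<in> M" for x
    using exists_extension[OF K M(1), of x] max by metis
  then obtain \<sigma> where "\<sigma> \<in> Gal K" "\<And>x y. (x, y) \<in> M \<Longrightarrow> \<sigma> x = y"
    using total_partial_hom_in_Gal[OF K M(1)] by blast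
  then show ?thesis using M(2) that by blast
qed

lemma GalD:
  assumes "\<sigma> \<in> Gal K"
  shows "field_hom \<sigma>" "bij \<sigma>" "\<And>x. x \<in> K \<Longrightarrow> \<sigma> x = x"
  using assms unfolding Gal_def by auto

lemma partial_hom_graph:
  assumes "subring_set K"
  shows "partial_hom K {(k, k) | k. k \<in> K}"
  unfolding partial_hom_def by (auto simp: subring_setD[OF assms])

text \<open>Separability: a minimal polynomial does not divide its derivative, so it has a second root.\<close>

lemma Gal_moves:
  fixes K :: "'a::alg_closed_field set"
  assumes K: "alg_closure_of K" and char: "\<And>n. n > 0 \<Longrightarrow> of_nat n \<noteq> (0 :: 'a)" and x: "x \<notin> K"
  obtains \<sigma> where "\<sigma> \<in> Gal K" "\<sigma> x \<noteq> x"
proof -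
  define S where "S = {(k, k) | k. k \<in> K}"
  have Kr: "subring_set K"
    using K subfield_imp_subring unfolding alg_closure_of_def by blast
  have S: "partial_hom K S" unfolding S_def using Kr by (rule partial_hom_graph)
  obtain f0 f0' where f0: "(f0, f0') \<in> hom_polys S" "lead_coeff f0 = 1" "lead_coeff f0' = 1"
    "degree f0' = degree f0" "0 < degree f0" "poly f0 x = 0"
    "\<forall>f f'. (f, f') \<in> hom_polys S \<longrightarrow> poly f x = 0 \<longrightarrow> f = 0 \<or> degree f0 \<le> degree f"
    using minimal_pair[OF K S, of x] by blast
  have mem: "(a, b) \<in> S \<longleftrightarrow> a = b \<and> a \<in> K" for a b
    unfolding S_def by auto
  have polys: "(f, f') \<in> hom_polys S \<longleftrightarrow> f = f' \<and> (\<forall>i. poly.coeff f i \<in> K)" for f f'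
    unfolding hom_polys_def[OF K S] mem poly_eq_iff by auto
  have f0K: "f0' = f0" "\<And>i. poly.coeff f0 i \<in> K" using f0(1) polys by auto
  obtain g where g: "f0 = [:- x, 1:] * g"
    using f0(6) by (auto simp: poly_eq_0_iff_dvd)
  have "g \<noteq> 0" using f0(5) unfolding g by auto
  then have deg: "degree f0 = Suc (degree g)"
    unfolding g by (subst degree_mult_eq) auto
  have "degree g \<noteq> 0"
  proof
    assume "degree g = 0"
    then obtain a where a: "g = [:a:]" by (rule degree_eq_zeroE)
    moreover have "a \<noteq> 0" using \<open>g \<noteq> 0\<close> a by simp
    ultimately have "f0 = [:- x, 1:]" using f0(2) unfolding g by simp
    then have "- x \<in> K" using f0K(2)[of 0] by simp
    then show False using x subring_setD(5)[OF Kr] by fastforce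
  qed
  have "poly g x \<noteq> 0"
  proof
    assume "poly g x = 0"
    then have root: "poly (pderiv f0) x = 0"
      unfolding g pderiv_mult by (simp add: pderiv_pCons del: mult_pCons_left)
    have "poly.coeff (pderiv f0) i \<in> K" for i
    proof -
      have "of_nat n * a \<in> K" if "a \<in> K" for n a
        using that by (induction n) (auto simp: subring_setD[OF Kr] distrib_right)
      then show ?thesis using f0K(2) by (auto simp: coeff_pderiv simp del: of_nat_Suc)
    qed
    then have "pderiv f0 = 0 \<or> degree f0 \<le> degree (pderiv f0)"
      using f0(7) root polys by blast
    \<comment> \<open>Characteristic 0 enters here: this coefficient of the derivative is the degree
      of \<open>f0\<close>.\<close>
    moreover have "poly.coeff (pderiv f0) (degree g) = of_nat (degree f0)"
      using f0(2) by (simp add: coeff_pderiv deg)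
    then have "pderiv f0 \<noteq> 0" using char[of "degree f0"] f0(5) by auto
    moreover have "degree (pderiv f0) \<le> degree g"
      using deg by (intro degree_le) (auto simp: coeff_pderiv coeff_eq_0)
    ultimately show False using deg by simp
  qed
  obtain y where y: "poly g y = 0"
    using alg_closed_imp_poly_has_root[of g] \<open>degree g \<noteq> 0\<close> by auto
  then have y0: "poly f0' y = 0" "y \<noteq> x"
    using \<open>poly g x \<noteq> 0\<close> unfolding f0K(1) g by auto
  show ?thesis
  proof (rule extend_partial_hom[OF K S f0(1-4,6) _ y0(1)])
    show "f = 0 \<or> degree f0 \<le> degree f" if "(f, f') \<in> hom_polys S" "poly f x = 0" for f f'
      using f0(7)[rule_format, OF that] .
    fix S' assume "partial_hom K S'" "(x, y) \<in> S'"
    then show ?thesis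
      using partial_hom_extends_to_Gal[OF K] y0(2) that by metis
  qed
qed

text \<open>Eventual agreement of the given automorphisms is a ring homomorphism on a subring, and any of
  its extensions is a limit.\<close>

lemma Gal_limit:
  fixes K :: "'a::alg_closed_field set"
  assumes K: "alg_closure_of K" and \<tau>: "\<And>n :: nat. \<tau> n \<in> Gal K"
  obtains \<sigma> where "\<sigma> \<in> Gal K" "\<And>x y n. (\<And>m. m \<ge> n \<Longrightarrow> \<tau> m x = y) \<Longrightarrow> \<sigma> x = y"
proof -
  let ?S = "{(x, y). \<exists>n. \<forall>m\<ge>n. \<tau> m x = y}"
  have "partial_hom K ?S"
    unfolding partial_hom_def
  proof (intro conjI ballI allI impI)
    fix k assume "k \<in> K"
    then show "(k, k) \<in> ?S" using GalD(3)[OF \<tau>] by auto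
  next
    fix x y x' y' assume "(x, y) \<in> ?S" "(x', y') \<in> ?S"
    then obtain n n' where "\<forall>m\<ge>n. \<tau> m x = y" "\<forall>m\<ge>n'. \<tau> m x' = y'" by auto
    then have *: "\<forall>m\<ge>n + n'. \<tau> m x = y \<and> \<tau> m x' = y'" by simp
    have "\<tau> m (x + x') = \<tau> m x + \<tau> m x'" "\<tau> m (x * x') = \<tau> m x * \<tau> m x'" for m
    proof -
      interpret field_hom "\<tau> m" by (rule GalD(1)[OF \<tau>])
      show "\<tau> m (x + x') = \<tau> m x + \<tau> m x'" "\<tau> m (x * x') = \<tau> m x * \<tau> m x'"
        by (rule hom_add, rule hom_mult)
    qed
    then show "(x + x', y + y') \<in> ?S" "(x * x', y * y') \<in> ?S"
      using * by auto
  next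
    fix y assume "(0, y) \<in> ?S"
    then obtain n where n: "\<tau> n 0 = y" by blast
    interpret field_hom "\<tau> n" by (rule GalD(1)[OF \<tau>])
    show "y = 0" using n by simp
  qed
  then obtain \<sigma> where "\<sigma> \<in> Gal K" "\<And>x y. (x, y) \<in> ?S \<Longrightarrow> \<sigma> x = y"
    using partial_hom_extends_to_Gal[OF K] by blast
  then show ?thesis by (intro that[of \<sigma>]) auto
qed

section \<open>Groups of field automorphisms\<close>

abbreviation finv :: "('a \<Rightarrow> 'b) \<Rightarrow> 'b \<Rightarrow> 'a" where
  "finv g \<equiv> inv_into UNIV g"

text \<open>Dedekind's independence of characters modulo a prime ideal Q of R. For Q = {0} it is the
  classical theorem; for the maximal ideal of a valuation ring it speaks of residues. The domain E
  is any multiplicatively closed set containing 1, so integrality can be built into it.\<close>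

lemma independent_characters:
  fixes c :: "'t \<Rightarrow> 'b::comm_ring_1" and ev :: "'t \<Rightarrow> 'e::monoid_mult \<Rightarrow> 'b"
  assumes R: "subring_set R"
    and Q: "\<And>x y. x \<in> Q \<Longrightarrow> y \<in> Q \<Longrightarrow> x - y \<in> Q" "\<And>a x. a \<in> R \<Longrightarrow> x \<in> Q \<Longrightarrow> a * x \<in> Q"
      "\<And>x y. x \<in> R \<Longrightarrow> y \<in> R \<Longrightarrow> x * y \<in> Q \<Longrightarrow> x \<in> Q \<or> y \<in> Q"
    and E: "1 \<in> E" "\<And>x y. x \<in> E \<Longrightarrow> y \<in> E \<Longrightarrow> x * y \<in> E"
    and T: "finite T" "\<And>t x. t \<in> T \<Longrightarrow> x \<in> E \<Longrightarrow> ev t x \<in> R"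
      "\<And>t x y. t \<in> T \<Longrightarrow> x \<in> E \<Longrightarrow> y \<in> E \<Longrightarrow> ev t (x * y) = ev t x * ev t y"
      "\<And>t. t \<in> T \<Longrightarrow> ev t 1 = 1"
      "\<And>t t'. t \<in> T \<Longrightarrow> t' \<in> T \<Longrightarrow> t \<noteq> t' \<Longrightarrow> \<exists>x\<in>E. ev t x - ev t' x \<notin> Q"
    and c: "\<And>t. t \<in> T \<Longrightarrow> c t \<in> R" "t0 \<in> T" "c t0 \<notin> Q"
  shows "\<exists>x\<in>E. (\<Sum>t\<in>T. c t * ev t x) \<notin> Q"
  using T c
proof (induction "card T" arbitrary: T c rule: less_induct)
  case less
  show ?case
  proof (cases "T = {t0}")
    case True
    then show ?thesis
      using less.prems E(1) by (intro bexI[of _ 1]) auto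
  next
    case False
    then obtain t1 where t1: "t1 \<in> T" "t1 \<noteq> t0"
      using less.prems(7) by blast
    obtain y where y: "y \<in> E" "ev t0 y - ev t1 y \<notin> Q"
      using less.prems(5)[OF less.prems(7) t1(1)] t1(2) by metis
    \<comment> \<open>Shortens the relation: the coefficient of t1 becomes 0, while that of t0 stays
      outside the prime Q.\<close>
    define c' where "c' = (\<lambda>t. c t * (ev t y - ev t1 y))"
    have c'R: "c' t \<in> R" if "t \<in> T" for t
      unfolding c'_def using that t1(1) y(1) less.prems(2,6)
      by (intro subring_setD(4,6)[OF R]) auto
    have "ev t0 y - ev t1 y \<in> R"
      using t1(1) y(1) less.prems(2,7) by (intro subring_setD(6)[OF R]) auto
    then have "c' t0 \<notin> Q"
      unfolding c'_def using Q(3)[OF less.prems(6)[OF less.prems(7)]] y(2) less.prems(8) by blast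
    moreover have "card (T - {t1}) < card T"
      using card_Diff1_less[OF less.prems(1) t1(1)] .
    ultimately have "\<exists>x\<in>E. (\<Sum>t\<in>T - {t1}. c' t * ev t x) \<notin> Q"
      using less.prems(1-5,7) c'R t1(2) by (intro less.hyps) auto
    then obtain x where x: "x \<in> E" "(\<Sum>t\<in>T - {t1}. c' t * ev t x) \<notin> Q"
      by blast
    have "(\<Sum>t\<in>T - {t1}. c' t * ev t x) = (\<Sum>t\<in>T. c' t * ev t x)"
      using t1(1) less.prems(1) by (simp add: sum.remove[of T t1] c'_def)
    also have "\<dots> = (\<Sum>t\<in>T. c t * ev t (x * y) - ev t1 y * (c t * ev t x))"
      using less.prems(3)[OF _ x(1) y(1)] by (intro sum.cong refl) (simp add: c'_def algebra_simps)
    also have "\<dots> = (\<Sum>t\<in>T. c t * ev t (x * y)) - ev t1 y * (\<Sum>t\<in>T. c t * ev t x)"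
      by (simp add: sum_subtractf sum_distrib_left)
    finally have "(\<Sum>t\<in>T. c t * ev t (x * y)) \<notin> Q \<or> (\<Sum>t\<in>T. c t * ev t x) \<notin> Q"
      using x(2) Q(1) Q(2)[OF less.prems(2)[OF t1(1) y(1)]] by metis
    then show ?thesis
      using x(1) y(1) E(2) by blast
  qed
qed

text \<open>Finite orbits stand in for algebraicity over the fixed field: they give stabilisers of
  finite sets finite index.\<close>

locale automorphism_group =
  fixes G :: "('a::field \<Rightarrow> 'a) set"
  assumes id_in: "id \<in> G"
    and comp_in: "g \<in> G \<Longrightarrow> h \<in> G \<Longrightarrow> g \<circ> h \<in> G"
    and inv_in: "g \<in> G \<Longrightarrow> finv g \<in> G"
    and bij_G: "g \<in> G \<Longrightarrow> bij g"
    and hom_G: "g \<in> G \<Longrightarrow> field_hom g"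
    and finite_orbit: "finite {g x | g. g \<in> G}"
begin

lemma hom_simps:
  assumes "g \<in> G"
  shows "g 0 = 0" "g 1 = 1" "g (x + y) = g x + g y" "g (x - y) = g x - g y" "g (x * y) = g x * g y"
    "g (- x) = - g x" "g (inverse x) = inverse (g x)" "g (x / y) = g x / g y" "g (x ^ n) = g x ^ n"
    "g (of_nat n) = of_nat n" "g x = 0 \<longleftrightarrow> x = 0" "g (sum F I) = (\<Sum>i\<in>I. g (F i))"
    "g (prod F I) = (\<Prod>i\<in>I. g (F i))" "g x = g y \<longleftrightarrow> x = y" "g (x powi k) = g x powi k"
proof -
  interpret field_hom g by (rule hom_G[OF assms])
  show "g 0 = 0" "g 1 = 1" "g (x + y) = g x + g y" "g (x - y) = g x - g y" "g (x * y) = g x * g y"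
    "g (- x) = - g x" "g (inverse x) = inverse (g x)" "g (x / y) = g x / g y" "g (x ^ n) = g x ^ n"
    "g (of_nat n) = of_nat n" "g x = 0 \<longleftrightarrow> x = 0" "g (sum F I) = (\<Sum>i\<in>I. g (F i))"
    "g (prod F I) = (\<Prod>i\<in>I. g (F i))" "g (x powi k) = g x powi k"
    by (simp_all add: hom_distribs power_int_def)
  show "g x = g y \<longleftrightarrow> x = y"
    using bij_G[OF assms] by (simp add: bij_is_inj inj_eq)
qed

lemma inv_simps [simp]:
  assumes "g \<in> G"
  shows "finv g (g x) = x" "g (finv g x) = x" "g \<circ> finv g = id" "finv g \<circ> g = id" "finv (finv g) = g"
  using bij_G[OF assms]
  by (auto simp: bij_is_inj bij_is_surj surj_f_inv_f inv_inv_eq fun_eq_iff)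

lemma comp_cancel:
  assumes "g \<in> G"
  shows "(h \<circ> g) \<circ> (finv g \<circ> k) = h \<circ> k" "(h \<circ> finv g) \<circ> (g \<circ> k) = h \<circ> k"
    "g \<circ> (finv g \<circ> k) = k" "finv g \<circ> (g \<circ> k) = k"
  using assms by (simp_all add: fun_eq_iff)

lemma inv_comp: "g \<in> G \<Longrightarrow> h \<in> G \<Longrightarrow> finv (g \<circ> h) = finv h \<circ> finv g"
  using bij_G by (intro o_inv_distrib) auto

section \<open>Subgroups, stabilisers and fixed fields\<close>

definition sgrp :: "('a \<Rightarrow> 'a) set \<Rightarrow> bool" where
  "sgrp N \<longleftrightarrow> N \<subseteq> G \<and> id \<in> N \<and> (\<forall>g\<in>N. \<forall>h\<in>N. g \<circ> h \<in> N) \<and> (\<forall>g\<in>N. finv g \<in> N)"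

lemma sgrpD:
  assumes "sgrp N"
  shows "N \<subseteq> G" "id \<in> N" "\<And>g h. g \<in> N \<Longrightarrow> h \<in> N \<Longrightarrow> g \<circ> h \<in> N" "\<And>g. g \<in> N \<Longrightarrow> finv g \<in> N"
    "\<And>g. g \<in> N \<Longrightarrow> g \<in> G"
  using assms unfolding sgrp_def by auto

lemma sgrp_G: "sgrp G"
  unfolding sgrp_def using id_in comp_in inv_in by auto

lemma sgrp_funpow: "sgrp N \<Longrightarrow> g \<in> N \<Longrightarrow> g ^^ n \<in> N"
  by (induction n) (auto intro: sgrpD)

definition stab :: "'a set \<Rightarrow> ('a \<Rightarrow> 'a) set" where
  "stab B = {g \<in> G. \<forall>x\<in>B. g x = x}"

lemma sgrp_stab: "sgrp (stab B)"
  unfolding sgrp_def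
proof (intro conjI ballI)
  show "stab B \<subseteq> G" "id \<in> stab B"
    unfolding stab_def using id_in by auto
  show "g \<circ> h \<in> stab B" if "g \<in> stab B" "h \<in> stab B" for g h
    using that comp_in unfolding stab_def by simp
  show "finv g \<in> stab B" if "g \<in> stab B" for g
  proof -
    have "g x = x" if "x \<in> B" for x
      using that \<open>g \<in> stab B\<close> unfolding stab_def by auto
    moreover have "g \<in> G" using that unfolding stab_def by blast
    ultimately have "finv g x = x" if "x \<in> B" for x
      using inv_simps(1)[of g x] that by metis
    then show ?thesis using inv_in[OF \<open>g \<in> G\<close>] unfolding stab_def by blast
  qed
qed

lemma sgrp_Int: "sgrp N \<Longrightarrow> sgrp M \<Longrightarrow> sgrp (N \<inter> M)"
  unfolding sgrp_def by blast

definition fixed :: "('a \<Rightarrow> 'a) set \<Rightarrow> 'a set" where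
  "fixed N = {x. \<forall>g\<in>N. g x = x}"

lemma fixedD: "x \<in> fixed N \<Longrightarrow> g \<in> N \<Longrightarrow> g x = x"
  unfolding fixed_def by blast

lemma fixed_mono: "M \<subseteq> N \<Longrightarrow> fixed N \<subseteq> fixed M"
  unfolding fixed_def by blast

lemma stab_fixed: "B \<subseteq> fixed (stab B)"
  unfolding fixed_def stab_def by blast

lemma fixed_closed:
  assumes "N \<subseteq> G"
  shows "0 \<in> fixed N" "1 \<in> fixed N" "x \<in> fixed N \<Longrightarrow> y \<in> fixed N \<Longrightarrow> x + y \<in> fixed N"
    "x \<in> fixed N \<Longrightarrow> y \<in> fixed N \<Longrightarrow> x * y \<in> fixed N" "x \<in> fixed N \<Longrightarrow> y \<in> fixed N \<Longrightarrow> x - y \<in> fixed N"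
    "x \<in> fixed N \<Longrightarrow> y \<in> fixed N \<Longrightarrow> x / y \<in> fixed N" "x \<in> fixed N \<Longrightarrow> x ^ n \<in> fixed N"
    "of_nat n \<in> fixed N"
  using assms unfolding fixed_def by (auto simp: hom_simps subset_iff)

text \<open>Openness in the Krull topology, stated without a topology.\<close>

definition open_sgrp :: "('a \<Rightarrow> 'a) set \<Rightarrow> bool" where
  "open_sgrp N \<longleftrightarrow> sgrp N \<and> (\<exists>B. finite B \<and> stab B \<subseteq> N)"

lemma open_sgrp_mono: "open_sgrp M \<Longrightarrow> M \<subseteq> N \<Longrightarrow> sgrp N \<Longrightarrow> open_sgrp N"
  unfolding open_sgrp_def by (meson subset_trans)

lemma open_stab: "finite B \<Longrightarrow> open_sgrp (stab B)"
  unfolding open_sgrp_def using sgrp_stab by auto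

lemma open_sgrp_Int:
  assumes "open_sgrp N" "open_sgrp M"
  shows "open_sgrp (N \<inter> M)"
proof -
  obtain B B' where "finite B" "stab B \<subseteq> N" "finite B'" "stab B' \<subseteq> M"
    using assms unfolding open_sgrp_def by blast
  then have "finite (B \<union> B')" "stab (B \<union> B') \<subseteq> N \<inter> M"
    unfolding stab_def by auto
  moreover have "sgrp (N \<inter> M)"
    using assms by (intro sgrp_Int) (simp_all add: open_sgrp_def)
  ultimately show ?thesis
    unfolding open_sgrp_def by meson
qed

text \<open>Representatives of the left cosets t M in N; the index of M in N appears as the
  cardinality of T.\<close>

definition transversal :: "('a \<Rightarrow> 'a) set \<Rightarrow> ('a \<Rightarrow> 'a) set \<Rightarrow> ('a \<Rightarrow> 'a) set \<Rightarrow> bool" where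
  "transversal N M T \<longleftrightarrow> finite T \<and> T \<subseteq> N \<and> (\<forall>g\<in>N. \<exists>!t. t \<in> T \<and> finv t \<circ> g \<in> M)"

lemma finite_restrictions:
  assumes "finite B"
  shows "finite ((\<lambda>g. restrict g B) ` G)"
proof (rule finite_subset)
  show "(\<lambda>g. restrict g B) ` G \<subseteq> (\<Pi>\<^sub>E x\<in>B. {g x | g. g \<in> G})"
    by (auto simp: restrict_PiE_iff)
  show "finite (\<Pi>\<^sub>E x\<in>B. {g x | g. g \<in> G})"
    using assms finite_orbit by (intro finite_PiE) auto
qed

lemma agree_on_imp_inv_comp_stab:
  assumes "g \<in> G" "h \<in> G" "\<And>x. x \<in> B \<Longrightarrow> g x = h x"
  shows "finv g \<circ> h \<in> stab B"
proof -
  have "finv g (h x) = x" if "x \<in> B" for x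
    using assms(3)[OF that] inv_simps(1)[OF assms(1), of x] by simp
  then show ?thesis
    unfolding stab_def using assms(1,2) by (auto intro: comp_in inv_in)
qed

text \<open>A left coset of M is determined by the restriction of any member to the finite set B,
  and finite orbits leave only finitely many restrictions.\<close>

lemma exists_transversal:
  assumes N: "sgrp N" and M: "open_sgrp M" "M \<subseteq> N"
  obtains T where "transversal N M T"
proof -
  obtain B where B: "finite B" "stab B \<subseteq> M"
    using M(1) unfolding open_sgrp_def by blast
  have Ms: "sgrp M" using M(1) unfolding open_sgrp_def by blast
  define C where "C = (\<lambda>g. {h \<in> N. finv g \<circ> h \<in> M})"
  have C_eq: "C g = C h" if gh: "g \<in> N" "h \<in> N" "finv g \<circ> h \<in> M" for g h
  proof -
    have G: "g \<in> G" "h \<in> G" using gh sgrpD(5)[OF N] by auto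
    have "finv (finv g \<circ> h) \<in> M" using sgrpD(4)[OF Ms gh(3)] .
    then have hg: "finv h \<circ> g \<in> M"
      using G by (simp add: inv_comp inv_in)
    have "finv g \<circ> k \<in> M \<longleftrightarrow> finv h \<circ> k \<in> M" for k
    proof
      assume "finv g \<circ> k \<in> M"
      then have "(finv h \<circ> g) \<circ> (finv g \<circ> k) \<in> M" using sgrpD(3)[OF Ms hg] by blast
      then show "finv h \<circ> k \<in> M" by (simp only: comp_cancel(1)[OF G(1)])
    next
      assume "finv h \<circ> k \<in> M"
      then have "(finv g \<circ> h) \<circ> (finv h \<circ> k) \<in> M" using sgrpD(3)[OF Ms gh(3)] by blast
      then show "finv g \<circ> k \<in> M" by (simp only: comp_cancel(1)[OF G(2)])
    qed
    then show ?thesis unfolding C_def by auto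
  qed
  have self: "g \<in> C g" if "g \<in> N" for g
    using that sgrpD(2)[OF Ms] sgrpD(5)[OF N that] unfolding C_def by simp
  have "finite (C ` N)"
  proof (rule finite_surj[of "(\<lambda>g. restrict g B) ` G"])
    show "finite ((\<lambda>g. restrict g B) ` G)" using B(1) by (rule finite_restrictions)
    show "C ` N \<subseteq> (\<lambda>r. C (SOME g. g \<in> N \<and> restrict g B = r)) ` ((\<lambda>g. restrict g B) ` G)"
    proof
      fix X assume "X \<in> C ` N"
      then obtain g where g: "g \<in> N" "X = C g" by blast
      let ?h = "SOME h. h \<in> N \<and> restrict h B = restrict g B"
      have h: "?h \<in> N \<and> restrict ?h B = restrict g B"
        by (rule someI[of _ g]) (use g in simp)
      have "g x = ?h x" if "x \<in> B" for x
        using fun_cong[OF conjunct2[OF h], of x] that by simp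
      then have "finv g \<circ> ?h \<in> stab B"
        using g(1) h sgrpD(5)[OF N] by (intro agree_on_imp_inv_comp_stab) auto
      then have "C g = C ?h" using B(2) h g(1) by (intro C_eq) auto
      then show "X \<in> (\<lambda>r. C (SOME g. g \<in> N \<and> restrict g B = r)) ` ((\<lambda>g. restrict g B) ` G)"
        using g sgrpD(5)[OF N] by blast
    qed
  qed
  define T where "T = (\<lambda>X. SOME h. h \<in> X) ` (C ` N)"
  have rep: "(SOME h. h \<in> C g) \<in> C g" if "g \<in> N" for g
    using self[OF that] by (rule someI[of "\<lambda>h. h \<in> C g"])
  have "transversal N M T"
    unfolding transversal_def
  proof (intro conjI ballI)
    show "finite T" unfolding T_def using \<open>finite (C ` N)\<close> by blast
    show "T \<subseteq> N"
    proof
      fix t assume "t \<in> T"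
      then obtain g where "g \<in> N" "t = (SOME h. h \<in> C g)" unfolding T_def by blast
      then have "t \<in> C g" using rep by simp
      then show "t \<in> N" unfolding C_def by simp
    qed
    fix g assume g: "g \<in> N"
    let ?t = "SOME h. h \<in> C g"
    have "?t \<in> C g" by (rule rep[OF g])
    then have t: "?t \<in> N" "finv g \<circ> ?t \<in> M" by (simp_all only: C_def mem_Collect_eq)
    then have "C ?t = C g" using C_eq[OF g t(1)] by simp
    then have "g \<in> C ?t" using self[OF g] by simp
    then have "finv ?t \<circ> g \<in> M" by (simp only: C_def mem_Collect_eq)
    show "\<exists>!t. t \<in> T \<and> finv t \<circ> g \<in> M"
    proof (rule ex1I[of _ ?t])
      show "?t \<in> T \<and> finv ?t \<circ> g \<in> M"
        using g \<open>finv ?t \<circ> g \<in> M\<close> by (simp add: T_def)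
      fix s assume s: "s \<in> T \<and> finv s \<circ> g \<in> M"
      then obtain h where h: "h \<in> N" "s = (SOME x. x \<in> C h)" unfolding T_def by blast
      have "s \<in> C h" using rep[OF h(1)] h(2) by simp
      then have "s \<in> N" "finv h \<circ> s \<in> M" by (simp_all only: C_def mem_Collect_eq)
      then have "C h = C s" using C_eq[OF h(1)] by simp
      moreover have "C s = C g" using C_eq[OF \<open>s \<in> N\<close> g] s by simp
      ultimately show "s = ?t" using h(2) by simp
    qed
  qed
  then show ?thesis by (rule that)
qed

lemma transversalD:
  assumes "transversal N M T"
  shows "finite T" "T \<subseteq> N" "\<And>g. g \<in> N \<Longrightarrow> \<exists>!t. t \<in> T \<and> finv t \<circ> g \<in> M"
  using assms unfolding transversal_def by auto

lemma transversal_unique: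
  assumes N: "sgrp N" and T: "transversal N M T" and M: "sgrp M"
    and "s \<in> T" "t \<in> T" "finv s \<circ> t \<in> M"
  shows "s = t"
proof -
  have "t \<in> N" using T assms(5) transversalD(2) by blast
  then have "finv t \<circ> t \<in> M" using sgrpD(2)[OF M] sgrpD(5)[OF N] by simp
  then show ?thesis using transversalD(3)[OF T \<open>t \<in> N\<close>] assms(4-6) by blast
qed

lemma transversal_nonempty: "sgrp N \<Longrightarrow> transversal N M T \<Longrightarrow> T \<noteq> {}"
  using transversalD(3)[of N M T id] sgrpD(2) by blast

text \<open>Left multiplication by \<sigma> permutes the left cosets; \<rho> is the resulting
  permutation of their representatives.\<close>

lemma transversal_shift:
  assumes N: "sgrp N" and M: "sgrp M" "M \<subseteq> N" and T: "transversal N M T" and \<sigma>: "\<sigma> \<in> N"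
  obtains \<rho> where "bij_betw \<rho> T T" "\<And>t. t \<in> T \<Longrightarrow> finv (\<rho> t) \<circ> (\<sigma> \<circ> t) \<in> M"
proof -
  have TN: "t \<in> N" "t \<in> G" if "t \<in> T" for t
    using that transversalD(2)[OF T] sgrpD(1)[OF N] by auto
  have \<sigma>G: "\<sigma> \<in> G" using \<sigma> sgrpD(5)[OF N] by blast
  define \<rho> where "\<rho> = (\<lambda>t. THE s. s \<in> T \<and> finv s \<circ> (\<sigma> \<circ> t) \<in> M)"
  have \<rho>: "\<rho> t \<in> T \<and> finv (\<rho> t) \<circ> (\<sigma> \<circ> t) \<in> M" if "t \<in> T" for t
    unfolding \<rho>_def by (rule theI'[OF transversalD(3)[OF T sgrpD(3)[OF N \<sigma> TN(1)[OF that]]]])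
  have "inj_on \<rho> T"
  proof (rule inj_onI)
    fix s t assume st: "s \<in> T" "t \<in> T" "\<rho> s = \<rho> t"
    let ?r = "\<rho> t"
    have r: "?r \<in> G" using \<rho>[OF st(2)] TN by blast
    have "finv (finv ?r \<circ> (\<sigma> \<circ> s)) \<circ> (finv ?r \<circ> (\<sigma> \<circ> t)) \<in> M"
      using \<rho>[OF st(1)] \<rho>[OF st(2)] st(3) sgrpD(3,4)[OF M(1)] by simp
    also have "finv (finv ?r \<circ> (\<sigma> \<circ> s)) \<circ> (finv ?r \<circ> (\<sigma> \<circ> t)) = finv s \<circ> t"
      using r \<sigma>G TN[OF st(1)] by (simp add: inv_comp comp_in inv_in fun_eq_iff)
    finally show "s = t" by (rule transversal_unique[OF N T M(1) st(1,2)])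
  qed
  then have "bij_betw \<rho> T T"
    using transversalD(1)[OF T] \<rho> by (simp add: bij_betw_def endo_inj_surj image_subsetI)
  then show ?thesis using \<rho> that by blast
qed

lemma coset_eval:
  assumes "s \<in> G" "g \<in> G" "finv s \<circ> g \<in> M" "x \<in> fixed M"
  shows "g x = s x"
  using fixedD[OF assms(4,3)] assms(1) by (metis comp_apply inv_simps(2))

text \<open>Trace and norm from the fixed field of M to that of N: on an element fixed by M the
  value of t depends only on its coset, and N permutes the cosets.\<close>

lemma transversal_sum_fixed:
  assumes N: "sgrp N" and M: "sgrp M" "M \<subseteq> N" and T: "transversal N M T" and x: "x \<in> fixed M"
  shows "(\<Sum>t\<in>T. t x) \<in> fixed N" "(\<Prod>t\<in>T. t x) \<in> fixed N"
proof -
  have *: "(\<Sum>t\<in>T. \<sigma> (t x)) = (\<Sum>t\<in>T. t x) \<and> (\<Prod>t\<in>T. \<sigma> (t x)) = (\<Prod>t\<in>T. t x)" if \<sigma>: "\<sigma> \<in> N" for \<sigma>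
  proof -
    obtain \<rho> where \<rho>: "bij_betw \<rho> T T" "\<And>t. t \<in> T \<Longrightarrow> finv (\<rho> t) \<circ> (\<sigma> \<circ> t) \<in> M"
      using transversal_shift[OF N M T \<sigma>] by blast
    have "\<sigma> (t x) = \<rho> t x" if "t \<in> T" for t
    proof -
      have "t \<in> G" "\<rho> t \<in> G" "\<sigma> \<in> G"
        using that \<rho>(1) \<sigma> transversalD(2)[OF T] sgrpD(1)[OF N] by (auto simp: bij_betw_def)
      then show ?thesis
        using coset_eval[OF _ _ \<rho>(2)[OF that] x] comp_in by simp
    qed
    then have "(\<Sum>t\<in>T. \<sigma> (t x)) = (\<Sum>t\<in>T. \<rho> t x)" "(\<Prod>t\<in>T. \<sigma> (t x)) = (\<Prod>t\<in>T. \<rho> t x)"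
      by simp_all
    then show ?thesis
      using sum.reindex_bij_betw[OF \<rho>(1), of "\<lambda>t. t x"] prod.reindex_bij_betw[OF \<rho>(1), of "\<lambda>t. t x"]
      by simp
  qed
  then show "(\<Sum>t\<in>T. t x) \<in> fixed N" "(\<Prod>t\<in>T. t x) \<in> fixed N"
    unfolding fixed_def using sgrpD(5)[OF N] by (auto simp: hom_simps)
qed

text \<open>Representatives of distinct cosets of the stabiliser differ at a point of B, so they are
  distinct characters of its fixed field.\<close>

lemma independent_automorphisms:
  assumes B: "finite B" and T: "finite T" "T \<subseteq> G"
    "\<And>t t'. t \<in> T \<Longrightarrow> t' \<in> T \<Longrightarrow> t \<noteq> t' \<Longrightarrow> finv t \<circ> t' \<notin> stab B"
    and c: "t0 \<in> T" "c t0 \<noteq> 0"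
  obtains x where "x \<in> fixed (stab B)" "(\<Sum>t\<in>T. c t * t x) \<noteq> 0"
proof -
  have G: "t \<in> G" if "t \<in> T" for t using T(2) that by blast
  have st: "stab B \<subseteq> G" unfolding stab_def by blast
  have "\<exists>x\<in>fixed (stab B). (\<Sum>t\<in>T. c t * t x) \<notin> {0}"
  proof (rule independent_characters[where R = UNIV and ev = "\<lambda>t. t"])
    show "\<exists>x\<in>fixed (stab B). t x - t' x \<notin> {0}" if "t \<in> T" "t' \<in> T" "t \<noteq> t'" for t t'
      using agree_on_imp_inv_comp_stab[OF G G, of t t' B] T(3)[OF that] that stab_fixed[of B] by auto
  qed (use T(1) c G fixed_closed[OF st] in \<open>auto simp: subring_set_def hom_simps\<close>)
  then show ?thesis using that by blast
qed

text \<open>Galois correspondence for open subgroups. If \<sigma> lay outside N, coset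
  representatives in N and their translates by \<sigma> would be independent, so some x would have a
  trace to the fixed field of N that \<sigma> moves.\<close>

lemma fixes_fixed_imp_mem:
  assumes N: "open_sgrp N" and \<sigma>: "\<sigma> \<in> G" "\<And>x. x \<in> fixed N \<Longrightarrow> \<sigma> x = x"
  shows "\<sigma> \<in> N"
proof (rule ccontr)
  assume \<sigma>N: "\<sigma> \<notin> N"
  have Ns: "sgrp N" using N unfolding open_sgrp_def by blast
  obtain B where B: "finite B" "stab B \<subseteq> N"
    using N unfolding open_sgrp_def by blast
  note M = sgrp_stab[of B]
  obtain T where T: "transversal N (stab B) T"
    using exists_transversal[OF Ns open_stab[OF B(1)] B(2)] by blast
  have TN: "t \<in> N" "t \<in> G" if "t \<in> T" for t
    using that transversalD(2)[OF T] sgrpD(1)[OF Ns] by auto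
  let ?T' = "(\<lambda>t. \<sigma> \<circ> t) ` T"
  have mixed: "finv t \<circ> (\<sigma> \<circ> s) \<notin> N" if "t \<in> T" "s \<in> T" for s t
  proof
    assume "finv t \<circ> (\<sigma> \<circ> s) \<in> N"
    then have "t \<circ> (finv t \<circ> (\<sigma> \<circ> s)) \<circ> finv s \<in> N"
      using sgrpD(3)[OF Ns sgrpD(3)[OF Ns TN(1)[OF that(1)]] sgrpD(4)[OF Ns TN(1)[OF that(2)]]] by blast
    moreover have "t \<circ> (finv t \<circ> (\<sigma> \<circ> s)) \<circ> finv s = \<sigma>"
      using TN that by (simp add: fun_eq_iff)
    ultimately show False using \<sigma>N by metis
  qed
  have disj: "T \<inter> ?T' = {}"
  proof -
    have "\<sigma> \<circ> s \<notin> T" if s: "s \<in> T" for s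
    proof
      assume "\<sigma> \<circ> s \<in> T"
      from mixed[OF this s] show False
        using sgrpD(2)[OF Ns] TN(2)[OF \<open>\<sigma> \<circ> s \<in> T\<close>] by simp
    qed
    then show ?thesis by blast
  qed
  obtain t0 where t0: "t0 \<in> T" using transversal_nonempty[OF Ns T] by blast
  \<comment> \<open>With these signs the combination is the trace minus its image under
    \<sigma>.\<close>
  define c :: "('a \<Rightarrow> 'a) \<Rightarrow> 'a" where "c = (\<lambda>t. if t \<in> T then 1 else - 1)"
  obtain x where x: "x \<in> fixed (stab B)" "(\<Sum>t\<in>T \<union> ?T'. c t * t x) \<noteq> 0"
  proof (rule independent_automorphisms[OF B(1), of "T \<union> ?T'" t0 c])
    show "finite (T \<union> ?T')" using transversalD(1)[OF T] by simp
    show "T \<union> ?T' \<subseteq> G" using TN \<sigma>(1) comp_in by auto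
    show "t0 \<in> T \<union> ?T'" "c t0 \<noteq> 0" using t0 by (auto simp: c_def)
    fix t t' assume tt: "t \<in> T \<union> ?T'" "t' \<in> T \<union> ?T'" "t \<noteq> t'"
    have inv_\<sigma>: "finv (\<sigma> \<circ> s) \<circ> (\<sigma> \<circ> s') = finv s \<circ> s'" if "s \<in> T" for s s'
      using TN(2)[OF that] \<sigma>(1) by (simp add: inv_comp comp_cancel)
    have swap: "finv (\<sigma> \<circ> s) \<circ> s' = finv (finv s' \<circ> (\<sigma> \<circ> s))" if "s \<in> T" "s' \<in> T" for s s'
      using TN(2) that \<sigma>(1) by (simp add: inv_comp comp_in inv_in)
    have swapN: "finv (\<sigma> \<circ> s) \<circ> s' \<notin> N" if "s \<in> T" "s' \<in> T" for s s'
    proof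
      assume "finv (\<sigma> \<circ> s) \<circ> s' \<in> N"
      then have "finv (finv (finv s' \<circ> (\<sigma> \<circ> s))) \<in> N"
        unfolding swap[OF that] by (rule sgrpD(4)[OF Ns])
      then show False
        using mixed[OF that(2,1)] TN(2) that \<sigma>(1) by (simp add: comp_in inv_in)
    qed
    show "finv t \<circ> t' \<notin> stab B"
      using tt(1,2)
    proof (elim UnE imageE)
      assume "t \<in> T" "t' \<in> T"
      then show ?thesis using transversal_unique[OF Ns T M] tt(3) by blast
    next
      fix s assume "t \<in> T" "t' = \<sigma> \<circ> s" "s \<in> T"
      then show ?thesis using mixed B(2) by blast
    next
      fix s assume "t = \<sigma> \<circ> s" "s \<in> T" "t' \<in> T"
      then show ?thesis using swapN B(2) by blast
    next
      fix s s' assume "t = \<sigma> \<circ> s" "s \<in> T" "t' = \<sigma> \<circ> s'" "s' \<in> T"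
      then show ?thesis
        using transversal_unique[OF Ns T M, of s s'] tt(3) inv_\<sigma>[of s s'] by auto
    qed
  qed
  have inj: "inj_on (\<lambda>t. \<sigma> \<circ> t) T"
    using \<sigma>(1) by (auto simp: inj_on_def fun_eq_iff hom_simps)
  have "(\<Sum>t\<in>T \<union> ?T'. c t * t x) = (\<Sum>t\<in>T. c t * t x) + (\<Sum>t\<in>?T'. c t * t x)"
    using transversalD(1)[OF T] disj by (intro sum.union_disjoint) auto
  also have "(\<Sum>t\<in>T. c t * t x) = (\<Sum>t\<in>T. t x)"
    by (simp add: c_def)
  also have "(\<Sum>t\<in>?T'. c t * t x) = (\<Sum>t\<in>T. - \<sigma> (t x))"
  proof (subst sum.reindex[OF inj], rule sum.cong[OF refl])
    fix s assume "s \<in> T"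
    then have "\<sigma> \<circ> s \<notin> T" using disj by blast
    then show "((\<lambda>t. c t * t x) \<circ> (\<circ>) \<sigma>) s = - \<sigma> (s x)" by (simp add: c_def)
  qed
  also have "\<dots> = - \<sigma> (\<Sum>t\<in>T. t x)"
    using \<sigma>(1) by (simp add: hom_simps sum_negf)
  also have "\<sigma> (\<Sum>t\<in>T. t x) = (\<Sum>t\<in>T. t x)"
    by (rule \<sigma>(2)[OF transversal_sum_fixed(1)[OF Ns M B(2) T x(1)]])
  finally show False using x(2) by (simp only: add.right_inverse)
qed

definition normal :: "('a \<Rightarrow> 'a) set \<Rightarrow> bool" where
  "normal N \<longleftrightarrow> (\<forall>g\<in>G. \<forall>n\<in>N. finv g \<circ> n \<circ> g \<in> N)"

lemma fixed_normal:
  assumes "normal N" "N \<subseteq> G" "g \<in> G" "x \<in> fixed N"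
  shows "g x \<in> fixed N"
  unfolding fixed_def
proof (safe)
  fix n assume n: "n \<in> N"
  have "(finv g \<circ> n \<circ> g) x = x"
    using assms n unfolding normal_def by (blast intro: fixedD)
  then show "n (g x) = g x"
    using assms(3) by (metis comp_apply inv_simps(2))
qed

end

section \<open>Cauchy's theorem and fixed points of p-groups\<close>

lemma (in group) cauchy:
  assumes fin: "finite (carrier G)" and q: "prime (q :: nat)" "q dvd order G"
  obtains x where "x \<in> carrier G" "x \<noteq> \<one>" "x [^] q = \<one>"
proof -
  have "order G = q ^ 1 * (order G div q)"
    using q(2) by simp
  then obtain H where H: "subgroup H G" "card H = q"
    using sylow_thm[OF q(1) is_group, of 1 "order G div q"] fin by auto
  have "H \<noteq> {\<one>}" using H(2) prime_gt_1_nat[OF q(1)] by auto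
  then obtain x where x: "x \<in> H" "x \<noteq> \<one>"
    using subgroup.one_closed[OF H(1)] by blast
  interpret H: group "G\<lparr>carrier := H\<rparr>"
    using subgroup.subgroup_is_group[OF H(1) is_group] .
  have "x [^]\<^bsub>G\<lparr>carrier := H\<rparr>\<^esub> order (G\<lparr>carrier := H\<rparr>) = \<one>"
    using H.pow_order_eq_1[of x] x(1) by simp
  then have "x [^] q = \<one>"
    using H(2) by (simp add: order_def nat_pow_consistent[symmetric])
  then show ?thesis
    using x subgroup.subset[OF H(1)] that by blast
qed

text \<open>By Cauchy, a finite group of elements of p-power order has no other prime in its order,
  so every orbit of more than one point has size divisible by p. A is only a monoid of maps, with
  p-power order asked on \<Omega> alone; its restrictions to \<Omega> form the group.\<close>

lemma fixed_point_free_p_group: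
  fixes A :: "('x \<Rightarrow> 'x) set"
  assumes p: "prime (p :: nat)" and fin: "finite \<Omega>"
    and A: "id \<in> A" "\<And>g h. g \<in> A \<Longrightarrow> h \<in> A \<Longrightarrow> g \<circ> h \<in> A" "\<And>g x. g \<in> A \<Longrightarrow> x \<in> \<Omega> \<Longrightarrow> g x \<in> \<Omega>"
    and ord: "\<And>g. g \<in> A \<Longrightarrow> \<exists>a. \<forall>x\<in>\<Omega>. (g ^^ (p ^ a)) x = x"
    and free: "\<And>x. x \<in> \<Omega> \<Longrightarrow> \<exists>g\<in>A. g x \<noteq> x"
  shows "p dvd card \<Omega>"
proof -
  define \<Gamma> where "\<Gamma> = (\<lambda>g. restrict g \<Omega>) ` A"
  have pow_A: "g ^^ n \<in> A" if "g \<in> A" for g n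
    using that A(1,2) by (induction n) auto
  have inv_A: "\<exists>h\<in>A. \<forall>x\<in>\<Omega>. h (g x) = x \<and> g (h x) = x" if g: "g \<in> A" for g
  proof -
    obtain a where a: "\<forall>x\<in>\<Omega>. (g ^^ (p ^ a)) x = x" using ord[OF g] by blast
    have "p ^ a \<noteq> 0" using prime_gt_0_nat[OF p] by simp
    then obtain m where m: "p ^ a = Suc m" using not0_implies_Suc by blast
    \<comment> \<open>On \<Omega> the inverse of g is its power of exponent p^a - 1, which lies in
      A.\<close>
    have "(g ^^ m) (g x) = x \<and> g ((g ^^ m) x) = x" if "x \<in> \<Omega>" for x
      using bspec[OF a that] unfolding m by (simp add: funpow_swap1)
    then show ?thesis using pow_A[OF g] by blast
  qed
  have Bij: "restrict g \<Omega> \<in> Bij \<Omega>" if g: "g \<in> A" for g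
  proof -
    obtain h where h: "h \<in> A" "\<forall>x\<in>\<Omega>. h (g x) = x \<and> g (h x) = x" using inv_A[OF g] by blast
    have "bij_betw (restrict g \<Omega>) \<Omega> \<Omega>"
      using h A(3) g by (intro bij_betw_byWitness[of _ h]) auto
    then show ?thesis unfolding Bij_def by simp
  qed
  have comp: "restrict g \<Omega> \<otimes>\<^bsub>BijGroup \<Omega>\<^esub> restrict h \<Omega> = restrict (g \<circ> h) \<Omega>" if "g \<in> A" "h \<in> A" for g h
    using Bij[OF that(1)] Bij[OF that(2)] A(3)[OF that(2)]
    by (simp add: BijGroup_def compose_def fun_eq_iff restrict_def)
  interpret S: group "BijGroup \<Omega>" by (rule group_BijGroup)
  have one: "\<one>\<^bsub>BijGroup \<Omega>\<^esub> = restrict id \<Omega>"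
    by (simp add: BijGroup_def restrict_def fun_eq_iff)
  have sub: "subgroup \<Gamma> (BijGroup \<Omega>)"
  proof (rule S.subgroupI)
    show "\<Gamma> \<subseteq> carrier (BijGroup \<Omega>)" using Bij unfolding \<Gamma>_def by (auto simp: BijGroup_def)
    show "\<Gamma> \<noteq> {}" using A(1) unfolding \<Gamma>_def by blast
  next
    fix a assume "a \<in> \<Gamma>"
    then obtain g where g: "g \<in> A" "a = restrict g \<Omega>" unfolding \<Gamma>_def by blast
    obtain h where h: "h \<in> A" "\<forall>x\<in>\<Omega>. h (g x) = x \<and> g (h x) = x" using inv_A[OF g(1)] by blast
    have "restrict h \<Omega> \<otimes>\<^bsub>BijGroup \<Omega>\<^esub> a = \<one>\<^bsub>BijGroup \<Omega>\<^esub>"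
      unfolding g(2) comp[OF h(1) g(1)] one using h(2) by (auto simp: restrict_def fun_eq_iff)
    then have "inv\<^bsub>BijGroup \<Omega>\<^esub> a = restrict h \<Omega>"
      using Bij[OF g(1)] Bij[OF h(1)] g(2) by (intro S.inv_equality) (auto simp: BijGroup_def)
    then show "inv\<^bsub>BijGroup \<Omega>\<^esub> a \<in> \<Gamma>" using h(1) unfolding \<Gamma>_def by blast
  next
    fix a b assume "a \<in> \<Gamma>" "b \<in> \<Gamma>"
    then show "a \<otimes>\<^bsub>BijGroup \<Omega>\<^esub> b \<in> \<Gamma>" unfolding \<Gamma>_def using comp A(2) by auto
  qed
  define \<G> where "\<G> = BijGroup \<Omega>\<lparr>carrier := \<Gamma>\<rparr>"
  interpret \<G>: group \<G>
    unfolding \<G>_def by (rule subgroup.subgroup_is_group[OF sub group_BijGroup])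
  have fin\<Gamma>: "finite (carrier \<G>)"
  proof (rule finite_subset)
    show "carrier \<G> \<subseteq> (\<Pi>\<^sub>E x\<in>\<Omega>. \<Omega>)"
      unfolding \<G>_def \<Gamma>_def using A(3) by auto
    show "finite (\<Pi>\<^sub>E x\<in>\<Omega>. \<Omega>)" using fin by (intro finite_PiE) auto
  qed
  have mult\<G>: "mult \<G> = mult (BijGroup \<Omega>)" by (simp add: \<G>_def)
  have pow: "restrict g \<Omega> [^]\<^bsub>\<G>\<^esub> n = restrict (g ^^ n) \<Omega>" if "g \<in> A" for g and n :: nat
  proof (induction n)
    case 0
    have "\<one>\<^bsub>\<G>\<^esub> = restrict (g ^^ 0) \<Omega>"
      using one by (simp add: \<G>_def id_def)
    then show ?case by (simp only: nat_pow_0)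
  next
    case (Suc n)
    have "restrict g \<Omega> [^]\<^bsub>\<G>\<^esub> Suc n = restrict (g ^^ n) \<Omega> \<otimes>\<^bsub>\<G>\<^esub> restrict g \<Omega>"
      by (simp only: \<G>.nat_pow_Suc Suc)
    also have "\<dots> = restrict (g ^^ n \<circ> g) \<Omega>"
      unfolding mult\<G> by (rule comp[OF pow_A[OF that] that])
    finally show ?case by (simp only: funpow_Suc_right)
  qed
  have prime_dvd: "q = p" if q: "prime q" "q dvd order \<G>" for q
  proof (rule ccontr)
    assume "q \<noteq> p"
    obtain x where x: "x \<in> carrier \<G>" "x \<noteq> \<one>\<^bsub>\<G>\<^esub>" "x [^]\<^bsub>\<G>\<^esub> q = \<one>\<^bsub>\<G>\<^esub>"
      using \<G>.cauchy[OF fin\<Gamma> q] by blast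
    obtain g where g: "g \<in> A" "x = restrict g \<Omega>"
      using x(1) unfolding \<G>_def \<Gamma>_def by auto
    obtain a where a: "\<forall>y\<in>\<Omega>. (g ^^ (p ^ a)) y = y" using ord[OF g(1)] by blast
    have "x [^]\<^bsub>\<G>\<^esub> (p ^ a) = \<one>\<^bsub>\<G>\<^esub>"
      unfolding g(2) pow[OF g(1)] using a by (simp add: \<G>_def one restrict_def fun_eq_iff)
    then have "\<G>.ord x dvd p ^ a" "\<G>.ord x dvd q"
      using x by (simp_all add: \<G>.pow_eq_id)
    moreover have "coprime (p ^ a) q"
      using p q(1) \<open>q \<noteq> p\<close> by (simp add: primes_coprime)
    ultimately have "\<G>.ord x = 1"
      by (metis coprime_common_divisor_nat)
    then show False using x(1,2) \<G>.ord_eq_1 by blast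
  qed
  have hom: "id \<in> hom \<G> (BijGroup \<Omega>)"
    using subgroup.subset[OF sub] unfolding \<G>_def hom_def by auto
  interpret act: group_action \<G> \<Omega> id
    unfolding group_action_def group_hom_def group_hom_axioms_def
    using hom \<G>.is_group group_BijGroup by blast
  have dvd_orbit: "p dvd card X" if X: "X \<in> orbits \<G> \<Omega> id" for X
  proof -
    obtain x where x: "x \<in> \<Omega>" "X = orbit \<G> id x"
      using X unfolding orbits_def by blast
    have "card X * card (stabilizer \<G> id x) = order \<G>"
      using act.orbit_stabilizer_theorem[OF x(1)] x(2) by simp
    then have dvd: "card X dvd order \<G>" by (metis dvd_triv_left)
    have "card X \<noteq> 1"
    proof
      assume "card X = 1"
      then obtain y where y: "X = {y}" by (rule card_1_singletonE)
      obtain g where g: "g \<in> A" "g x \<noteq> x" using free[OF x(1)] by blast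
      have "g' x \<in> X" if "g' \<in> A" for g'
        using that x(1) unfolding x(2) orbit_def \<G>_def \<Gamma>_def
        by (intro CollectI exI[of _ "restrict g' \<Omega>"]) simp
      then have "g x = y" "id x = y" using y g(1) A(1) by blast+
      then show False using g(2) by simp
    qed
    then obtain q where q: "prime q" "q dvd card X"
      using prime_factor_nat by blast
    then show ?thesis using prime_dvd[OF q(1)] dvd dvd_trans by blast
  qed
  have "p dvd (\<Sum>X\<in>orbits \<G> \<Omega> id. \<Sum>x\<in>X. 1)"
  proof (rule dvd_sum)
    show "p dvd (\<Sum>x\<in>X. 1)" if "X \<in> orbits \<G> \<Omega> id" for X
      using dvd_orbit[OF that] by (simp only: card_eq_sum)
  qed
  also have "(\<Sum>X\<in>orbits \<G> \<Omega> id. \<Sum>x\<in>X. 1) = (\<Sum>x\<in>\<Omega>. 1 :: nat)"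
    by (rule act.disjoint_sum[OF fin])
  finally show ?thesis by simp
qed

context automorphism_group
begin

text \<open>An element of order p in I / N, which Cauchy's theorem would supply, lifts to some
  \<sigma> outside N with \<open>\<sigma> ^^ p\<close> in N, against \<open>tors\<close>.\<close>

lemma index_coprime:
  assumes I: "sgrp I" and N: "sgrp N" "N \<subseteq> I" and norm: "\<And>g n. g \<in> I \<Longrightarrow> n \<in> N \<Longrightarrow> finv g \<circ> n \<circ> g \<in> N"
    and T: "transversal I N T" and p: "prime (p :: nat)"
    and tors: "\<And>\<sigma>. \<sigma> \<in> I \<Longrightarrow> \<sigma> ^^ p \<in> N \<Longrightarrow> \<sigma> \<in> N"
  shows "\<not> p dvd card T"
proof
  assume dvd: "p dvd card T"
  define \<G> where "\<G> = \<lparr>carrier = I, mult = (\<circ>), one = id :: 'a \<Rightarrow> 'a\<rparr>"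
  have car: "carrier \<G> = I" "mult \<G> = (\<circ>)" "one \<G> = id" by (simp_all add: \<G>_def)
  interpret \<G>: group \<G>
  proof (rule groupI)
    fix x assume "x \<in> carrier \<G>"
    then show "\<exists>y\<in>carrier \<G>. y \<otimes>\<^bsub>\<G>\<^esub> x = \<one>\<^bsub>\<G>\<^esub>"
      using sgrpD(4,5)[OF I] by (intro bexI[of _ "finv x"]) (auto simp: car)
  qed (use sgrpD[OF I] in \<open>auto simp: car comp_assoc\<close>)
  have inv_eq: "inv\<^bsub>\<G>\<^esub> x = finv x" if "x \<in> I" for x
    using that sgrpD(4,5)[OF I] by (intro \<G>.inv_equality) (auto simp: car)
  have "N \<lhd> \<G>"
    unfolding \<G>.normal_inv_iff
  proof (intro conjI ballI)
    show "subgroup N \<G>"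
      using N sgrpD[OF N(1)] by (intro \<G>.subgroupI) (auto simp: car inv_eq)
    fix x h assume "x \<in> carrier \<G>" "h \<in> N"
    then show "x \<otimes>\<^bsub>\<G>\<^esub> h \<otimes>\<^bsub>\<G>\<^esub> inv\<^bsub>\<G>\<^esub> x \<in> N"
      using norm[OF sgrpD(4)[OF I, of x], of h] sgrpD(5)[OF I, of x] by (simp add: car inv_eq)
  qed
  then interpret N: normal N \<G> .
  interpret Q: group "\<G> Mod N" by (rule N.factorgroup_is_group)
  have carQ: "carrier (\<G> Mod N) = (\<lambda>t. N #>\<^bsub>\<G>\<^esub> t) ` T"
  proof
    show "(\<lambda>t. N #>\<^bsub>\<G>\<^esub> t) ` T \<subseteq> carrier (\<G> Mod N)"
      using transversalD(2)[OF T] by (auto simp: FactGroup_def RCOSETS_def car)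
    show "carrier (\<G> Mod N) \<subseteq> (\<lambda>t. N #>\<^bsub>\<G>\<^esub> t) ` T"
    proof
      fix X assume "X \<in> carrier (\<G> Mod N)"
      then obtain g where g: "g \<in> I" "X = N #>\<^bsub>\<G>\<^esub> g"
        by (auto simp: FactGroup_def RCOSETS_def car)
      obtain t where t: "t \<in> T" "finv t \<circ> g \<in> N" using transversalD(3)[OF T g(1)] by blast
      have tI: "t \<in> I" "t \<in> G" using t(1) transversalD(2)[OF T] sgrpD(5)[OF I] by auto
      \<comment> \<open>The quotient group is built from right cosets while T represents left
        cosets; normality converts one into the other.\<close>
      have "finv (finv t) \<circ> (finv t \<circ> g) \<circ> finv t \<in> N"
        by (rule norm[OF sgrpD(4)[OF I tI(1)] t(2)])
      then have "g \<circ> finv t \<in> N" using tI(2) by (simp add: comp_cancel)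
      moreover have "g = (g \<circ> finv t) \<otimes>\<^bsub>\<G>\<^esub> t"
        using tI(2) by (simp add: car comp_assoc)
      ultimately have "g \<in> N #>\<^bsub>\<G>\<^esub> t" unfolding r_coset_def by blast
      then have "N #>\<^bsub>\<G>\<^esub> t = N #>\<^bsub>\<G>\<^esub> g"
        using tI(1) N.subgroup_axioms by (intro \<G>.repr_independence) (simp_all add: car)
      then show "X \<in> (\<lambda>t. N #>\<^bsub>\<G>\<^esub> t) ` T" using t(1) g(2) by blast
    qed
  qed
  have "inj_on (\<lambda>t. N #>\<^bsub>\<G>\<^esub> t) T"
  proof (rule inj_onI)
    fix s t assume st: "s \<in> T" "t \<in> T" "N #>\<^bsub>\<G>\<^esub> s = N #>\<^bsub>\<G>\<^esub> t"
    have I': "s \<in> I" "t \<in> I" "s \<in> G" "t \<in> G"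
      using st(1,2) transversalD(2)[OF T] sgrpD(5)[OF I] by auto
    have "t \<in> N #>\<^bsub>\<G>\<^esub> t" using I'(2) \<G>.rcos_self[OF _ N.subgroup_axioms, of t] by (simp add: car)
    then obtain n where n: "n \<in> N" "t = n \<circ> s"
      using st(3) unfolding r_coset_def by (auto simp: car)
    have "finv s \<circ> t = finv s \<circ> n \<circ> s" using n(2) by (simp add: comp_assoc)
    then have "finv s \<circ> t \<in> N" using norm[OF I'(1) n(1)] by simp
    then show "s = t" by (rule transversal_unique[OF I T N(1) st(1,2)])
  qed
  then have "order (\<G> Mod N) = card T"
    unfolding order_def carQ by (rule card_image)
  moreover have "finite (carrier (\<G> Mod N))"
    unfolding carQ using transversalD(1)[OF T] by blast
  ultimately obtain X where X: "X \<in> carrier (\<G> Mod N)" "X \<noteq> \<one>\<^bsub>\<G> Mod N\<^esub>" "X [^]\<^bsub>\<G> Mod N\<^esub> p = \<one>\<^bsub>\<G> Mod N\<^esub>"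
    using Q.cauchy[OF _ p] dvd by auto
  obtain g where g: "g \<in> I" "X = N #>\<^bsub>\<G>\<^esub> g"
    using X(1) by (auto simp: FactGroup_def RCOSETS_def car)
  have pow: "g [^]\<^bsub>\<G>\<^esub> n = g ^^ n" for n :: nat
  proof (induction n)
    case (Suc n)
    then show ?case by (simp add: car funpow_Suc_right del: funpow.simps)
  qed (simp add: car)
  have "N #>\<^bsub>\<G>\<^esub> (g ^^ p) = N"
    using X(3) N.FactGroup_pow[of g p] g by (simp add: pow car)
  moreover have "g ^^ p \<in> N #>\<^bsub>\<G>\<^esub> (g ^^ p)"
    using \<G>.rcos_self[OF _ N.subgroup_axioms, of "g ^^ p"] sgrp_funpow[OF I g(1)] by (simp add: car)
  ultimately have "g \<in> N" using tors[OF g(1)] by simp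
  then have "X = N"
    using g \<G>.coset_join2[OF _ N.subgroup_axioms, of g] by (simp add: car)
  then show False using X(2) by simp
qed

end

section \<open>Galois groups of valued fields\<close>

locale valuation_ring =
  fixes Ov :: "'a::field set"
  assumes Ov: "subring_set Ov" and val: "x \<in> Ov \<or> inverse x \<in> Ov"
begin

definition vunit :: "'a \<Rightarrow> bool" where
  "vunit x \<longleftrightarrow> x \<noteq> 0 \<and> x \<in> Ov \<and> inverse x \<in> Ov"

definition mx :: "'a set" where
  "mx = {x \<in> Ov. \<not> vunit x}"

lemma vunit_simps:
  "vunit 1" "vunit x \<Longrightarrow> vunit y \<Longrightarrow> vunit (x * y)" "vunit x \<Longrightarrow> vunit (inverse x)"
  "vunit x \<Longrightarrow> vunit y \<Longrightarrow> vunit (x / y)" "vunit x \<Longrightarrow> x \<noteq> 0" "vunit x \<Longrightarrow> x \<in> Ov"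
  unfolding vunit_def divide_inverse by (auto simp: subring_setD[OF Ov])

lemma vunit_power: "vunit x \<Longrightarrow> vunit (x ^ n)"
  by (induction n) (auto intro: vunit_simps)

lemma vunit_prod: "(\<And>i. i \<in> I \<Longrightarrow> vunit (f i)) \<Longrightarrow> vunit (prod f I)"
  by (induction I rule: infinite_finite_induct) (auto intro: vunit_simps)

lemma mxD: "x \<in> mx \<Longrightarrow> x \<in> Ov" "x \<in> mx \<Longrightarrow> \<not> vunit x"
  unfolding mx_def by auto

lemma not_mx_imp_vunit: "x \<in> Ov \<Longrightarrow> x \<notin> mx \<Longrightarrow> vunit x"
  unfolding mx_def by auto

lemma mx_mult:
  assumes "a \<in> Ov" "x \<in> mx"
  shows "a * x \<in> mx"
proof -
  have "a * x \<in> Ov" using assms mxD subring_setD(4)[OF Ov] by blast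
  moreover have "\<not> vunit (a * x)"
  proof
    assume u: "vunit (a * x)"
    then have *: "a * inverse (a * x) \<in> Ov" and "a \<noteq> 0" "x \<noteq> 0"
      using assms(1) subring_setD(4)[OF Ov] unfolding vunit_def by auto
    have eq: "a * inverse (a * x) = inverse x"
      using \<open>a \<noteq> 0\<close> by (simp add: field_simps)
    have "inverse x \<in> Ov" using * unfolding eq .
    then show False using assms(2) \<open>x \<noteq> 0\<close> unfolding mx_def vunit_def by auto
  qed
  ultimately show ?thesis unfolding mx_def by blast
qed

text \<open>One of x / y and y / x is integral, so the sum is an integral multiple of y or of
  x.\<close>

lemma mx_add:
  assumes "x \<in> mx" "y \<in> mx"
  shows "x + y \<in> mx"
proof (cases "x = 0 \<or> y = 0")
  case True
  then show ?thesis using assms by (elim disjE) simp_all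
next
  case False
  have "x / y \<in> Ov \<or> y / x \<in> Ov"
    using val[of "x / y"] by simp
  then show ?thesis
  proof
    assume "x / y \<in> Ov"
    then have "(x / y + 1) * y \<in> mx"
      using assms(2) by (intro mx_mult subring_setD[OF Ov])
    then show ?thesis using False by (simp add: distrib_right)
  next
    assume "y / x \<in> Ov"
    then have "(1 + y / x) * x \<in> mx"
      using assms(1) by (intro mx_mult subring_setD[OF Ov])
    then show ?thesis using False by (simp add: distrib_right)
  qed
qed

lemma mx_uminus: "x \<in> mx \<Longrightarrow> - x \<in> mx"
  using mx_mult[of "- 1" x] subring_setD(2,5)[OF Ov] by simp

lemma mx_diff: "x \<in> mx \<Longrightarrow> y \<in> mx \<Longrightarrow> x - y \<in> mx"
  using mx_add[of x "- y"] mx_uminus by simp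

lemma mx_0: "0 \<in> mx"
  unfolding mx_def vunit_def using subring_setD(1)[OF Ov] by simp

lemma mx_sum: "(\<And>i. i \<in> I \<Longrightarrow> f i \<in> mx) \<Longrightarrow> sum f I \<in> mx"
  by (induction I rule: infinite_finite_induct) (auto intro: mx_add mx_0)

lemma mx_prime: "x \<in> Ov \<Longrightarrow> y \<in> Ov \<Longrightarrow> x * y \<in> mx \<Longrightarrow> x \<in> mx \<or> y \<in> mx"
  using vunit_simps(2) unfolding mx_def by blast

lemma mx_power: "x \<in> Ov \<Longrightarrow> x ^ n \<in> mx \<Longrightarrow> x \<in> mx"
proof (induction n)
  case 0
  then show ?case using vunit_simps(1) mxD by auto
next
  case (Suc n)
  then show ?case using mx_prime[OF Suc(2) subring_set_power[OF Ov Suc(2), of n]] by auto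
qed

lemma of_nat_Ov: "of_nat n \<in> Ov"
  by (induction n) (auto simp: subring_setD[OF Ov])

lemma of_int_Ov: "of_int n \<in> Ov"
  by (cases n) (auto simp: of_nat_Ov subring_setD[OF Ov] simp del: of_nat_Suc)

lemma vunit_add_mx: "vunit x \<Longrightarrow> y - x \<in> mx \<Longrightarrow> vunit y"
proof (rule ccontr)
  assume x: "vunit x" and "y - x \<in> mx" and "\<not> vunit y"
  moreover have "y = (y - x) + x" by simp
  then have "y \<in> Ov" using mxD(1)[OF \<open>y - x \<in> mx\<close>] vunit_simps(6)[OF x] subring_setD(3)[OF Ov] by metis
  ultimately have "y \<in> mx" by (simp add: mx_def)
  from mx_diff[OF this \<open>y - x \<in> mx\<close>] have "x \<in> mx" by simp
  then show False using x mxD by blast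
qed

end

text \<open>\<open>uniformised\<close> says that the valuation is discrete on the base field, with
  uniformiser \<pi>. \<open>limit\<close> is compactness of the Galois group: with no assumption of
  convergence, some \<sigma> takes the eventual value of the sequence wherever there is one.\<close>

locale valued_galois = automorphism_group G + valuation_ring Ov
  for G :: "('a::field \<Rightarrow> 'a) set" and Ov :: "'a set" +
  fixes p :: nat and \<pi> :: 'a and r :: "nat \<Rightarrow> 'a"
  assumes stable: "g \<in> G \<Longrightarrow> x \<in> Ov \<Longrightarrow> g x \<in> Ov"
    and p: "prime p" and p_nonunit: "inverse (of_nat p) \<notin> Ov"
    and \<pi>: "\<pi> \<noteq> 0" "inverse \<pi> \<notin> Ov" "g \<in> G \<Longrightarrow> g \<pi> = \<pi>"
    and uniformised: "x \<in> fixed G \<Longrightarrow> x \<noteq> 0 \<Longrightarrow>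
      \<exists>k u. x = \<pi> powi k * u \<and> u \<in> Ov \<and> inverse u \<in> Ov"
    and r: "r 0 = \<pi>" "r (Suc n) ^ p = r n"
    and limit: "(\<And>n :: nat. \<tau> n \<in> G) \<Longrightarrow>
      \<exists>\<sigma>\<in>G. \<forall>x y n. (\<forall>m\<ge>n. \<tau> m x = y) \<longrightarrow> \<sigma> x = y"
begin

lemma p_mx: "of_nat p \<in> mx"
  unfolding mx_def vunit_def using of_nat_Ov p_nonunit by blast

text \<open>Bezout against p: otherwise n and p would both lie in the maximal ideal, and hence so
  would 1.\<close>

lemma vunit_of_nat:
  assumes "\<not> p dvd n"
  shows "vunit (of_nat n)"
proof (rule ccontr)
  assume "\<not> vunit (of_nat n)"
  then have n: "of_nat n \<in> mx" unfolding mx_def using of_nat_Ov by blast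
  have "coprime (int n) (int p)"
    using prime_imp_coprime[OF p assms] by (simp add: coprime_commute)
  then obtain u v where "u * int n + v * int p = 1"
    using bezout_int[of "int n" "int p"] by auto
  then have "of_int u * of_nat n + of_int v * of_nat p = (1 :: 'a)"
    by (metis of_int_1 of_int_add of_int_mult of_int_of_nat_eq)
  moreover have "of_int u * of_nat n + of_int v * of_nat p \<in> mx"
    by (intro mx_add mx_mult of_int_Ov n p_mx)
  ultimately show False using mxD(2) vunit_simps(1) by auto
qed

lemma G_vunit:
  assumes "g \<in> G"
  shows "vunit (g x) \<longleftrightarrow> vunit x"
proof -
  have "vunit (h x)" if "h \<in> G" "vunit x" for h x
    using that stable[OF that(1)] unfolding vunit_def by (simp add: hom_simps flip: hom_simps(7))
  from this[OF assms] this[OF inv_in[OF assms], of "g x"] show ?thesis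
    using inv_simps(1)[OF assms] by auto
qed

lemma G_mx: "g \<in> G \<Longrightarrow> x \<in> mx \<Longrightarrow> g x \<in> mx"
  unfolding mx_def using stable G_vunit by simp

text \<open>Valuations are invariant: otherwise the orbit of \<open>y\<close> under powers of \<open>g\<close> would be infinite.\<close>

lemma conjugate_vunit:
  assumes g: "g \<in> G" and y: "y \<noteq> 0"
  shows "vunit (g y / y)"
proof -
  have pow_G: "g ^^ i \<in> G" for i using sgrp_funpow[OF sgrp_G g] .
  have "\<not> inj (\<lambda>i. (g ^^ i) y)"
  proof
    assume "inj (\<lambda>i. (g ^^ i) y)"
    moreover have "finite (range (\<lambda>i. (g ^^ i) y))"
      using pow_G by (intro finite_subset[OF _ finite_orbit[of y]]) blast
    ultimately show False
      using finite_imageD by fastforce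
  qed
  then obtain i j where ij: "(g ^^ i) y = (g ^^ j) y" "i < j"
    unfolding inj_on_def by (metis linorder_neqE_nat)
  then have "(g ^^ i) ((g ^^ (j - i)) y) = (g ^^ i) y"
    by (metis add_diff_inverse_nat comp_apply funpow_add less_imp_not_less)
  then have n: "(g ^^ (j - i)) y = y" using hom_simps(14)[OF pow_G] by blast
  define c where "c = g y / y"
  \<comment> \<open>Telescoping product. When \<open>g ^^ n\<close> fixes y, the conjugates of c
    multiply to 1, so \<open>inverse c\<close> is a product of conjugates of c; integrality of
    either one then gives that of the other.\<close>
  have prod: "(g ^^ n) y = y * (\<Prod>i<n. (g ^^ i) c)" for n
  proof (induction n)
    case (Suc n)
    have "(g ^^ Suc n) y = (g ^^ n) (y * c)" using y by (simp add: funpow_swap1 c_def)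
    also have "\<dots> = (g ^^ n) y * (g ^^ n) c" by (simp only: hom_simps(5)[OF pow_G])
    finally show ?case using Suc by simp
  qed simp
  have one: "(\<Prod>i<j - i. (g ^^ i) c) = 1" using prod[of "j - i"] n y by simp
  obtain k where k: "j - i = Suc k" using ij(2) by (metis Suc_diff_Suc)
  have one': "c * (\<Prod>i<k. (g ^^ Suc i) c) = 1"
    using one unfolding k prod.lessThan_Suc_shift by simp
  have c0: "c \<noteq> 0" using y hom_simps(11)[OF g] by (simp add: c_def)
  have inv: "inverse c = (\<Prod>i<k. (g ^^ Suc i) c)"
    using one' by (rule inverse_unique)
  have "vunit c"
  proof (cases "c \<in> Ov")
    case True
    then have "inverse c \<in> Ov"
      unfolding inv by (intro subring_set_prod[OF Ov] stable[OF pow_G])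
    then show ?thesis unfolding vunit_def using True c0 by blast
  next
    case False
    then have *: "inverse c \<in> Ov" using val by blast
    have "c = inverse (\<Prod>i<k. (g ^^ Suc i) c)" using inv by (metis inverse_inverse_eq)
    also have "\<dots> = (\<Prod>i<k. (g ^^ Suc i) (inverse c))"
      by (simp only: prod_inversef[symmetric] hom_simps(7)[OF pow_G] comp_def)
    also have "\<dots> \<in> Ov"
      using * by (intro subring_set_prod[OF Ov] stable[OF pow_G])
    finally show ?thesis using False by blast
  qed
  then show ?thesis unfolding c_def .
qed

text \<open>If \<open>\<sigma>\<close> moves an element of the fixed field modulo the maximal ideal for every \<open>\<sigma>\<close> outside \<open>I\<close>, then
  Dedekind's independence theorem holds modulo that ideal and yields a trace of valuation that of \<open>y\<close>.\<close>

lemma unramified: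
  assumes I: "open_sgrp I" and moves: "\<And>\<sigma>. \<sigma> \<in> G \<Longrightarrow> \<sigma> \<notin> I \<Longrightarrow> \<exists>a\<in>fixed I \<inter> Ov. \<sigma> a - a \<notin> mx"
    and y: "y \<in> fixed I" "y \<noteq> 0"
  obtains z where "z \<in> fixed G" "vunit (z / y)"
proof -
  have Is: "sgrp I" using I unfolding open_sgrp_def by blast
  note IG = sgrpD(1)[OF Is]
  obtain T where T: "transversal G I T" using exists_transversal[OF sgrp_G I IG] by blast
  have TG: "t \<in> G" if "t \<in> T" for t using that transversalD(2)[OF T] by blast
  obtain t0 where t0: "t0 \<in> T" using transversal_nonempty[OF sgrp_G T] by blast
  \<comment> \<open>The coefficients \<open>t y / y\<close> are units, so the combination cannot
    vanish identically on residues; it is the trace of \<open>y * a\<close> divided by y.\<close>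
  have "\<exists>a\<in>fixed I \<inter> Ov. (\<Sum>t\<in>T. (t y / y) * t a) \<notin> mx"
  proof (rule independent_characters[where R = Ov and ev = "\<lambda>t. t"])
    show "1 \<in> fixed I \<inter> Ov" using fixed_closed(2)[OF IG] subring_setD(2)[OF Ov] by blast
    show "x * z \<in> fixed I \<inter> Ov" if "x \<in> fixed I \<inter> Ov" "z \<in> fixed I \<inter> Ov" for x z
      using that fixed_closed(4)[OF IG] subring_setD(4)[OF Ov] by blast
    show "finite T" using transversalD(1)[OF T] .
    show "t x \<in> Ov" if "t \<in> T" "x \<in> fixed I \<inter> Ov" for t x
      using stable[OF TG[OF that(1)]] that(2) by blast
    show "t y / y \<in> Ov" if "t \<in> T" for t
      using conjugate_vunit[OF TG[OF that] y(2)] by (rule vunit_simps(6))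
    show "t0 y / y \<notin> mx"
      using conjugate_vunit[OF TG[OF t0] y(2)] mxD by blast
    show "\<exists>x\<in>fixed I \<inter> Ov. t x - t' x \<notin> mx" if tt: "t \<in> T" "t' \<in> T" "t \<noteq> t'" for t t'
    proof -
      have "finv t' \<circ> t \<notin> I"
        using transversal_unique[OF sgrp_G T Is tt(2,1)] tt(3) by metis
      then obtain a where a: "a \<in> fixed I \<inter> Ov" "(finv t' \<circ> t) a - a \<notin> mx"
        using moves[of "finv t' \<circ> t"] comp_in inv_in TG tt(1,2) by metis
      have "finv t' (t a - t' a) = (finv t' \<circ> t) a - a"
        using TG[OF tt(2)] inv_in by (simp add: hom_simps)
      then have "t a - t' a \<notin> mx"
        using a(2) G_mx[OF inv_in[OF TG[OF tt(2)]]] by metis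
      then show ?thesis using a(1) by blast
    qed
  qed (use Ov mx_diff mx_mult mx_prime t0 TG in \<open>auto simp: hom_simps\<close>)
  then obtain a where a: "a \<in> fixed I" "a \<in> Ov" "(\<Sum>t\<in>T. (t y / y) * t a) \<notin> mx" by blast
  let ?z = "\<Sum>t\<in>T. t (y * a)"
  have eq: "?z / y = (\<Sum>t\<in>T. (t y / y) * t a)"
    using TG by (simp add: sum_divide_distrib hom_simps)
  have "(\<Sum>t\<in>T. (t y / y) * t a) \<in> Ov"
    using stable[OF TG a(2)] vunit_simps(6)[OF conjugate_vunit[OF TG y(2)]]
    by (intro subring_set_sum[OF Ov] subring_setD(4)[OF Ov]) auto
  then have "vunit (?z / y)" unfolding eq using a(3) not_mx_imp_vunit by blast
  moreover have "?z \<in> fixed G"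
    using fixed_closed(4)[OF IG y(1) a(1)] by (rule transversal_sum_fixed(1)[OF sgrp_G Is IG T])
  ultimately show ?thesis by (rule that[rotated])
qed

text \<open>Wild inertia of the fixed field of N: asking that \<open>\<sigma> x / x\<close> have
  residue 1 for every nonzero x, not only for units, cuts it out of the inertia group.\<close>

definition wild :: "('a \<Rightarrow> 'a) set \<Rightarrow> ('a \<Rightarrow> 'a) set" where
  "wild N = {\<sigma> \<in> G. \<forall>x\<in>fixed N. x \<noteq> 0 \<longrightarrow> \<sigma> x / x - 1 \<in> mx}"

lemma wild_comp:
  assumes "\<sigma> \<in> wild N" "\<tau> \<in> wild N"
  shows "\<sigma> \<circ> \<tau> \<in> wild N"
proof -
  have G: "\<sigma> \<in> G" "\<tau> \<in> G" using assms unfolding wild_def by auto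
  have "(\<sigma> \<circ> \<tau>) x / x - 1 \<in> mx" if x: "x \<in> fixed N" "x \<noteq> 0" for x
  proof -
    have *: "\<sigma> x / x - 1 \<in> mx" "\<tau> x / x - 1 \<in> mx" using assms x unfolding wild_def by auto
    have "\<sigma> x / x \<in> Ov" using conjugate_vunit[OF G(1) x(2)] by (rule vunit_simps(6))
    then have "(\<sigma> x / x) * \<sigma> (\<tau> x / x - 1) + (\<sigma> x / x - 1) \<in> mx"
      using * by (intro mx_add mx_mult G_mx[OF G(1)])
    moreover have "(\<sigma> x / x) * \<sigma> (\<tau> x / x - 1) + (\<sigma> x / x - 1) = (\<sigma> \<circ> \<tau>) x / x - 1"
      using x(2) G by (simp add: hom_simps right_diff_distrib)
    ultimately show ?thesis by metis
  qed
  then show ?thesis unfolding wild_def using comp_in[OF G] by blast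
qed

lemma id_wild: "id \<in> wild N"
  unfolding wild_def using id_in mx_0 by simp

lemma wild_funpow: "\<sigma> \<in> wild N \<Longrightarrow> \<sigma> ^^ n \<in> wild N"
  by (induction n) (auto intro: wild_comp id_wild)

text \<open>Take n positive with \<open>\<sigma> ^^ n\<close> in N and split it into a power of p
  and a part l prime to p. For s, the corresponding p-power of \<sigma>, the sum S over its first l
  powers acts up to the maximal ideal as multiplication by the unit l, so it kills nothing nonzero.
  But it kills \<open>x - S x / l\<close>, and \<open>S x\<close> is fixed by s, so x is
  too.\<close>

lemma wild_p_power:
  assumes N: "open_sgrp N" "normal N" and \<sigma>: "\<sigma> \<in> wild N"
  obtains a where "\<sigma> ^^ (p ^ a) \<in> N"
proof -
  have Ns: "sgrp N" using N(1) unfolding open_sgrp_def by blast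
  note NG = sgrpD(1)[OF Ns]
  have \<sigma>G: "\<sigma> \<in> G" using \<sigma> unfolding wild_def by blast
  have pow_G: "\<sigma> ^^ i \<in> G" for i using sgrp_funpow[OF sgrp_G \<sigma>G] .
  obtain n where n: "n > 0" "\<sigma> ^^ n \<in> N"
  proof -
    obtain T where T: "transversal G N T" using exists_transversal[OF sgrp_G N(1) NG] by blast
    obtain f where f: "\<And>i. f i \<in> T \<and> finv (f i) \<circ> \<sigma> ^^ i \<in> N"
      using transversalD(3)[OF T pow_G] by metis
    have "\<not> inj f"
    proof
      assume "inj f"
      moreover have "range f \<subseteq> T" using f by blast
      ultimately show False
        using transversalD(1)[OF T] finite_subset finite_imageD infinite_UNIV_nat by metis
    qed
    then obtain i j where ij: "f i = f j" "i < j"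
      unfolding inj_on_def by (metis linorder_neqE_nat)
    have fG: "f i \<in> G" using f transversalD(2)[OF T] by blast
    have "finv (finv (f i) \<circ> \<sigma> ^^ i) \<circ> (finv (f i) \<circ> \<sigma> ^^ j) \<in> N"
      using f[of i] f[of j] ij(1) sgrpD(3,4)[OF Ns] by metis
    also have "finv (finv (f i) \<circ> \<sigma> ^^ i) \<circ> (finv (f i) \<circ> \<sigma> ^^ j) = finv (\<sigma> ^^ i) \<circ> \<sigma> ^^ j"
      using fG pow_G by (simp add: inv_comp inv_in comp_cancel)
    also have "\<sigma> ^^ j = \<sigma> ^^ i \<circ> \<sigma> ^^ (j - i)"
      using ij(2) by (simp add: funpow_add[symmetric])
    finally have "\<sigma> ^^ (j - i) \<in> N" using pow_G by (simp add: comp_cancel)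
    then show ?thesis using ij(2) by (intro that[of "j - i"]) simp_all
  qed
  obtain l where l: "n = p ^ multiplicity p n * l" "\<not> p dvd l"
    using multiplicity_decompose'[of n p] n(1) p by (metis not_prime_unit neq0_conv)
  define s where "s = \<sigma> ^^ (p ^ multiplicity p n)"
  have s: "s \<in> wild N" "s \<in> G" "s ^^ l \<in> N"
    unfolding s_def using wild_funpow[OF \<sigma>] pow_G n(2) l(1) by (simp_all add: funpow_mult mult.commute)
  have spow: "s ^^ i \<in> G" "s ^^ i \<in> wild N" for i
    using sgrp_funpow[OF sgrp_G s(2)] wild_funpow[OF s(1)] by auto
  define S where "S = (\<lambda>y. \<Sum>i<l. (s ^^ i) y)"
  have l0: "vunit (of_nat l)" using vunit_of_nat[OF l(2)] .
  have S_fix: "s (S y) = S y" if y: "y \<in> fixed N" for y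
  proof -
    have "s (S y) = (\<Sum>i<l. (s ^^ Suc i) y)"
      unfolding S_def using s(2) by (simp add: hom_simps)
    also have "\<dots> = (\<Sum>i<Suc l. (s ^^ i) y) - y"
      unfolding sum.lessThan_Suc_shift by simp
    also have "\<dots> = S y"
      unfolding S_def using fixedD[OF y s(3)] by simp
    finally show ?thesis .
  qed
  have S_fixed: "S y \<in> fixed N" if y: "y \<in> fixed N" for y
  proof -
    have "(\<Sum>i\<in>I. (s ^^ i) y) \<in> fixed N" if "finite I" for I
      using that by induction (auto intro: fixed_closed[OF NG] fixed_normal[OF N(2) NG spow(1) y])
    then show ?thesis unfolding S_def by blast
  qed
  have S_nz: "S y \<noteq> 0" if y: "y \<in> fixed N" "y \<noteq> 0" for y
  proof
    assume S0: "S y = 0"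
    have "(\<Sum>i<l. ((s ^^ i) y / y - 1)) \<in> mx"
      using spow(2) y unfolding wild_def by (intro mx_sum) blast
    also have "(\<Sum>i<l. ((s ^^ i) y / y - 1)) = S y / y - of_nat l"
      unfolding S_def by (simp add: sum_subtractf sum_divide_distrib)
    finally have "- of_nat l \<in> mx" using S0 by simp
    then show False using mx_uminus l0 mxD(2) by fastforce
  qed
  have "s x = x" if x: "x \<in> fixed N" for x
  proof -
    let ?y = "x - S x / of_nat l"
    have y: "?y \<in> fixed N"
      using x S_fixed[OF x] by (intro fixed_closed[OF NG])
    have "(s ^^ i) (S x) = S x" for i
      using S_fix[OF x] by (induction i) simp_all
    then have "S ?y = S x - of_nat l * (S x / of_nat l)"
      unfolding S_def using spow(1) by (simp add: hom_simps sum_subtractf)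
    also have "\<dots> = 0" using vunit_simps(5)[OF l0] by simp
    finally have "?y = 0" using S_nz[OF y] by blast
    then have "x = S x / of_nat l" by simp
    then show ?thesis using S_fix[OF x] s(2) by (metis hom_simps(8,10))
  qed
  then have "s \<in> N" using fixes_fixed_imp_mem[OF N(1) s(2)] by blast
  then show ?thesis unfolding s_def by (rule that)
qed

text \<open>The value group is not available, so a ramification index prime to \<open>p\<close> is expressed by
  exponents.\<close>

definition tame :: "('a \<Rightarrow> 'a) set \<Rightarrow> bool" where
  "tame N \<longleftrightarrow> (\<forall>y\<in>fixed N. y \<noteq> 0 \<longrightarrow> (\<exists>m k u. \<not> p dvd m \<and> vunit u \<and> y ^ m = \<pi> powi k * u))"

text \<open>The residue characteristic is p, so (c - 1)^p and c^p - 1 agree modulo the maximal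
  ideal, which is prime.\<close>

lemma frobenius_mx:
  assumes "c \<in> Ov" "c ^ p - 1 \<in> mx"
  shows "c - 1 \<in> mx"
proof -
  define d where "d = c - 1"
  have d: "d \<in> Ov" unfolding d_def using assms(1) subring_setD(2,6)[OF Ov] by blast
  obtain q where q: "p = Suc q" using prime_gt_0_nat[OF p] gr0_implies_Suc by blast
  have "c ^ p = (d + 1) ^ p" by (simp add: d_def)
  also have "\<dots> = (\<Sum>k\<le>p. of_nat (p choose k) * d ^ k)"
    by (simp add: binomial_ring)
  also have "\<dots> = 1 + (\<Sum>k<q. of_nat (p choose Suc k) * d ^ Suc k) + d ^ p"
  proof -
    have "(\<Sum>k\<le>Suc q. F k) = F 0 + (\<Sum>k<q. F (Suc k)) + F (Suc q)" for F :: "nat \<Rightarrow> 'a"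
      unfolding sum.atMost_Suc_shift by (simp add: lessThan_Suc_atMost[symmetric] add.assoc)
    from this[of "\<lambda>k. of_nat (p choose k) * d ^ k"] show ?thesis
      unfolding q[symmetric] by simp
  qed
  finally have "d ^ p = (c ^ p - 1) - (\<Sum>k<q. of_nat (p choose Suc k) * d ^ Suc k)"
    by simp
  moreover have "of_nat (p choose Suc k) * d ^ Suc k \<in> mx" if "k < q" for k
  proof -
    have "p dvd p choose Suc k"
      using that q p by (intro dvd_choose_prime) auto
    then obtain e where "p choose Suc k = p * e" by blast
    then have "of_nat (p choose Suc k) * d ^ Suc k = (of_nat e * d ^ Suc k) * of_nat p"
      by simp
    then show ?thesis
      using mx_mult[OF subring_setD(4)[OF Ov of_nat_Ov subring_set_power[OF Ov d]] p_mx] by metis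
  qed
  ultimately have "d ^ p \<in> mx"
    using assms(2) by (auto intro!: mx_diff mx_sum)
  then show ?thesis using mx_power[OF d] unfolding d_def by blast
qed

text \<open>The inertia group \<open>I\<close> of the fixed field of \<open>N\<close> has no \<open>p\<close>-torsion modulo \<open>N\<close>, and the norm from
  \<open>N\<close> to \<open>I\<close> multiplies valuations by \<open>[I : N]\<close>.\<close>

lemma tame_if_wild_trivial:
  assumes N: "open_sgrp N" "normal N" and W: "wild N \<subseteq> N"
  shows "tame N"
proof -
  have Ns: "sgrp N" using N(1) unfolding open_sgrp_def by blast
  note NG = sgrpD(1)[OF Ns]
  define I where "I = {\<sigma> \<in> G. \<forall>a\<in>fixed N \<inter> Ov. \<sigma> a - a \<in> mx}"
  have IG: "I \<subseteq> G" unfolding I_def by blast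
  have Is: "sgrp I"
    unfolding sgrp_def
  proof (intro conjI ballI IG)
    show "id \<in> I" unfolding I_def using id_in mx_0 by simp
    fix g h assume gh: "g \<in> I" "h \<in> I"
    then have G: "g \<in> G" "h \<in> G" using IG by auto
    have "(g \<circ> h) a - a \<in> mx" if a: "a \<in> fixed N \<inter> Ov" for a
    proof -
      have "g (h a - a) + (g a - a) \<in> mx"
        using gh a G_mx[OF G(1)] unfolding I_def by (intro mx_add) auto
      then show ?thesis using G by (simp add: hom_simps)
    qed
    then show "g \<circ> h \<in> I" unfolding I_def using comp_in[OF G] by blast
  next
    fix g assume g: "g \<in> I"
    then have G: "g \<in> G" using IG by auto
    have "finv g a - a \<in> mx" if a: "a \<in> fixed N \<inter> Ov" for a
    proof -
      have "finv g (- (g a - a)) \<in> mx"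
        using g a unfolding I_def by (intro G_mx[OF inv_in[OF G]] mx_uminus) auto
      then show ?thesis using G inv_in[OF G] by (simp add: hom_simps)
    qed
    then show "finv g \<in> I" unfolding I_def using inv_in[OF G] by blast
  qed
  have NI: "N \<subseteq> I" unfolding I_def using NG mx_0 by (auto simp: fixedD)
  have Io: "open_sgrp I" by (rule open_sgrp_mono[OF N(1) NI Is])
  obtain T where T: "transversal I N T" using exists_transversal[OF Is N(1) NI] by blast
  have TI: "t \<in> I" "t \<in> G" if "t \<in> T" for t using that transversalD(2)[OF T] IG by auto
  define m where "m = card T"
  have tors: "\<sigma> \<in> N" if \<sigma>: "\<sigma> \<in> I" "\<sigma> ^^ p \<in> N" for \<sigma>
  proof -
    have \<sigma>G: "\<sigma> \<in> G" using \<sigma>(1) IG by blast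
    have pow_G: "\<sigma> ^^ i \<in> G" for i using sgrp_funpow[OF sgrp_G \<sigma>G] .
    have "\<sigma> x / x - 1 \<in> mx" if x: "x \<in> fixed N" "x \<noteq> 0" for x
    proof -
      let ?d = "\<lambda>i. (\<sigma> ^^ i) x / x"
      define c where "c = \<sigma> x / x"
      have c: "c \<in> Ov" unfolding c_def using conjugate_vunit[OF \<sigma>G x(2)] by (rule vunit_simps(6))
      have d: "?d i \<in> fixed N \<inter> Ov" for i
      proof
        show "?d i \<in> fixed N"
          using fixed_normal[OF N(2) NG pow_G x(1)] x(1) by (rule fixed_closed(6)[OF NG])
        show "?d i \<in> Ov" using conjugate_vunit[OF pow_G x(2)] by (rule vunit_simps(6))
      qed
      \<comment> \<open>Inertia acts trivially on residues of the fixed field of N, so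
        \<open>(\<sigma> ^^ i) x / x\<close> becomes multiplicative in i there.\<close>
      have "?d i - c ^ i \<in> mx" for i
      proof (induction i)
        case 0
        then show ?case using x(2) mx_0 by simp
      next
        case (Suc i)
        have "\<sigma> (?d i) - ?d i \<in> mx" using \<sigma>(1) d[of i] unfolding I_def by blast
        then have "c * ((\<sigma> (?d i) - ?d i) + (?d i - c ^ i)) \<in> mx"
          using Suc by (intro mx_mult[OF c] mx_add)
        moreover have "\<sigma> (?d i) * c = ?d (Suc i)"
          unfolding c_def using x(2) \<sigma>G by (simp add: hom_simps)
        then have "c * ((\<sigma> (?d i) - ?d i) + (?d i - c ^ i)) = ?d (Suc i) - c ^ Suc i"
          by (simp add: algebra_simps del: funpow.simps)
        ultimately show ?case by metis
      qed
      from this[of p] have "1 - c ^ p \<in> mx"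
        using fixedD[OF x(1) \<sigma>(2)] x(2) by simp
      then have "c ^ p - 1 \<in> mx" using mx_uminus by fastforce
      then show ?thesis using frobenius_mx[OF c] unfolding c_def by blast
    qed
    then have "\<sigma> \<in> wild N" unfolding wild_def using \<sigma>G by blast
    then show ?thesis using W by blast
  qed
  have m: "\<not> p dvd m"
    unfolding m_def
  proof (rule index_coprime[OF Is Ns NI _ T p tors])
    show "finv g \<circ> n \<circ> g \<in> N" if "g \<in> I" "n \<in> N" for g n
      using N(2) that IG unfolding normal_def by blast
  qed
  have moves: "\<exists>a\<in>fixed I \<inter> Ov. \<sigma> a - a \<notin> mx" if \<sigma>: "\<sigma> \<in> G" "\<sigma> \<notin> I" for \<sigma>
  proof -
    obtain a where a: "a \<in> fixed N" "a \<in> Ov" "\<sigma> a - a \<notin> mx" using \<sigma> unfolding I_def by blast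
    \<comment> \<open>Summing over I / N lands in the fixed field of I and multiplies the residue of
      a by m, which is a unit, so \<sigma> still moves it.\<close>
    let ?a = "\<Sum>t\<in>T. t a"
    have "(\<Sum>t\<in>T. t a - a) \<in> mx"
      using TI(1) a unfolding I_def by (intro mx_sum) blast
    then have *: "?a - of_nat m * a \<in> mx"
      unfolding m_def by (simp add: sum_subtractf)
    then have **: "\<sigma> ?a - of_nat m * \<sigma> a \<in> mx"
      using G_mx[OF \<sigma>(1) *] \<sigma>(1) by (simp add: hom_simps)
    have "\<sigma> ?a - ?a \<notin> mx"
    proof
      assume "\<sigma> ?a - ?a \<in> mx"
      from mx_diff[OF mx_add[OF this *] **]
      have "of_nat m * (\<sigma> a - a) \<in> mx" by (simp add: algebra_simps)
      moreover have "\<sigma> a - a \<in> Ov" by (intro subring_setD(6)[OF Ov] stable[OF \<sigma>(1)] a(2))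
      ultimately have "of_nat m \<in> mx"
        using mx_prime[OF of_nat_Ov] a(3) by blast
      then show False using vunit_of_nat[OF m] mxD(2) by blast
    qed
    moreover have "?a \<in> fixed I" by (rule transversal_sum_fixed(1)[OF Is Ns NI T a(1)])
    moreover have "?a \<in> Ov" using a(2) stable TI(2) by (intro subring_set_sum[OF Ov]) blast
    ultimately show ?thesis by blast
  qed
  show ?thesis
    unfolding tame_def
  proof (intro ballI impI)
    fix y assume y: "y \<in> fixed N" "y \<noteq> 0"
    let ?y = "\<Prod>t\<in>T. t y"
    have "?y \<in> fixed I" by (rule transversal_sum_fixed(2)[OF Is Ns NI T y(1)])
    moreover have "?y \<noteq> 0" using transversalD(1)[OF T] TI(2) y(2) by (simp add: hom_simps)
    \<comment> \<open>The fixed field of I is unramified over the base field, so the norm of y has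
      the valuation of an element of the base field, hence of a power of \<pi>.\<close>
    ultimately obtain z where z: "z \<in> fixed G" "vunit (z / ?y)"
      using unramified[OF Io moves] by blast
    then have "z \<noteq> 0" using vunit_simps(5) by fastforce
    then obtain k u where ku: "z = \<pi> powi k * u" "u \<in> Ov" "inverse u \<in> Ov"
      using uniformised[OF z(1)] by blast
    then have u: "vunit u" unfolding vunit_def using \<open>z \<noteq> 0\<close> by auto
    have "?y / y ^ m = (\<Prod>t\<in>T. t y / y)"
      unfolding m_def by (simp add: prod_dividef)
    also have "vunit \<dots>" using conjugate_vunit[OF TI(2) y(2)] by (intro vunit_prod)
    finally have "vunit (u / (z / ?y) / (?y / y ^ m))"
      by (rule vunit_simps(4)[OF vunit_simps(4)[OF u z(2)]])
    moreover have "y ^ m = \<pi> powi k * (u / (z / ?y) / (?y / y ^ m))"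
      using ku(1) \<open>z \<noteq> 0\<close> \<open>?y \<noteq> 0\<close> y(2) by simp
    ultimately show "\<exists>m k u. \<not> p dvd m \<and> vunit u \<and> y ^ m = \<pi> powi k * u"
      using m by blast
  qed
qed

end

section \<open>Kummer theory of the uniformiser\<close>

context valued_galois
begin

text \<open>In the application this is the Galois group of \<open>K_infinity\<close>, described by
  its action on the chosen roots.\<close>

definition H :: "('a \<Rightarrow> 'a) set" where
  "H = {g \<in> G. \<forall>n. g (r n) = r n}"

lemma r_nonzero: "r n \<noteq> 0"
proof (induction n)
  case (Suc n)
  then show ?case using r(2)[of n] prime_gt_0_nat[OF p] by (auto simp: power_0_left)
qed (use r(1) \<pi>(1) in simp)

lemma r_power: "r (n + k) ^ (p ^ k) = r n"
proof (induction k)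
  case (Suc k)
  have "r (n + Suc k) ^ (p ^ Suc k) = (r (Suc (n + k)) ^ p) ^ (p ^ k)"
    by (simp add: power_mult[symmetric])
  then show ?case using Suc r(2)[of "n + k"] by simp
qed simp

lemma r_power_pi: "r n ^ (p ^ n) = \<pi>"
  using r_power[of 0 n] r(1) by simp

lemma fixes_lower_root:
  assumes "g \<in> G" "g (r m) = r m" "n \<le> m"
  shows "g (r n) = r n"
proof -
  have "r n = r m ^ (p ^ (m - n))" using r_power[of n "m - n"] assms(3) by simp
  then show ?thesis using assms by (metis hom_simps(9))
qed

text \<open>The exponent of \<pi> serves as the valuation, since a power of \<pi> with nonzero
  exponent is never a unit. Comparisons of valuations come down to this.\<close>

lemma powi_pi_unique:
  assumes "\<pi> powi a = \<pi> powi b * u" "vunit u"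
  shows "a = b"
proof -
  have pimx: "\<pi> \<in> mx" unfolding mx_def vunit_def using val[of \<pi>] \<pi>(2) by auto
  have pos: "\<not> vunit (\<pi> powi k)" if "k > 0" for k :: int
  proof -
    define n where "n = nat k - 1"
    have n: "k = int (Suc n)" using that unfolding n_def by simp
    have "\<pi> ^ n * \<pi> \<in> mx"
      using mxD(1)[OF pimx] pimx by (intro mx_mult subring_set_power[OF Ov])
    then have "\<not> vunit (\<pi> ^ Suc n)" using mxD(2) by (simp add: mult.commute)
    then show ?thesis unfolding n power_int_of_nat .
  qed
  have u: "\<pi> powi (a - b) = u"
    using assms(1) \<pi>(1) by (simp add: power_int_diff)
  have "\<not> a - b > 0" using pos u assms(2) by metis
  moreover have "\<not> b - a > 0"
  proof
    assume "b - a > 0"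
    moreover have "\<pi> powi (b - a) = inverse u"
      using u by (metis minus_diff_eq power_int_minus)
    ultimately show False using pos vunit_simps(3)[OF assms(2)] by metis
  qed
  ultimately show ?thesis by simp
qed

lemma finite_roots:
  fixes c :: 'a
  assumes "n > 0"
  shows "finite {y. y ^ n = c}" "card {y. y ^ n = c} \<le> n"
proof -
  let ?q = "Polynomial.monom 1 n - [:c:]"
  have "Polynomial.coeff ?q n = 1" using assms by (simp add: coeff_pCons split: nat.splits)
  then have q0: "?q \<noteq> 0" by (metis coeff_0 zero_neq_one)
  have deg: "degree ?q \<le> n" by (intro degree_diff_le) (auto simp: degree_monom_le)
  have eq: "{y. y ^ n = c} = {y. poly ?q y = 0}" by (auto simp: poly_monom)
  show "finite {y. y ^ n = c}" unfolding eq using q0 by (rule poly_roots_finite)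
  show "card {y. y ^ n = c} \<le> n"
    unfolding eq using card_poly_roots_bound[OF q0] deg by linarith
qed

text \<open>The product of the orbit of \<open>r n\<close> has valuation \<open>d / p ^ n\<close>, where \<open>d\<close> is the size of the
  orbit, so tameness forces the orbit to consist of all roots.\<close>

lemma root_orbit:
  assumes N: "open_sgrp N" "tame N" and T: "transversal N (N \<inter> stab {r n}) T"
  shows "card T = p ^ n" "(\<lambda>t. t (r n)) ` T = {y. y ^ (p ^ n) = \<pi>}"
proof -
  have Ns: "sgrp N" using N(1) unfolding open_sgrp_def by blast
  note NG = sgrpD(1)[OF Ns]
  let ?M = "N \<inter> stab {r n}"
  have Ms: "sgrp ?M" by (rule sgrp_Int[OF Ns sgrp_stab])
  have MN: "?M \<subseteq> N" by blast
  have rM: "r n \<in> fixed ?M" using stab_fixed[of "{r n}"] fixed_mono[of ?M "stab {r n}"] by blast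
  have TN: "t \<in> N" "t \<in> G" if "t \<in> T" for t using that transversalD(2)[OF T] NG by auto
  note fin = transversalD(1)[OF T]
  have pn: "p ^ n > 0" using prime_gt_0_nat[OF p] by simp
  have inj: "inj_on (\<lambda>t. t (r n)) T"
  proof (rule inj_onI)
    fix s t assume st: "s \<in> T" "t \<in> T" "s (r n) = t (r n)"
    have "finv s \<circ> t \<in> stab {r n}"
      using st(3) by (intro agree_on_imp_inv_comp_stab TN st) auto
    moreover have "finv s \<circ> t \<in> N" using sgrpD(3,4)[OF Ns] TN(1) st by blast
    ultimately show "s = t" by (intro transversal_unique[OF Ns T Ms st(1,2)]) blast
  qed
  have sub: "(\<lambda>t. t (r n)) ` T \<subseteq> {y. y ^ (p ^ n) = \<pi>}"
    using TN(2) \<pi>(3) r_power_pi[of n] by (auto simp flip: hom_simps(9))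
  let ?y = "\<Prod>t\<in>T. t (r n)"
  have "?y \<in> fixed N" by (rule transversal_sum_fixed(2)[OF Ns Ms MN T rM])
  moreover have "?y \<noteq> 0" using fin TN(2) r_nonzero by (simp add: hom_simps)
  ultimately obtain m k u where mku: "\<not> p dvd m" "vunit u" "?y ^ m = \<pi> powi k * u"
    using N(2) unfolding tame_def by blast
  have "?y ^ (p ^ n) = (\<Prod>t\<in>T. \<pi>)"
    using TN(2) \<pi>(3) r_power_pi[of n] unfolding prod_power_distrib
    by (intro prod.cong) (auto simp flip: hom_simps(9))
  then have y: "?y ^ (p ^ n) = \<pi> ^ card T" by simp
  \<comment> \<open>The product y of the orbit satisfies y^(p^n) = \<pi>^(card T) and y^m = \<pi>^k
    u. Comparing exponents in the power m p^n of y gives card T * m = k p^n, with m prime to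
    p.\<close>
  have "\<pi> powi (int (card T * m)) = (?y ^ (p ^ n)) ^ m"
    unfolding y by (simp only: power_int_of_nat power_mult)
  also have "\<dots> = (?y ^ m) ^ (p ^ n)" by (simp only: power_mult[symmetric] mult.commute)
  also have "\<dots> = \<pi> powi (k * int (p ^ n)) * u ^ (p ^ n)"
    unfolding mku(3) by (simp only: power_mult_distrib power_int_mult power_int_of_nat)
  finally have "int (card T * m) = k * int (p ^ n)"
    using powi_pi_unique vunit_power[OF mku(2)] by blast
  then have "int (p ^ n) dvd int (card T * m)" by simp
  then have "p ^ n dvd card T * m" by (simp only: int_dvd_int_iff)
  moreover have "coprime (p ^ n) m" using prime_imp_coprime[OF p mku(1)] by simp
  ultimately have "p ^ n dvd card T" by (simp only: coprime_dvd_mult_left_iff)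
  moreover have "card T > 0" using fin transversal_nonempty[OF Ns T] by (simp add: card_gt_0_iff)
  ultimately have ge: "p ^ n \<le> card T" by (rule dvd_imp_le)
  have "card ((\<lambda>t. t (r n)) ` T) = card T" by (rule card_image[OF inj])
  then have "card {y. y ^ (p ^ n) = \<pi>} \<le> card ((\<lambda>t. t (r n)) ` T)"
    using finite_roots(2)[OF pn, of \<pi>] ge by linarith
  then show eq: "(\<lambda>t. t (r n)) ` T = {y. y ^ (p ^ n) = \<pi>}"
    using sub finite_roots(1)[OF pn, of \<pi>] by (intro card_seteq)
  show "card T = p ^ n"
    using ge finite_roots(2)[OF pn, of \<pi>] \<open>card ((\<lambda>t. t (r n)) ` T) = card T\<close> eq by simp
qed

lemma root_transversal:
  assumes N: "open_sgrp N"
  obtains T where "transversal N (N \<inter> stab {r n}) T"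
proof -
  have "open_sgrp (N \<inter> stab {r n})" by (intro open_sgrp_Int N open_stab) simp
  then show ?thesis
    using exists_transversal[of N "N \<inter> stab {r n}"] N that unfolding open_sgrp_def by blast
qed

lemma transitive_on_roots:
  assumes N: "open_sgrp N" "tame N" and y: "y ^ (p ^ n) = \<pi>"
  obtains t where "t \<in> N" "t (r n) = y"
proof -
  obtain T where T: "transversal N (N \<inter> stab {r n}) T" using root_transversal[OF N(1)] .
  have "y \<in> (\<lambda>t. t (r n)) ` T" using root_orbit(2)[OF N T] y by blast
  then show ?thesis using transversalD(2)[OF T] that by blast
qed

text \<open>For each n some element of N carries \<open>r n\<close> to \<open>finv g (r n)\<close>.
  Followed by g it fixes \<open>r n\<close> and agrees with g on the fixed field of N; a limit over
  n lies in H and still agrees with g there.\<close>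

lemma G_eq_HN:
  assumes N: "open_sgrp N" "normal N" "tame N" and g: "g \<in> G"
  obtains h where "h \<in> H" "finv g \<circ> h \<in> N"
proof -
  have Ns: "sgrp N" using N(1) unfolding open_sgrp_def by blast
  note NG = sgrpD(1)[OF Ns]
  have "\<exists>t\<in>N. t (r n) = finv g (r n)" for n
  proof -
    have "finv g (r n) ^ (p ^ n) = \<pi>"
      using r_power_pi[of n] \<pi>(3) inv_in[OF g] by (simp flip: hom_simps(9))
    then show ?thesis using transitive_on_roots[OF N(1,3)] by metis
  qed
  then obtain \<nu> where \<nu>: "\<And>n. \<nu> n \<in> N \<and> \<nu> n (r n) = finv g (r n)" by metis
  define \<tau> where "\<tau> = (\<lambda>n. g \<circ> \<nu> n)"
  have \<tau>G: "\<tau> n \<in> G" for n unfolding \<tau>_def using \<nu> NG comp_in[OF g] by blast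
  obtain h where h: "h \<in> G" and h_lim: "\<forall>x y n. (\<forall>m\<ge>n. \<tau> m x = y) \<longrightarrow> h x = y"
    using limit[of \<tau>, OF \<tau>G] by (elim bexE)
  \<comment> \<open>Fixing \<open>r m\<close> fixes all lower roots, so the sequence is eventually
    constant at every \<open>r n\<close>.\<close>
  have \<tau>r: "\<tau> m (r n) = r n" if "m \<ge> n" for m n
  proof (rule fixes_lower_root[OF \<tau>G _ that])
    show "\<tau> m (r m) = r m" unfolding \<tau>_def using \<nu> g by simp
  qed
  have "h \<in> H" unfolding H_def using h h_lim[rule_format, OF \<tau>r] by blast
  moreover have "finv g \<circ> h \<in> N"
  proof (rule fixes_fixed_imp_mem[OF N(1)])
    show "finv g \<circ> h \<in> G" using comp_in[OF inv_in[OF g] h] .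
    fix x assume x: "x \<in> fixed N"
    have "\<tau> m x = g x" for m
      using fixedD[OF x, of "\<nu> m"] \<nu> by (simp add: \<tau>_def)
    then have "h x = g x" using h_lim by blast
    then show "(finv g \<circ> h) x = x" using g by simp
  qed
  ultimately show ?thesis by (rule that)
qed

section \<open>Characters of exponent p and their radicals\<close>

lemma inj_powers_root_of_unity:
  assumes "\<omega> ^ p = 1" "\<omega> \<noteq> (1 :: 'a)"
  shows "inj_on (\<lambda>i. \<omega> ^ i) {..<p}"
proof -
  have "\<omega> \<noteq> 0" using assms(1) prime_gt_0_nat[OF p] by (auto simp: power_0_left)
  have False if ij: "i < j" "j < p" "\<omega> ^ i = \<omega> ^ j" for i j
  proof -
    have "\<omega> ^ j = \<omega> ^ i * \<omega> ^ (j - i)" using that(1) by (simp flip: power_add)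
    then have 1: "\<omega> ^ (j - i) = 1" using that(3) \<open>\<omega> \<noteq> 0\<close> by simp
    have "\<not> p dvd j - i" using that by (auto dest: dvd_imp_le)
    then have "coprime (j - i) p"
      using prime_imp_coprime[OF p] coprime_commute by blast
    then obtain a b where ab: "(j - i) * a = p * b + 1"
      using bezout_nat[of "j - i" p] ij(1) by auto
    have "(\<omega> ^ (j - i)) ^ a = \<omega> ^ (p * b + 1)"
      unfolding ab[symmetric] by (rule power_mult[symmetric])
    also have "\<dots> = (\<omega> ^ p) ^ b * \<omega>" by (simp add: power_mult)
    finally have "(\<omega> ^ (j - i)) ^ a = (\<omega> ^ p) ^ b * \<omega>" .
    then show False using 1 assms(1,2) by simp
  qed
  then show ?thesis unfolding inj_on_def by (metis lessThan_iff linorder_neqE_nat)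
qed

lemma roots_of_unity_powers:
  assumes "\<omega> ^ p = 1" "\<omega> \<noteq> (1 :: 'a)" "x ^ p = 1"
  obtains i where "i < p" "x = \<omega> ^ i"
proof -
  have p0: "p > 0" using prime_gt_0_nat[OF p] .
  note inj = inj_powers_root_of_unity[OF assms(1,2)]
  have "(\<lambda>i. \<omega> ^ i) ` {..<p} \<subseteq> {y. y ^ p = 1}"
  proof safe
    fix i
    have "(\<omega> ^ i) ^ p = (\<omega> ^ p) ^ i" by (simp only: power_mult[symmetric] mult.commute)
    then show "(\<omega> ^ i) ^ p = 1" using assms(1) by simp
  qed
  moreover have "card ((\<lambda>i. \<omega> ^ i) ` {..<p}) = p" using card_image[OF inj] by simp
  ultimately have "(\<lambda>i. \<omega> ^ i) ` {..<p} = {y. y ^ p = 1}"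
    using finite_roots[OF p0, of 1] by (intro card_seteq) auto
  then show ?thesis using assms(3) that by blast
qed

text \<open>Hilbert's theorem 90 for the character \<open>\<psi>\<close>.\<close>

lemma character_eigenvector:
  assumes N: "open_sgrp N" "\<And>\<sigma> x. \<sigma> \<in> N \<Longrightarrow> x ^ p = 1 \<Longrightarrow> \<sigma> x = x"
    and B: "finite B" "stab B \<subseteq> N"
    and \<psi>: "\<And>\<sigma>. \<sigma> \<in> N \<Longrightarrow> \<psi> \<sigma> ^ p = (1 :: 'a)" "\<And>\<sigma> \<tau>. \<sigma> \<in> N \<Longrightarrow> \<tau> \<in> N \<Longrightarrow> \<psi> (\<sigma> \<circ> \<tau>) = \<psi> \<sigma> * \<psi> \<tau>"
      "\<And>\<sigma>. \<sigma> \<in> stab B \<Longrightarrow> \<psi> \<sigma> = 1"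
  obtains \<alpha> where "\<alpha> \<noteq> 0" "\<And>\<sigma>. \<sigma> \<in> N \<Longrightarrow> \<sigma> \<alpha> = \<psi> \<sigma> * \<alpha>"
proof -
  have Ns: "sgrp N" using N(1) unfolding open_sgrp_def by blast
  note NG = sgrpD(1)[OF Ns]
  have p0: "p > 0" using prime_gt_0_nat[OF p] .
  have \<psi>0: "\<psi> \<sigma> \<noteq> 0" if "\<sigma> \<in> N" for \<sigma> using \<psi>(1)[OF that] p0 by (auto simp: power_0_left)
  obtain T where T: "transversal N (stab B) T"
    using exists_transversal[OF Ns open_stab[OF B(1)] B(2)] .
  have TN: "t \<in> N" "t \<in> G" if "t \<in> T" for t using that transversalD(2)[OF T] NG by auto
  obtain t0 where t0: "t0 \<in> T" using transversal_nonempty[OF Ns T] by blast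
  \<comment> \<open>Independence of automorphisms makes some Lagrange resolvent nonzero.\<close>
  obtain x where x: "x \<in> fixed (stab B)" "(\<Sum>t\<in>T. inverse (\<psi> t) * t x) \<noteq> 0"
  proof (rule independent_automorphisms[OF B(1), of T t0 "\<lambda>t. inverse (\<psi> t)"])
    show "inverse (\<psi> t0) \<noteq> 0" using \<psi>0 TN(1)[OF t0] by simp
    show "finv t \<circ> t' \<notin> stab B" if "t \<in> T" "t' \<in> T" "t \<noteq> t'" for t t'
      using transversal_unique[OF Ns T sgrp_stab that(1,2)] that(3) by blast
  qed (use transversalD(1)[OF T] TN t0 in auto)
  show ?thesis
  proof (rule that[OF x(2)])
    fix \<sigma> assume \<sigma>: "\<sigma> \<in> N"
    then have \<sigma>G: "\<sigma> \<in> G" using NG by blast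
    obtain \<rho> where \<rho>: "bij_betw \<rho> T T" "\<And>t. t \<in> T \<Longrightarrow> finv (\<rho> t) \<circ> (\<sigma> \<circ> t) \<in> stab B"
      using transversal_shift[OF Ns sgrp_stab B(2) T \<sigma>] by blast
    have eq: "\<sigma> (inverse (\<psi> t) * t x) = \<psi> \<sigma> * (inverse (\<psi> (\<rho> t)) * \<rho> t x)" if t: "t \<in> T" for t
    proof -
      have \<rho>t: "\<rho> t \<in> T" using \<rho>(1) t by (auto simp: bij_betw_def)
      have "\<sigma> \<circ> t = \<rho> t \<circ> (finv (\<rho> t) \<circ> (\<sigma> \<circ> t))"
        using TN(2)[OF \<rho>t] by (simp add: comp_cancel)
      then have "\<psi> (\<sigma> \<circ> t) = \<psi> (\<rho> t) * \<psi> (finv (\<rho> t) \<circ> (\<sigma> \<circ> t))"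
        using \<psi>(2)[OF TN(1)[OF \<rho>t], of "finv (\<rho> t) \<circ> (\<sigma> \<circ> t)"] \<rho>(2)[OF t] B(2) by auto
      then have "\<psi> \<sigma> * \<psi> t = \<psi> (\<rho> t)"
        using \<psi>(2)[OF \<sigma> TN(1)[OF t]] \<psi>(3)[OF \<rho>(2)[OF t]] by simp
      then have "inverse (\<psi> t) = \<psi> \<sigma> * inverse (\<psi> (\<rho> t))"
        using \<psi>0[OF \<sigma>] \<psi>0[OF TN(1)[OF t]] by (auto simp: field_simps)
      moreover have "\<sigma> (t x) = \<rho> t x"
        using coset_eval[OF TN(2)[OF \<rho>t] comp_in[OF \<sigma>G TN(2)[OF t]] \<rho>(2)[OF t] x(1)] by simp
      moreover have "\<sigma> (inverse (\<psi> t)) = inverse (\<psi> t)"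
        using N(2)[OF \<sigma>, of "\<psi> t"] \<psi>(1)[OF TN(1)[OF t]] \<sigma>G by (simp add: hom_simps)
      ultimately show ?thesis using \<sigma>G by (simp add: hom_simps)
    qed
    have "\<sigma> (\<Sum>t\<in>T. inverse (\<psi> t) * t x) = (\<Sum>t\<in>T. \<psi> \<sigma> * (inverse (\<psi> (\<rho> t)) * \<rho> t x))"
      using eq unfolding hom_simps(12)[OF \<sigma>G] by simp
    also have "\<dots> = (\<Sum>t\<in>T. \<psi> \<sigma> * (inverse (\<psi> t) * t x))"
      by (rule sum.reindex_bij_betw[OF \<rho>(1), of "\<lambda>t. \<psi> \<sigma> * (inverse (\<psi> t) * t x)"])
    finally show "\<sigma> (\<Sum>t\<in>T. inverse (\<psi> t) * t x) = \<psi> \<sigma> * (\<Sum>t\<in>T. inverse (\<psi> t) * t x)"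
      by (simp add: sum_distrib_left)
  qed
qed

context
  fixes N B and \<psi> :: "('a \<Rightarrow> 'a) \<Rightarrow> 'a"
  assumes N: "open_sgrp N" "tame N" and \<mu>: "\<And>\<sigma> x. \<sigma> \<in> N \<Longrightarrow> x ^ p = 1 \<Longrightarrow> \<sigma> x = x"
    and B: "finite B" "stab B \<subseteq> N"
    and \<psi>: "\<And>\<sigma>. \<sigma> \<in> N \<Longrightarrow> \<psi> \<sigma> ^ p = 1" "\<And>\<sigma> \<tau>. \<sigma> \<in> N \<Longrightarrow> \<tau> \<in> N \<Longrightarrow> \<psi> (\<sigma> \<circ> \<tau>) = \<psi> \<sigma> * \<psi> \<tau>"
      "\<And>\<sigma>. \<sigma> \<in> stab B \<Longrightarrow> \<psi> \<sigma> = 1" "\<And>\<sigma>. \<sigma> \<in> N \<Longrightarrow> \<sigma> \<in> H \<Longrightarrow> \<psi> \<sigma> = 1"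
begin

lemma sgrp_N: "sgrp N"
  using N(1) unfolding open_sgrp_def by blast

text \<open>Compactness. Among counterexamples at all levels infinitely many have the same
  restriction to B, hence the same value under \<psi>. A limit of these lies in H and in N and has
  that value, which is not 1.\<close>

lemma character_trivial_at_finite_level:
  "\<exists>n. \<forall>\<sigma>\<in>N. \<sigma> (r n) = r n \<longrightarrow> \<psi> \<sigma> = 1"
proof (rule ccontr)
  assume "\<not> ?thesis"
  then obtain \<tau> where \<tau>: "\<And>n. \<tau> n \<in> N \<and> \<tau> n (r n) = r n \<and> \<psi> (\<tau> n) \<noteq> 1" by metis
  have \<tau>G: "\<tau> n \<in> G" for n using \<tau> sgrpD(5)[OF sgrp_N] by blast
  have "finite (range (\<lambda>n. restrict (\<tau> n) B))"
    using \<tau>G by (intro finite_subset[OF _ finite_restrictions[OF B(1)]]) blast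
  then obtain n0 where inf: "infinite {n. restrict (\<tau> n) B = restrict (\<tau> n0) B}"
    using pigeonhole_infinite[of UNIV "\<lambda>n. restrict (\<tau> n) B"] infinite_UNIV_nat by auto
  have "\<exists>k\<ge>n. restrict (\<tau> k) B = restrict (\<tau> n0) B" for n
    using inf unfolding infinite_nat_iff_unbounded_le by auto
  then obtain k where k: "\<And>n. k n \<ge> n \<and> restrict (\<tau> (k n)) B = restrict (\<tau> n0) B" by metis
  obtain h where h: "h \<in> G" and h_lim: "\<forall>x y n. (\<forall>m\<ge>n. \<tau> (k m) x = y) \<longrightarrow> h x = y"
    using limit[of "\<lambda>n. \<tau> (k n)", OF \<tau>G] by (elim bexE)
  have \<tau>r: "\<tau> (k m) (r n) = r n" if "m \<ge> n" for m n
    using \<tau>[of "k m"] k[of m] that by (intro fixes_lower_root[OF \<tau>G[of "k m"], of "k m" n]) auto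
  then have "h \<in> H" unfolding H_def using h h_lim[rule_format, OF \<tau>r] by blast
  have "h x = \<tau> n0 x" if "x \<in> B" for x
  proof -
    have "\<tau> (k m) x = \<tau> n0 x" for m
      using fun_cong[OF conjunct2[OF k[of m]], of x] that by simp
    then show ?thesis using h_lim by blast
  qed
  then have *: "finv (\<tau> n0) \<circ> h \<in> stab B"
    by (intro agree_on_imp_inv_comp_stab \<tau>G h) simp
  then have **: "finv (\<tau> n0) \<circ> h \<in> N" using B(2) by blast
  have eq: "h = \<tau> n0 \<circ> (finv (\<tau> n0) \<circ> h)" using \<tau>G by (simp add: comp_cancel)
  have "h \<in> N" using sgrpD(3)[OF sgrp_N _ **, of "\<tau> n0"] \<tau> eq by metis
  moreover have "\<psi> h = \<psi> (\<tau> n0)"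
    using \<psi>(2)[OF _ **, of "\<tau> n0"] \<psi>(3)[OF *] \<tau> eq by (metis mult_1_right)
  ultimately show False using \<psi>(4) \<open>h \<in> H\<close> \<tau> by metis
qed

text \<open>A radical \<open>\<alpha>\<close> with character \<open>\<psi>\<close> has valuation in \<open>\<int>/p\<close> up to denominators prime to \<open>p\<close>. If
  \<open>\<psi>\<close> first becomes trivial at level \<open>j + 1\<close>, Kummer theory makes \<open>\<alpha>\<close> a power of \<open>r (j + 1)\<close> times
  an element of level \<open>j\<close>, and comparing valuations excludes \<open>j \<ge> 1\<close>.\<close>

lemma character_descent:
  assumes j: "j \<ge> 1" and triv: "\<And>\<sigma>. \<sigma> \<in> N \<Longrightarrow> \<sigma> (r (Suc j)) = r (Suc j) \<Longrightarrow> \<psi> \<sigma> = 1"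
    and \<tau>: "\<tau> \<in> N" "\<tau> (r j) = r j"
  shows "\<psi> \<tau> = 1"
proof (rule ccontr)
  assume nt: "\<psi> \<tau> \<noteq> 1"
  note Ns = sgrp_N
  note NG = sgrpD(1)[OF Ns]
  have p0: "p > 0" using prime_gt_0_nat[OF p] .
  let ?R = "r (Suc j)"
  have quot: "(\<sigma> ?R / ?R) ^ p = 1" if "\<sigma> \<in> N" "\<sigma> (r j) = r j" for \<sigma>
    using that r(2)[of j] r_nonzero[of j] NG by (simp add: power_divide subset_iff flip: hom_simps(9))
  define \<omega> where "\<omega> = \<tau> ?R / ?R"
  have \<omega>: "\<omega> ^ p = 1" unfolding \<omega>_def using quot[OF \<tau>] .
  have \<omega>1: "\<omega> \<noteq> 1"
  proof
    assume "\<omega> = 1"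
    then have "\<tau> ?R = ?R" unfolding \<omega>_def using r_nonzero by simp
    then show False using triv[OF \<tau>(1)] nt by blast
  qed
  obtain i where i: "\<psi> \<tau> = \<omega> ^ i" using roots_of_unity_powers[OF \<omega> \<omega>1 \<psi>(1)[OF \<tau>(1)]] .
  have pi: "\<not> p dvd i"
  proof
    assume "p dvd i"
    then have "\<omega> ^ i = 1" using \<omega> by (auto simp: power_mult)
    then show False using i nt by simp
  qed
  obtain \<alpha> where \<alpha>: "\<alpha> \<noteq> 0" "\<And>\<sigma>. \<sigma> \<in> N \<Longrightarrow> \<sigma> \<alpha> = \<psi> \<sigma> * \<alpha>"
  proof (rule character_eigenvector[of N B \<psi>])
    show "open_sgrp N" "finite B" "stab B \<subseteq> N" by (fact N B)+
    show "\<sigma> x = x" if "\<sigma> \<in> N" "x ^ p = 1" for \<sigma> x by (rule \<mu>[OF that])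
    show "\<psi> \<sigma> ^ p = 1" if "\<sigma> \<in> N" for \<sigma> by (rule \<psi>(1)[OF that])
    show "\<psi> (\<sigma> \<circ> \<tau>) = \<psi> \<sigma> * \<psi> \<tau>" if "\<sigma> \<in> N" "\<tau> \<in> N" for \<sigma> \<tau> by (rule \<psi>(2)[OF that])
    show "\<psi> \<sigma> = 1" if "\<sigma> \<in> stab B" for \<sigma> by (rule \<psi>(3)[OF that])
  qed (rule that)
  \<comment> \<open>Dividing by the matching power of the root of level j + 1 cancels the character
    on the stabiliser of \<open>r j\<close>, so b lives at level j.\<close>
  define b where "b = \<alpha> / ?R ^ i"
  have b0: "b \<noteq> 0" unfolding b_def using \<alpha>(1) r_nonzero by simp
  have pow: "\<tau> ^^ s \<in> N" "(\<tau> ^^ s) ?R = \<omega> ^ s * ?R" "\<psi> (\<tau> ^^ s) = \<psi> \<tau> ^ s" for s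
  proof (induction s)
    case 0
    show "\<tau> ^^ 0 \<in> N" using sgrpD(2)[OF Ns] by simp
    show "(\<tau> ^^ 0) ?R = \<omega> ^ 0 * ?R" by simp
    show "\<psi> (\<tau> ^^ 0) = \<psi> \<tau> ^ 0"
      using triv[OF sgrpD(2)[OF Ns]] by (simp add: id_def)
  next
    case (Suc s)
    show "\<tau> ^^ Suc s \<in> N" using sgrpD(3)[OF Ns \<tau>(1) Suc(1)] by simp
    have "\<tau> (\<omega> ^ s) = \<omega> ^ s" using \<omega> \<mu>[OF \<tau>(1), of "\<omega> ^ s"] by (metis mult.commute power_mult power_one)
    moreover have "\<tau> ?R = \<omega> * ?R" unfolding \<omega>_def using r_nonzero by simp
    ultimately show "(\<tau> ^^ Suc s) ?R = \<omega> ^ Suc s * ?R"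
      using Suc(2) NG \<tau>(1) by (simp add: hom_simps subset_iff)
    show "\<psi> (\<tau> ^^ Suc s) = \<psi> \<tau> ^ Suc s" using \<psi>(2)[OF \<tau>(1) Suc(1)] Suc(3) by simp
  qed
  let ?M = "N \<inter> stab {r j}"
  have bM: "b \<in> fixed ?M"
    unfolding fixed_def
  proof safe
    fix \<sigma> assume \<sigma>: "\<sigma> \<in> N" "\<sigma> \<in> stab {r j}"
    then have \<sigma>G: "\<sigma> \<in> G" "\<sigma> (r j) = r j" unfolding stab_def by auto
    obtain s where s: "\<sigma> ?R / ?R = \<omega> ^ s"
      using roots_of_unity_powers[OF \<omega> \<omega>1 quot[OF \<sigma>(1) \<sigma>G(2)]] .
    then have \<sigma>R: "\<sigma> ?R = \<omega> ^ s * ?R" using r_nonzero by (metis nonzero_eq_divide_eq)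
    have tG: "\<tau> ^^ s \<in> G" using pow(1) NG by blast
    have n: "finv (\<tau> ^^ s) \<circ> \<sigma> \<in> N" using sgrpD(3,4)[OF Ns] pow(1) \<sigma>(1) by blast
    have "(finv (\<tau> ^^ s) \<circ> \<sigma>) ?R = ?R"
      unfolding comp_apply \<sigma>R pow(2)[symmetric] using tG by simp
    then have "\<psi> (finv (\<tau> ^^ s) \<circ> \<sigma>) = 1" by (rule triv[OF n])
    moreover have "\<sigma> = \<tau> ^^ s \<circ> (finv (\<tau> ^^ s) \<circ> \<sigma>)" using tG by (simp add: comp_cancel)
    ultimately have "\<psi> \<sigma> = \<psi> \<tau> ^ s"
      using \<psi>(2)[OF pow(1)[of s] n] pow(3)[of s] by (metis mult_1_right)
    then have \<psi>\<sigma>: "\<psi> \<sigma> = (\<omega> ^ s) ^ i" using i by (metis mult.commute power_mult)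
    have "\<sigma> b = (\<psi> \<sigma> * \<alpha>) / (\<omega> ^ s * ?R) ^ i"
      unfolding b_def using \<alpha>(2)[OF \<sigma>(1)] \<sigma>R \<sigma>G(1) by (simp add: hom_simps)
    also have "\<dots> = b"
      unfolding b_def \<psi>\<sigma> power_mult_distrib using \<omega> p0 by (auto simp: power_0_left)
    finally show "\<sigma> b = b" .
  qed
  obtain T where T: "transversal N ?M T" using root_transversal[OF N(1)] .
  have TN: "t \<in> N" "t \<in> G" if "t \<in> T" for t using that transversalD(2)[OF T] NG by auto
  have cT: "card T = p ^ j" by (rule root_orbit(1)[OF N T])
  \<comment> \<open>The norm of b to the fixed field of N, which multiplies the valuation by the
    degree p^j.\<close>
  let ?c = "\<Prod>t\<in>T. t b"
  have "?c \<in> fixed N"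
    by (rule transversal_sum_fixed(2)[OF Ns _ _ T bM]) (auto intro: sgrp_Int[OF Ns sgrp_stab])
  moreover have "?c \<noteq> 0" using transversalD(1)[OF T] TN(2) b0 by (simp add: hom_simps)
  ultimately obtain m k u where mku: "\<not> p dvd m" "vunit u" "?c ^ m = \<pi> powi k * u"
    using N(2) unfolding tame_def by blast
  define v where "v = ?c / b ^ (p ^ j)"
  have v: "vunit v"
  proof -
    have "v = (\<Prod>t\<in>T. t b / b)" unfolding v_def cT[symmetric] by (simp add: prod_dividef)
    then show ?thesis using conjugate_vunit[OF TN(2) b0] by (simp add: vunit_prod)
  qed
  have cv: "?c = b ^ (p ^ j) * v" unfolding v_def using b0 by simp
  have "\<alpha> ^ p \<in> fixed N"
    unfolding fixed_def
  proof safe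
    fix \<sigma> assume \<sigma>: "\<sigma> \<in> N"
    then have "\<sigma> (\<alpha> ^ p) = (\<psi> \<sigma> * \<alpha>) ^ p" using \<alpha>(2) NG by (simp add: hom_simps subset_iff)
    then show "\<sigma> (\<alpha> ^ p) = \<alpha> ^ p" using \<psi>(1)[OF \<sigma>] by (simp add: power_mult_distrib)
  qed
  moreover have "\<alpha> ^ p \<noteq> 0" using \<alpha>(1) by simp
  ultimately obtain m' k' u' where mku': "\<not> p dvd m'" "vunit u'" "(\<alpha> ^ p) ^ m' = \<pi> powi k' * u'"
    using N(2) unfolding tame_def by blast
  have \<alpha>b: "\<alpha> = b * ?R ^ i" unfolding b_def using r_nonzero by simp
  \<comment> \<open>An exponent that clears all denominators: the corresponding powers of \<alpha>,
    of b and of the root are powers of \<pi> up to units.\<close>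
  let ?e = "p ^ Suc j * m * m'"
  have R: "(?R ^ i) ^ ?e = \<pi> powi (int (i * m * m'))"
  proof -
    have "(?R ^ i) ^ ?e = (?R ^ (p ^ Suc j)) ^ (i * m * m')"
      by (simp only: power_mult[symmetric] mult_ac)
    then show ?thesis by (simp only: r_power_pi power_int_of_nat)
  qed
  have E1: "\<alpha> ^ ?e = \<pi> powi (k' * int (p ^ j * m)) * u' ^ (p ^ j * m)"
  proof -
    have "\<alpha> ^ ?e = ((\<alpha> ^ p) ^ m') ^ (p ^ j * m)"
      by (simp only: power_mult[symmetric] power_Suc mult_ac)
    then show ?thesis
      unfolding mku'(3) by (simp only: power_mult_distrib power_int_mult power_int_of_nat)
  qed
  have E2: "b ^ ?e * v ^ (p * m * m') = \<pi> powi (k * int (p * m')) * u ^ (p * m')"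
  proof -
    have "b ^ ?e * v ^ (p * m * m') = ((b ^ (p ^ j) * v) ^ m) ^ (p * m')"
      by (simp only: power_mult_distrib power_mult[symmetric] power_Suc mult_ac)
    then show ?thesis
      unfolding cv[symmetric] mku(3) by (simp only: power_mult_distrib power_int_mult power_int_of_nat)
  qed
  have E3: "\<alpha> ^ ?e = b ^ ?e * \<pi> powi (int (i * m * m'))"
    unfolding R[symmetric] power_mult_distrib[symmetric] \<alpha>b[symmetric] ..
  have "\<pi> powi (k' * int (p ^ j * m)) * u' ^ (p ^ j * m) * v ^ (p * m * m')
      = (b ^ ?e * v ^ (p * m * m')) * \<pi> powi (int (i * m * m'))"
    unfolding E1[symmetric] E3 by (simp only: mult_ac)
  also have "\<dots> = \<pi> powi (k * int (p * m') + int (i * m * m')) * u ^ (p * m')"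
    unfolding E2 using \<pi>(1) by (simp add: power_int_add mult_ac)
  finally have eq: "\<pi> powi (k' * int (p ^ j * m)) * (u' ^ (p ^ j * m) * v ^ (p * m * m'))
      = \<pi> powi (k * int (p * m') + int (i * m * m')) * u ^ (p * m')"
    by (simp only: mult.assoc)
  let ?w = "u' ^ (p ^ j * m) * v ^ (p * m * m')"
  have w: "vunit ?w" by (intro vunit_simps(2) vunit_power mku'(2) v)
  have "\<pi> powi (k' * int (p ^ j * m))
      = \<pi> powi (k * int (p * m') + int (i * m * m')) * (u ^ (p * m') / ?w)"
    using eq vunit_simps(5)[OF w] by (simp add: field_simps)
  then have "k' * int (p ^ j * m) = k * int (p * m') + int (i * m * m')"
    by (rule powi_pi_unique) (intro vunit_simps(4) vunit_power mku(2) w)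
  \<comment> \<open>As j is at least 1, the valuations of \<alpha> and b contribute multiples of p,
    and so must that of the root; but i, m and m' are prime to p.\<close>
  then have "int (i * m * m') = int p * (k' * int (p ^ (j - 1) * m) - k * int m')"
    using j by (cases j) (simp_all add: algebra_simps)
  then have "int p dvd int (i * m * m')" by (metis dvd_triv_left)
  then have "p dvd i * m * m'" by (simp only: int_dvd_int_iff)
  then show False using p pi mku(1) mku'(1) by (simp add: prime_dvd_mult_iff)
qed

lemma character_trivial:
  assumes "\<sigma> \<in> N" "\<sigma> (r 1) = r 1"
  shows "\<psi> \<sigma> = 1"
proof -
  obtain n where n: "\<forall>\<sigma>\<in>N. \<sigma> (r n) = r n \<longrightarrow> \<psi> \<sigma> = 1"
    using character_trivial_at_finite_level by blast
  \<comment> \<open>Descent reaches down to level 1 only, so the induction is started from a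
    positive level.\<close>
  then have "\<forall>\<sigma>\<in>N. \<sigma> (r (Suc n)) = r (Suc n) \<longrightarrow> \<psi> \<sigma> = 1"
    using fixes_lower_root[of _ "Suc n" n] sgrpD(5)[OF sgrp_N] by auto
  then have "\<forall>\<sigma>\<in>N. \<sigma> (r (Suc 0)) = r (Suc 0) \<longrightarrow> \<psi> \<sigma> = 1"
  proof (induction n)
    case (Suc n)
    then have "\<forall>\<sigma>\<in>N. \<sigma> (r (Suc n)) = r (Suc n) \<longrightarrow> \<psi> \<sigma> = 1"
      using character_descent[of "Suc n"] by auto
    then show ?case by (rule Suc.IH)
  qed
  then show ?thesis using assms by simp
qed

end

end

section \<open>Representations\<close>

locale group_rep = automorphism_group G + finite_dimensional_vector_space scale Basis
  for G :: "('a::field \<Rightarrow> 'a) set" and scale :: "'f::field \<Rightarrow> 'v::ab_group_add \<Rightarrow> 'v" and Basis +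
  fixes ac :: "('a \<Rightarrow> 'a) \<Rightarrow> 'v \<Rightarrow> 'v"
  assumes ac_add: "g \<in> G \<Longrightarrow> ac g (x + y) = ac g x + ac g y"
    and ac_scale: "g \<in> G \<Longrightarrow> ac g (scale c x) = scale c (ac g x)"
    and ac_id: "ac id x = x"
    and ac_comp: "g \<in> G \<Longrightarrow> h \<in> G \<Longrightarrow> ac (g \<circ> h) x = ac g (ac h x)"
begin

lemma ac_zero: "g \<in> G \<Longrightarrow> ac g 0 = 0"
  using ac_scale[of g 0 0] by simp

lemma ac_diff: "g \<in> G \<Longrightarrow> ac g (x - y) = ac g x - ac g y"
  using ac_add[of g "x - y" y] by simp

lemma ac_sum: "g \<in> G \<Longrightarrow> ac g (sum f I) = (\<Sum>i\<in>I. ac g (f i))"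
  by (induction I rule: infinite_finite_induct) (auto simp: ac_zero ac_add)

lemma ac_inv: "g \<in> G \<Longrightarrow> ac (finv g) (ac g x) = x" "g \<in> G \<Longrightarrow> ac g (ac (finv g) x) = x"
  using ac_comp[of "finv g" g x] ac_comp[of g "finv g" x] inv_in[of g] by (simp_all add: ac_id)

definition invariant :: "'v set \<Rightarrow> bool" where
  "invariant A \<longleftrightarrow> subspace A \<and> (\<forall>g\<in>G. \<forall>x\<in>A. ac g x \<in> A)"

lemma invariantD:
  assumes "invariant A"
  shows "subspace A" "0 \<in> A" "\<And>x y. x \<in> A \<Longrightarrow> y \<in> A \<Longrightarrow> x + y \<in> A"
    "\<And>x y. x \<in> A \<Longrightarrow> y \<in> A \<Longrightarrow> x - y \<in> A" "\<And>c x. x \<in> A \<Longrightarrow> scale c x \<in> A"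
    "\<And>g x. g \<in> G \<Longrightarrow> x \<in> A \<Longrightarrow> ac g x \<in> A" "\<And>x. x \<in> A \<Longrightarrow> - x \<in> A"
proof -
  show sub: "subspace A" using assms unfolding invariant_def by blast
  show "0 \<in> A" "\<And>x y. x \<in> A \<Longrightarrow> y \<in> A \<Longrightarrow> x + y \<in> A"
    "\<And>x y. x \<in> A \<Longrightarrow> y \<in> A \<Longrightarrow> x - y \<in> A" "\<And>c x. x \<in> A \<Longrightarrow> scale c x \<in> A"
    "\<And>x. x \<in> A \<Longrightarrow> - x \<in> A"
    using subspace_0[OF sub] subspace_add[OF sub] subspace_diff[OF sub] subspace_scale[OF sub]
      subspace_neg[OF sub] by simp_all
  show "\<And>g x. g \<in> G \<Longrightarrow> x \<in> A \<Longrightarrow> ac g x \<in> A" using assms unfolding invariant_def by blast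
qed

lemma invariantI:
  assumes "0 \<in> A" "\<And>x y. x \<in> A \<Longrightarrow> y \<in> A \<Longrightarrow> x + y \<in> A" "\<And>c x. x \<in> A \<Longrightarrow> scale c x \<in> A"
    "\<And>g x. g \<in> G \<Longrightarrow> x \<in> A \<Longrightarrow> ac g x \<in> A"
  shows "invariant A"
  using assms unfolding invariant_def subspace_def by blast

lemma invariant_zero: "invariant {0}"
  by (rule invariantI) (auto simp: ac_zero)

lemma invariant_UNIV: "invariant UNIV"
  by (rule invariantI) auto

lemma invariant_Int: "invariant A \<Longrightarrow> invariant B \<Longrightarrow> invariant (A \<inter> B)"
  by (rule invariantI) (auto dest: invariantD)

lemma invariant_plus:
  assumes "invariant A" "invariant B"
  shows "invariant (A + B)"
proof (rule invariantI)
  show "0 \<in> A + B"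
    using set_plus_intro[OF invariantD(2)[OF assms(1)] invariantD(2)[OF assms(2)]] by simp
  fix x y assume "x \<in> A + B" "y \<in> A + B"
  then obtain a b a' b' where *: "a \<in> A" "b \<in> B" "a' \<in> A" "b' \<in> B" "x = a + b" "y = a' + b'"
    by (auto elim!: set_plus_elim)
  have "(a + a') + (b + b') \<in> A + B"
    using * invariantD(3)[OF assms(1)] invariantD(3)[OF assms(2)] by (intro set_plus_intro) auto
  then show "x + y \<in> A + B" using * by (simp add: algebra_simps)
next
  fix c x assume "x \<in> A + B"
  then obtain a b where "a \<in> A" "b \<in> B" "x = a + b" by (auto elim!: set_plus_elim)
  then show "scale c x \<in> A + B"
    using invariantD(5)[OF assms(1)] invariantD(5)[OF assms(2)] by (auto simp: scale_right_distrib)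
next
  fix g x assume "g \<in> G" "x \<in> A + B"
  then obtain a b where "a \<in> A" "b \<in> B" "x = a + b" by (auto elim!: set_plus_elim)
  then show "ac g x \<in> A + B"
    using invariantD(6)[OF assms(1) \<open>g \<in> G\<close>] invariantD(6)[OF assms(2) \<open>g \<in> G\<close>] \<open>g \<in> G\<close>
    by (auto simp: ac_add)
qed

lemma subset_plus: "invariant B \<Longrightarrow> A \<subseteq> A + B" "invariant A \<Longrightarrow> B \<subseteq> A + B"
  using set_plus_intro[of _ A 0 B] set_plus_intro[of 0 A _ B] by (auto dest: invariantD(2))

lemma plus_subset: "invariant C \<Longrightarrow> A \<subseteq> C \<Longrightarrow> B \<subseteq> C \<Longrightarrow> A + B \<subseteq> C"
  by (auto elim!: set_plus_elim dest: invariantD(3))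

text \<open>Irreducibility of A / B, expressed by the invariant subspaces between B and A so that no
  type of cosets occurs.\<close>

definition irr :: "'v set \<Rightarrow> 'v set \<Rightarrow> bool" where
  "irr A B \<longleftrightarrow> invariant A \<and> invariant B \<and> B \<subseteq> A \<and> B \<noteq> A \<and>
     (\<forall>C. invariant C \<longrightarrow> B \<subseteq> C \<longrightarrow> C \<subseteq> A \<longrightarrow> C = B \<or> C = A)"

lemma irrD:
  assumes "irr A B"
  shows "invariant A" "invariant B" "B \<subseteq> A" "B \<noteq> A"
    "\<And>C. invariant C \<Longrightarrow> B \<subseteq> C \<Longrightarrow> C \<subseteq> A \<Longrightarrow> C = B \<or> C = A"
  using assms unfolding irr_def by blast+

lemma dim_less: "invariant A \<Longrightarrow> invariant B \<Longrightarrow> A \<subset> B \<Longrightarrow> dim A < dim B"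
  by (rule dim_psubset) (simp add: span_eq_iff[THEN iffD2] invariantD(1))

lemma dim_bound: "dim A \<le> dim UNIV"
  by (rule dim_subset) simp

lemma coset_eq_iff:
  assumes "invariant B"
  shows "x +o B = y +o B \<longleftrightarrow> x - y \<in> B"
proof
  assume "x +o B = y +o B"
  then have "x \<in> y +o B"
    using set_plus_intro2[OF invariantD(2)[OF assms], of x] by simp
  then show "x - y \<in> B" by (auto simp: elt_set_plus_def)
next
  assume *: "x - y \<in> B"
  show "x +o B = y +o B"
  proof (intro equalityI subsetI)
    fix z assume "z \<in> x +o B"
    then obtain b where "b \<in> B" "z = x + b" by (auto simp: elt_set_plus_def)
    then show "z \<in> y +o B"
      using invariantD(3)[OF assms * \<open>b \<in> B\<close>]
      by (auto simp: elt_set_plus_def intro!: bexI[of _ "x - y + b"])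
  next
    fix z assume "z \<in> y +o B"
    then obtain b where "b \<in> B" "z = y + b" by (auto simp: elt_set_plus_def)
    then show "z \<in> x +o B"
      using invariantD(4)[OF assms \<open>b \<in> B\<close> *]
      by (auto simp: elt_set_plus_def intro!: bexI[of _ "b - (x - y)"])
  qed
qed

lemma coset_eq_self_iff: "invariant B \<Longrightarrow> x +o B = B \<longleftrightarrow> x \<in> B"
  using coset_eq_iff[of B x 0] by simp

lemma ac_image_invariant: "invariant B \<Longrightarrow> g \<in> G \<Longrightarrow> ac g ` B = B"
  using invariantD(6)[of B] ac_inv(2)[of g] inv_in[of g] by (force intro: rev_image_eqI)

lemma ac_coset:
  assumes "invariant B" "g \<in> G"
  shows "ac g ` (x +o B) = ac g x +o B"
proof -
  have im: "y +o C = (\<lambda>b. y + b) ` C" for y :: 'v and C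
    by (auto simp: elt_set_plus_def)
  have "ac g ` (x +o B) = ac g x +o (ac g ` B)"
    unfolding im image_image using ac_add[OF assms(2)] by simp
  then show ?thesis using ac_image_invariant[OF assms] by simp
qed

text \<open>A \<open>p\<close>-group acting on an irreducible section has a nonzero fixed vector: the vectors of the
  \<open>\<F>\<^sub>p\<close>-span of an orbit are counted modulo \<open>p\<close> in two ways.\<close>

lemma normal_p_subgroup_trivial:
  assumes irr: "irr A B" and p: "prime (p :: nat)" "of_nat p = (0 :: 'f)"
    and fin: "\<And>x. finite {ac g x | g. g \<in> G}"
    and P: "P \<subseteq> G" "id \<in> P" "\<And>g h. g \<in> P \<Longrightarrow> h \<in> P \<Longrightarrow> g \<circ> h \<in> P"
      "\<And>g \<sigma>. g \<in> G \<Longrightarrow> \<sigma> \<in> P \<Longrightarrow> finv g \<circ> \<sigma> \<circ> g \<in> P"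
    and ord: "\<And>\<sigma>. \<sigma> \<in> P \<Longrightarrow> \<exists>a. \<forall>x\<in>A. ac (\<sigma> ^^ (p ^ a)) x - x \<in> B"
    and \<sigma>: "\<sigma> \<in> P" "a \<in> A"
  shows "ac \<sigma> a - a \<in> B"
proof -
  note A = irrD(1)[OF irr] and B = irrD(2)[OF irr]
  \<comment> \<open>The preimage of the P-fixed vectors of A / B. It is invariant because
    conjugation by G preserves P, so either no nonzero vector of A / B is fixed or all are.\<close>
  define F where "F = {x \<in> A. \<forall>\<sigma>\<in>P. ac \<sigma> x - x \<in> B}"
  have PG: "\<sigma> \<in> G" if "\<sigma> \<in> P" for \<sigma> using P(1) that by blast
  have "invariant F"
  proof (rule invariantI)
    show "0 \<in> F" unfolding F_def using invariantD(2)[OF A] invariantD(2)[OF B] PG by (simp add: ac_zero)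
    show "x + y \<in> F" if "x \<in> F" "y \<in> F" for x y
    proof -
      have "ac \<sigma> (x + y) - (x + y) \<in> B" if \<sigma>: "\<sigma> \<in> P" for \<sigma>
      proof -
        have "(ac \<sigma> x - x) + (ac \<sigma> y - y) \<in> B"
          using \<open>x \<in> F\<close> \<open>y \<in> F\<close> \<sigma> unfolding F_def by (intro invariantD(3)[OF B]) blast+
        then show ?thesis using ac_add[OF PG[OF \<sigma>]] by (simp add: algebra_simps)
      qed
      then show ?thesis using that invariantD(3)[OF A] unfolding F_def by blast
    qed
    show "scale c x \<in> F" if "x \<in> F" for c x
    proof -
      have "ac \<sigma> (scale c x) - scale c x \<in> B" if \<sigma>: "\<sigma> \<in> P" for \<sigma>
      proof -
        have "scale c (ac \<sigma> x - x) \<in> B"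
          using \<open>x \<in> F\<close> \<sigma> unfolding F_def by (intro invariantD(5)[OF B]) blast
        then show ?thesis using ac_scale[OF PG[OF \<sigma>]] by (simp add: scale_right_diff_distrib)
      qed
      then show ?thesis using that invariantD(5)[OF A] unfolding F_def by blast
    qed
    show "ac g x \<in> F" if g: "g \<in> G" and x: "x \<in> F" for g x
    proof -
      have "ac \<sigma> (ac g x) - ac g x \<in> B" if \<sigma>: "\<sigma> \<in> P" for \<sigma>
      proof -
        have "ac g (ac (finv g \<circ> \<sigma> \<circ> g) x - x) \<in> B"
          using x P(4)[OF g \<sigma>] g unfolding F_def by (intro invariantD(6)[OF B]) blast+
        moreover have "ac (finv g \<circ> \<sigma> \<circ> g) x = ac (finv g) (ac \<sigma> (ac g x))"
          using g PG[OF \<sigma>] by (simp add: ac_comp comp_in inv_in)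
        ultimately show ?thesis using g by (simp add: ac_diff ac_inv)
      qed
      then show ?thesis using x g invariantD(6)[OF A] unfolding F_def by blast
    qed
  qed
  moreover have "B \<subseteq> F"
    unfolding F_def using irrD(3)[OF irr] invariantD(4,6)[OF B] PG by blast
  moreover have "F \<subseteq> A" unfolding F_def by blast
  ultimately consider "F = B" | "F = A" using irrD(5)[OF irr] by blast
  then show ?thesis
  proof cases
    case 1
    obtain v where v: "v \<in> A" "v \<notin> B" using irrD(3,4)[OF irr] by blast
    define Y where "Y = {ac g v | g. g \<in> G}"
    have Y: "finite Y" unfolding Y_def by (rule fin)
    have YA: "y \<in> A" if "y \<in> Y" for y using that invariantD(6)[OF A _ v(1)] unfolding Y_def by auto
    have vY: "v \<in> Y" unfolding Y_def using id_in ac_id[of v] by force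
    \<comment> \<open>Combinations of an orbit with natural coefficients: modulo B they form its
      span over the prime field, which is finite and stable under G, whereas A / B itself may be
      infinite.\<close>
    define L where "L = (\<lambda>n :: 'v \<Rightarrow> nat. \<Sum>y\<in>Y. scale (of_nat (n y)) y)"
    define \<Omega> where "\<Omega> = range (\<lambda>n. L n +o B)"
    have LA: "L n \<in> A" for n
      unfolding L_def by (intro subspace_sum[OF invariantD(1)[OF A]] invariantD(5)[OF A] YA)
    have mod: "of_nat (n mod p) = (of_nat n :: 'f)" for n
    proof -
      have "(of_nat n :: 'f) = of_nat (p * (n div p) + n mod p)" by simp
      also have "\<dots> = of_nat (n mod p)" using p(2) by (simp only: of_nat_add of_nat_mult) simp
      finally show ?thesis ..
    qed
    have finO: "finite \<Omega>"
    proof (rule finite_subset)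
      show "\<Omega> \<subseteq> (\<lambda>n. L n +o B) ` (\<Pi>\<^sub>E y\<in>Y. {..<p})"
      proof
        fix X assume "X \<in> \<Omega>"
        then obtain n where n: "X = L n +o B" unfolding \<Omega>_def by blast
        have l: "L n = L (restrict (\<lambda>y. n y mod p) Y)"
          unfolding L_def by (intro sum.cong) (simp_all add: mod)
        have r: "restrict (\<lambda>y. n y mod p) Y \<in> (\<Pi>\<^sub>E y\<in>Y. {..<p})"
          using prime_gt_0_nat[OF p(1)] by auto
        show "X \<in> (\<lambda>n. L n +o B) ` (\<Pi>\<^sub>E y\<in>Y. {..<p})"
          unfolding n using arg_cong[OF l, of "\<lambda>x. x +o B"] r by (rule image_eqI[where f = "\<lambda>n. L n +o B"])
      qed
      show "finite ((\<lambda>n. L n +o B) ` (\<Pi>\<^sub>E y\<in>Y. {..<p}))"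
        using Y by (intro finite_imageI finite_PiE) auto
    qed
    have shift: "scale (of_nat k) v +o (L n +o B) = L (n(v := n v + k)) +o B" for k n
    proof -
      have "L (n(v := n v + k)) = scale (of_nat (n v + k)) v + (\<Sum>y\<in>Y - {v}. scale (of_nat (n y)) y)"
        unfolding L_def using Y vY by (simp add: sum.remove[of Y v])
      moreover have "L n = scale (of_nat (n v)) v + (\<Sum>y\<in>Y - {v}. scale (of_nat (n y)) y)"
        unfolding L_def using Y vY by (rule sum.remove)
      ultimately have "L (n(v := n v + k)) = scale (of_nat k) v + L n"
        by (simp add: scale_left_distrib algebra_simps)
      then show ?thesis by (simp add: set_plus_rearrange2)
    qed
    \<comment> \<open>Translations by multiples of v have p-power order and no fixed point on
      \<Omega>, because v is not in B.\<close>
    have "p dvd card \<Omega>"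
    proof (rule fixed_point_free_p_group[OF p(1) finO, of "range (\<lambda>k X. scale (of_nat k) v +o X)"])
      show "id \<in> range (\<lambda>k X. scale (of_nat k) v +o X)"
        by (intro range_eqI[of _ _ 0]) (simp add: fun_eq_iff)
      show "g \<circ> h \<in> range (\<lambda>k X. scale (of_nat k) v +o X)"
        if gh: "g \<in> range (\<lambda>k X. scale (of_nat k) v +o X)" "h \<in> range (\<lambda>k X. scale (of_nat k) v +o X)" for g h
      proof -
        obtain k l where "g = (\<lambda>X. scale (of_nat k) v +o X)" "h = (\<lambda>X. scale (of_nat l) v +o X)"
          using gh by blast
        then have "g \<circ> h = (\<lambda>X. scale (of_nat (k + l)) v +o X)"
          by (simp add: fun_eq_iff set_plus_rearrange2 scale_left_distrib)
        then show ?thesis by blast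
      qed
      show "g X \<in> \<Omega>" if "g \<in> range (\<lambda>k X. scale (of_nat k) v +o X)" "X \<in> \<Omega>" for g X
        using that shift unfolding \<Omega>_def by auto
      show "\<exists>a. \<forall>X\<in>\<Omega>. (g ^^ (p ^ a)) X = X" if g: "g \<in> range (\<lambda>k X. scale (of_nat k) v +o X)" for g
      proof -
        obtain k where k: "g = (\<lambda>X. scale (of_nat k) v +o X)" using g by blast
        have "(g ^^ m) X = scale (of_nat (m * k)) v +o X" for m X
        proof (induction m)
          case (Suc m)
          then show ?case by (simp add: k set_plus_rearrange2 scale_left_distrib)
        qed simp
        from this[of "p ^ 1"] have "(g ^^ (p ^ 1)) X = X" for X
          using p(2) by simp
        then show ?thesis by blast
      qed
      show "\<exists>g\<in>range (\<lambda>k X. scale (of_nat k) v +o X). g X \<noteq> X" if X: "X \<in> \<Omega>" for X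
      proof -
        obtain n where n: "X = L n +o B" using X unfolding \<Omega>_def by blast
        have "scale (of_nat 1) v +o X \<noteq> X"
          unfolding n using v(2) coset_eq_iff[OF B, of "v + L n" "L n"]
          by (simp add: set_plus_rearrange2)
        then show ?thesis by blast
      qed
    qed
    \<comment> \<open>P would have no fixed point on the nonzero cosets, so p would divide both the
      number of all cosets and that number less one.\<close>
    moreover have "p dvd card (\<Omega> - {B})"
    proof (rule fixed_point_free_p_group[OF p(1), of _ "(\<lambda>\<sigma> X. ac \<sigma> ` X) ` P"])
      show "finite (\<Omega> - {B})" using finO by blast
      show "id \<in> (\<lambda>\<sigma> X. ac \<sigma> ` X) ` P"
        using P(2) by (intro image_eqI[of _ _ id]) (auto simp: fun_eq_iff ac_id)
      show "g \<circ> h \<in> (\<lambda>\<sigma> X. ac \<sigma> ` X) ` P"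
        if gh: "g \<in> (\<lambda>\<sigma> X. ac \<sigma> ` X) ` P" "h \<in> (\<lambda>\<sigma> X. ac \<sigma> ` X) ` P" for g h
      proof -
        obtain \<sigma> \<tau> where *: "\<sigma> \<in> P" "\<tau> \<in> P" "g = (\<lambda>X. ac \<sigma> ` X)" "h = (\<lambda>X. ac \<tau> ` X)" using gh by blast
        have "g \<circ> h = (\<lambda>X. ac (\<sigma> \<circ> \<tau>) ` X)"
          unfolding *(3,4) using PG[OF *(1)] PG[OF *(2)] by (auto simp: fun_eq_iff ac_comp image_image)
        then show ?thesis using P(3)[OF *(1,2)] by blast
      qed
      show "g X \<in> \<Omega> - {B}" if gX: "g \<in> (\<lambda>\<sigma> X. ac \<sigma> ` X) ` P" "X \<in> \<Omega> - {B}" for g X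
      proof -
        obtain \<sigma> where \<sigma>: "\<sigma> \<in> P" "g = (\<lambda>X. ac \<sigma> ` X)" using gX(1) by blast
        obtain n where n: "X = L n +o B" using gX(2) unfolding \<Omega>_def by blast
        note \<sigma>G = PG[OF \<sigma>(1)]
        have bij: "bij_betw (ac (finv \<sigma>)) Y Y"
        proof (rule bij_betw_byWitness[of _ "ac \<sigma>"])
          show "\<forall>y\<in>Y. ac \<sigma> (ac (finv \<sigma>) y) = y" "\<forall>y\<in>Y. ac (finv \<sigma>) (ac \<sigma> y) = y"
            using ac_inv[OF \<sigma>G] by auto
          have "ac g y \<in> Y" if "g \<in> G" "y \<in> Y" for g y
            using that unfolding Y_def by (auto simp: ac_comp[symmetric] intro: comp_in)
          then show "ac (finv \<sigma>) ` Y \<subseteq> Y" "ac \<sigma> ` Y \<subseteq> Y" using \<sigma>G inv_in by auto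
        qed
        have "ac \<sigma> (L n) = (\<Sum>y\<in>Y. scale (of_nat (n y)) (ac \<sigma> y))"
          unfolding L_def using \<sigma>G by (simp add: ac_sum ac_scale)
        also have "\<dots> = (\<Sum>y\<in>Y. scale (of_nat (n (ac (finv \<sigma>) y))) (ac \<sigma> (ac (finv \<sigma>) y)))"
          by (rule sum.reindex_bij_betw[OF bij, symmetric])
        also have "\<dots> = L (\<lambda>y. n (ac (finv \<sigma>) y))"
          unfolding L_def using ac_inv(2)[OF \<sigma>G] by simp
        finally have eq: "g X = L (\<lambda>y. n (ac (finv \<sigma>) y)) +o B"
          unfolding \<sigma>(2) n ac_coset[OF B \<sigma>G] by simp
        moreover have "g X \<noteq> B"
        proof
          assume "g X = B"
          then have "ac \<sigma> (L n) \<in> B"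
            unfolding \<sigma>(2) n ac_coset[OF B \<sigma>G] coset_eq_self_iff[OF B] .
          then have "L n \<in> B"
            using invariantD(6)[OF B inv_in[OF \<sigma>G]] ac_inv(1)[OF \<sigma>G] by metis
          then show False using gX(2) n coset_eq_self_iff[OF B] by simp
        qed
        ultimately show ?thesis unfolding \<Omega>_def by blast
      qed
      show "\<exists>a. \<forall>X\<in>\<Omega> - {B}. (g ^^ (p ^ a)) X = X" if g: "g \<in> (\<lambda>\<sigma> X. ac \<sigma> ` X) ` P" for g
      proof -
        obtain \<sigma> where \<sigma>: "\<sigma> \<in> P" "g = (\<lambda>X. ac \<sigma> ` X)" using g by blast
        note \<sigma>G = PG[OF \<sigma>(1)]
        obtain a where a: "\<forall>x\<in>A. ac (\<sigma> ^^ (p ^ a)) x - x \<in> B" using ord[OF \<sigma>(1)] by blast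
        have pow: "(g ^^ m) X = ac (\<sigma> ^^ m) ` X" for m X
        proof (induction m)
          case 0
          show ?case using ac_id by (simp add: id_def[symmetric])
        next
          case (Suc m)
          then show ?case
            using ac_comp[OF \<sigma>G sgrp_funpow[OF sgrp_G \<sigma>G, of m]]
            by (simp add: \<sigma>(2) image_image comp_def)
        qed
        have "(g ^^ (p ^ a)) X = X" if X: "X \<in> \<Omega>" for X
        proof -
          obtain n where n: "X = L n +o B" using X unfolding \<Omega>_def by blast
          show ?thesis
            unfolding pow n ac_coset[OF B sgrp_funpow[OF sgrp_G \<sigma>G]] coset_eq_iff[OF B]
            using a LA by blast
        qed
        then show ?thesis by blast
      qed
      show "\<exists>g\<in>(\<lambda>\<sigma> X. ac \<sigma> ` X) ` P. g X \<noteq> X" if X: "X \<in> \<Omega> - {B}" for X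
      proof -
        obtain n where n: "X = L n +o B" using X unfolding \<Omega>_def by blast
        have "L n \<notin> B" using X n coset_eq_self_iff[OF B] by simp
        then obtain \<sigma> where \<sigma>: "\<sigma> \<in> P" "ac \<sigma> (L n) - L n \<notin> B"
          using 1 LA unfolding F_def by blast
        then have "ac \<sigma> ` X \<noteq> X"
          unfolding n ac_coset[OF B PG[OF \<sigma>(1)]] coset_eq_iff[OF B] by blast
        then show ?thesis using \<sigma>(1) by blast
      qed
    qed
    moreover have "B \<in> \<Omega>"
    proof -
      have "L (\<lambda>_. 0) +o B = B" unfolding L_def by simp
      then show ?thesis unfolding \<Omega>_def by (metis rangeI)
    qed
    then have "card \<Omega> = Suc (card (\<Omega> - {B}))" by (intro card.remove finO)
    ultimately have "p dvd 1" by (metis dvd_add_right_iff Suc_eq_plus1)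
    then show ?thesis using p(1) by simp
  next
    case 2
    then show ?thesis using \<sigma> unfolding F_def by blast
  qed
qed

section \<open>Composition series in the lattice of invariant subspaces\<close>

definition series :: "'v set \<Rightarrow> nat \<Rightarrow> (nat \<Rightarrow> 'v set) \<Rightarrow> bool" where
  "series A n F \<longleftrightarrow> F 0 = A \<and> F n = {0} \<and> (\<forall>i<n. irr (F i) (F (Suc i)))"

lemma series_Cons:
  assumes "series B n F" "irr A B"
  shows "series A (Suc n) (case_nat A F)"
  using assms unfolding series_def by (auto split: nat.splits simp: less_Suc_eq_0_disj)

text \<open>A proper invariant subspace above B of the largest possible dimension is
  maximal.\<close>

lemma maximal_below:
  assumes A: "invariant A" and B: "invariant B" "B \<subset> A"
  obtains C where "irr A C" "B \<subseteq> C"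
proof -
  let ?P = "\<lambda>C. invariant C \<and> B \<subseteq> C \<and> C \<subset> A"
  have "\<exists>C. ?P C \<and> (\<forall>D. ?P D \<longrightarrow> dim D \<le> dim C)"
    using B dim_bound by (intro ex_has_greatest_nat[of ?P B dim "Suc (dim UNIV)"]) (auto simp: less_Suc_eq_le)
  then obtain C where C: "?P C" "\<forall>D. ?P D \<longrightarrow> dim D \<le> dim C" by blast
  have "irr A C"
    unfolding irr_def
  proof (intro conjI allI impI)
    fix D assume D: "invariant D" "C \<subseteq> D" "D \<subseteq> A"
    show "D = C \<or> D = A"
    proof (rule ccontr)
      assume "\<not> ?thesis"
      then have "?P D" "C \<subset> D" using C(1) D by auto
      then show False using dim_less[of C D] C by fastforce
    qed
  qed (use A C(1) in auto)
  then show ?thesis using C(1) that by blast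
qed

lemma exists_series:
  assumes "invariant A"
  obtains n F where "series A n F"
proof -
  have "\<exists>n F. series A n F"
    using assms
  proof (induction "dim A" arbitrary: A rule: less_induct)
    case less
    show ?case
    proof (cases "A = {0}")
      case True
      then show ?thesis unfolding series_def by (intro exI[of _ 0] exI[of _ "\<lambda>_. {0}"]) simp
    next
      case False
      then have "{0} \<subset> A" using invariantD(2)[OF less(2)] by blast
      then obtain C where C: "irr A C" using maximal_below[OF less(2) invariant_zero] by metis
      have "dim C < dim A" using irrD[OF C] by (intro dim_less) auto
      then obtain n F where "series C n F" using less(1) irrD(2)[OF C] by blast
      then show ?thesis using series_Cons C by blast
    qed
  qed
  then show ?thesis using that by blast
qed

text \<open>Descend from E by maximal invariant subspaces containing X until X is reached, then
  continue through Y. This is how a section is exhibited as a Jordan-Hoelder factor.\<close>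

lemma exists_series_through:
  assumes "irr X Y" "invariant E" "X \<subseteq> E"
  obtains n F i where "series E n F" "i < n" "F i = X" "F (Suc i) = Y"
proof -
  have "\<exists>n F. series E n F \<and> (\<exists>i<n. F i = X \<and> F (Suc i) = Y)"
    using assms(2,3)
  proof (induction "dim E" arbitrary: E rule: less_induct)
    case less
    show ?case
    proof (cases "E = X")
      case True
      obtain n F where F: "series Y n F" using exists_series[OF irrD(2)[OF assms(1)]] .
      have "series X (Suc n) (case_nat X F)" by (rule series_Cons[OF F assms(1)])
      moreover have "case_nat X F 0 = X" "case_nat X F (Suc 0) = Y"
        using F unfolding series_def by auto
      ultimately show ?thesis unfolding True by (metis zero_less_Suc)
    next
      case False
      then have "X \<subset> E" using less(3) by blast
      then obtain C where C: "irr E C" "X \<subseteq> C"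
        using maximal_below[OF less(2) irrD(1)[OF assms(1)]] by metis
      have "dim C < dim E" using irrD[OF C(1)] by (intro dim_less) auto
      then obtain n F i where F: "series C n F" "i < n" "F i = X" "F (Suc i) = Y"
        using less(1) irrD(2)[OF C(1)] C(2) by blast
      have "series E (Suc n) (case_nat E F)" by (rule series_Cons[OF F(1) C(1)])
      moreover have "case_nat E F (Suc i) = X" "case_nat E F (Suc (Suc i)) = Y" "Suc i < Suc n"
        using F by auto
      ultimately show ?thesis by blast
    qed
  qed
  then show ?thesis using that by blast
qed

section \<open>Quotients made of cosets versus pairs of invariant subspaces\<close>

abbreviation sub :: "'v set \<Rightarrow> ('a \<Rightarrow> 'a, 'f, 'v) rep" where
  "sub E \<equiv> \<lparr>space = E, null = 0, scal = scale, act = ac\<rparr>"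

lemma subrep_iff: "subrep G (sub E) A \<longleftrightarrow> A \<subseteq> E \<and> invariant A"
  unfolding subrep_def invariant_def subspace_def by auto

lemma restrict_sub: "restrict_rep (sub E) A = sub A"
  by (simp add: restrict_rep_def)

lemma coset_plus: "invariant B \<Longrightarrow> (x +o B) + (y +o B) = (x + y) +o B"
  using plus_subset[of B B B] subset_plus(1)[of B B]
  by (simp add: set_plus_rearrange)

lemma coset_absorb: "invariant B \<Longrightarrow> (x +o B) + B = x +o B"
  using coset_plus[of B x 0] by simp

lemma quot_ops:
  assumes "invariant B"
  shows "space (quot_rep (sub A) B) = (\<lambda>x. x +o B) ` A" "null (quot_rep (sub A) B) = B"
    "scal (quot_rep (sub A) B) c (x +o B) = scale c x +o B"
    "g \<in> G \<Longrightarrow> act (quot_rep (sub A) B) g (x +o B) = ac g x +o B"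
proof -
  show "space (quot_rep (sub A) B) = (\<lambda>x. x +o B) ` A" "null (quot_rep (sub A) B) = B"
    by (simp_all add: quot_rep_def)
  show "act (quot_rep (sub A) B) g (x +o B) = ac g x +o B" if "g \<in> G"
    using that by (simp add: quot_rep_def ac_coset[OF assms] coset_absorb[OF assms])
  have "scale c ` (x +o B) + B = scale c x +o B"
  proof (intro equalityI subsetI)
    fix z assume "z \<in> scale c ` (x +o B) + B"
    then obtain b b' where "b \<in> B" "b' \<in> B" "z = scale c (x + b) + b'"
      by (auto simp: elt_set_plus_def elim!: set_plus_elim)
    then show "z \<in> scale c x +o B"
      using invariantD(3)[OF assms invariantD(5)[OF assms \<open>b \<in> B\<close>] \<open>b' \<in> B\<close>, of c]
      by (auto simp: elt_set_plus_def scale_right_distrib add.assoc)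
  next
    fix z assume "z \<in> scale c x +o B"
    then obtain b where b: "b \<in> B" "z = scale c x + b" by (auto simp: elt_set_plus_def)
    have "x \<in> x +o B" using set_plus_intro2[OF invariantD(2)[OF assms], of x] by simp
    then show "z \<in> scale c ` (x +o B) + B" using b by (auto intro: set_plus_intro)
  qed
  then show "scal (quot_rep (sub A) B) c (x +o B) = scale c x +o B"
    by (simp add: quot_rep_def)
qed

text \<open>Subrepresentations of the quotient correspond to invariant subspaces between B and A, by
  image and preimage under the map to cosets.\<close>

lemma irreducible_quot_iff:
  assumes A: "invariant A" and B: "invariant B" "B \<subseteq> A"
  shows "irreducible_rep G (quot_rep (sub A) B) \<longleftrightarrow> irr A B"
proof
  let ?Q = "quot_rep (sub A) B"
  assume irr: "irreducible_rep G ?Q"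
  have mem: "x +o B \<in> (\<lambda>x. x +o B) ` C \<longleftrightarrow> x \<in> C" if "invariant C" "B \<subseteq> C" for x C
  proof
    assume "x +o B \<in> (\<lambda>x. x +o B) ` C"
    then obtain y where y: "y \<in> C" "x - y \<in> B" using coset_eq_iff[OF B(1)] by blast
    then show "x \<in> C" using invariantD(3)[OF that(1), of "x - y" y] that(2) by auto
  qed blast
  have "B \<noteq> A"
  proof
    assume "B = A"
    then have "space ?Q = {B}"
      using quot_ops(1)[OF B(1), of A] coset_eq_self_iff[OF B(1)] invariantD(2)[OF B(1)]
      by (auto simp: image_iff intro!: bexI[of _ 0])
    then show False using irr quot_ops(2)[OF B(1), of A] unfolding irreducible_rep_def by simp
  qed
  moreover have "C = B \<or> C = A" if C: "invariant C" "B \<subseteq> C" "C \<subseteq> A" for C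
  proof -
    let ?C = "(\<lambda>x. x +o B) ` C"
    have "subrep G ?Q ?C"
      unfolding subrep_def quot_ops(1,2)[OF B(1)]
    proof (intro conjI ballI allI)
      show "?C \<subseteq> (\<lambda>x. x +o B) ` A" using C(3) by blast
      show "B \<in> ?C" using invariantD(2)[OF C(1)] by (intro image_eqI[of _ _ 0]) simp_all
      show "X + Y \<in> ?C" if "X \<in> ?C" "Y \<in> ?C" for X Y
        using that invariantD(3)[OF C(1)] coset_plus[OF B(1)] by auto
      show "scal ?Q c X \<in> ?C" if "X \<in> ?C" for c X
        using that invariantD(5)[OF C(1)] quot_ops(3)[OF B(1)] by auto
      show "act ?Q g X \<in> ?C" if "g \<in> G" "X \<in> ?C" for g X
        using that invariantD(6)[OF C(1)] quot_ops(4)[OF B(1)] by auto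
    qed
    then have "?C = {null ?Q} \<or> ?C = space ?Q"
      using irr unfolding irreducible_rep_def by (elim conjE) simp
    then have "?C = {B} \<or> ?C = (\<lambda>x. x +o B) ` A"
      unfolding quot_ops(1,2)[OF B(1)] .
    then show ?thesis
    proof
      assume 1: "?C = {B}"
      then have "C \<subseteq> B" using coset_eq_self_iff[OF B(1)] by blast
      then show ?thesis using C(2) by blast
    next
      assume 2: "?C = (\<lambda>x. x +o B) ` A"
      have "A \<subseteq> C"
      proof
        fix x assume "x \<in> A"
        then have "x +o B \<in> ?C" unfolding 2 by (rule imageI)
        then show "x \<in> C" by (simp only: mem[OF C(1,2)])
      qed
      then show ?thesis using C(3) by blast
    qed
  qed
  ultimately show "irr A B" unfolding irr_def using A B by blast
next
  let ?Q = "quot_rep (sub A) B"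
  assume irr: "irr A B"
  show "irreducible_rep G ?Q"
    unfolding irreducible_rep_def quot_ops(1,2)[OF B(1)]
  proof (intro conjI allI impI)
    obtain x where "x \<in> A" "x \<notin> B" using irrD(3,4)[OF irr] by blast
    then show "(\<lambda>x. x +o B) ` A \<noteq> {B}" using coset_eq_self_iff[OF B(1)] by blast
    fix X assume X: "subrep G ?Q X"
    define C where "C = {x \<in> A. x +o B \<in> X}"
    have X': "X \<subseteq> (\<lambda>x. x +o B) ` A" "B \<in> X" "\<And>Y Z. Y \<in> X \<Longrightarrow> Z \<in> X \<Longrightarrow> Y + Z \<in> X"
      "\<And>c Y. Y \<in> X \<Longrightarrow> scal ?Q c Y \<in> X" "\<And>g Y. g \<in> G \<Longrightarrow> Y \<in> X \<Longrightarrow> act ?Q g Y \<in> X"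
      using X unfolding subrep_def quot_ops(1,2)[OF B(1)] by auto
    have C: "invariant C"
    proof (rule invariantI)
      show "0 \<in> C" unfolding C_def using X'(2) invariantD(2)[OF A] by simp
      show "x + y \<in> C" if "x \<in> C" "y \<in> C" for x y
        using that invariantD(3)[OF A] X'(3)[of "x +o B" "y +o B"] coset_plus[OF B(1)]
        unfolding C_def by auto
      show "scale c x \<in> C" if "x \<in> C" for c x
        using that invariantD(5)[OF A] X'(4)[of "x +o B" c] quot_ops(3)[OF B(1)]
        unfolding C_def by auto
      show "ac g x \<in> C" if "g \<in> G" "x \<in> C" for g x
        using that invariantD(6)[OF A] X'(5)[of g "x +o B"] quot_ops(4)[OF B(1)]
        unfolding C_def by auto
    qed
    have "B \<subseteq> C"
    proof
      fix x assume "x \<in> B"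
      then have "x +o B = B" "x \<in> A" using coset_eq_self_iff[OF B(1)] B(2) by auto
      then show "x \<in> C" unfolding C_def using X'(2) by simp
    qed
    then consider "C = B" | "C = A" using irrD(5)[OF irr C] unfolding C_def by blast
    then show "X = {B} \<or> X = (\<lambda>x. x +o B) ` A"
    proof cases
      case 1
      have "Y = B" if Y: "Y \<in> X" for Y
      proof -
        obtain y where y: "y \<in> A" "Y = y +o B" using X'(1) Y by blast
        then have "y \<in> B" using Y 1 unfolding C_def by blast
        then show ?thesis using y(2) coset_eq_self_iff[OF B(1)] by simp
      qed
      then show ?thesis using X'(2) by blast
    next
      case 2
      then show ?thesis using X'(1) unfolding C_def by blast
    qed
  qed
qed

text \<open>The graph of an isomorphism of \<open>A / A1\<close>, twisted by \<open>\<chi>\<close>, with \<open>S / D\<close>, as a set of pairs of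
  representatives.\<close>

definition twisted_rel ::
  "(('a \<Rightarrow> 'a) \<Rightarrow> 'f) \<Rightarrow> ('v \<times> 'v) set \<Rightarrow> 'v set \<Rightarrow> 'v set \<Rightarrow> 'v set \<Rightarrow> 'v set \<Rightarrow> bool" where
  "twisted_rel \<chi> R A A1 S D \<longleftrightarrow> R \<subseteq> A \<times> S \<and>
     (\<forall>x y x' y'. (x, y) \<in> R \<longrightarrow> (x', y') \<in> R \<longrightarrow> (x + x', y + y') \<in> R) \<and>
     (\<forall>c x y. (x, y) \<in> R \<longrightarrow> (scale c x, scale c y) \<in> R) \<and>
     (\<forall>g x y. g \<in> G \<longrightarrow> (x, y) \<in> R \<longrightarrow> (scale (\<chi> g) (ac g x), ac g y) \<in> R) \<and>
     (\<forall>x\<in>A. \<exists>y. (x, y) \<in> R) \<and> (\<forall>y\<in>S. \<exists>x. (x, y) \<in> R) \<and>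
     (\<forall>x y. (x, y) \<in> R \<longrightarrow> (x \<in> A1 \<longleftrightarrow> y \<in> D)) \<and>
     (\<forall>x\<in>A1. (x, 0) \<in> R) \<and> (\<forall>y\<in>D. (0, y) \<in> R)"

lemma twisted_relD:
  assumes "twisted_rel \<chi> R A A1 S D"
  shows "\<And>x y. (x, y) \<in> R \<Longrightarrow> x \<in> A \<and> y \<in> S"
    "\<And>x y x' y'. (x, y) \<in> R \<Longrightarrow> (x', y') \<in> R \<Longrightarrow> (x + x', y + y') \<in> R"
    "\<And>c x y. (x, y) \<in> R \<Longrightarrow> (scale c x, scale c y) \<in> R"
    "\<And>g x y. g \<in> G \<Longrightarrow> (x, y) \<in> R \<Longrightarrow> (scale (\<chi> g) (ac g x), ac g y) \<in> R"
    "\<And>x. x \<in> A \<Longrightarrow> \<exists>y. (x, y) \<in> R" "\<And>y. y \<in> S \<Longrightarrow> \<exists>x. (x, y) \<in> R"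
    "\<And>x y. (x, y) \<in> R \<Longrightarrow> x \<in> A1 \<longleftrightarrow> y \<in> D"
    "\<And>x. x \<in> A1 \<Longrightarrow> (x, 0) \<in> R" "\<And>y. y \<in> D \<Longrightarrow> (0, y) \<in> R"
proof -
  note c1 = assms[unfolded twisted_rel_def]
  note c2 = conjunct2[OF c1] note c3 = conjunct2[OF c2] note c4 = conjunct2[OF c3]
  note c5 = conjunct2[OF c4] note c6 = conjunct2[OF c5] note c7 = conjunct2[OF c6]
  note c8 = conjunct2[OF c7]
  show "\<And>x y. (x, y) \<in> R \<Longrightarrow> x \<in> A \<and> y \<in> S" using conjunct1[OF c1] by blast
  show "\<And>x y x' y'. (x, y) \<in> R \<Longrightarrow> (x', y') \<in> R \<Longrightarrow> (x + x', y + y') \<in> R"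
    using conjunct1[OF c2] by blast
  show "\<And>c x y. (x, y) \<in> R \<Longrightarrow> (scale c x, scale c y) \<in> R" using conjunct1[OF c3] by blast
  show "\<And>g x y. g \<in> G \<Longrightarrow> (x, y) \<in> R \<Longrightarrow> (scale (\<chi> g) (ac g x), ac g y) \<in> R"
    using conjunct1[OF c4] by blast
  show "\<And>x. x \<in> A \<Longrightarrow> \<exists>y. (x, y) \<in> R" using conjunct1[OF c5] by blast
  show "\<And>y. y \<in> S \<Longrightarrow> \<exists>x. (x, y) \<in> R" using conjunct1[OF c6] by blast
  show "\<And>x y. (x, y) \<in> R \<Longrightarrow> x \<in> A1 \<longleftrightarrow> y \<in> D" using conjunct1[OF c7] by blast
  show "\<And>x. x \<in> A1 \<Longrightarrow> (x, 0) \<in> R" using conjunct1[OF c8] by blast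
  show "\<And>y. y \<in> D \<Longrightarrow> (0, y) \<in> R" using conjunct2[OF c8] by blast
qed

text \<open>A coset is sent to the set of all R-partners of its members. This is one full coset of D
  because R relates elements of A1 only to elements of D, and 0 to all of D.\<close>

lemma twisted_rel_imp_iso:
  assumes R: "twisted_rel \<chi> R A A1 S D" and inv: "invariant A" "invariant A1" "invariant S" "invariant D"
  shows "rep_iso G (twist \<chi> (quot_rep (sub A) A1)) (quot_rep (sub S) D)"
proof -
  note R' = twisted_relD[OF R]
  have diff: "(x - x', y - y') \<in> R" if "(x, y) \<in> R" "(x', y') \<in> R" for x y x' y'
    using R'(2)[OF that(1) R'(3)[OF that(2), of "- 1"]] by simp
  define \<phi> where "\<phi> = (\<lambda>X. {s. \<exists>z\<in>X. (z, s) \<in> R})"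
  have \<phi>: "\<phi> (z +o A1) = s +o D" if zs: "(z, s) \<in> R" for z s
  proof (intro equalityI subsetI)
    fix s' assume "s' \<in> \<phi> (z +o A1)"
    then obtain a where a: "a \<in> A1" "(z + a, s') \<in> R" unfolding \<phi>_def by (auto simp: elt_set_plus_def)
    from diff[OF a(2) zs] have "(a, s' - s) \<in> R" by simp
    then have "s' - s \<in> D" using R'(7) a(1) by blast
    then show "s' \<in> s +o D" by (auto simp: elt_set_plus_def intro!: bexI[of _ "s' - s"])
  next
    fix s' assume "s' \<in> s +o D"
    then obtain d where d: "d \<in> D" "s' = s + d" by (auto simp: elt_set_plus_def)
    have "(z, s') \<in> R" using R'(2)[OF zs R'(9)[OF d(1)]] d(2) by simp
    moreover have "z \<in> z +o A1" using set_plus_intro2[OF invariantD(2)[OF inv(2)], of z] by simp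
    ultimately show "s' \<in> \<phi> (z +o A1)" unfolding \<phi>_def by blast
  qed
  let ?V = "twist \<chi> (quot_rep (sub A) A1)" and ?W = "quot_rep (sub S) D"
  have spV: "space ?V = (\<lambda>x. x +o A1) ` A" and scV: "scal ?V c (x +o A1) = scale c x +o A1" for c x
    unfolding twist_def using quot_ops[OF inv(2)] by simp_all
  have acV: "act ?V g (x +o A1) = scale (\<chi> g) (ac g x) +o A1" if "g \<in> G" for g x
    unfolding twist_def using that by (simp add: quot_ops[OF inv(2)])
  note W = quot_ops[OF inv(4)]
  have "rep_hom G ?V ?W \<phi>"
    unfolding rep_hom_def
  proof (intro conjI ballI allI)
    show "\<phi> ` space ?V \<subseteq> space ?W"
    proof clarify
      fix X assume "X \<in> space ?V"
      then obtain x where x: "x \<in> A" "X = x +o A1" unfolding spV by blast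
      then obtain s where s: "(x, s) \<in> R" using R'(5) by blast
      then show "\<phi> X \<in> space ?W" unfolding W(1) x(2) \<phi>[OF s] using R'(1) by blast
    qed
    fix X assume "X \<in> space ?V"
    then obtain x s where x: "(x, s) \<in> R" "X = x +o A1" unfolding spV using R'(5) by blast
    show "\<phi> (X + Y) = \<phi> X + \<phi> Y" if Y: "Y \<in> space ?V" for Y
    proof -
      obtain y t where y: "(y, t) \<in> R" "Y = y +o A1" using Y unfolding spV using R'(5) by blast
      show ?thesis
        unfolding x(2) y(2) coset_plus[OF inv(2)] \<phi>[OF x(1)] \<phi>[OF y(1)] \<phi>[OF R'(2)[OF x(1) y(1)]]
        by (simp add: coset_plus[OF inv(4)])
    qed
    show "\<phi> (scal ?V c X) = scal ?W c (\<phi> X)" for c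
      unfolding x(2) scV \<phi>[OF x(1)] \<phi>[OF R'(3)[OF x(1)]] W(3) ..
    show "\<phi> (act ?V g X) = act ?W g (\<phi> X)" if "g \<in> G" for g
      unfolding x(2) acV[OF that] \<phi>[OF x(1)] \<phi>[OF R'(4)[OF that x(1)]] W(4)[OF that] ..
  qed
  moreover have "inj_on \<phi> (space ?V)"
  proof (rule inj_onI)
    fix X Y assume XY: "X \<in> space ?V" "Y \<in> space ?V" "\<phi> X = \<phi> Y"
    obtain x s where x: "(x, s) \<in> R" "X = x +o A1" using XY(1) unfolding spV using R'(5) by blast
    obtain y t where y: "(y, t) \<in> R" "Y = y +o A1" using XY(2) unfolding spV using R'(5) by blast
    have "s - t \<in> D" using XY(3) unfolding x(2) y(2) \<phi>[OF x(1)] \<phi>[OF y(1)] coset_eq_iff[OF inv(4)] .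
    then have "x - y \<in> A1" using R'(7)[OF diff[OF x(1) y(1)]] by blast
    then show "X = Y" unfolding x(2) y(2) coset_eq_iff[OF inv(2)] .
  qed
  moreover have "\<phi> ` space ?V = space ?W"
  proof
    show "\<phi> ` space ?V \<subseteq> space ?W" using calculation(1) unfolding rep_hom_def by blast
    show "space ?W \<subseteq> \<phi> ` space ?V"
    proof
      fix Z assume "Z \<in> space ?W"
      then obtain s where s: "s \<in> S" "Z = s +o D" unfolding W(1) by blast
      then obtain x where x: "(x, s) \<in> R" using R'(6) by blast
      then have "x +o A1 \<in> space ?V" unfolding spV using R'(1) by blast
      then show "Z \<in> \<phi> ` space ?V" unfolding s(2) \<phi>[OF x, symmetric] by blast
    qed
  qed
  ultimately show ?thesis
    unfolding rep_iso_def bij_betw_def by blast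
qed

lemma series_imp_composition_series:
  assumes "invariant E" "series E n F"
  shows "composition_series G (sub E) n F"
proof -
  have irr: "irr (F i) (F (Suc i))" if "i < n" for i using that assms(2) unfolding series_def by blast
  have F0: "F 0 = E" "F n = {0}" using assms(2) unfolding series_def by auto
  have inv: "invariant (F i) \<and> F i \<subseteq> E" if "i \<le> n" for i
    using that
  proof (induction i)
    case (Suc i)
    then show ?case using irrD(2,3)[OF irr[of i]] by auto
  qed (use F0(1) assms(1) in auto)
  show ?thesis
    unfolding composition_series_def restrict_sub
    using F0 inv irr irrD(3)[OF irr] by (auto simp: subrep_iff irreducible_quot_iff)
qed

lemma composition_seriesD:
  assumes "composition_series G (sub UNIV) n F"
  shows "F 0 = UNIV" "F n = {0}" "\<And>i. i \<le> n \<Longrightarrow> invariant (F i)" "\<And>i. i < n \<Longrightarrow> irr (F i) (F (Suc i))"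
proof -
  show "F 0 = UNIV" "F n = {0}" using assms unfolding composition_series_def by auto
  show inv: "invariant (F i)" if "i \<le> n" for i
    using assms that unfolding composition_series_def subrep_iff by blast
  show "irr (F i) (F (Suc i))" if "i < n" for i
  proof -
    have "F (Suc i) \<subseteq> F i" "irreducible_rep G (quot_rep (restrict_rep (sub UNIV) (F i)) (F (Suc i)))"
      using assms that unfolding composition_series_def by blast+
    then show ?thesis
      using irreducible_quot_iff inv[of i] inv[of "Suc i"] that unfolding restrict_sub by auto
  qed
qed

text \<open>For the least \<open>i\<close> with \<open>A \<inter> F (Suc i) \<subseteq> A1\<close>, the factor \<open>F i / F (Suc i)\<close> is isomorphic to \<open>A / A1\<close>,
  and \<open>S / B\<close> is isomorphic to a section of \<open>F (Suc i)\<close>.\<close>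

lemma no_twisted_section:
  assumes free: "composition_series G (sub UNIV) n F"
      "\<And>i. i < n \<Longrightarrow> \<not> JH_factor G (twist \<chi> (quot_rep (sub (F i)) (F (Suc i)))) (sub (F (Suc i)))"
    and irrA: "irr A A1" and irrS: "irr S B" and SA: "S \<subseteq> A1"
    and max: "\<And>C. invariant C \<Longrightarrow> B \<subseteq> C \<Longrightarrow> C \<subseteq> A \<Longrightarrow> C \<noteq> A \<Longrightarrow> C \<subseteq> A1"
    and R: "twisted_rel \<chi> R A A1 S B"
  shows False
proof -
  note F = composition_seriesD[OF free(1)]
  note A = irrD[OF irrA] and S = irrD[OF irrS]
  have BA: "B \<subseteq> A1" using S(3) SA by blast
  have "\<exists>i<n. A \<inter> F (Suc i) \<subseteq> A1 \<and> \<not> A \<inter> F i \<subseteq> A1"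
  proof -
    have "A \<inter> F n \<subseteq> A1" using F(2) invariantD(2)[OF A(2)] by auto
    moreover have "\<not> A \<inter> F 0 \<subseteq> A1" using F(1) A(3,4) by auto
    ultimately show ?thesis
      using ex_least_nat_less[of "\<lambda>i. A \<inter> F i \<subseteq> A1" n] by blast
  qed
  then obtain i where i: "i < n" "A \<inter> F (Suc i) \<subseteq> A1" "\<not> A \<inter> F i \<subseteq> A1" by blast
  let ?P = "F i" and ?E = "F (Suc i)"
  have P: "irr ?P ?E" using F(4)[OF i(1)] .
  note P' = irrD[OF P]
  \<comment> \<open>\<open>max\<close> makes A1 the largest proper invariant subspace of A above B,
    and the sum of \<open>A \<inter> ?P\<close> and B is not contained in it.\<close>
  have AP: "A \<subseteq> (A \<inter> ?P) + B"
  proof -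
    have inv: "invariant ((A \<inter> ?P) + B)" by (intro invariant_plus invariant_Int A(1) P'(1) S(2))
    have "(A \<inter> ?P) + B \<subseteq> A" using BA A(3) by (intro plus_subset[OF A(1)]) auto
    moreover have "\<not> (A \<inter> ?P) + B \<subseteq> A1" using i(3) subset_plus(1)[OF S(2), of "A \<inter> ?P"] by blast
    ultimately show ?thesis using max[OF inv] subset_plus(2)[OF invariant_Int[OF A(1) P'(1)], of B] by blast
  qed
  have mem_iff: "a \<in> ?E \<longleftrightarrow> a \<in> A1" if a: "a \<in> A" "a \<in> ?P" for a
  proof
    assume "a \<in> ?E" then show "a \<in> A1" using a i(2) by blast
  next
    assume aA1: "a \<in> A1"
    \<comment> \<open>By irreducibility this is one of the two ends; were it all of
      \<open>?P\<close>, every element of A in \<open>?P\<close> would lie in A1.\<close>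
    let ?C = "(A1 \<inter> ?P) + ?E"
    have inv: "invariant ?C" by (intro invariant_plus invariant_Int A(2) P'(1,2))
    have "?E \<subseteq> ?C" using subset_plus(2)[OF invariant_Int[OF A(2) P'(1)]] by blast
    moreover have "?C \<subseteq> ?P" using P'(3) by (intro plus_subset[OF P'(1)]) auto
    ultimately have "?C = ?E \<or> ?C = ?P" using P'(5)[OF inv] by blast
    moreover have "?C \<noteq> ?P"
    proof
      assume CP: "?C = ?P"
      have "A \<inter> ?P \<subseteq> A1"
      proof
        fix x assume x: "x \<in> A \<inter> ?P"
        then have "x \<in> (A1 \<inter> ?P) + ?E" using CP by simp
        then obtain u w where uw: "u \<in> A1" "w \<in> ?E" "x = u + w"
          by (auto elim!: set_plus_elim)
        have "w = x - u" using uw(3) by simp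
        then have "w \<in> A" using x uw(1) A(3) invariantD(4)[OF A(1)] by blast
        then have "w \<in> A1" using uw(2) i(2) by blast
        then show "x \<in> A1" using uw invariantD(3)[OF A(2)] by blast
      qed
      then show False using i(3) by blast
    qed
    ultimately have "?C = ?E" by blast
    then show "a \<in> ?E" using aA1 a subset_plus(1)[OF P'(2), of "A1 \<inter> ?P"] by blast
  qed
  \<comment> \<open>S / B is moved into \<open>?E\<close>: every element of S is congruent modulo B
    to one of \<open>?E\<close>, so the intersections represent the same factor.\<close>
  let ?X = "S \<inter> ?E" and ?Y = "B \<inter> ?E"
  have invX: "invariant ?X" "invariant ?Y" by (intro invariant_Int S(1,2) P'(2))+
  have SX: "\<exists>x b. x \<in> ?X \<and> b \<in> B \<and> s = x + b" if s: "s \<in> S" for s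
  proof -
    have "s \<in> A" using s SA A(3) by blast
    then obtain a b where ab: "a \<in> A" "a \<in> ?P" "b \<in> B" "s = a + b"
      using AP by (auto elim!: set_plus_elim)
    have "a = s - b" using ab(4) by simp
    then have "a \<in> S" using s ab(3) S(3) invariantD(4)[OF S(1)] by blast
    then have "a \<in> ?E" using mem_iff[OF ab(1,2)] SA by blast
    then show ?thesis using \<open>a \<in> S\<close> ab by blast
  qed
  have irrX: "irr ?X ?Y"
    unfolding irr_def
  proof (intro conjI allI impI invX)
    show "?Y \<subseteq> ?X" using S(3) by blast
    show "?Y \<noteq> ?X"
    proof
      assume YX: "?Y = ?X"
      have "S \<subseteq> B"
      proof
        fix s assume "s \<in> S"
        then obtain x b where "x \<in> ?X" "b \<in> B" "s = x + b" using SX by blast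
        then show "s \<in> B" using YX invariantD(3)[OF S(2)] by blast
      qed
      then show False using S(3,4) by blast
    qed
    fix C assume C: "invariant C" "?Y \<subseteq> C" "C \<subseteq> ?X"
    have inv: "invariant (C + B)" by (intro invariant_plus C(1) S(2))
    have "B \<subseteq> C + B" using subset_plus(2)[OF C(1)] .
    moreover have "C + B \<subseteq> S" using C(3) S(3) by (intro plus_subset[OF S(1)]) auto
    ultimately consider "C + B = B" | "C + B = S" using S(5)[OF inv] by blast
    then show "C = ?Y \<or> C = ?X"
    proof cases
      case 1
      then have "C \<subseteq> B" using subset_plus(1)[OF S(2), of C] by blast
      then show ?thesis using C by blast
    next
      case 2
      have "?X \<subseteq> C"
      proof
        fix x assume x: "x \<in> ?X"
        then obtain c b where cb: "c \<in> C" "b \<in> B" "x = c + b" using 2 by (auto elim!: set_plus_elim)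
        have "b = x - c" using cb(3) by simp
        then have "b \<in> ?E" using x cb(1) C(3) invariantD(4)[OF P'(2)] by blast
        then have "b \<in> C" using cb(2) C(2) by blast
        then show "x \<in> C" using cb invariantD(3)[OF C(1)] by blast
      qed
      then show ?thesis using C(3) by blast
    qed
  qed
  obtain m F' k where F': "series ?E m F'" "k < m" "F' k = ?X" "F' (Suc k) = ?Y"
    using exists_series_through[OF irrX P'(2)] by blast
  note R' = twisted_relD[OF R]
  \<comment> \<open>The isomorphism of \<open>?P / ?E\<close> with a section of
    \<open>A \<inter> ?P\<close>, followed by R: an element f of \<open>?P\<close> is related to the
    partners of a representative a modulo \<open>?E\<close>.\<close>
  define R2 where "R2 = {(f, s). f \<in> ?P \<and> s \<in> ?X \<and> (\<exists>a\<in>A \<inter> ?P. f - a \<in> ?E \<and> (a, s) \<in> R)}"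
  have "twisted_rel \<chi> R2 ?P ?E ?X ?Y"
    unfolding twisted_rel_def
  proof (intro conjI allI impI ballI)
    show "R2 \<subseteq> ?P \<times> ?X" unfolding R2_def by blast
    show "(x + x', y + y') \<in> R2" if xy: "(x, y) \<in> R2" "(x', y') \<in> R2" for x y x' y'
    proof -
      obtain a where a: "a \<in> A \<inter> ?P" "x - a \<in> ?E" "(a, y) \<in> R" "x \<in> ?P" "y \<in> ?X"
        using xy(1) unfolding R2_def by blast
      obtain a' where a': "a' \<in> A \<inter> ?P" "x' - a' \<in> ?E" "(a', y') \<in> R" "x' \<in> ?P" "y' \<in> ?X"
        using xy(2) unfolding R2_def by blast
      have "(x - a) + (x' - a') \<in> ?E" using a a' by (intro invariantD(3)[OF P'(2)])
      then have "(x + x') - (a + a') \<in> ?E" by (simp add: algebra_simps)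
      moreover have "a + a' \<in> A \<inter> ?P" using a a' invariantD(3)[OF invariant_Int[OF A(1) P'(1)]] by blast
      ultimately show ?thesis
        unfolding R2_def using R'(2)[OF a(3) a'(3)] invariantD(3)[OF P'(1) a(4) a'(4)]
          invariantD(3)[OF invX(1) a(5) a'(5)] by blast
    qed
    show "(scale c x, scale c y) \<in> R2" if xy: "(x, y) \<in> R2" for c x y
    proof -
      obtain a where a: "a \<in> A \<inter> ?P" "x - a \<in> ?E" "(a, y) \<in> R" "x \<in> ?P" "y \<in> ?X"
        using xy unfolding R2_def by blast
      have "scale c x - scale c a \<in> ?E"
        using invariantD(5)[OF P'(2) a(2), of c] by (simp add: scale_right_diff_distrib)
      then show ?thesis
        unfolding R2_def using R'(3)[OF a(3), of c] invariantD(5)[OF P'(1) a(4), of c]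
          invariantD(5)[OF invX(1) a(5), of c] invariantD(5)[OF invariant_Int[OF A(1) P'(1)] a(1), of c] by blast
    qed
    show "(scale (\<chi> g) (ac g x), ac g y) \<in> R2" if g: "g \<in> G" and xy: "(x, y) \<in> R2" for g x y
    proof -
      obtain a where a: "a \<in> A \<inter> ?P" "x - a \<in> ?E" "(a, y) \<in> R" "x \<in> ?P" "y \<in> ?X"
        using xy unfolding R2_def by blast
      have "scale (\<chi> g) (ac g x) - scale (\<chi> g) (ac g a) \<in> ?E"
        using invariantD(5)[OF P'(2) invariantD(6)[OF P'(2) g a(2)], of "\<chi> g"] g
        by (simp add: scale_right_diff_distrib ac_diff)
      then show ?thesis
        unfolding R2_def using R'(4)[OF g a(3)] invariantD(5)[OF P'(1) invariantD(6)[OF P'(1) g a(4)], of "\<chi> g"]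
          invariantD(6)[OF invX(1) g a(5)]
          invariantD(5)[OF invariant_Int[OF A(1) P'(1)] invariantD(6)[OF invariant_Int[OF A(1) P'(1)] g a(1)], of "\<chi> g"]
        by blast
    qed
    show "\<exists>y. (x, y) \<in> R2" if x: "x \<in> ?P" for x
    proof -
      let ?C = "(A \<inter> ?P) + ?E"
      have inv: "invariant ?C" by (intro invariant_plus invariant_Int A(1) P'(1,2))
      have "?E \<subseteq> ?C" using subset_plus(2)[OF invariant_Int[OF A(1) P'(1)]] by blast
      moreover have "?C \<subseteq> ?P" using P'(3) by (intro plus_subset[OF P'(1)]) auto
      moreover have "?C \<noteq> ?E"
        using i(2,3) subset_plus(1)[OF P'(2), of "A \<inter> ?P"] by blast
      ultimately have "?C = ?P" using P'(5)[OF inv] by blast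
      then have "x \<in> (A \<inter> ?P) + ?E" using x by simp
      then obtain a w where aw: "a \<in> A \<inter> ?P" "w \<in> ?E" "x = a + w" by (auto elim!: set_plus_elim)
      obtain s where s: "(a, s) \<in> R" using R'(5) aw(1) by blast
      then obtain s' b where sb: "s' \<in> ?X" "b \<in> B" "s = s' + b" using SX R'(1) by blast
      have "(a - 0, s - b) \<in> R"
        using R'(2)[OF s R'(3)[OF R'(9)[OF sb(2)], of "- 1"]] by simp
      then have "(a, s') \<in> R" using sb(3) by simp
      moreover have "x - a \<in> ?E" using aw by simp
      ultimately show ?thesis using x sb(1) aw(1) unfolding R2_def by blast
    qed
    show "\<exists>x. (x, y) \<in> R2" if y: "y \<in> ?X" for y
    proof -
      obtain a where a: "(a, y) \<in> R" using R'(6) y by blast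
      then obtain a' b where ab: "a' \<in> A \<inter> ?P" "b \<in> B" "a = a' + b"
        using R'(1) AP by (blast elim!: set_plus_elim)
      have "(a - b, y - 0) \<in> R"
        using R'(2)[OF a R'(3)[OF R'(8), of b "- 1"]] ab(2) BA by auto
      then have "(a', y) \<in> R" using ab(3) by simp
      moreover have "a' - a' \<in> ?E" using invariantD(2)[OF P'(2)] by simp
      ultimately show ?thesis using ab(1) y unfolding R2_def by blast
    qed
    show "x \<in> ?E \<longleftrightarrow> y \<in> ?Y" if xy: "(x, y) \<in> R2" for x y
    proof -
      obtain a where a: "a \<in> A" "a \<in> ?P" "x - a \<in> ?E" "(a, y) \<in> R" "x \<in> ?P" "y \<in> ?X"
        using xy unfolding R2_def by blast
      have "x \<in> ?E \<longleftrightarrow> a \<in> ?E"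
        using invariantD(3)[OF P'(2) a(3), of a] invariantD(4)[OF P'(2) _ a(3), of x] by auto
      also have "\<dots> \<longleftrightarrow> y \<in> B" using mem_iff[OF a(1,2)] R'(7)[OF a(4)] by blast
      finally show ?thesis using a(6) by blast
    qed
    have 0: "(0, y) \<in> R2" if "y \<in> ?X" "(0, y) \<in> R" for y
      unfolding R2_def using that invariantD(2)[OF A(1)] invariantD(2)[OF P'(1)] invariantD(2)[OF P'(2)]
      by (auto intro!: bexI[of _ 0])
    show "(0, y) \<in> R2" if "y \<in> ?Y" for y using that R'(9) S(3) by (intro 0) auto
    show "(x, 0) \<in> R2" if "x \<in> ?E" for x
      unfolding R2_def using that invariantD(2)[OF A(1)] invariantD(2)[OF P'(1)] P'(3)
        invariantD(2)[OF invX(1)] R'(8)[OF invariantD(2)[OF A(2)]] by (auto intro!: bexI[of _ 0])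
  qed
  then have "rep_iso G (twist \<chi> (quot_rep (sub ?P) ?E)) (quot_rep (sub ?X) ?Y)"
    by (rule twisted_rel_imp_iso) (fact P' invX)+
  moreover have "composition_series G (sub ?E) m F'"
    by (rule series_imp_composition_series[OF P'(2) F'(1)])
  ultimately have "JH_factor G (twist \<chi> (quot_rep (sub ?P) ?E)) (sub ?E)"
    unfolding JH_factor_def using F'(2-4) by (intro exI[of _ m] exI[of _ F'] conjI exI[of _ k]) (simp_all add: restrict_sub)
  then show False using free(2)[OF i(1)] by blast
qed

end

section \<open>The cocycle of an equivariant map\<close>

text \<open>Regard the space as a vector space over the field with p elements, take a linear
  functional that is 0 on D and 1 at w0, and use its values as exponents of \<zeta>. Such characters
  turn vector-valued homomorphisms into the characters of exponent p handled by Kummer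
  theory.\<close>

lemma exists_character:
  fixes scale :: "'f::field \<Rightarrow> 'w::ab_group_add \<Rightarrow> 'w" and \<zeta> :: "'a::field"
  assumes vs: "vector_space scale" and char: "of_nat CARD('p::prime_card) = (0 :: 'f)"
    and D: "module.subspace scale D" and w0: "w0 \<notin> D" and \<zeta>: "\<zeta> ^ CARD('p) = 1"
  obtains \<psi> :: "'w \<Rightarrow> 'a" where "\<And>x y. \<psi> (x + y) = \<psi> x * \<psi> y" "\<And>x. \<psi> x ^ CARD('p) = 1"
    "\<And>x. x \<in> D \<Longrightarrow> \<psi> x = 1" "\<psi> w0 = \<zeta>"
proof -
  interpret W: vector_space scale by (rule vs)
  let ?p = "CARD('p)"
  define e :: "'p mod_ring \<Rightarrow> 'f" where "e k = of_int (to_int_mod_ring k)" for k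
  have mod: "(of_int (k mod int ?p) :: 'f) = of_int k" for k
  proof -
    have "(of_int k :: 'f) = of_int (int ?p * (k div int ?p) + k mod int ?p)" by simp
    also have "\<dots> = of_nat ?p * of_int (k div int ?p) + of_int (k mod int ?p)"
      by (simp only: of_int_add of_int_mult of_int_of_nat_eq)
    also have "\<dots> = of_int (k mod int ?p)" unfolding char by simp
    finally show ?thesis ..
  qed
  have e_add: "e (k + l) = e k + e l" for k l
  proof -
    have "to_int_mod_ring (k + l) = (to_int_mod_ring k + to_int_mod_ring l) mod int ?p"
      by transfer (simp add: mod_simps)
    then show ?thesis unfolding e_def by (simp only: mod of_int_add)
  qed
  have e_mult: "e (k * l) = e k * e l" for k l
  proof -
    have "to_int_mod_ring (k * l) = (to_int_mod_ring k * to_int_mod_ring l) mod int ?p"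
      by transfer (simp add: mod_simps)
    then show ?thesis unfolding e_def by (simp only: mod of_int_mult)
  qed
  have e_1: "e 1 = 1" unfolding e_def by simp
  define sc where "sc k w = scale (e k) w" for k w
  have V: "vector_space sc"
    by unfold_locales
      (simp_all add: sc_def e_add e_mult e_1 W.scale_right_distrib W.scale_left_distrib)
  interpret V: vector_space sc by (rule V)
  interpret M: vector_space "(*) :: 'p mod_ring \<Rightarrow> 'p mod_ring \<Rightarrow> 'p mod_ring"
    by unfold_locales (simp_all add: algebra_simps)
  interpret VM: vector_space_pair sc "(*) :: 'p mod_ring \<Rightarrow> 'p mod_ring \<Rightarrow> 'p mod_ring" ..
  have D': "V.subspace D"
    using D unfolding V.subspace_def W.subspace_def sc_def by blast
  obtain B where B: "B \<subseteq> D" "V.independent B" "V.span B = D"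
    using V.basis_exists[of D] V.span_minimal[of _ D] D' by (metis subset_antisym)
  have "w0 \<notin> V.span B" using w0 B(3) by simp
  then have ind: "V.independent (insert w0 B)" using B(2) by (rule V.independent_insertI)
  obtain g where g: "Vector_Spaces.linear sc (*) g" "\<And>x. x \<in> insert w0 B \<Longrightarrow> g x = (if x = w0 then 1 else 0)"
    using VM.linear_independent_extend[OF ind, of "\<lambda>x. if x = w0 then 1 else 0"] by blast
  interpret g: Vector_Spaces.linear sc "(*)" g by (rule g(1))
  have gD: "g x = 0" if "x \<in> D" for x
  proof -
    have "g b = 0" if "b \<in> B" for b
      using g(2)[of b] that w0 B(1) by auto
    then show ?thesis
      using VM.linear_eq_0_on_span[OF g(1), of B x] that B(3) by blast
  qed
  define \<psi> where "\<psi> w = \<zeta> ^ nat (to_int_mod_ring (g w))" for w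
  have red: "\<zeta> ^ (n mod ?p) = \<zeta> ^ n" for n
  proof -
    have "\<zeta> ^ n = \<zeta> ^ (?p * (n div ?p) + n mod ?p)" by simp
    also have "\<dots> = (\<zeta> ^ ?p) ^ (n div ?p) * \<zeta> ^ (n mod ?p)" by (simp only: power_add power_mult)
    finally show ?thesis using \<zeta> by simp
  qed
  have nonneg: "0 \<le> to_int_mod_ring k" for k :: "'p mod_ring"
    by transfer simp
  show ?thesis
  proof (rule that[of \<psi>])
    fix x y
    have "to_int_mod_ring (g x + g y) = (to_int_mod_ring (g x) + to_int_mod_ring (g y)) mod int ?p"
      by transfer (simp add: mod_simps)
    then have "nat (to_int_mod_ring (g (x + y)))
        = (nat (to_int_mod_ring (g x)) + nat (to_int_mod_ring (g y))) mod ?p"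
      using nonneg by (simp add: g.add nat_mod_distrib nat_add_distrib)
    then show "\<psi> (x + y) = \<psi> x * \<psi> y"
      unfolding \<psi>_def by (simp only: red power_add)
    have "\<psi> x ^ ?p = (\<zeta> ^ ?p) ^ nat (to_int_mod_ring (g x))"
      unfolding \<psi>_def by (simp only: power_mult[symmetric] mult.commute)
    then show "\<psi> x ^ ?p = 1" using \<zeta> by simp
    show "\<psi> x = 1" if "x \<in> D" unfolding \<psi>_def gD[OF that] by simp
    show "\<psi> w0 = \<zeta>" unfolding \<psi>_def using g(2)[of w0] by simp
  qed
qed

text \<open>B witnesses continuity: its stabiliser acts trivially on both spaces and fixes the p-th
  roots of unity. The character \<chi> is tied to the action on \<zeta> by a common
  exponent.\<close>

locale rep_pair = valued_galois G Ov p \<pi> r +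
  V: group_rep G sV BV aV + W: group_rep G sW BW aW
  for G :: "('a::field \<Rightarrow> 'a) set" and Ov :: "'a set" and p :: nat and \<pi> :: 'a and r :: "nat \<Rightarrow> 'a"
    and sV :: "'f::field \<Rightarrow> 'v::ab_group_add \<Rightarrow> 'v" and BV and aV
    and sW :: "'f \<Rightarrow> 'w::ab_group_add \<Rightarrow> 'w" and BW and aW +
  fixes f :: "'v \<Rightarrow> 'w" and B :: "'a set" and \<zeta> :: 'a and \<chi> :: "('a \<Rightarrow> 'a) \<Rightarrow> 'f"
    and T :: "'p::prime_card itself"
  assumes p_card: "p = CARD('p)" and charF: "of_nat p = (0 :: 'f)"
    and f_add: "f (x + y) = f x + f y" and f_scale: "f (sV k x) = sW k (f x)"
    and f_H: "h \<in> H \<Longrightarrow> f (aV h x) = aW h (f x)"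
    and B: "finite B" "\<sigma> \<in> stab B \<Longrightarrow> aV \<sigma> x = x" "\<sigma> \<in> stab B \<Longrightarrow> aW \<sigma> w = w"
    and B_mu: "z ^ p = 1 \<Longrightarrow> z \<in> B"
    and \<zeta>: "\<zeta> ^ p = 1" "\<zeta> \<noteq> 1"
    and \<chi>: "g \<in> G \<Longrightarrow> \<exists>n. \<chi> g = of_nat n \<and> g \<zeta> = \<zeta> ^ n"
begin

lemma f_diff: "f (x - y) = f x - f y"
  using f_add[of "x - y" y] by simp

lemma f_zero: "f 0 = 0"
  using f_diff[of 0 0] by simp

lemma HG: "h \<in> H \<Longrightarrow> h \<in> G"
  unfolding H_def by blast

lemma finv_H: "h \<in> H \<Longrightarrow> finv h \<in> H"
  unfolding H_def using inv_in inv_simps(1) by (auto, metis inv_simps(1))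

text \<open>In this form, membership of the cocycle in an invariant subspace follows from that of
  the failure \<open>f (aV g x) - aW g (f x)\<close> of equivariance.\<close>

definition c :: "('a \<Rightarrow> 'a) \<Rightarrow> 'v \<Rightarrow> 'w" where
  "c g x = aW (finv g) (f (aV g x) - aW g (f x))"

lemma c_alt: "g \<in> G \<Longrightarrow> c g x = aW (finv g) (f (aV g x)) - f x"
  unfolding c_def by (simp add: W.ac_diff inv_in W.ac_inv)

lemma c_add: "g \<in> G \<Longrightarrow> c g (x + y) = c g x + c g y"
  by (simp add: c_alt V.ac_add W.ac_add inv_in f_add)

lemma c_diff: "g \<in> G \<Longrightarrow> c g (x - y) = c g x - c g y"
  using c_add[of g "x - y" y] by simp

lemma c_scale: "g \<in> G \<Longrightarrow> c g (sV k x) = sW k (c g x)"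
  by (simp add: c_alt V.ac_scale W.ac_scale inv_in f_scale W.scale_right_diff_distrib)

text \<open>The cocycle identity for the right action of G on linear maps by conjugation.\<close>

lemma c_comp:
  assumes "g \<in> G" "h \<in> G"
  shows "c (g \<circ> h) x = aW (finv h) (c g (aV h x)) + c h x"
  using assms by (simp add: c_alt comp_in inv_comp V.ac_comp W.ac_comp inv_in W.ac_diff)

lemma c_H: "h \<in> H \<Longrightarrow> c h x = 0"
  using HG[of h] by (simp add: c_alt f_H W.ac_inv)

lemma c_stab: "\<sigma> \<in> stab B \<Longrightarrow> c \<sigma> x = 0"
  using sgrpD(4,5)[OF sgrp_stab, of \<sigma> B] B(2,3) by (simp add: c_alt)

lemma finite_image_of_agreement:
  assumes "\<And>g h. g \<in> G \<Longrightarrow> h \<in> G \<Longrightarrow> finv g \<circ> h \<in> stab B \<Longrightarrow> \<phi> g = \<phi> h"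
  shows "finite {\<phi> g | g. g \<in> G}"
proof (rule finite_surj[OF finite_restrictions[OF B(1)]])
  show "{\<phi> g | g. g \<in> G} \<subseteq> (\<lambda>u. \<phi> (SOME g. g \<in> G \<and> restrict g B = u)) ` ((\<lambda>g. restrict g B) ` G)"
  proof clarify
    fix g assume g: "g \<in> G"
    let ?h = "SOME h. h \<in> G \<and> restrict h B = restrict g B"
    have h: "?h \<in> G \<and> restrict ?h B = restrict g B"
      by (rule someI[of _ g]) (use g in simp)
    have "g x = ?h x" if "x \<in> B" for x
      using fun_cong[OF conjunct2[OF h], of x] that by simp
    then have "finv g \<circ> ?h \<in> stab B" using g h by (intro agree_on_imp_inv_comp_stab) auto
    then have "\<phi> g = \<phi> ?h" using g h by (intro assms) auto
    then show "\<phi> g \<in> (\<lambda>u. \<phi> (SOME g. g \<in> G \<and> restrict g B = u)) ` ((\<lambda>g. restrict g B) ` G)"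
      using g by blast
  qed
qed

lemma finite_orbits: "finite {aV g x | g. g \<in> G}" "finite {aW g y | g. g \<in> G}"
proof -
  have "aV g x = aV h x \<and> aW g y = aW h y" if "g \<in> G" "h \<in> G" "finv g \<circ> h \<in> stab B" for g h
  proof -
    have "h = g \<circ> (finv g \<circ> h)" using that(1) by (simp add: comp_cancel)
    then have "aV h x = aV g (aV (finv g \<circ> h) x)" "aW h y = aW g (aW (finv g \<circ> h) y)"
      using V.ac_comp[of g "finv g \<circ> h"] W.ac_comp[of g "finv g \<circ> h"] that by (metis comp_in inv_in)+
    then show ?thesis using B(2,3)[OF that(3)] by simp
  qed
  then show "finite {aV g x | g. g \<in> G}" "finite {aW g y | g. g \<in> G}"
    by (intro finite_image_of_agreement; blast)+
qed

section \<open>The normal subgroup N and the tameness of its fixed field\<close>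

context
  fixes A A1 S D
  assumes irrV: "V.irr A A1" and irrW: "W.irr S D"
begin

lemmas A = V.irrD[OF irrV] and S = W.irrD[OF irrW]

definition N :: "('a \<Rightarrow> 'a) set" where
  "N = {g \<in> G. (\<forall>a\<in>A. aV g a - a \<in> A1) \<and> (\<forall>s\<in>S. aW g s - s \<in> D) \<and> (\<forall>z. z ^ p = 1 \<longrightarrow> g z = z)}"

lemma ND:
  assumes "g \<in> N"
  shows "g \<in> G" "\<And>a. a \<in> A \<Longrightarrow> aV g a - a \<in> A1" "\<And>s. s \<in> S \<Longrightarrow> aW g s - s \<in> D"
    "\<And>z. z ^ p = 1 \<Longrightarrow> g z = z"
  using assms unfolding N_def by blast+

lemma stab_N: "stab B \<subseteq> N"
proof
  fix g assume g: "g \<in> stab B"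
  then have "g \<in> G" "\<And>z. z \<in> B \<Longrightarrow> g z = z" unfolding stab_def by auto
  then show "g \<in> N"
    unfolding N_def using B(2,3)[OF g] B_mu V.invariantD(2)[OF A(2)] W.invariantD(2)[OF S(2)] by simp
qed

lemma sgrp_N: "sgrp N"
  unfolding sgrp_def
proof (intro conjI ballI)
  show "N \<subseteq> G" unfolding N_def by blast
  show "id \<in> N"
    unfolding N_def using id_in V.invariantD(2)[OF A(2)] W.invariantD(2)[OF S(2)]
    by (simp add: V.ac_id W.ac_id)
  show "g \<circ> h \<in> N" if "g \<in> N" "h \<in> N" for g h
  proof -
    note g = ND[OF that(1)] and h = ND[OF that(2)]
    have "aV (g \<circ> h) a - a \<in> A1" if a: "a \<in> A" for a
    proof -
      have "aV g (aV h a - a) + (aV g a - a) \<in> A1"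
        using V.invariantD(6)[OF A(2) g(1) h(2)[OF a]] g(2)[OF a] by (rule V.invariantD(3)[OF A(2)])
      then show ?thesis using g(1) h(1) by (simp add: V.ac_comp V.ac_diff)
    qed
    moreover have "aW (g \<circ> h) s - s \<in> D" if s: "s \<in> S" for s
    proof -
      have "aW g (aW h s - s) + (aW g s - s) \<in> D"
        using W.invariantD(6)[OF S(2) g(1) h(3)[OF s]] g(3)[OF s] by (rule W.invariantD(3)[OF S(2)])
      then show ?thesis using g(1) h(1) by (simp add: W.ac_comp W.ac_diff)
    qed
    moreover have "(g \<circ> h) z = z" if "z ^ p = 1" for z using g(4)[OF that] h(4)[OF that] by simp
    ultimately show ?thesis unfolding N_def using comp_in[OF g(1) h(1)] by blast
  qed
  show "finv g \<in> N" if "g \<in> N" for g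
  proof -
    note g = ND[OF that]
    note g' = inv_in[OF g(1)]
    have "aV (finv g) a - a \<in> A1" if a: "a \<in> A" for a
    proof -
      have "aV (finv g) (- (aV g a - a)) \<in> A1"
        by (intro V.invariantD(6)[OF A(2) g'] V.invariantD(7)[OF A(2)] g(2) a)
      then show ?thesis using g(1) g' by (simp add: V.ac_diff V.ac_inv)
    qed
    moreover have "aW (finv g) s - s \<in> D" if s: "s \<in> S" for s
    proof -
      have "aW (finv g) (- (aW g s - s)) \<in> D"
        by (intro W.invariantD(6)[OF S(2) g'] W.invariantD(7)[OF S(2)] g(3) s)
      then show ?thesis using g(1) g' by (simp add: W.ac_diff W.ac_inv)
    qed
    moreover have "finv g z = z" if "z ^ p = 1" for z using g(4)[OF that] inv_simps(1)[OF g(1), of z] by simp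
    ultimately show ?thesis unfolding N_def using g' by blast
  qed
qed

lemma open_N: "open_sgrp N"
  by (rule open_sgrp_mono[OF open_stab[OF B(1)] stab_N sgrp_N])

lemma normal_N: "normal N"
  unfolding normal_def
proof (intro ballI)
  fix g n assume g: "g \<in> G" and "n \<in> N"
  note n = ND[OF \<open>n \<in> N\<close>]
  note g' = inv_in[OF g]
  have "aV (finv g \<circ> n \<circ> g) a - a \<in> A1" if a: "a \<in> A" for a
  proof -
    have "aV (finv g) (aV n (aV g a) - aV g a) \<in> A1"
      by (intro V.invariantD(6)[OF A(2) g'] n(2) V.invariantD(6)[OF A(1) g] a)
    then show ?thesis using g g' n(1) by (simp add: V.ac_comp V.ac_diff V.ac_inv comp_in)
  qed
  moreover have "aW (finv g \<circ> n \<circ> g) s - s \<in> D" if s: "s \<in> S" for s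
  proof -
    have "aW (finv g) (aW n (aW g s) - aW g s) \<in> D"
      by (intro W.invariantD(6)[OF S(2) g'] n(3) W.invariantD(6)[OF S(1) g] s)
    then show ?thesis using g g' n(1) by (simp add: W.ac_comp W.ac_diff W.ac_inv comp_in)
  qed
  moreover have "(finv g \<circ> n \<circ> g) z = z" if "z ^ p = 1" for z
  proof -
    have "g z ^ p = 1" using that g by (simp add: hom_simps flip: hom_simps(9))
    then show ?thesis using n(4) g by simp
  qed
  ultimately show "finv g \<circ> n \<circ> g \<in> N"
    unfolding N_def using comp_in[OF comp_in[OF g' n(1)] g] by blast
qed

lemma wild_conj:
  assumes "g \<in> G" "\<sigma> \<in> wild N"
  shows "finv g \<circ> \<sigma> \<circ> g \<in> wild N"
proof -
  have \<sigma>: "\<sigma> \<in> G" using assms(2) unfolding wild_def by blast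
  note g' = inv_in[OF assms(1)]
  have "(finv g \<circ> \<sigma> \<circ> g) x / x - 1 \<in> mx" if x: "x \<in> fixed N" "x \<noteq> 0" for x
  proof -
    have "g x \<in> fixed N" "g x \<noteq> 0"
      using fixed_normal[OF normal_N sgrpD(1)[OF sgrp_N] assms(1) x(1)] x(2) assms(1)
      by (simp_all add: hom_simps)
    then have "finv g (\<sigma> (g x) / g x - 1) \<in> mx"
      using assms(2) unfolding wild_def by (intro G_mx[OF g']) blast
    then show ?thesis using assms(1) g' by (simp add: hom_simps)
  qed
  then show ?thesis unfolding wild_def using comp_in[OF comp_in[OF g' \<sigma>] assms(1)] by blast
qed

text \<open>The nontrivial p-th roots of unity number at least one and fewer than p, so wild
  inertia, a p-group modulo N, fixes one of them, and its powers are all the others.\<close>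

lemma wild_fixes_mu:
  assumes "\<sigma> \<in> wild N" "z ^ p = 1"
  shows "\<sigma> z = z"
proof -
  have WG: "\<tau> \<in> G" if "\<tau> \<in> wild N" for \<tau> using that unfolding wild_def by blast
  define \<Omega> where "\<Omega> = {y :: 'a. y ^ p = 1} - {1}"
  have p0: "p > 0" using prime_gt_0_nat[OF p] .
  have fin: "finite {y :: 'a. y ^ p = 1}" by (rule finite_roots(1)[OF p0])
  have "(1 :: 'a) \<in> {y. y ^ p = 1}" by simp
  then have "card \<Omega> < p"
    using finite_roots(2)[OF p0, of 1] card_Diff1_less[OF fin, of 1] unfolding \<Omega>_def by linarith
  moreover have "card \<Omega> > 0"
  proof -
    have "finite \<Omega>" "\<zeta> \<in> \<Omega>" unfolding \<Omega>_def using fin \<zeta> by simp_all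
    then show ?thesis by (auto simp: card_gt_0_iff)
  qed
  ultimately have ndvd: "\<not> p dvd card \<Omega>" using dvd_imp_le by fastforce
  have "\<exists>y\<in>\<Omega>. \<forall>\<tau>\<in>wild N. \<tau> y = y"
  proof (rule ccontr)
    assume "\<not> ?thesis"
    then have free: "\<exists>\<tau>\<in>wild N. \<tau> y \<noteq> y" if "y \<in> \<Omega>" for y using that by blast
    have "p dvd card \<Omega>"
    proof (rule fixed_point_free_p_group[OF p _ id_wild wild_comp _ _ free])
      show "finite \<Omega>" unfolding \<Omega>_def using fin by blast
      show "\<tau> y \<in> \<Omega>" if "\<tau> \<in> wild N" "y \<in> \<Omega>" for \<tau> y
        using that WG[OF that(1)] unfolding \<Omega>_def
        by (auto simp: hom_simps simp flip: hom_simps(9)) (metis hom_simps(2,14))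
      show "\<exists>a. \<forall>y\<in>\<Omega>. (\<tau> ^^ p ^ a) y = y" if \<tau>: "\<tau> \<in> wild N" for \<tau>
      proof -
        obtain a where "\<tau> ^^ (p ^ a) \<in> N" using wild_p_power[OF open_N normal_N \<tau>] .
        then show ?thesis using ND(4) unfolding \<Omega>_def by blast
      qed
    qed
    then show False using ndvd by blast
  qed
  then obtain y where y: "y ^ p = 1" "y \<noteq> 1" "\<forall>\<tau>\<in>wild N. \<tau> y = y" unfolding \<Omega>_def by blast
  obtain i where "z = y ^ i" using roots_of_unity_powers[OF y(1,2) assms(2)] .
  moreover have "\<sigma> y = y" using y(3) assms(1) by blast
  ultimately show ?thesis using WG[OF assms(1)] by (simp add: hom_simps)
qed

lemma wild_N: "wild N \<subseteq> N"
proof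
  fix \<sigma> assume \<sigma>: "\<sigma> \<in> wild N"
  have WG: "wild N \<subseteq> G" unfolding wild_def by blast
  have "aV \<sigma> a - a \<in> A1" if a: "a \<in> A" for a
  proof (rule V.normal_p_subgroup_trivial[OF irrV p charF finite_orbits(1) WG id_wild wild_comp wild_conj _ \<sigma> a])
    show "\<exists>b. \<forall>x\<in>A. aV (\<tau> ^^ p ^ b) x - x \<in> A1" if "\<tau> \<in> wild N" for \<tau>
      using wild_p_power[OF open_N normal_N that] ND(2) by metis
  qed
  moreover have "aW \<sigma> s - s \<in> D" if s: "s \<in> S" for s
  proof (rule W.normal_p_subgroup_trivial[OF irrW p charF finite_orbits(2) WG id_wild wild_comp wild_conj _ \<sigma> s])
    show "\<exists>b. \<forall>x\<in>S. aW (\<tau> ^^ p ^ b) x - x \<in> D" if "\<tau> \<in> wild N" for \<tau>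
      using wild_p_power[OF open_N normal_N that] ND(3) by metis
  qed
  ultimately show "\<sigma> \<in> N" unfolding N_def using \<sigma> WG wild_fixes_mu[OF \<sigma>] by blast
qed

lemma tame_N: "tame N"
  by (rule tame_if_wild_trivial[OF open_N normal_N wild_N])

lemma decompose:
  assumes "g \<in> G"
  obtains h n where "h \<in> H" "n \<in> N" "g = h \<circ> n"
proof -
  obtain h where h: "h \<in> H" "finv g \<circ> h \<in> N"
    using G_eq_HN[OF open_N normal_N tame_N assms] .
  have "finv (finv g \<circ> h) = finv h \<circ> g"
    using assms HG[OF h(1)] by (simp add: inv_comp inv_in)
  then have "finv h \<circ> g \<in> N" using sgrpD(4)[OF sgrp_N h(2)] by simp
  moreover have "g = h \<circ> (finv h \<circ> g)" using HG[OF h(1)] by (simp add: comp_cancel)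
  ultimately show ?thesis using h(1) that by blast
qed

text \<open>Here f induces a map from A / A1 to S / D, on both of which N acts trivially, so
  equivariance under H passes to G = H N. This excludes later that f carries A into S.\<close>

lemma irreducible_equivariant:
  assumes fS: "\<And>a. a \<in> A \<Longrightarrow> f a \<in> S" "\<And>a. a \<in> A1 \<Longrightarrow> f a \<in> D" and g: "g \<in> G" and a: "a \<in> A"
  shows "f (aV g a) - aW g (f a) \<in> D"
proof -
  obtain h n where hn: "h \<in> H" "n \<in> N" "g = h \<circ> n" using decompose[OF g] .
  note n = ND[OF hn(2)] and h = HG[OF hn(1)]
  have "aW h (f (aV n a - a)) - aW h (aW n (f a) - f a) \<in> D"
    by (intro W.invariantD(4)[OF S(2)] W.invariantD(6)[OF S(2) h] fS(2) n(2,3) fS(1) a)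
  moreover have "f (aV g a) = aW h (f (aV n a))" "aW g (f a) = aW h (aW n (f a))"
    unfolding hn(3) using h n(1) f_H[OF hn(1)] by (simp_all add: V.ac_comp W.ac_comp)
  ultimately show ?thesis using h by (simp add: f_diff W.ac_diff)
qed

section \<open>The cocycle on N and the map it determines\<close>

context
  assumes \<delta>S: "\<And>g a. g \<in> G \<Longrightarrow> a \<in> A \<Longrightarrow> f (aV g a) - aW g (f a) \<in> S"
    and \<delta>D: "\<And>g a. g \<in> G \<Longrightarrow> a \<in> A1 \<Longrightarrow> f (aV g a) - aW g (f a) \<in> D"
begin

lemma c_mem: "g \<in> G \<Longrightarrow> a \<in> A \<Longrightarrow> c g a \<in> S" "g \<in> G \<Longrightarrow> a \<in> A1 \<Longrightarrow> c g a \<in> D"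
  unfolding c_def using W.invariantD(6)[OF S(1)] W.invariantD(6)[OF S(2)] inv_in \<delta>S \<delta>D by blast+

text \<open>N acts trivially on A / A1 and on S / D, so modulo D the conjugation in the cocycle
  identity disappears as soon as the second factor is in N.\<close>

lemma c_N_comp:
  assumes "\<sigma> \<in> G" "\<tau> \<in> N" "x \<in> A"
  shows "c (\<sigma> \<circ> \<tau>) x - (c \<sigma> x + c \<tau> x) \<in> D"
proof -
  note \<tau> = ND[OF assms(2)] and \<tau>' = ND[OF sgrpD(4)[OF sgrp_N assms(2)]]
  have "aV \<tau> x \<in> A" using V.invariantD(6)[OF A(1) \<tau>(1) assms(3)] .
  then have "(aW (finv \<tau>) (c \<sigma> (aV \<tau> x)) - c \<sigma> (aV \<tau> x)) + c \<sigma> (aV \<tau> x - x) \<in> D"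
    by (intro W.invariantD(3)[OF S(2)] \<tau>'(3) c_mem assms(1) \<tau>(2) assms(3))
  then show ?thesis using assms(1) \<tau>(1) by (simp add: c_comp c_diff algebra_simps)
qed

text \<open>A value outside D would be detected by a character of the space that is trivial on D.
  Composed with the cocycle it is a character of N of exponent p, trivial on elements of H, hence
  trivial on the stabiliser of \<open>r 1\<close>.\<close>

lemma c_trivial_on_stabiliser:
  assumes "\<tau> \<in> N" "\<tau> (r 1) = r 1" and x: "x \<in> A"
  shows "c \<tau> x \<in> D"
proof (rule ccontr)
  assume nD: "c \<tau> x \<notin> D"
  obtain \<psi> :: "'w \<Rightarrow> 'a" where \<psi>: "\<And>x y. \<psi> (x + y) = \<psi> x * \<psi> y" "\<And>x. \<psi> x ^ p = 1"
    "\<And>x. x \<in> D \<Longrightarrow> \<psi> x = 1" "\<psi> (c \<tau> x) = \<zeta>"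
    using exists_character[where ?'p = 'p, OF W.vector_space_axioms _ W.invariantD(1)[OF S(2)] nD, of \<zeta>]
      charF \<zeta>(1) unfolding p_card by blast
  have "\<psi> (c \<tau> x) = 1"
  proof (rule character_trivial[OF open_N tame_N _ B(1) stab_N, of "\<lambda>\<sigma>. \<psi> (c \<sigma> x)"])
    show "\<sigma> z = z" if "\<sigma> \<in> N" "z ^ p = 1" for \<sigma> z using ND(4)[OF that] .
    show "\<psi> (c \<sigma> x) ^ p = 1" for \<sigma> by (rule \<psi>(2))
    show "\<psi> (c (\<sigma> \<circ> \<upsilon>) x) = \<psi> (c \<sigma> x) * \<psi> (c \<upsilon> x)" if "\<sigma> \<in> N" "\<upsilon> \<in> N" for \<sigma> \<upsilon>
    proof -
      let ?d = "c (\<sigma> \<circ> \<upsilon>) x - (c \<sigma> x + c \<upsilon> x)"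
      have "\<psi> (?d + (c \<sigma> x + c \<upsilon> x)) = \<psi> (c \<sigma> x) * \<psi> (c \<upsilon> x)"
        unfolding \<psi>(1) using \<psi>(3)[OF c_N_comp[OF ND(1)[OF that(1)] that(2) x]] by simp
      then show ?thesis by simp
    qed
    show "\<psi> (c \<sigma> x) = 1" if "\<sigma> \<in> stab B" for \<sigma>
      using c_stab[OF that] \<psi>(3) W.invariantD(2)[OF S(2)] by simp
    show "\<psi> (c \<sigma> x) = 1" if "\<sigma> \<in> H" for \<sigma>
      using c_H[OF that] \<psi>(3) W.invariantD(2)[OF S(2)] by simp
  qed (fact assms)+
  then show False using \<psi>(4) \<zeta>(2) by simp
qed

text \<open>The map \<xi> is the cocycle at some \<tau> in N multiplying \<open>r 1\<close> by
  \<zeta>. On N the cocycle modulo D depends only on the effect on \<open>r 1\<close>, so its values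
  are multiples of \<xi>; irreducibility of both factors makes \<xi> an isomorphism between
  them.\<close>

lemma twisting_map:
  assumes not_D: "g0 \<in> G" "a0 \<in> A" "f (aV g0 a0) - aW g0 (f a0) \<notin> D"
  obtains \<xi> where "\<And>x y. \<xi> (x + y) = \<xi> x + \<xi> y" "\<And>k x. \<xi> (sV k x) = sW k (\<xi> x)"
    "\<And>a. a \<in> A \<Longrightarrow> \<xi> a \<in> S" "\<And>a. a \<in> A \<Longrightarrow> \<xi> a \<in> D \<longleftrightarrow> a \<in> A1"
    "\<And>s. s \<in> S \<Longrightarrow> \<exists>a\<in>A. s - \<xi> a \<in> D"
    "\<And>g a. g \<in> G \<Longrightarrow> a \<in> A \<Longrightarrow> \<xi> (sV (\<chi> g) (aV g a)) - aW g (\<xi> a) \<in> D"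
proof -
  have "(\<zeta> * r 1) ^ (p ^ 1) = \<pi>"
    using \<zeta>(1) r_power_pi[of 1] by (simp add: power_mult_distrib)
  then obtain \<tau> where \<tau>: "\<tau> \<in> N" "\<tau> (r 1) = \<zeta> * r 1"
    using transitive_on_roots[OF open_N tame_N] by metis
  note \<tau>G = ND(1)[OF \<tau>(1)]
  define \<xi> where "\<xi> = c \<tau>"
  have \<xi>_add: "\<xi> (x + y) = \<xi> x + \<xi> y" for x y unfolding \<xi>_def by (rule c_add[OF \<tau>G])
  have \<xi>_diff: "\<xi> (x - y) = \<xi> x - \<xi> y" for x y unfolding \<xi>_def by (rule c_diff[OF \<tau>G])
  have \<xi>_scale: "\<xi> (sV k x) = sW k (\<xi> x)" for k x unfolding \<xi>_def by (rule c_scale[OF \<tau>G])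
  have \<xi>_mem: "\<xi> a \<in> S" if "a \<in> A" for a unfolding \<xi>_def by (rule c_mem(1)[OF \<tau>G that])
  have \<xi>_mem': "\<xi> a \<in> D" if "a \<in> A1" for a unfolding \<xi>_def by (rule c_mem(2)[OF \<tau>G that])
  note Dcl = W.invariantD[OF S(2)]
  have pow: "\<tau> ^^ n \<in> N" "(\<tau> ^^ n) (r 1) = \<zeta> ^ n * r 1"
    "a \<in> A \<Longrightarrow> c (\<tau> ^^ n) a - sW (of_nat n) (\<xi> a) \<in> D" for n a
  proof -
    show N: "\<tau> ^^ n \<in> N" for n by (rule sgrp_funpow[OF sgrp_N \<tau>(1)])
    show "(\<tau> ^^ n) (r 1) = \<zeta> ^ n * r 1"
    proof (induction n)
      case (Suc n)
      have "(\<tau> ^^ Suc n) (r 1) = \<tau> (\<zeta> ^ n * r 1)" using Suc by simp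
      also have "\<dots> = \<zeta> ^ Suc n * r 1"
        using ND(4)[OF \<tau>(1) \<zeta>(1)] \<tau>(2) \<tau>G by (simp add: hom_simps)
      finally show ?case .
    qed simp
    show "c (\<tau> ^^ n) a - sW (of_nat n) (\<xi> a) \<in> D" if a: "a \<in> A"
    proof (induction n)
      case 0
      then show ?case using c_stab[of id a] sgrpD(2)[OF sgrp_stab] Dcl(2) by (simp add: id_def[symmetric])
    next
      case (Suc n)
      have *: "(c (\<tau> \<circ> \<tau> ^^ n) a - (c \<tau> a + c (\<tau> ^^ n) a)) + (c (\<tau> ^^ n) a - sW (of_nat n) (\<xi> a)) \<in> D"
        by (intro Dcl(3) c_N_comp \<tau>G N a Suc)
      have **: "(c (\<tau> \<circ> \<tau> ^^ n) a - (c \<tau> a + c (\<tau> ^^ n) a)) + (c (\<tau> ^^ n) a - sW (of_nat n) (\<xi> a))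
          = c (\<tau> ^^ Suc n) a - sW (of_nat (Suc n)) (\<xi> a)"
        by (simp add: \<xi>_def W.scale_left_distrib algebra_simps)
      show ?case using * unfolding ** .
    qed
  qed
  have c_N: "c \<sigma> a - sW (of_nat n) (\<xi> a) \<in> D" if \<sigma>: "\<sigma> \<in> N" "\<sigma> (r 1) = \<zeta> ^ n * r 1" and a: "a \<in> A" for \<sigma> n a
  proof -
    let ?\<tau> = "\<tau> ^^ n"
    have G: "?\<tau> \<in> G" "\<sigma> \<in> G" using pow(1) \<sigma>(1) ND(1) by auto
    have N: "finv ?\<tau> \<circ> \<sigma> \<in> N" using sgrpD(3,4)[OF sgrp_N] pow(1) \<sigma>(1) by blast
    have "(finv ?\<tau> \<circ> \<sigma>) (r 1) = r 1"
      unfolding comp_apply \<sigma>(2) pow(2)[symmetric] using G(1) by simp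
    then have "c (finv ?\<tau> \<circ> \<sigma>) a \<in> D" using c_trivial_on_stabiliser[OF N _ a] by blast
    moreover have "c (?\<tau> \<circ> (finv ?\<tau> \<circ> \<sigma>)) a - (c ?\<tau> a + c (finv ?\<tau> \<circ> \<sigma>) a) \<in> D"
      by (rule c_N_comp[OF G(1) N a])
    ultimately have "(c (?\<tau> \<circ> (finv ?\<tau> \<circ> \<sigma>)) a - (c ?\<tau> a + c (finv ?\<tau> \<circ> \<sigma>) a))
        + c (finv ?\<tau> \<circ> \<sigma>) a + (c ?\<tau> a - sW (of_nat n) (\<xi> a)) \<in> D"
      using pow(3)[OF a] by (intro Dcl(3))
    then show ?thesis using G(1) by (simp add: comp_cancel algebra_simps)
  qed
  have twist_H: "\<xi> (sV (of_nat n) (aV h a)) - aW h (\<xi> a) \<in> D"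
    if h: "h \<in> H" "h \<zeta> = \<zeta> ^ n" and a: "a \<in> A" for h n a
  proof -
    have G: "h \<in> G" "finv h \<in> G" using HG[OF h(1)] inv_in by auto
    have "h (r 1) = r 1" "finv h (r 1) = r 1" using h(1) finv_H[OF h(1)] unfolding H_def by blast+
    then have "(h \<circ> \<tau> \<circ> finv h) (r 1) = \<zeta> ^ n * r 1"
      using \<tau>(2) h(2) G by (simp add: hom_simps)
    moreover have "h \<circ> \<tau> \<circ> finv h \<in> N"
      using normal_N G(2) \<tau>(1) inv_simps(5)[OF G(1)] unfolding normal_def by metis
    moreover have ha: "aV h a \<in> A" using V.invariantD(6)[OF A(1) G(1) a] .
    ultimately have "c (h \<circ> \<tau> \<circ> finv h) (aV h a) - sW (of_nat n) (\<xi> (aV h a)) \<in> D"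
      using c_N by blast
    \<comment> \<open>The cocycle at the conjugate of \<tau> is evaluated twice: by its effect on
      \<open>r 1\<close> it is n times \<xi>, and by the cocycle identity, as c vanishes on H, it is
      a conjugate of \<xi>.\<close>
    moreover have "c (h \<circ> \<tau> \<circ> finv h) (aV h a) = aW h (\<xi> a)"
      using G \<tau>G by (simp add: c_comp comp_in V.ac_inv c_H[OF h(1)] c_H[OF finv_H[OF h(1)]] \<xi>_def W.ac_zero inv_in)
    ultimately have "aW h (\<xi> a) - \<xi> (sV (of_nat n) (aV h a)) \<in> D"
      by (simp add: \<xi>_scale)
    then show ?thesis using Dcl(7) by fastforce
  qed
  have twist: "\<xi> (sV (\<chi> g) (aV g a)) - aW g (\<xi> a) \<in> D" if g: "g \<in> G" and a: "a \<in> A" for g a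
  proof -
    obtain h n where hn: "h \<in> H" "n \<in> N" "g = h \<circ> n" using decompose[OF g] .
    note n = ND[OF hn(2)] and h = HG[OF hn(1)]
    obtain m where m: "\<chi> g = of_nat m" "g \<zeta> = \<zeta> ^ m" using \<chi>[OF g] by blast
    then have "h \<zeta> = \<zeta> ^ m" using n(4)[OF \<zeta>(1)] unfolding hn(3) by simp
    then have 1: "\<xi> (sV (of_nat m) (aV h a)) - aW h (\<xi> a) \<in> D" by (rule twist_H[OF hn(1) _ a])
    have "aV h (aV n a - a) \<in> A1" using V.invariantD(6)[OF A(2) h n(2)[OF a]] .
    then have 2: "\<xi> (sV (of_nat m) (aV h (aV n a - a))) \<in> D"
      by (intro \<xi>_mem' V.invariantD(5)[OF A(2)])
    have 3: "aW h (aW n (\<xi> a) - \<xi> a) \<in> D"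
      using W.invariantD(6)[OF S(2) h n(3)[OF \<xi>_mem[OF a]]] .
    have "(\<xi> (sV (of_nat m) (aV h a)) - aW h (\<xi> a)) + \<xi> (sV (of_nat m) (aV h (aV n a - a)))
        - aW h (aW n (\<xi> a) - \<xi> a) \<in> D"
      by (rule Dcl(4)[OF Dcl(3)[OF 1 2] 3])
    moreover have "aV g a = aV h (aV n a)" "aW g (\<xi> a) = aW h (aW n (\<xi> a))"
      unfolding hn(3) using h n(1) by (simp_all add: V.ac_comp W.ac_comp)
    ultimately show ?thesis
      unfolding m(1) using h
      by (simp add: V.ac_diff W.ac_diff \<xi>_scale \<xi>_diff W.scale_right_diff_distrib)
  qed
  have twist_D: "\<xi> (aV g a) \<in> D" if g: "g \<in> G" and a: "a \<in> A" "\<xi> a \<in> D" for g a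
  proof -
    obtain m where m: "\<chi> g = of_nat m" "g \<zeta> = \<zeta> ^ m" using \<chi>[OF g] by blast
    have "sW (\<chi> g) (\<xi> (aV g a)) = (\<xi> (sV (\<chi> g) (aV g a)) - aW g (\<xi> a)) + aW g (\<xi> a)"
      by (simp add: \<xi>_scale)
    also have "\<dots> \<in> D" using twist[OF g a(1)] Dcl(6)[OF g a(2)] by (rule Dcl(3))
    finally have *: "sW (\<chi> g) (\<xi> (aV g a)) \<in> D" .
    \<comment> \<open>If p divided m, then g would send \<zeta> to 1; so m is invertible modulo p,
      and with it \<chi> g.\<close>
    have "\<chi> g \<noteq> 0"
    proof
      assume "\<chi> g = 0"
      have "\<not> p dvd m"
      proof
        assume "p dvd m"
        then have "g \<zeta> = 1" using m(2) \<zeta>(1) by (auto simp: power_mult)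
        then show False using \<zeta>(2) g by (metis hom_simps(2,14))
      qed
      then have "coprime m p" using prime_imp_coprime[OF p] coprime_commute by blast
      then obtain u v where uv: "m * u = p * v + 1"
        using bezout_nat[of m p] \<open>\<not> p dvd m\<close> by (metis coprime_imp_gcd_eq_1 dvd_0_right)
      have "(of_nat (m * u) :: 'f) = of_nat (p * v + 1)" unfolding uv ..
      then show False using \<open>\<chi> g = 0\<close> m(1) charF by simp
    qed
    then show ?thesis using Dcl(5)[OF *, of "inverse (\<chi> g)"] by simp
  qed
  \<comment> \<open>Schur's argument: the kernel and, further on, the image of \<xi> modulo D are
    invariant by twisted equivariance, so each is trivial or everything.\<close>
  let ?K = "{a \<in> A. \<xi> a \<in> D}"
  have "V.invariant ?K"
  proof (rule V.invariantI)
    show "0 \<in> ?K" using V.invariantD(2)[OF A(1)] V.invariantD(2)[OF A(2)] \<xi>_mem' by blast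
    show "x + y \<in> ?K" if "x \<in> ?K" "y \<in> ?K" for x y
      using that V.invariantD(3)[OF A(1)] Dcl(3) \<xi>_add by auto
    show "sV k x \<in> ?K" if "x \<in> ?K" for k x
      using that V.invariantD(5)[OF A(1)] Dcl(5) \<xi>_scale by auto
    show "aV g x \<in> ?K" if "g \<in> G" "x \<in> ?K" for g x
      using that V.invariantD(6)[OF A(1)] twist_D by blast
  qed
  moreover have "A1 \<subseteq> ?K" using \<xi>_mem' A(3) by blast
  ultimately have "?K = A1 \<or> ?K = A" using A(5) by blast
  moreover have "?K \<noteq> A"
  proof
    \<comment> \<open>If \<xi> vanished modulo D, so would the cocycle at the N-part of g0 and then
      at g0, against the choice of g0 and a0.\<close>
    assume KA: "?K = A"
    obtain h n where hn: "h \<in> H" "n \<in> N" "g0 = h \<circ> n" using decompose[OF not_D(1)] .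
    note n = ND[OF hn(2)] and h = HG[OF hn(1)]
    have "(n (r 1) / r 1) ^ p = 1"
    proof -
      have "n (r 1) ^ p = r 1 ^ p" using n(1) \<pi>(3) r_power_pi[of 1] by (simp flip: hom_simps(9))
      then show ?thesis using r_nonzero[of 1] by (simp add: power_divide)
    qed
    then obtain i where i: "n (r 1) / r 1 = \<zeta> ^ i" using roots_of_unity_powers[OF \<zeta>] by metis
    then have "n (r 1) = \<zeta> ^ i * r 1" using r_nonzero[of 1] by (metis nonzero_eq_divide_eq)
    then have "c n a0 - sW (of_nat i) (\<xi> a0) \<in> D" by (rule c_N[OF hn(2) _ not_D(2)])
    moreover have "\<xi> a0 \<in> D" using KA not_D(2) by blast
    ultimately have "(c n a0 - sW (of_nat i) (\<xi> a0)) + sW (of_nat i) (\<xi> a0) \<in> D"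
      using Dcl(3,5) by blast
    moreover have "c g0 a0 = c n a0"
      unfolding hn(3) using h n(1) c_H[OF hn(1)] inv_in by (simp add: c_comp W.ac_zero)
    ultimately have "c g0 a0 \<in> D" by simp
    then have "aW g0 (c g0 a0) \<in> D" by (rule Dcl(6)[OF not_D(1)])
    then show False using not_D(1,3) unfolding c_def by (simp add: W.ac_inv)
  qed
  ultimately have K: "?K = A1" by blast
  let ?I = "{s \<in> S. \<exists>a\<in>A. s - \<xi> a \<in> D}"
  have "W.invariant ?I"
  proof (rule W.invariantI)
    have "\<xi> 0 \<in> D" using \<xi>_mem' V.invariantD(2)[OF A(2)] by blast
    then have "0 - \<xi> 0 \<in> D" using Dcl(4)[OF Dcl(2)] by blast
    then show "0 \<in> ?I" using W.invariantD(2)[OF S(1)] V.invariantD(2)[OF A(1)] by blast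
    show "x + y \<in> ?I" if xy: "x \<in> ?I" "y \<in> ?I" for x y
    proof -
      obtain a b where ab: "a \<in> A" "x - \<xi> a \<in> D" "b \<in> A" "y - \<xi> b \<in> D" using xy by blast
      have "(x + y) - \<xi> (a + b) \<in> D" using Dcl(3)[OF ab(2,4)] by (simp add: \<xi>_add algebra_simps)
      then show ?thesis using xy W.invariantD(3)[OF S(1)] V.invariantD(3)[OF A(1) ab(1,3)] by blast
    qed
    show "sW k x \<in> ?I" if x: "x \<in> ?I" for k x
    proof -
      obtain a where a: "a \<in> A" "x - \<xi> a \<in> D" using x by blast
      have "sW k x - \<xi> (sV k a) \<in> D"
        using Dcl(5)[OF a(2), of k] by (simp add: \<xi>_scale W.scale_right_diff_distrib)
      then show ?thesis using x W.invariantD(5)[OF S(1)] V.invariantD(5)[OF A(1) a(1)] by blast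
    qed
    show "aW g x \<in> ?I" if g: "g \<in> G" and x: "x \<in> ?I" for g x
    proof -
      obtain a where a: "a \<in> A" "x - \<xi> a \<in> D" using x by blast
      have "aW g (x - \<xi> a) - (\<xi> (sV (\<chi> g) (aV g a)) - aW g (\<xi> a)) \<in> D"
        using Dcl(6)[OF g a(2)] twist[OF g a(1)] by (rule Dcl(4))
      then have "aW g x - \<xi> (sV (\<chi> g) (aV g a)) \<in> D" using g by (simp add: W.ac_diff)
      then show ?thesis
        using x W.invariantD(6)[OF S(1) g] V.invariantD(5)[OF A(1) V.invariantD(6)[OF A(1) g a(1)]] by blast
    qed
  qed
  moreover have "D \<subseteq> ?I"
  proof
    fix d assume d: "d \<in> D"
    have "d - \<xi> 0 \<in> D" using \<xi>_mem' V.invariantD(2)[OF A(2)] Dcl(4)[OF d] by blast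
    then show "d \<in> ?I" using d S(3) V.invariantD(2)[OF A(1)] by blast
  qed
  ultimately have "?I = D \<or> ?I = S" using S(5) by blast
  moreover have "?I \<noteq> D"
  proof
    assume ID: "?I = D"
    have "\<xi> a \<in> D" if a: "a \<in> A" for a
    proof -
      have "\<xi> a - \<xi> a \<in> D" using Dcl(2) by simp
      then have "\<xi> a \<in> ?I" using a \<xi>_mem by blast
      then show ?thesis using ID by blast
    qed
    then show False using K A(4) by blast
  qed
  ultimately have I: "?I = S" by blast
  show ?thesis
  proof (rule that[of \<xi>])
    show "\<xi> a \<in> D \<longleftrightarrow> a \<in> A1" if "a \<in> A" for a using K that by blast
    show "\<exists>a\<in>A. s - \<xi> a \<in> D" if "s \<in> S" for s using I that by blast
  qed (fact \<xi>_add \<xi>_scale \<xi>_mem twist)+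
qed

end

end

section \<open>The minimal counterexample\<close>

definition equivariant_mod :: "'v set \<Rightarrow> 'w set \<Rightarrow> bool" where
  "equivariant_mod A D \<longleftrightarrow> (\<forall>g\<in>G. \<forall>a\<in>A. f (aV g a) - aW g (f a) \<in> D)"

lemma minimal_counterexample:
  assumes "\<not> equivariant_mod UNIV {0}"
  obtains A D where "V.invariant A" "W.invariant D" "\<not> equivariant_mod A D"
    "\<And>A'. V.invariant A' \<Longrightarrow> A' \<subseteq> A \<Longrightarrow> A' \<noteq> A \<Longrightarrow> equivariant_mod A' D"
    "\<And>D'. W.invariant D' \<Longrightarrow> D \<subseteq> D' \<Longrightarrow> D' \<noteq> D \<Longrightarrow> equivariant_mod A D'"
proof -
  let ?P = "\<lambda>(A, D). V.invariant A \<and> W.invariant D \<and> \<not> equivariant_mod A D"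
  \<comment> \<open>Dimension of A plus codimension of D: shrinking A or enlarging D decreases it,
    so one minimum provides both extremal properties.\<close>
  let ?m = "\<lambda>(A, D). V.dim A + (W.dim UNIV - W.dim D)"
  have "?P (UNIV, {0})" using assms V.invariant_UNIV W.invariant_zero by simp
  then have "\<exists>x. ?P x \<and> (\<forall>y. ?P y \<longrightarrow> ?m x \<le> ?m y)" by (rule ex_has_least_nat)
  then obtain A D where P: "?P (A, D)" and min: "\<forall>y. ?P y \<longrightarrow> ?m (A, D) \<le> ?m y" by auto
  have inv: "V.invariant A" "W.invariant D" using P by auto
  show ?thesis
  proof (rule that[OF inv])
    show "\<not> equivariant_mod A D" using P by simp
    show "equivariant_mod A' D" if A': "V.invariant A'" "A' \<subseteq> A" "A' \<noteq> A" for A'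
    proof (rule ccontr)
      assume "\<not> equivariant_mod A' D"
      then have "?P (A', D)" using A' inv by simp
      from min[rule_format, OF this] have "V.dim A \<le> V.dim A'" by simp
      moreover have "V.dim A' < V.dim A" using A' inv by (intro V.dim_less) auto
      ultimately show False by simp
    qed
    show "equivariant_mod A D'" if D': "W.invariant D'" "D \<subseteq> D'" "D' \<noteq> D" for D'
    proof (rule ccontr)
      assume "\<not> equivariant_mod A D'"
      then have "?P (A, D')" using D' inv by simp
      from min[rule_format, OF this]
      have "W.dim UNIV - W.dim D \<le> W.dim UNIV - W.dim D'" by simp
      moreover have "W.dim D < W.dim D'" using D' inv by (intro W.dim_less) auto
      ultimately show False using W.dim_bound[of D'] by simp
    qed
  qed
qed

context
  fixes X C
  assumes X: "V.invariant X" and C: "W.invariant C"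
    and equi: "\<And>g a. g \<in> G \<Longrightarrow> a \<in> X \<Longrightarrow> f (aV g a) - aW g (f a) \<in> C"
begin

text \<open>Equivariance of f on X modulo C is enough for f to have invariant preimages here, and
  invariant images once C is added, although f itself need not be equivariant.\<close>

lemma invariant_preimage: "V.invariant {a \<in> X. f a \<in> C}"
proof (rule V.invariantI)
  note Xcl = V.invariantD[OF X] and Ccl = W.invariantD[OF C]
  show "0 \<in> {a \<in> X. f a \<in> C}" using Xcl(2) Ccl(2) by (simp add: f_zero)
  show "a + b \<in> {a \<in> X. f a \<in> C}" if "a \<in> {a \<in> X. f a \<in> C}" "b \<in> {a \<in> X. f a \<in> C}" for a b
    using that Xcl(3) Ccl(3) by (simp add: f_add)
  show "sV k a \<in> {a \<in> X. f a \<in> C}" if "a \<in> {a \<in> X. f a \<in> C}" for k a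
    using that Xcl(5) Ccl(5) by (simp add: f_scale)
  show "aV g a \<in> {a \<in> X. f a \<in> C}" if "g \<in> G" "a \<in> {a \<in> X. f a \<in> C}" for g a
    using that Xcl(6) Ccl(3)[OF Ccl(6)[OF that(1)] equi[OF that(1)], of "f a" a] by auto
qed

lemma invariant_image_plus: "W.invariant {c. \<exists>a\<in>X. c - f a \<in> C}"
proof (rule W.invariantI)
  note Xcl = V.invariantD[OF X] and Ccl = W.invariantD[OF C]
  show "0 \<in> {c. \<exists>a\<in>X. c - f a \<in> C}" using Xcl(2) Ccl(2) f_zero by (auto intro!: bexI[of _ 0])
  show "x + y \<in> {c. \<exists>a\<in>X. c - f a \<in> C}"
    if xy: "x \<in> {c. \<exists>a\<in>X. c - f a \<in> C}" "y \<in> {c. \<exists>a\<in>X. c - f a \<in> C}" for x y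
  proof -
    obtain a b where ab: "a \<in> X" "x - f a \<in> C" "b \<in> X" "y - f b \<in> C" using xy by blast
    have "(x + y) - f (a + b) \<in> C" using Ccl(3)[OF ab(2,4)] by (simp add: f_add algebra_simps)
    then show ?thesis using Xcl(3)[OF ab(1,3)] by blast
  qed
  show "sW k x \<in> {c. \<exists>a\<in>X. c - f a \<in> C}" if x: "x \<in> {c. \<exists>a\<in>X. c - f a \<in> C}" for k x
  proof -
    obtain a where a: "a \<in> X" "x - f a \<in> C" using x by blast
    have "sW k x - f (sV k a) \<in> C"
      using Ccl(5)[OF a(2), of k] by (simp add: f_scale W.scale_right_diff_distrib)
    then show ?thesis using Xcl(5)[OF a(1)] by blast
  qed
  show "aW g x \<in> {c. \<exists>a\<in>X. c - f a \<in> C}" if g: "g \<in> G" and x: "x \<in> {c. \<exists>a\<in>X. c - f a \<in> C}" for g x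
  proof -
    obtain a where a: "a \<in> X" "x - f a \<in> C" using x by blast
    have "aW g (x - f a) - (f (aV g a) - aW g (f a)) \<in> C"
      by (rule Ccl(4)[OF Ccl(6)[OF g a(2)] equi[OF g a(1)]])
    then have "aW g x - f (aV g a) \<in> C" using g by (simp add: W.ac_diff algebra_simps)
    then show ?thesis using Xcl(6)[OF g a(1)] by blast
  qed
qed

end

theorem equivariant:
  assumes V_free: "composition_series G (V.sub UNIV) n F"
      "\<And>i. i < n \<Longrightarrow> \<not> JH_factor G (twist \<chi> (quot_rep (V.sub (F i)) (F (Suc i)))) (V.sub (F (Suc i)))"
    and W_free: "composition_series G (W.sub UNIV) m E"
      "\<And>i. i < m \<Longrightarrow> \<not> JH_factor G (twist \<chi> (quot_rep (W.sub (E i)) (E (Suc i)))) (W.sub (E (Suc i)))"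
    and g: "g \<in> G"
  shows "f (aV g x) = aW g (f x)"
proof (rule ccontr)
  assume "f (aV g x) \<noteq> aW g (f x)"
  then have "\<not> equivariant_mod UNIV {0}" unfolding equivariant_mod_def using g by auto
  then obtain A D where inv: "V.invariant A" "W.invariant D" and not: "\<not> equivariant_mod A D"
    and minA: "\<And>A'. V.invariant A' \<Longrightarrow> A' \<subseteq> A \<Longrightarrow> A' \<noteq> A \<Longrightarrow> equivariant_mod A' D"
    and maxD: "\<And>D'. W.invariant D' \<Longrightarrow> D \<subseteq> D' \<Longrightarrow> D' \<noteq> D \<Longrightarrow> equivariant_mod A D'"
    using minimal_counterexample by blast
  note Acl = V.invariantD[OF inv(1)] and Dcl = W.invariantD[OF inv(2)]
  define \<delta> where "\<delta> g a = f (aV g a) - aW g (f a)" for g a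
  have \<delta>_add: "\<delta> g (a + b) = \<delta> g a + \<delta> g b" if "g \<in> G" for g a b
    unfolding \<delta>_def using that by (simp add: V.ac_add W.ac_add f_add algebra_simps)
  have \<delta>_scale: "\<delta> g (sV k a) = sW k (\<delta> g a)" if "g \<in> G" for g k a
    unfolding \<delta>_def using that by (simp add: V.ac_scale W.ac_scale f_scale W.scale_right_diff_distrib)
  have equi: "equivariant_mod A' D' \<longleftrightarrow> (\<forall>g\<in>G. \<forall>a\<in>A'. \<delta> g a \<in> D')" for A' D'
    unfolding equivariant_mod_def \<delta>_def ..
  \<comment> \<open>The largest invariant subspace of A on which equivariance fails only by elements
    of D; quantifying over h makes it stable. By minimality of A it contains every proper invariant
    subspace.\<close>
  define A1 where "A1 = {a \<in> A. \<forall>g\<in>G. \<forall>h\<in>G. \<delta> g (aV h a) \<in> D}"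
  have A1: "V.invariant A1"
  proof (rule V.invariantI)
    show "0 \<in> A1" unfolding A1_def using Acl(2) Dcl(2)
      by (simp add: V.ac_zero \<delta>_def W.ac_zero f_zero)
    show "a + b \<in> A1" if "a \<in> A1" "b \<in> A1" for a b
      using that Acl(3) Dcl(3) unfolding A1_def by (simp add: V.ac_add \<delta>_add)
    show "sV k a \<in> A1" if "a \<in> A1" for k a
      using that Acl(5) Dcl(5) unfolding A1_def by (simp add: V.ac_scale \<delta>_scale)
    show "aV g a \<in> A1" if "g \<in> G" "a \<in> A1" for g a
      using that Acl(6) comp_in unfolding A1_def by (simp add: V.ac_comp[symmetric])
  qed
  have A1_sub: "A1 \<subseteq> A" unfolding A1_def by blast
  have \<delta>D: "\<delta> g a \<in> D" if "g \<in> G" "a \<in> A1" for g a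
  proof -
    have "\<delta> g (aV id a) \<in> D" using that id_in unfolding A1_def by blast
    then show ?thesis by (simp add: V.ac_id)
  qed
  have maxA: "C \<subseteq> A1" if C: "V.invariant C" "C \<subseteq> A" "C \<noteq> A" for C
    using minA[OF C] C V.invariantD(6)[OF C(1)] unfolding equi A1_def by blast
  have A1_neq: "A1 \<noteq> A" using \<delta>D not unfolding equi by blast
  have irrV: "V.irr A A1"
    unfolding V.irr_def using inv(1) A1 A1_sub A1_neq maxA by blast
  \<comment> \<open>By maximality of D the values of \<delta> on A lie in every invariant subspace
    strictly above D, so even the intersection of these is strictly above D.\<close>
  define S where "S = \<Inter>{D'. W.invariant D' \<and> D \<subseteq> D' \<and> D' \<noteq> D}"
  have S: "W.invariant S"
    by (rule W.invariantI) (auto simp: S_def intro: W.invariantD)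
  have DS: "D \<subseteq> S" unfolding S_def by blast
  have minS: "S \<subseteq> D'" if "W.invariant D'" "D \<subseteq> D'" "D' \<noteq> D" for D'
    unfolding S_def using that by blast
  have \<delta>S: "\<delta> g a \<in> S" if "g \<in> G" "a \<in> A" for g a
    unfolding S_def using maxD that unfolding equi by blast
  have S_neq: "S \<noteq> D" using \<delta>S not unfolding equi by blast
  have irrW: "W.irr S D"
    unfolding W.irr_def using S inv(2) DS S_neq minS by blast
  note Scl = W.invariantD[OF S] and A1cl = V.invariantD[OF A1]
  obtain g0 a0 where g0: "g0 \<in> G" "a0 \<in> A" "f (aV g0 a0) - aW g0 (f a0) \<notin> D"
    using not unfolding equivariant_mod_def by blast
  obtain \<xi> where \<xi>_add: "\<And>x y. \<xi> (x + y) = \<xi> x + \<xi> y" and \<xi>_scale: "\<And>k x. \<xi> (sV k x) = sW k (\<xi> x)"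
    and \<xi>S: "\<And>a. a \<in> A \<Longrightarrow> \<xi> a \<in> S" and \<xi>D: "\<And>a. a \<in> A \<Longrightarrow> \<xi> a \<in> D \<longleftrightarrow> a \<in> A1"
    and \<xi>_surj: "\<And>s. s \<in> S \<Longrightarrow> \<exists>a\<in>A. s - \<xi> a \<in> D"
    and \<xi>_twist: "\<And>g a. g \<in> G \<Longrightarrow> a \<in> A \<Longrightarrow> \<xi> (sV (\<chi> g) (aV g a)) - aW g (\<xi> a) \<in> D"
  proof (rule twisting_map[OF irrV irrW _ _ g0])
    show "f (aV g a) - aW g (f a) \<in> S" if "g \<in> G" "a \<in> A" for g a using \<delta>S[OF that] unfolding \<delta>_def .
    show "f (aV g a) - aW g (f a) \<in> D" if "g \<in> G" "a \<in> A1" for g a using \<delta>D[OF that] unfolding \<delta>_def .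
  qed (rule that)
  have \<xi>_0: "\<xi> 0 = 0" using \<xi>_add[of 0 0] by simp
  have f_ac: "f (aV g a) = aW g (f a) + \<delta> g a" for g a unfolding \<delta>_def by simp
  show False
  proof (cases "f ` A1 \<subseteq> D")
    case False
    let ?I = "\<lambda>X. {c. \<exists>a\<in>X. c - f a \<in> D}"
    have image: "W.invariant (?I X)" if "V.invariant X" "X \<subseteq> A1" for X
      using invariant_image_plus[OF that(1) inv(2)] \<delta>D that(2) unfolding \<delta>_def by blast
    have D_image: "D \<subseteq> ?I X" if "V.invariant X" for X
      using V.invariantD(2)[OF that] f_zero by (auto intro!: bexI[of _ 0])
    have "?I A1 \<noteq> D"
    proof
      assume eq: "?I A1 = D"
      have "f a \<in> ?I A1" if "a \<in> A1" for a using that Dcl(2) by (auto intro!: bexI[of _ a])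
      then show False using False unfolding eq by blast
    qed
    \<comment> \<open>On A1 the map f is equivariant modulo D, so the image of A1 together with D is
      an invariant subspace strictly above D and contains S.\<close>
    then have SfA1: "S \<subseteq> ?I A1" using minS[OF image[OF A1] D_image[OF A1]] by blast
    \<comment> \<open>With these preimages in A1, f induces an isomorphism from S' / B' to S /
      D.\<close>
    define S' where "S' = {a \<in> A1. f a \<in> S}"
    define B' where "B' = {a \<in> A1. f a \<in> D}"
    have preimage: "V.invariant {a \<in> A1. f a \<in> C}" if "W.invariant C" "D \<subseteq> C" for C
      using invariant_preimage[OF A1 that(1)] \<delta>D that(2) unfolding \<delta>_def by blast
    have lift: "\<exists>a\<in>S'. s - f a \<in> D" if s: "s \<in> S" for s
    proof -
      obtain a where a: "a \<in> A1" "s - f a \<in> D" using SfA1 s by blast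
      have "s - (s - f a) \<in> S" by (rule Scl(4)[OF s subsetD[OF DS a(2)]])
      then show ?thesis using a unfolding S'_def by auto
    qed
    have irrS': "V.irr S' B'"
      unfolding V.irr_def
    proof (intro conjI allI impI)
      show "V.invariant S'" unfolding S'_def by (rule preimage[OF S DS])
      show "V.invariant B'" unfolding B'_def by (rule preimage[OF inv(2)]) simp
      show "B' \<subseteq> S'" unfolding B'_def S'_def using DS by blast
      show "B' \<noteq> S'"
      proof
        assume BS: "B' = S'"
        have "S \<subseteq> D"
        proof
          fix s assume "s \<in> S"
          then obtain a where a: "a \<in> S'" "s - f a \<in> D" using lift by blast
          then have "f a \<in> D" using BS unfolding B'_def by blast
          then have "(s - f a) + f a \<in> D" using a(2) Dcl(3) by blast
          then show "s \<in> D" by simp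
        qed
        then show False using DS S_neq by blast
      qed
      fix C assume C: "V.invariant C" "B' \<subseteq> C" "C \<subseteq> S'"
      note Ccl = V.invariantD[OF C(1)]
      let ?fC = "{s \<in> S. \<exists>a\<in>C. s - f a \<in> D}"
      have CA1: "C \<subseteq> A1" using C(3) unfolding S'_def by blast
      have "?fC = S \<inter> ?I C" by blast
      then have fC: "W.invariant ?fC" using W.invariant_Int[OF S image[OF C(1) CA1]] by simp
      have "D \<subseteq> ?fC" using DS Ccl(2) f_zero by (force intro!: bexI[of _ 0])
      then have "?fC = D \<or> S \<subseteq> ?fC" using minS[OF fC] by blast
      then show "C = B' \<or> C = S'"
      proof
        assume eq: "?fC = D"
        have "c \<in> B'" if c: "c \<in> C" for c
        proof -
          have "f c \<in> S" using c C(3) unfolding S'_def by blast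
          moreover have "f c - f c \<in> D" using Dcl(2) by simp
          ultimately have "f c \<in> ?fC" using c by blast
          then show ?thesis using eq c CA1 unfolding B'_def by blast
        qed
        then show ?thesis using C(2) by blast
      next
        assume sub: "S \<subseteq> ?fC"
        have "s \<in> C" if s: "s \<in> S'" for s
        proof -
          have "f s \<in> S" "s \<in> A1" using s unfolding S'_def by auto
          then obtain a where a: "a \<in> C" "f s - f a \<in> D" using sub by blast
          have "s - a \<in> B'"
            unfolding B'_def using a \<open>s \<in> A1\<close> CA1 A1cl(4) by (auto simp: f_diff)
          then have "(s - a) + a \<in> C" using C(2) a(1) Ccl(3) by blast
          then show ?thesis by simp
        qed
        then show ?thesis using C(3) by blast
      qed
    qed
    \<comment> \<open>\<xi> followed by the inverse of that isomorphism, from A / A1 to S' /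
      B'.\<close>
    define R where "R = {(x, s). x \<in> A \<and> s \<in> S' \<and> \<xi> x - f s \<in> D}"
    have S'cl: "V.invariant S'" using V.irrD(1)[OF irrS'] .
    have "V.twisted_rel \<chi> R A A1 S' B'"
      unfolding V.twisted_rel_def
    proof (intro conjI allI impI ballI)
      show "R \<subseteq> A \<times> S'" unfolding R_def by blast
      show "(x + x', y + y') \<in> R" if "(x, y) \<in> R" "(x', y') \<in> R" for x y x' y'
      proof -
        have "(\<xi> x - f y) + (\<xi> x' - f y') \<in> D" using that unfolding R_def by (intro Dcl(3)) auto
        then have "\<xi> (x + x') - f (y + y') \<in> D" by (simp add: \<xi>_add f_add algebra_simps)
        then show ?thesis using that Acl(3) V.invariantD(3)[OF S'cl] unfolding R_def by blast
      qed
      show "(sV k x, sV k y) \<in> R" if xy: "(x, y) \<in> R" for k x y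
      proof -
        have "sW k (\<xi> x - f y) \<in> D" using xy unfolding R_def by (intro Dcl(5)) auto
        then have "\<xi> (sV k x) - f (sV k y) \<in> D" by (simp add: \<xi>_scale f_scale W.scale_right_diff_distrib)
        then show ?thesis using xy Acl(5) V.invariantD(5)[OF S'cl] unfolding R_def by blast
      qed
      show "(sV (\<chi> g) (aV g x), aV g y) \<in> R" if g: "g \<in> G" and xy: "(x, y) \<in> R" for g x y
      proof -
        have *: "x \<in> A" "y \<in> S'" "\<xi> x - f y \<in> D" using xy unfolding R_def by auto
        have yA1: "y \<in> A1" using *(2) unfolding S'_def by blast
        have "(\<xi> (sV (\<chi> g) (aV g x)) - aW g (\<xi> x)) + aW g (\<xi> x - f y) - \<delta> g y \<in> D"
          using \<xi>_twist[OF g *(1)] Dcl(6)[OF g *(3)] \<delta>D[OF g yA1] by (blast intro: Dcl(3,4))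
        then have "\<xi> (sV (\<chi> g) (aV g x)) - f (aV g y) \<in> D"
          using g by (simp add: f_ac W.ac_diff algebra_simps)
        then show ?thesis
          unfolding R_def using Acl(5)[OF Acl(6)[OF g *(1)]] V.invariantD(6)[OF S'cl g *(2)] by blast
      qed
      show "\<exists>y. (x, y) \<in> R" if x: "x \<in> A" for x
      proof -
        obtain a where "a \<in> S'" "\<xi> x - f a \<in> D" using lift[OF \<xi>S[OF x]] by blast
        then show ?thesis using x unfolding R_def by blast
      qed
      show "\<exists>x. (x, y) \<in> R" if y: "y \<in> S'" for y
      proof -
        have "f y \<in> S" using y unfolding S'_def by blast
        then obtain a where a: "a \<in> A" "f y - \<xi> a \<in> D" using \<xi>_surj by blast
        have "- (f y - \<xi> a) \<in> D" by (rule Dcl(7)[OF a(2)])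
        then have "\<xi> a - f y \<in> D" by simp
        then show ?thesis using a(1) y unfolding R_def by blast
      qed
      show "x \<in> A1 \<longleftrightarrow> y \<in> B'" if xy: "(x, y) \<in> R" for x y
      proof -
        have *: "x \<in> A" "y \<in> S'" "\<xi> x - f y \<in> D" using xy unfolding R_def by auto
        have "\<xi> x \<in> D \<longleftrightarrow> f y \<in> D"
          using Dcl(4)[OF _ *(3), of "\<xi> x"] Dcl(3)[OF *(3), of "f y"] by auto
        then show ?thesis using \<xi>D[OF *(1)] *(2) unfolding B'_def S'_def by blast
      qed
      show "(x, 0) \<in> R" if "x \<in> A1" for x
        unfolding R_def using that A1_sub \<xi>D[of x] V.invariantD(2)[OF S'cl] by (auto simp: f_zero)
      show "(0, y) \<in> R" if "y \<in> B'" for y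
        unfolding R_def using that Acl(2) V.irrD(3)[OF irrS'] Dcl(4)[OF Dcl(2), of "f y"]
        by (auto simp: \<xi>_0 B'_def)
    qed
    note R = this
    show False
    proof (rule V.no_twisted_section[OF V_free irrV irrS' _ _ R])
      show "S' \<subseteq> A1" unfolding S'_def by blast
      show "C \<subseteq> A1" if "V.invariant C" "B' \<subseteq> C" "C \<subseteq> A" "C \<noteq> A" for C
        by (rule maxA[OF that(1,3,4)])
    qed
  next
    case True
    \<comment> \<open>If f carried A into S, it would be equivariant modulo D by
      \<open>irreducible_equivariant\<close>; hence exactly A1 is carried into S.\<close>
    define K where "K = {a \<in> A. f a \<in> S}"
    have K: "V.invariant K"
      using invariant_preimage[OF inv(1) S] \<delta>S unfolding \<delta>_def K_def by blast
    have "A1 \<subseteq> K" unfolding K_def using True DS A1_sub by blast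
    moreover have "K \<noteq> A"
    proof
      assume KA: "K = A"
      have "f (aV g0 a0) - aW g0 (f a0) \<in> D"
        by (rule irreducible_equivariant[OF irrV irrW _ _ g0(1,2)]) (use KA True in \<open>auto simp: K_def\<close>)
      then show False using g0(3) by blast
    qed
    ultimately have KA1: "K = A1" using V.irrD(5)[OF irrV K] unfolding K_def by blast
    have fS: "f a \<in> S \<longleftrightarrow> a \<in> A1" if "a \<in> A" for a using KA1 that unfolding K_def by blast
    \<comment> \<open>The image of A together with S, so that f identifies A / A1 with C /
      S.\<close>
    define C where "C = {c. \<exists>a\<in>A. c - f a \<in> S}"
    have C: "W.invariant C"
      using invariant_image_plus[OF inv(1) S] \<delta>S unfolding \<delta>_def C_def by blast
    note Ccl = W.invariantD[OF C]
    have fC: "f a \<in> C" if "a \<in> A" for a unfolding C_def using that Scl(2) by (auto intro!: bexI[of _ a])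
    have SC: "S \<subseteq> C" unfolding C_def using Acl(2) f_zero by (auto intro!: bexI[of _ 0])
    have CS: "C \<noteq> S"
    proof
      assume "C = S"
      then have "A \<subseteq> A1" using fC fS by blast
      then show False using A1_sub A1_neq by blast
    qed
    have irrC: "W.irr C S"
      unfolding W.irr_def
    proof (intro conjI allI impI C S SC)
      show "S \<noteq> C" using CS by blast
      fix X assume X: "W.invariant X" "S \<subseteq> X" "X \<subseteq> C"
      note Xcl = W.invariantD[OF X(1)]
      let ?Y = "{a \<in> A. f a \<in> X}"
      have Y: "V.invariant ?Y"
        using invariant_preimage[OF inv(1) X(1)] \<delta>S X(2) unfolding \<delta>_def by blast
      have "A1 \<subseteq> ?Y" using True DS X(2) A1_sub by blast
      then have "?Y = A1 \<or> ?Y = A" using V.irrD(5)[OF irrV Y] by blast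
      then show "X = S \<or> X = C"
      proof
        assume YA1: "?Y = A1"
        have "x \<in> S" if x: "x \<in> X" for x
        proof -
          obtain a where a: "a \<in> A" "x - f a \<in> S" using X(3) x unfolding C_def by blast
          have "x - (x - f a) \<in> X" by (rule Xcl(4)[OF x subsetD[OF X(2) a(2)]])
          then have "a \<in> A1" using a(1) YA1 by auto
          then have "(x - f a) + f a \<in> S" using a fS by (intro Scl(3)) auto
          then show ?thesis by simp
        qed
        then show ?thesis using X(2) by blast
      next
        assume YA: "?Y = A"
        have "x \<in> X" if x: "x \<in> C" for x
        proof -
          obtain a where a: "a \<in> A" "x - f a \<in> S" using x unfolding C_def by blast
          have "(x - f a) + f a \<in> X" using a X(2) YA by (intro Xcl(3)) auto
          then show ?thesis by simp
        qed
        then show ?thesis using X(3) by blast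
      qed
    qed
    \<comment> \<open>From C / S back to A / A1 through f, then to S / D through \<xi>.\<close>
    define R where "R = {(c, s). s \<in> S \<and> (\<exists>a\<in>A. c - f a \<in> S \<and> s - \<xi> a \<in> D)}"
    have "W.twisted_rel \<chi> R C S S D"
      unfolding W.twisted_rel_def
    proof (intro conjI allI impI ballI)
      show "R \<subseteq> C \<times> S" unfolding R_def C_def by blast
      show "(x + x', y + y') \<in> R" if xy: "(x, y) \<in> R" "(x', y') \<in> R" for x y x' y'
      proof -
        obtain a where a: "a \<in> A" "x - f a \<in> S" "y - \<xi> a \<in> D" "y \<in> S" using xy(1) unfolding R_def by blast
        obtain b where b: "b \<in> A" "x' - f b \<in> S" "y' - \<xi> b \<in> D" "y' \<in> S" using xy(2) unfolding R_def by blast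
        have "(x + x') - f (a + b) \<in> S" using Scl(3)[OF a(2) b(2)] by (simp add: f_add algebra_simps)
        moreover have "(y + y') - \<xi> (a + b) \<in> D" using Dcl(3)[OF a(3) b(3)] by (simp add: \<xi>_add algebra_simps)
        ultimately show ?thesis unfolding R_def using Scl(3)[OF a(4) b(4)] Acl(3)[OF a(1) b(1)] by blast
      qed
      show "(sW k x, sW k y) \<in> R" if xy: "(x, y) \<in> R" for k x y
      proof -
        obtain a where a: "a \<in> A" "x - f a \<in> S" "y - \<xi> a \<in> D" "y \<in> S" using xy unfolding R_def by blast
        have "sW k x - f (sV k a) \<in> S"
          using Scl(5)[OF a(2), of k] by (simp add: f_scale W.scale_right_diff_distrib)
        moreover have "sW k y - \<xi> (sV k a) \<in> D"
          using Dcl(5)[OF a(3), of k] by (simp add: \<xi>_scale W.scale_right_diff_distrib)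
        ultimately show ?thesis unfolding R_def using Scl(5)[OF a(4)] Acl(5)[OF a(1)] by blast
      qed
      show "(sW (\<chi> g) (aW g x), aW g y) \<in> R" if g: "g \<in> G" and xy: "(x, y) \<in> R" for g x y
      proof -
        obtain a where a: "a \<in> A" "x - f a \<in> S" "y - \<xi> a \<in> D" "y \<in> S" using xy unfolding R_def by blast
        have "sW (\<chi> g) (aW g (x - f a) - \<delta> g a) \<in> S"
          by (rule Scl(5)[OF Scl(4)[OF Scl(6)[OF g a(2)] \<delta>S[OF g a(1)]]])
        then have 1: "sW (\<chi> g) (aW g x) - f (sV (\<chi> g) (aV g a)) \<in> S"
          using g by (simp add: f_scale f_ac W.ac_diff W.scale_right_diff_distrib W.scale_right_distrib algebra_simps)
        have "aW g (y - \<xi> a) - (\<xi> (sV (\<chi> g) (aV g a)) - aW g (\<xi> a)) \<in> D"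
          by (rule Dcl(4)[OF Dcl(6)[OF g a(3)] \<xi>_twist[OF g a(1)]])
        then have 2: "aW g y - \<xi> (sV (\<chi> g) (aV g a)) \<in> D"
          using g by (simp add: W.ac_diff)
        show ?thesis
          unfolding R_def using 1 2 Scl(6)[OF g a(4)] Acl(5)[OF Acl(6)[OF g a(1)]] by blast
      qed
      show "\<exists>y. (x, y) \<in> R" if x: "x \<in> C" for x
      proof -
        obtain a where a: "a \<in> A" "x - f a \<in> S" using x unfolding C_def by blast
        have "\<xi> a - \<xi> a \<in> D" using Dcl(2) by simp
        then show ?thesis using a \<xi>S[OF a(1)] unfolding R_def by blast
      qed
      show "\<exists>x. (x, y) \<in> R" if y: "y \<in> S" for y
      proof -
        obtain a where a: "a \<in> A" "y - \<xi> a \<in> D" using \<xi>_surj[OF y] by blast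
        have "f a - f a \<in> S" using Scl(2) by simp
        then show ?thesis using a y unfolding R_def by blast
      qed
      show "x \<in> S \<longleftrightarrow> y \<in> D" if xy: "(x, y) \<in> R" for x y
      proof -
        obtain a where a: "a \<in> A" "x - f a \<in> S" "y - \<xi> a \<in> D" "y \<in> S" using xy unfolding R_def by blast
        have "x \<in> S \<longleftrightarrow> f a \<in> S"
          using Scl(4)[OF _ a(2), of x] Scl(3)[OF a(2), of "f a"] by auto
        also have "\<dots> \<longleftrightarrow> \<xi> a \<in> D" using fS[OF a(1)] \<xi>D[OF a(1)] by blast
        also have "\<dots> \<longleftrightarrow> y \<in> D"
          using Dcl(4)[OF _ a(3), of y] Dcl(3)[OF a(3), of "\<xi> a"] by auto
        finally show ?thesis .
      qed
      show "(x, 0) \<in> R" if "x \<in> S" for x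
        unfolding R_def using that Scl(2) Acl(2) Dcl(2) \<xi>_0 f_zero by (auto intro!: bexI[of _ 0])
      show "(0, y) \<in> R" if "y \<in> D" for y
        unfolding R_def using that DS Scl(2) Acl(2) \<xi>_0 f_zero by (auto intro!: bexI[of _ 0])
    qed
    note R = this
    show False
    \<comment> \<open>S plays two roles: it is the largest proper invariant subspace of C above D
      and the upper end of the section S / D.\<close>
    proof (rule W.no_twisted_section[OF W_free irrC irrW _ _ R])
      show "S \<subseteq> S" by simp
      show "X \<subseteq> S" if X: "W.invariant X" "D \<subseteq> X" "X \<subseteq> C" "X \<noteq> C" for X
      proof (cases "X = D")
        case False
        then have "S \<subseteq> X" using minS X by blast
        then show ?thesis using W.irrD(5)[OF irrC X(1)] X by blast
      qed (use DS in simp)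
    qed
  qed
qed

end

section \<open>The valuation of the algebraic closure\<close>

definition integral_closure_set :: "('p::prime_card padic \<Rightarrow> 'a::field) \<Rightarrow> 'a set" where
  "integral_closure_set \<iota> = {x. integral_over (range (\<lambda>a. \<iota> (Fract a 1))) x}"

text \<open>The representative at level n is n itself, because n < p^n.\<close>

lemma padic_of_nat_nonzero:
  assumes "n > 0"
  shows "of_nat n \<noteq> (0 :: 'p::prime_card padic_int)"
proof
  assume "of_nat n = (0 :: 'p padic_int)"
  then have "Rep_padic_int (of_nat n :: 'p padic_int) n = Rep_padic_int (of_nat 0 :: 'p padic_int) n"
    by simp
  then have "int n mod pint TYPE('p) ^ n = 0"
    unfolding Rep_of_nat by simp
  moreover have "n < CARD('p) ^ n"
    using power_gt_expt[of "CARD('p)" n] prime_gt_1_nat[OF prime_card[where ?'a = 'p]] by simp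
  then have "int n < pint TYPE('p) ^ n"
    using of_nat_less_iff[of n "CARD('p) ^ n", where ?'a = int] by simp
  ultimately show False using assms by simp
qed

lemma Fract_one_eq_0 [simp]: "Fract a 1 = 0 \<longleftrightarrow> a = 0"
  by (simp add: Zero_fract_def eq_fract)

lemma poly_fixed_coeffs:
  assumes "field_hom g" "\<And>i. g (Polynomial.coeff q i) = Polynomial.coeff q i"
  shows "g (poly q x) = poly q (g x)"
proof -
  interpret field_hom g by (rule assms)
  show ?thesis by (simp add: poly_altdef hom_distribs assms(2))
qed

lemma poly_split_at:
  fixes q :: "'b::comm_ring_1 poly"
  assumes "j \<le> degree q"
  shows "poly q x = (\<Sum>i<j. poly.coeff q i * x ^ i) +
    x ^ j * (poly.coeff q j + (\<Sum>i\<in>{j<..degree q}. poly.coeff q i * x ^ (i - j)))"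
proof -
  have "{..degree q} = {..<j} \<union> {j} \<union> {j<..degree q}" using assms by auto
  then have "poly q x = (\<Sum>i\<in>{..<j} \<union> {j} \<union> {j<..degree q}. poly.coeff q i * x ^ i)"
    by (simp add: poly_altdef)
  also have "\<dots> = (\<Sum>i\<in>{..<j}. poly.coeff q i * x ^ i) + poly.coeff q j * x ^ j +
      (\<Sum>i\<in>{j<..degree q}. poly.coeff q i * x ^ i)"
    by (subst sum.union_disjoint; (subst sum.union_disjoint)?; auto)
  also have "(\<Sum>i\<in>{j<..degree q}. poly.coeff q i * x ^ i) =
      x ^ j * (\<Sum>i\<in>{j<..degree q}. poly.coeff q i * x ^ (i - j))"
    unfolding sum_distrib_left by (rule sum.cong) (auto simp: mult_ac simp flip: power_add)
  finally show ?thesis by (simp add: algebra_simps)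
qed

lemma Gal_comp:
  assumes gh: "g \<in> Gal K" "h \<in> Gal K"
  shows "g \<circ> h \<in> Gal K"
proof -
  interpret g: field_hom g by (rule GalD(1)[OF gh(1)])
  interpret h: field_hom h by (rule GalD(1)[OF gh(2)])
  have "field_hom (g \<circ> h)" by unfold_locales (simp_all add: g.hom_add g.hom_mult h.hom_add h.hom_mult)
  then show ?thesis unfolding Gal_def using GalD[OF gh(1)] GalD[OF gh(2)] bij_comp by auto
qed

lemma automorphism_group_Gal:
  fixes K :: "'a::alg_closed_field set"
  assumes K: "alg_closure_of K"
  shows "automorphism_group (Gal K)"
proof (rule automorphism_group.intro)
  show "id \<in> Gal K" unfolding Gal_def by (auto, unfold_locales) auto
  show "g \<circ> h \<in> Gal K" if "g \<in> Gal K" "h \<in> Gal K" for g h using Gal_comp[OF that] .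
  show "finv g \<in> Gal K" if g: "g \<in> Gal K" for g
  proof -
    interpret g: field_hom g by (rule GalD(1)[OF g])
    have b: "bij g" by (rule GalD(2)[OF g])
    have i: "finv g (g x) = x" "g (finv g x) = x" for x
      using b by (simp_all add: bij_is_inj bij_is_surj surj_f_inv_f)
    have e: "finv g x = y" if "g y = x" for x y using i(1)[of y] that by simp
    have "field_hom (finv g)"
      by unfold_locales (auto intro!: e simp: g.hom_add g.hom_mult i)
    moreover have "finv g k = k" if "k \<in> K" for k by (rule e) (rule GalD(3)[OF g that])
    ultimately show ?thesis unfolding Gal_def using bij_imp_bij_inv[OF b] by auto
  qed
  show "bij g" "field_hom g" if "g \<in> Gal K" for g using GalD[OF that] by auto
  show "finite {g x | g. g \<in> Gal K}" for x
  proof -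
    obtain q where q: "q \<noteq> 0" "\<And>i. Polynomial.coeff q i \<in> K" "poly q x = 0"
      using K unfolding alg_closure_of_def algebraic_over_def by blast
    have "poly q (g x) = 0" if g: "g \<in> Gal K" for g
    proof -
      interpret g: field_hom g by (rule GalD(1)[OF g])
      show ?thesis
        using poly_fixed_coeffs[OF GalD(1)[OF g] GalD(3)[OF g q(2)], of x] q(3) by simp
    qed
    then have "{g x | g. g \<in> Gal K} \<subseteq> {y. poly q y = 0}" by auto
    then show ?thesis using poly_roots_finite[OF q(1)] finite_subset by blast
  qed
qed

locale padic_field =
  fixes \<iota> :: "'p::prime_card padic \<Rightarrow> 'a::alg_closed_field" and K :: "'a set"
  assumes \<iota>: "field_hom \<iota>" and ext: "finite_ext (range \<iota>) K" and alg: "alg_closure_of K"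
begin

sublocale \<iota>: field_hom \<iota> by (rule \<iota>)

abbreviation emb :: "'p padic_int \<Rightarrow> 'a" where
  "emb a \<equiv> \<iota> (Fract a 1)"

abbreviation O\<^sub>v :: "'a set" where
  "O\<^sub>v \<equiv> integral_closure_set \<iota>"

lemma inj_emb: "inj_idom_hom emb"
proof
  show "emb 0 = 0" using \<iota>.hom_zero unfolding Zero_fract_def .
  show "emb 1 = 1" using \<iota>.hom_one unfolding One_fract_def .
  show "emb (x + y) = emb x + emb y" for x y by (simp flip: \<iota>.hom_add)
  show "emb (x * y) = emb x * emb y" for x y by (simp flip: \<iota>.hom_mult)
  show "x = 0" if "emb x = 0" for x using that by simp
qed

sublocale emb: inj_idom_hom emb by (rule inj_emb)

lemma subring_emb: "subring_set (range emb)"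
  unfolding subring_set_def
proof (intro conjI ballI)
  show "0 \<in> range emb" "1 \<in> range emb" using emb.hom_zero emb.hom_one by (metis rangeI)+
  fix x y assume "x \<in> range emb" "y \<in> range emb"
  then obtain a b where ab: "x = emb a" "y = emb b" by auto
  show "x + y \<in> range emb" "x * y \<in> range emb" "- x \<in> range emb"
    unfolding ab emb.hom_add[symmetric] emb.hom_mult[symmetric] emb.hom_uminus[symmetric]
    by (rule rangeI)+
qed

lemma emb_K: "emb a \<in> K"
  using ext unfolding finite_ext_def by blast

lemma K_field: "subfield_set K"
  using ext unfolding finite_ext_def by blast

lemma K_closed:
  "0 \<in> K" "1 \<in> K" "x \<in> K \<Longrightarrow> y \<in> K \<Longrightarrow> x * y \<in> K" "x \<in> K \<Longrightarrow> inverse x \<in> K"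
  "x \<in> K \<Longrightarrow> y \<in> K \<Longrightarrow> x / y \<in> K" "x \<in> K \<Longrightarrow> x ^ n \<in> K"
proof -
  show *: "0 \<in> K" "1 \<in> K" "x \<in> K \<Longrightarrow> y \<in> K \<Longrightarrow> x * y \<in> K" "x \<in> K \<Longrightarrow> inverse x \<in> K" for x y
    using K_field unfolding subfield_set_def by auto
  then show "x \<in> K \<Longrightarrow> y \<in> K \<Longrightarrow> x / y \<in> K" unfolding divide_inverse by blast
  show "x \<in> K \<Longrightarrow> x ^ n \<in> K" using subring_set_power[OF subfield_imp_subring[OF K_field]] .
qed

lemma char_0: "n > 0 \<Longrightarrow> of_nat n \<noteq> (0 :: 'a)"
  using padic_of_nat_nonzero[of n, where ?'p = 'p] emb.hom_0_iff[of "of_nat n"] by (simp add: emb.hom_of_nat)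

lemma clear_denominators:
  assumes "finite I" "\<And>i. i \<in> I \<Longrightarrow> c i \<in> range \<iota>"
  shows "\<exists>d. d \<noteq> 0 \<and> (\<forall>i\<in>I. c i * emb d \<in> range emb)"
  using assms
proof (induction I)
  case (insert i I)
  then obtain d where d: "d \<noteq> 0" "\<forall>i\<in>I. c i * emb d \<in> range emb" by auto
  obtain x where x: "c i = \<iota> x" using insert by auto
  obtain a b where ab: "x = Fract a b" "b \<noteq> 0" by (cases x)
  have "x * Fract b 1 = Fract a 1" using ab by (simp add: eq_fract)
  then have cb: "c i * emb b = emb a" unfolding x by (metis \<iota>.hom_mult)
  have "c i * emb (d * b) = emb (a * d)"
    unfolding emb.hom_mult cb[symmetric] by (simp add: mult_ac)
  moreover have "c j * emb (d * b) \<in> range emb" if jI: "j \<in> I" for j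
  proof -
    have "c j * emb d \<in> range emb" by (rule d(2)[rule_format, OF jI])
    then obtain e where e: "c j * emb d = emb e" by (rule rangeE)
    have "c j * emb (d * b) = c j * emb d * emb b"
      unfolding emb.hom_mult by (rule mult.assoc[symmetric])
    also have "\<dots> = emb (e * b)" unfolding e by (rule emb.hom_mult[symmetric])
    finally have "c j * emb (d * b) = emb (e * b)" .
    then show ?thesis by blast
  qed
  ultimately have "\<forall>j\<in>insert i I. c j * emb (d * b) \<in> range emb" by blast
  then show ?case using d(1) ab(2) by (intro exI[of _ "d * b"]) simp
qed (intro exI[of _ 1]; simp)

text \<open>The element is integral over the p-adic numbers; clearing denominators in a relation
  gives a polynomial over the p-adic integers, to which the dichotomy of
  \<open>valuation_poly\<close> applies.\<close>

lemma val: "x \<in> O\<^sub>v \<or> inverse x \<in> O\<^sub>v"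
proof -
  have "integral_over (range \<iota>) x"
    by (rule integral_over_finite_ext[OF ext]) (use alg in \<open>simp add: alg_closure_of_def\<close>)
  then obtain q where q: "lead_coeff q = 1" "\<And>i. Polynomial.coeff q i \<in> range \<iota>" "poly q x = 0"
    unfolding integral_over_def by blast
  obtain d where d: "d \<noteq> 0" "\<And>i. i \<le> degree q \<Longrightarrow> Polynomial.coeff q i * emb d \<in> range emb"
    using clear_denominators[of "{..degree q}" "Polynomial.coeff q"] q(2) by auto
  have "\<exists>a. Polynomial.coeff q i * emb d = emb a" for i
  proof (cases "i \<le> degree q")
    case True
    then show ?thesis using d(2) by blast
  next
    case False
    then have "Polynomial.coeff q i * emb d = emb 0" by (simp add: coeff_eq_0)
    then show ?thesis by blast
  qed
  then obtain A where A: "\<And>i. Polynomial.coeff q i * emb d = emb (A i)" by metis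
  have "A i = 0" if "i > degree q" for i
    using A[of i] that by (simp add: coeff_eq_0)
  then have cf: "Polynomial.coeff (Abs_poly A) = A" by (rule coeff_Abs_poly)
  have eq: "map_poly emb (Abs_poly A) = Polynomial.smult (emb d) q"
    by (rule poly_eqI) (simp add: cf A[symmetric])
  have "Abs_poly A \<noteq> 0"
  proof
    assume "Abs_poly A = 0"
    then have "A (degree q) = 0" using cf by (metis coeff_0)
    then show False using A[of "degree q"] q(1) d(1) by simp
  qed
  then show ?thesis
    using valuation_poly[OF inj_emb, of "Abs_poly A" x] q(3) unfolding integral_closure_set_def eq by simp
qed

sublocale valuation_ring O\<^sub>v
  using subring_integral_closure[OF subring_emb] val unfolding integral_closure_set_def
  by unfold_locales auto

lemma emb_O: "emb a \<in> O\<^sub>v"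
  unfolding integral_closure_set_def using integral_over_base[OF subring_emb] by blast

lemma stable:
  assumes "g \<in> Gal K" "x \<in> O\<^sub>v"
  shows "g x \<in> O\<^sub>v"
proof -
  obtain q where q: "lead_coeff q = 1" "\<And>i. Polynomial.coeff q i \<in> range emb" "poly q x = 0"
    using assms(2) unfolding integral_closure_set_def integral_over_def by blast
  have "g (Polynomial.coeff q i) = Polynomial.coeff q i" for i
    using q(2)[of i] GalD(3)[OF assms(1)] emb_K by auto
  from poly_fixed_coeffs[OF GalD(1)[OF assms(1)] this, of x] have "poly q (g x) = g 0"
    using q(3) by simp
  moreover have "g 0 = 0" by (rule GalD(3)[OF assms(1) K_closed(1)])
  ultimately show ?thesis
    using q(1,2) unfolding integral_closure_set_def integral_over_def by auto
qed

text \<open>A relation of degree m for 1 / p, multiplied by p^m, exhibits 1 as a multiple of p in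
  the p-adic integers.\<close>

lemma p_not_unit: "inverse (of_nat CARD('p)) \<notin> O\<^sub>v"
proof
  let ?p = "of_nat CARD('p) :: 'a"
  have p0: "?p \<noteq> 0" using char_0[of "CARD('p)"] by (simp add: finite_UNIV_card_ge_0)
  assume "inverse ?p \<in> O\<^sub>v"
  then have "integral_over (range emb) (inverse ?p)" unfolding integral_closure_set_def by simp
  then obtain m c where m: "0 < m" "\<And>i. i < m \<Longrightarrow> c i \<in> range emb"
      "inverse ?p ^ m = (\<Sum>i<m. c i * inverse ?p ^ i)"
    using integral_power_relation[OF subring_emb] by blast
  have "1 = ?p ^ m * inverse ?p ^ m" using p0 by (simp add: power_inverse)
  also have "\<dots> = (\<Sum>i<m. c i * (?p ^ m * inverse ?p ^ i))"
    unfolding m(3) sum_distrib_left by (simp only: mult_ac)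
  also have "\<dots> = (\<Sum>i<m. ?p * (c i * ?p ^ (m - Suc i)))"
  proof (rule sum.cong)
    fix i assume "i \<in> {..<m}"
    then have "?p ^ m = ?p ^ i * (?p * ?p ^ (m - Suc i))"
      by (simp flip: power_add power_Suc)
    then show "c i * (?p ^ m * inverse ?p ^ i) = ?p * (c i * ?p ^ (m - Suc i))"
      using p0 by (simp add: power_inverse field_simps)
  qed simp
  also have "\<dots> = ?p * (\<Sum>i<m. c i * ?p ^ (m - Suc i))" by (rule sum_distrib_left[symmetric])
  finally have eq: "1 = ?p * (\<Sum>i<m. c i * ?p ^ (m - Suc i))" .
  have "?p \<in> range emb" using emb.hom_of_nat[of "CARD('p)"] by (metis rangeI)
  then have "(\<Sum>i<m. c i * ?p ^ (m - Suc i)) \<in> range emb"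
    by (intro subring_set_sum[OF subring_emb] subring_setD(4)[OF subring_emb] m(2)
      subring_set_power[OF subring_emb]) auto
  then obtain y where "(\<Sum>i<m. c i * ?p ^ (m - Suc i)) = emb y" by blast
  with eq have "emb 1 = emb (of_nat CARD('p) * y)" by (simp add: emb.hom_mult emb.hom_of_nat)
  then have "1 = of_nat CARD('p) * y" by (rule emb.injectivity)
  then show False using unif_not_unit[where ?'p = 'p] by (metis dvdI)
qed

lemma fixed_Gal:
  assumes "\<And>g. g \<in> Gal K \<Longrightarrow> g x = x"
  shows "x \<in> K"
  using Gal_moves[OF alg char_0, of x] assms by metis

lemma integral_relation:
  assumes "x \<in> O\<^sub>v"
  obtains q where "lead_coeff q = 1" "\<And>i. Polynomial.coeff q i \<in> range emb" "poly q x = 0"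
  using assms that unfolding integral_closure_set_def integral_over_def by blast

lemma emb_decomp:
  assumes "a \<noteq> 0"
  obtains N u where "vunit (emb u)" "emb a = of_nat CARD('p) ^ N * emb u"
proof -
  obtain N u where u: "u dvd 1" "a = unif ^ N * u" using padic_int_decomp[OF assms] .
  from u(1) obtain w where w: "1 = u * w" by (rule dvdE)
  have "emb u * emb w = emb (u * w)" by (rule emb.hom_mult[symmetric])
  also have "\<dots> = 1" unfolding w[symmetric] by (rule emb.hom_one)
  finally have uw: "emb u * emb w = 1" .
  then have "inverse (emb u) = emb w" by (rule inverse_unique)
  moreover have "emb u \<noteq> 0" using uw by (metis mult_zero_left zero_neq_one)
  ultimately have "vunit (emb u)" unfolding vunit_def using emb_O by metis
  moreover have "emb a = of_nat CARD('p) ^ N * emb u"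
    unfolding u(2) by (simp only: emb.hom_mult emb.hom_power emb.hom_of_nat)
  ultimately show ?thesis by (rule that)
qed

text \<open>In a monic relation for \<open>y\<close>, the term of least degree whose coefficient is a unit is divisible by
  \<open>p\<close>.\<close>

lemma power_div_p:
  assumes y: "y \<in> mx"
  shows "\<exists>k. y ^ k / of_nat CARD('p) \<in> O\<^sub>v"
proof -
  let ?p = "of_nat CARD('p) :: 'a"
  have p0: "?p \<noteq> 0" using char_0[of "CARD('p)"] by (simp add: finite_UNIV_card_ge_0)
  obtain q where q: "lead_coeff q = 1" "\<And>i. poly.coeff q i \<in> range emb" "poly q y = 0"
    using integral_relation[OF mxD(1)[OF y]] by blast
  define j where "j = (LEAST i. vunit (poly.coeff q i))"
  have lead: "vunit (poly.coeff q (degree q))" unfolding q(1) by (rule vunit_simps)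
  have j: "vunit (poly.coeff q j)" "j \<le> degree q"
    unfolding j_def using lead by (auto intro: LeastI Least_le)
  have low: "poly.coeff q i / ?p \<in> O\<^sub>v" if "i < j" for i
  proof -
    have nu: "\<not> vunit (poly.coeff q i)" using not_less_Least that unfolding j_def by blast
    obtain a where a: "poly.coeff q i = emb a" using q(2) by blast
    show ?thesis
    proof (cases "a = 0")
      case True
      then show ?thesis unfolding a using mxD(1)[OF mx_0] by simp
    next
      case False
      then obtain N u where u: "vunit (emb u)" "emb a = ?p ^ N * emb u" by (rule emb_decomp)
      then have "N \<noteq> 0" using nu unfolding a by (metis mult_1 power_0)
      then obtain M where "N = Suc M" using not0_implies_Suc by blast
      then have "emb a / ?p = ?p ^ M * emb u" using u(2) p0 by simp
      moreover have "?p ^ M * emb u \<in> O\<^sub>v"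
        using vunit_simps(6)[OF u(1)]
        by (intro subring_setD(4)[OF Ov] subring_set_power[OF Ov] of_nat_Ov)
      ultimately show ?thesis unfolding a by simp
    qed
  qed
  define A where "A = (\<Sum>i<j. poly.coeff q i / ?p * y ^ i)"
  define C where "C = (\<Sum>i\<in>{j<..degree q}. poly.coeff q i * y ^ (i - j))"
  have A: "A \<in> O\<^sub>v" unfolding A_def
    using low mxD(1)[OF y]
    by (intro subring_set_sum[OF Ov] subring_setD(4)[OF Ov] subring_set_power[OF Ov]) auto
  have "C \<in> mx" unfolding C_def
  proof (rule mx_sum)
    fix i assume "i \<in> {j<..degree q}"
    then obtain l where l: "i - j = Suc l" by (metis Suc_diff_Suc greaterThanAtMost_iff)
    have "(poly.coeff q i * y ^ l) * y \<in> mx"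
      using q(2)[of i] emb_O mxD(1)[OF y] y
      by (intro mx_mult subring_setD(4)[OF Ov] subring_set_power[OF Ov]) auto
    then show "poly.coeff q i * y ^ (i - j) \<in> mx" unfolding l by (simp add: mult_ac)
  qed
  \<comment> \<open>Once y^j is taken out of the terms of degree at least j, a unit plus an element
    of the maximal ideal remains; the lower terms are multiples of p.\<close>
  then have u: "vunit (poly.coeff q j + C)" using vunit_add_mx[OF j(1), of "poly.coeff q j + C"] by simp
  have "(\<Sum>i<j. poly.coeff q i * y ^ i) = ?p * A"
    unfolding A_def sum_distrib_left using p0 by simp
  then have "?p * A + y ^ j * (poly.coeff q j + C) = 0"
    using poly_split_at[OF j(2), of y] q(3) unfolding C_def by simp
  then have "y ^ j * (poly.coeff q j + C) = ?p * (- A)" by (simp add: eq_neg_iff_add_eq_0 add.commute)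
  then have "y ^ j / ?p = - A * inverse (poly.coeff q j + C)"
    using p0 vunit_simps(5)[OF u] by (simp add: field_simps)
  moreover have "- A * inverse (poly.coeff q j + C) \<in> O\<^sub>v"
    using A vunit_simps(6)[OF vunit_simps(3)[OF u]] by (intro subring_setD(4,5)[OF Ov])
  ultimately have "y ^ j / ?p \<in> O\<^sub>v" by simp
  then show ?thesis ..
qed

text \<open>A monic relation for \<open>x\<close>, divided by a power of \<open>x\<close>, has a nonzero constant term, which \<open>x\<close>
  divides.\<close>

lemma p_power_div:
  assumes x: "x \<in> O\<^sub>v" "x \<noteq> 0"
  shows "\<exists>N. of_nat CARD('p) ^ N / x \<in> O\<^sub>v"
proof -
  obtain q where q: "lead_coeff q = 1" "\<And>i. poly.coeff q i \<in> range emb" "poly q x = 0"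
    using integral_relation[OF x(1)] by blast
  define j where "j = (LEAST i. poly.coeff q i \<noteq> 0)"
  have lead: "poly.coeff q (degree q) \<noteq> 0" unfolding q(1) by simp
  have j: "poly.coeff q j \<noteq> 0" "j \<le> degree q"
    unfolding j_def by (rule LeastI Least_le, rule lead)+
  have low: "poly.coeff q i = 0" if "i < j" for i
    using not_less_Least that unfolding j_def by blast
  define C where "C = (\<Sum>i\<in>{j<..degree q}. poly.coeff q i * x ^ (i - Suc j))"
  have C: "C \<in> O\<^sub>v" unfolding C_def
  proof (rule subring_set_sum[OF Ov])
    fix i
    show "poly.coeff q i * x ^ (i - Suc j) \<in> O\<^sub>v"
      using q(2)[of i] emb_O x(1)
      by (intro subring_setD(4)[OF Ov] subring_set_power[OF Ov]) auto
  qed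
  have "(\<Sum>i\<in>{j<..degree q}. poly.coeff q i * x ^ (i - j)) = x * C"
    unfolding C_def sum_distrib_left
  proof (rule sum.cong)
    fix i assume "i \<in> {j<..degree q}"
    then have "x ^ (i - j) = x * x ^ (i - Suc j)" by (simp add: Suc_diff_Suc flip: power_Suc)
    then show "poly.coeff q i * x ^ (i - j) = x * (poly.coeff q i * x ^ (i - Suc j))" by simp
  qed simp
  then have "x ^ j * (poly.coeff q j + x * C) = 0"
    using poly_split_at[OF j(2), of x] q(3) low by simp
  then have "poly.coeff q j + x * C = 0" using x(2) by simp
  then have "poly.coeff q j = x * (- C)" by (simp add: eq_neg_iff_add_eq_0)
  then have qx: "poly.coeff q j / x \<in> O\<^sub>v" using x(2) subring_setD(5)[OF Ov C] by simp
  obtain a where a: "poly.coeff q j = emb a" using q(2) by blast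
  have "a \<noteq> 0" using j(1) emb.hom_zero unfolding a by blast
  then obtain N u where u: "vunit (emb u)" "emb a = of_nat CARD('p) ^ N * emb u" by (rule emb_decomp)
  have "of_nat CARD('p) ^ N / x = (poly.coeff q j / x) * inverse (emb u)"
    using u(2) vunit_simps(5)[OF u(1)] unfolding a by simp
  moreover have "(poly.coeff q j / x) * inverse (emb u) \<in> O\<^sub>v"
    using qx vunit_simps(6)[OF vunit_simps(3)[OF u(1)]] by (rule subring_setD(4)[OF Ov])
  ultimately show ?thesis by metis
qed

context
  fixes \<pi> :: 'a
  assumes \<pi>: "uniformiser (integers \<iota> K) \<pi>"
begin

lemma integers_eq: "integers \<iota> K = K \<inter> O\<^sub>v"
  unfolding integers_def integral_closure_set_def by blast

lemma uniformiser_simps: "\<pi> \<in> K" "\<pi> \<in> O\<^sub>v" "\<pi> \<noteq> 0" "inverse \<pi> \<notin> O\<^sub>v"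
proof -
  show 1: "\<pi> \<in> K" "\<pi> \<in> O\<^sub>v" "\<pi> \<noteq> 0" using \<pi> unfolding uniformiser_def integers_eq by auto
  show "inverse \<pi> \<notin> O\<^sub>v"
  proof
    assume "inverse \<pi> \<in> O\<^sub>v"
    then have "inverse \<pi> \<in> integers \<iota> K" "\<pi> * inverse \<pi> = 1"
      using 1 K_closed(4) unfolding integers_eq by auto
    moreover have "\<pi> * 1 \<in> {\<pi> * y | y. y \<in> integers \<iota> K}"
      using K_closed(2) subring_setD(2)[OF Ov] unfolding integers_eq by blast
    then have "\<pi> \<in> {x \<in> integers \<iota> K. \<not> (\<exists>y\<in>integers \<iota> K. x * y = 1)}"
      using \<pi> unfolding uniformiser_def by simp
    ultimately show False by blast
  qed
qed

text \<open>Some power of \<pi> is divisible by p and some power of p by x, so the powers of \<pi>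
  dividing x are bounded. At the last exponent the quotient is an integer of K not divisible by
  \<pi>, hence a unit, since \<pi> generates the non-units.\<close>

lemma uniformised_integral:
  assumes x: "x \<in> K" "x \<in> O\<^sub>v" "x \<noteq> 0"
  shows "\<exists>k. vunit (x / \<pi> ^ k)"
proof -
  note \<pi>s = uniformiser_simps
  have pimx: "\<pi> \<in> mx" unfolding mx_def vunit_def using \<pi>s by blast
  obtain k where k: "\<pi> ^ k / of_nat CARD('p) \<in> O\<^sub>v" using power_div_p[OF pimx] by blast
  obtain N where N: "of_nat CARD('p) ^ N / x \<in> O\<^sub>v" using p_power_div[OF x(2,3)] by blast
  have p0: "of_nat CARD('p) \<noteq> (0 :: 'a)" using char_0[of "CARD('p)"] by (simp add: finite_UNIV_card_ge_0)
  have "(\<pi> ^ k / of_nat CARD('p)) ^ N * (of_nat CARD('p) ^ N / x) \<in> O\<^sub>v"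
    using k N by (intro subring_setD(4)[OF Ov] subring_set_power[OF Ov])
  moreover have "(\<pi> ^ k / of_nat CARD('p)) ^ N * (of_nat CARD('p) ^ N / x) = \<pi> ^ (k * N) / x"
    using p0 by (simp add: power_divide power_mult)
  ultimately have kN: "\<pi> ^ (k * N) / x \<in> O\<^sub>v" by metis
  have "x / \<pi> ^ Suc (k * N) \<notin> O\<^sub>v"
  proof
    assume "x / \<pi> ^ Suc (k * N) \<in> O\<^sub>v"
    then have "(\<pi> ^ (k * N) / x) * (x / \<pi> ^ Suc (k * N)) \<in> O\<^sub>v"
      by (rule subring_setD(4)[OF Ov kN])
    moreover have "(\<pi> ^ (k * N) / x) * (x / \<pi> ^ Suc (k * N)) = inverse \<pi>"
      using x(3) \<pi>s(3) by (simp add: field_simps)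
    ultimately show False using \<pi>s(4) by metis
  qed
  then obtain n where n: "x / \<pi> ^ Suc n \<notin> O\<^sub>v" "x / \<pi> ^ n \<in> O\<^sub>v"
    using x(2) exists_least_lemma[of "\<lambda>n. x / \<pi> ^ n \<notin> O\<^sub>v"] by auto
  define z where "z = x / \<pi> ^ n"
  have z: "z \<in> integers \<iota> K"
    unfolding z_def integers_eq using n x(1) K_closed(5)[OF x(1) K_closed(6)[OF \<pi>s(1)]] by blast
  have "z \<notin> {\<pi> * y | y. y \<in> integers \<iota> K}"
  proof
    assume "z \<in> {\<pi> * y | y. y \<in> integers \<iota> K}"
    then obtain y where "y \<in> O\<^sub>v" "z = \<pi> * y" unfolding integers_eq by blast
    then have "x / \<pi> ^ Suc n \<in> O\<^sub>v" unfolding z_def using \<pi>s(3) by (simp add: field_simps)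
    then show False using n(1) by blast
  qed
  then obtain y where y: "y \<in> O\<^sub>v" "z * y = 1"
    using \<pi> z unfolding uniformiser_def integers_eq by blast
  have "inverse z = y" using y(2) by (rule inverse_unique)
  then have "vunit z" unfolding vunit_def using n(2) y unfolding z_def by auto
  then show ?thesis unfolding z_def by blast
qed

lemma uniformised:
  assumes x: "x \<in> K" "x \<noteq> 0"
  shows "\<exists>k u. x = \<pi> powi k * u \<and> u \<in> O\<^sub>v \<and> inverse u \<in> O\<^sub>v"
proof (cases "x \<in> O\<^sub>v")
  case True
  then obtain k where k: "vunit (x / \<pi> ^ k)" using uniformised_integral x by blast
  have "x = \<pi> powi int k * (x / \<pi> ^ k)" using uniformiser_simps(3) by simp
  then show ?thesis using k unfolding vunit_def by blast
next
  case False
  then have "inverse x \<in> O\<^sub>v" using val by blast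
  then obtain k where k: "vunit (inverse x / \<pi> ^ k)"
    using uniformised_integral[OF K_closed(4)[OF x(1)]] x(2) by auto
  have "x = \<pi> powi (- int k) * inverse (inverse x / \<pi> ^ k)"
    using uniformiser_simps(3) x(2) by (simp add: power_int_minus field_simps)
  then show ?thesis using vunit_simps(3)[OF k] unfolding vunit_def by blast
qed

lemma valued_galois:
  assumes r: "r 0 = \<pi>" "\<And>n. r (Suc n) ^ CARD('p) = r n"
  shows "valued_galois (Gal K) O\<^sub>v CARD('p) \<pi> r"
proof -
  interpret automorphism_group "Gal K" by (rule automorphism_group_Gal[OF alg])
  show ?thesis
  proof
    show "g x \<in> O\<^sub>v" if "g \<in> Gal K" "x \<in> O\<^sub>v" for g x using stable[OF that] .
    show "prime CARD('p)" by (rule prime_card)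
    show "inverse (of_nat CARD('p)) \<notin> O\<^sub>v" by (rule p_not_unit)
    show "\<pi> \<noteq> 0" "inverse \<pi> \<notin> O\<^sub>v" by (fact uniformiser_simps)+
    show "g \<pi> = \<pi>" if "g \<in> Gal K" for g by (rule GalD(3)[OF that uniformiser_simps(1)])
    show "\<exists>k u. x = \<pi> powi k * u \<and> u \<in> O\<^sub>v \<and> inverse u \<in> O\<^sub>v"
      if "x \<in> fixed (Gal K)" "x \<noteq> 0" for x
    proof (rule uniformised[OF _ that(2)])
      show "x \<in> K" by (rule fixed_Gal) (use that(1) in \<open>simp add: fixed_def\<close>)
    qed
    show "r 0 = \<pi>" "r (Suc n) ^ CARD('p) = r n" for n by (fact r)+
    show "\<exists>\<sigma>\<in>Gal K. \<forall>x y n. (\<forall>m\<ge>n. \<tau> m x = y) \<longrightarrow> \<sigma> x = y"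
      if \<tau>: "\<And>n :: nat. \<tau> n \<in> Gal K" for \<tau>
    proof -
      obtain \<sigma> where "\<sigma> \<in> Gal K" "\<And>x y n. (\<And>m. m \<ge> n \<Longrightarrow> \<tau> m x = y) \<Longrightarrow> \<sigma> x = y"
        using Gal_limit[where \<tau> = \<tau>, OF alg \<tau>] by blast
      then show ?thesis by blast
    qed
  qed
qed

end

end

section \<open>Continuous representations\<close>

lemma Gal_finite_ext:
  assumes "finite_ext K L"
  obtains B where "finite B" "\<forall>\<sigma>\<in>Gal K. (\<forall>b\<in>B. \<sigma> b = b) \<longrightarrow> \<sigma> \<in> Gal L"
proof -
  obtain B where B: "finite B" "\<And>x. x \<in> L \<Longrightarrow> \<exists>c. (\<forall>b\<in>B. c b \<in> K) \<and> x = (\<Sum>b\<in>B. c b * b)"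
    using assms unfolding finite_ext_def by blast
  show ?thesis
  proof (intro that[OF B(1)] ballI impI)
    fix \<sigma> assume \<sigma>: "\<sigma> \<in> Gal K" "\<forall>b\<in>B. \<sigma> b = b"
    interpret field_hom \<sigma> by (rule GalD(1)[OF \<sigma>(1)])
    have "\<sigma> x = x" if x: "x \<in> L" for x
    proof -
      obtain c where c: "\<forall>b\<in>B. c b \<in> K" "x = (\<Sum>b\<in>B. c b * b)" using B(2)[OF x] by blast
      have "\<sigma> x = (\<Sum>b\<in>B. \<sigma> (c b) * \<sigma> b)" unfolding c(2) by (simp add: hom_sum hom_mult)
      also have "\<dots> = (\<Sum>b\<in>B. c b * b)" using c(1) \<sigma>(2) GalD(3)[OF \<sigma>(1)] by (intro sum.cong) auto
      finally show ?thesis unfolding c(2) .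
    qed
    then show "\<sigma> \<in> Gal L" using \<sigma>(1) unfolding Gal_def by auto
  qed
qed

text \<open>Induction over the generation of the topology. A generating coset of Gal L that contains
  the identity absorbs right multiplication by Gal L, which contains the stabiliser of generators of
  L.\<close>

lemma krull_neighbourhood:
  assumes "openin (krull_topology K) U" "id \<in> U"
  obtains B where "finite B" "\<forall>\<sigma>\<in>Gal K. (\<forall>b\<in>B. \<sigma> b = b) \<longrightarrow> \<sigma> \<in> U"
proof -
  let ?S = "{(\<lambda>\<tau>. \<sigma> \<circ> \<tau>) ` Gal L | \<sigma> L. \<sigma> \<in> Gal K \<and> finite_ext K L}"
  let ?P = "\<lambda>U. \<exists>B. finite B \<and> (\<forall>\<sigma>\<in>Gal K. (\<forall>b\<in>B. \<sigma> b = b) \<longrightarrow> \<sigma> \<in> U)"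
  have "generate_topology_on ?S U"
    using assms(1) unfolding krull_topology_def openin_topology_generated_by_iff .
  then have "id \<in> U \<longrightarrow> ?P U"
  proof (induction rule: generate_topology_on.induct)
    case Empty
    show ?case by simp
  next
    case (Int a b)
    show ?case
    proof
      assume "id \<in> a \<inter> b"
      then have "id \<in> a" "id \<in> b" by auto
      then have "?P a" "?P b" using Int by blast+
      obtain A where A: "finite A" "\<forall>\<sigma>\<in>Gal K. (\<forall>b\<in>A. \<sigma> b = b) \<longrightarrow> \<sigma> \<in> a"
        using \<open>?P a\<close> by blast
      obtain B where B: "finite B" "\<forall>\<sigma>\<in>Gal K. (\<forall>b\<in>B. \<sigma> b = b) \<longrightarrow> \<sigma> \<in> b"
        using \<open>?P b\<close> by blast
      from A B show "?P (a \<inter> b)" by (intro exI[of _ "A \<union> B"]) auto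
    qed
  next
    case (UN C)
    show ?case
    proof
      assume "id \<in> \<Union> C"
      then obtain k where k: "k \<in> C" "id \<in> k" by blast
      then have "?P k" using UN by blast
      then show "?P (\<Union> C)" using k(1) by blast
    qed
  next
    case (Basis s)
    show ?case
    proof
      assume "id \<in> s"
      obtain \<sigma> L where \<sigma>: "s = (\<lambda>\<tau>. \<sigma> \<circ> \<tau>) ` Gal L" "finite_ext K L" using Basis by blast
      obtain \<tau> where \<tau>: "id = \<sigma> \<circ> \<tau>" "\<tau> \<in> Gal L" using \<open>id \<in> s\<close> \<sigma>(1) by blast
      obtain B where B: "finite B" "\<forall>\<sigma>\<in>Gal K. (\<forall>b\<in>B. \<sigma> b = b) \<longrightarrow> \<sigma> \<in> Gal L"
        using Gal_finite_ext[OF \<sigma>(2)] .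
      have "\<rho> \<in> s" if \<rho>: "\<rho> \<in> Gal K" "\<forall>b\<in>B. \<rho> b = b" for \<rho>
      proof -
        have "\<tau> \<circ> \<rho> \<in> Gal L" using Gal_comp[OF \<tau>(2)] B(2) \<rho> by blast
        moreover have "\<rho> = \<sigma> \<circ> (\<tau> \<circ> \<rho>)" by (simp add: comp_assoc[symmetric] \<tau>(1)[symmetric])
        ultimately show ?thesis unfolding \<sigma>(1) by blast
      qed
      then show "?P s" using B(1) by blast
    qed
  qed
  then show ?thesis using assms(2) that by blast
qed

text \<open>The space of a generated topology is the union of its generators; the trivial extension
  K / K provides one containing the identity.\<close>

lemma id_in_krull:
  assumes "subfield_set K"
  shows "id \<in> topspace (krull_topology K)"
proof -
  have "finite_ext K K"
    unfolding finite_ext_def using assms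
    by (intro conjI exI[of _ "{1}"]) (auto simp: subfield_set_def intro!: exI[of _ "\<lambda>_. _"])
  moreover have "id \<in> Gal K" unfolding Gal_def by (auto, unfold_locales) auto
  moreover have "id = id \<circ> (id :: 'a \<Rightarrow> 'a)" by simp
  ultimately show ?thesis unfolding krull_topology_def topology_generated_by_topspace by blast
qed

lemma Rep_GalD:
  assumes "Rep_Gal K V"
  shows "space V = UNIV" "null V = 0" "\<exists>B. finite_dimensional_vector_space (scal V) B"
    "\<And>g. g \<in> Gal K \<Longrightarrow> Vector_Spaces.linear (scal V) (scal V) (act V g)"
    "act V id = id" "\<And>g h. g \<in> Gal K \<Longrightarrow> h \<in> Gal K \<Longrightarrow> act V (g \<circ> h) = act V g \<circ> act V h"
    "continuous_map (prod_topology (krull_topology K) (discrete_topology UNIV))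
       (discrete_topology UNIV) (\<lambda>(g, v). act V g v)"
  using assms unfolding Rep_Gal_def by blast+

lemma Rep_Gal_group_rep:
  assumes V: "Rep_Gal K V" and K: "alg_closure_of K"
  obtains BV where "group_rep (Gal K) (scal V) BV (act V)"
proof -
  obtain BV where BV: "finite_dimensional_vector_space (scal V) BV" using Rep_GalD(3)[OF V] by blast
  interpret automorphism_group "Gal K" by (rule automorphism_group_Gal[OF K])
  interpret finite_dimensional_vector_space "scal V" BV by (rule BV)
  have "group_rep (Gal K) (scal V) BV (act V)"
  proof
    fix g x y c assume "g \<in> Gal K"
    then interpret l: Vector_Spaces.linear "scal V" "scal V" "act V g" by (rule Rep_GalD(4)[OF V])
    show "act V g (x + y) = act V g x + act V g y"
      by (rule l.add)
    show "act V g (scal V c x) = scal V c (act V g x)"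
      by (rule l.scale)
  next
    show "act V id x = x" for x using Rep_GalD(5)[OF V] by simp
    show "act V (g \<circ> h) x = act V g (act V h x)" if "g \<in> Gal K" "h \<in> Gal K" for g h x
      using Rep_GalD(6)[OF V that] by simp
  qed
  then show ?thesis by (rule that)
qed

text \<open>With discrete coefficients, continuity makes the stabiliser of each vector contain a
  neighbourhood of the identity; the finitely many vectors of a basis determine the action.\<close>

lemma Rep_Gal_stabiliser:
  assumes V: "Rep_Gal K V" and K: "alg_closure_of K"
  obtains B where "finite B"
    "\<forall>\<sigma>\<in>Gal K. (\<forall>b\<in>B. \<sigma> b = b) \<longrightarrow> (\<forall>x. act V \<sigma> x = x)"
proof -
  obtain BV where rep: "group_rep (Gal K) (scal V) BV (act V)" using Rep_Gal_group_rep[OF V K] .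
  interpret group_rep "Gal K" "scal V" BV "act V" by (rule rep)
  let ?X = "krull_topology K" and ?D = "discrete_topology (UNIV :: 'c set)"
  have id_top: "id \<in> topspace ?X" by (rule id_in_krull) (use K in \<open>simp add: alg_closure_of_def\<close>)
  have "\<exists>B. finite B \<and> (\<forall>\<sigma>\<in>Gal K. (\<forall>b\<in>B. \<sigma> b = b) \<longrightarrow> act V \<sigma> v = v)" for v
  proof -
    let ?S = "{z \<in> topspace (prod_topology ?X ?D). (\<lambda>(g, v). act V g v) z \<in> {v}}"
    have "openin (prod_topology ?X ?D) ?S"
      by (rule openin_continuous_map_preimage[OF Rep_GalD(7)[OF V]]) simp
    moreover have "(id, v) \<in> ?S" using id_top by (simp add: ac_id)
    ultimately obtain U U' where U: "openin ?X U" "id \<in> U" "v \<in> U'" "U \<times> U' \<subseteq> ?S"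
      unfolding openin_prod_topology_alt by blast
    obtain B where "finite B" "\<forall>\<sigma>\<in>Gal K. (\<forall>b\<in>B. \<sigma> b = b) \<longrightarrow> \<sigma> \<in> U"
      using krull_neighbourhood[OF U(1,2)] .
    then show ?thesis using U(3,4) by (intro exI[of _ B]) fastforce
  qed
  then obtain B where B: "\<And>v. finite (B v)"
    "\<And>v \<sigma>. \<sigma> \<in> Gal K \<Longrightarrow> \<forall>b\<in>B v. \<sigma> b = b \<Longrightarrow> act V \<sigma> v = v" by metis
  show ?thesis
  proof (intro that[of "\<Union>v\<in>BV. B v"] ballI impI allI)
    show "finite (\<Union>v\<in>BV. B v)" using finite_Basis B(1) by blast
    fix \<sigma> x assume \<sigma>: "\<sigma> \<in> Gal K" "\<forall>b\<in>\<Union>v\<in>BV. B v. \<sigma> b = b"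
    have "subspace {x. act V \<sigma> x = x}"
      unfolding subspace_def using \<sigma>(1) by (auto simp: ac_zero ac_add ac_scale)
    moreover have "BV \<subseteq> {x. act V \<sigma> x = x}" using B(2)[OF \<sigma>(1)] \<sigma>(2) by blast
    ultimately have "span BV \<subseteq> {x. act V \<sigma> x = x}" by (rule span_minimal[rotated])
    then show "act V \<sigma> x = x" using span_Basis by auto
  qed
qed

lemma restrict_Rep_Gal:
  assumes "Rep_Gal K V"
  shows "restrict_rep V A = \<lparr>space = A, null = 0, scal = scal V, act = act V\<rparr>"
  using Rep_GalD(2)[OF assms] unfolding restrict_rep_def by (cases V) simp

lemma Rep_Gal_eq:
  assumes "Rep_Gal K V"
  shows "V = \<lparr>space = UNIV, null = 0, scal = scal V, act = act V\<rparr>"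
  using Rep_GalD(1,2)[OF assms] by (cases V) simp

lemma Gal_K_infinity:
  assumes "h \<in> Gal K" "\<And>n. h (r n) = r n"
  shows "h \<in> Gal (K_infinity K r)"
proof -
  interpret field_hom h by (rule GalD(1)[OF assms(1)])
  have "subfield_set {x. h x = x}"
    unfolding subfield_set_def by (auto simp: hom_distribs)
  then have "adjoin K (r n) \<subseteq> {x. h x = x}" for n
    unfolding adjoin_def using assms GalD(3)[OF assms(1)] by (intro hull_minimal) auto
  then have "h x = x" if "x \<in> K_infinity K r" for x using that unfolding K_infinity_def by blast
  then show ?thesis using assms(1) unfolding Gal_def by auto
qed

text \<open>A root of 1 + X + ... + X^(n-1), which is not 1 because the value there is n.\<close>

lemma exists_root_of_unity:
  assumes "n > 1" "of_nat n \<noteq> (0 :: 'b::alg_closed_field)"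
  obtains \<zeta> :: "'b::alg_closed_field" where "\<zeta> ^ n = 1" "\<zeta> \<noteq> 1"
proof -
  obtain m where m: "n = Suc m" "m > 0" using assms(1) by (cases n) auto
  obtain \<zeta> :: 'b where "(\<Sum>k\<le>m. 1 * \<zeta> ^ k) = 0"
    using alg_closed[OF m(2), of "\<lambda>_. 1"] by auto
  then have z: "(\<Sum>k<n. \<zeta> ^ k) = 0" unfolding m(1) lessThan_Suc_atMost by simp
  have "\<zeta> ^ n - 1 = (\<zeta> - 1) * (\<Sum>k<n. \<zeta> ^ k)" by (rule power_diff_1_eq)
  then have "\<zeta> ^ n = 1" unfolding z by simp
  moreover have "\<zeta> \<noteq> 1" using z assms(2) by auto
  ultimately show ?thesis by (rule that)
qed

text \<open>The description in \<open>cyclotomic_char\<close> is resolved at \<zeta>: its powers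
  below p are distinct, so the exponent below p is unique.\<close>

lemma (in valued_galois) cyclotomic_char_power:
  assumes \<zeta>: "\<zeta> ^ p = 1" "\<zeta> \<noteq> (1 :: 'a)" and g: "g \<in> G"
  shows "\<exists>n. cyclotomic_char p g = (of_nat n :: 'f::field) \<and> g \<zeta> = \<zeta> ^ n"
proof -
  let ?P = "\<lambda>a. a < p \<and> (\<forall>x. x ^ p = 1 \<longrightarrow> g x = x ^ a)"
  have "g \<zeta> ^ p = 1" using \<zeta>(1) g by (simp flip: hom_simps(9) add: hom_simps(2))
  then obtain a where a: "a < p" "g \<zeta> = \<zeta> ^ a" using roots_of_unity_powers[OF \<zeta>] by metis
  have "?P a"
  proof (intro conjI allI impI a(1))
    fix x :: 'a assume "x ^ p = 1"
    then obtain i where "x = \<zeta> ^ i" using roots_of_unity_powers[OF \<zeta>] by metis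
    then show "g x = x ^ a"
      using g a(2) by (simp add: hom_simps mult.commute flip: power_mult)
  qed
  moreover have "b = a" if "?P b" for b
  proof -
    have "\<zeta> ^ b = \<zeta> ^ a" using that \<zeta>(1) a(2) by auto
    then show ?thesis
      using inj_onD[OF inj_powers_root_of_unity[OF \<zeta>], of b a] that a(1) by simp
  qed
  ultimately have "(THE a. ?P a) = a" by (rule the_equality)
  then have "cyclotomic_char p g = (of_nat a :: 'f)" unfolding cyclotomic_char_def by simp
  then show ?thesis using a(2) by blast
qed

theorem theorem2p1p3:
  fixes \<iota> :: "'p::prime_card padic \<Rightarrow> 'a::alg_closed_field"
    and K :: "'a set"
    and \<pi> :: 'a
    and r :: "nat \<Rightarrow> 'a"
    and V :: "('a \<Rightarrow> 'a, 'f::alg_closed_field, 'v::ab_group_add) rep"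
    and W :: "('a \<Rightarrow> 'a, 'f, 'w::ab_group_add) rep"
    and f :: "'v \<Rightarrow> 'w"
  assumes coefficients: "CHAR('f) = CARD('p)" "alg_closure_of (range of_int :: 'f set)"
    and K: "field_hom \<iota>" "finite_ext (range \<iota>) K" "alg_closure_of K"
    and uniformiser: "uniformiser (integers \<iota> K) \<pi>"
    and roots: "r 0 = \<pi>" "\<And>n. r (Suc n) ^ CARD('p) = r n"
    and V: "Rep_Gal K V" "cyclotomic_free CARD('p) K V"
    and W: "Rep_Gal K W" "cyclotomic_free CARD('p) K W"
    and f: "rep_hom (Gal (K_infinity K r)) V W f"
  shows "rep_hom (Gal K) V W f"
proof -
  let ?p = "CARD('p)" and ?\<chi> = "cyclotomic_char CARD('p) :: ('a \<Rightarrow> 'a) \<Rightarrow> 'f"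
  interpret padic_field \<iota> K by (rule padic_field.intro) (fact K)+
  interpret valued_galois "Gal K" "integral_closure_set \<iota>" ?p \<pi> r
    by (rule valued_galois[OF uniformiser roots])
  obtain BV where BV: "group_rep (Gal K) (scal V) BV (act V)" using Rep_Gal_group_rep[OF V(1) K(3)] .
  obtain BW where BW: "group_rep (Gal K) (scal W) BW (act W)" using Rep_Gal_group_rep[OF W(1) K(3)] .
  interpret V: group_rep "Gal K" "scal V" BV "act V" by (rule BV)
  interpret W: group_rep "Gal K" "scal W" BW "act W" by (rule BW)
  obtain SV where SV: "finite SV"
    "\<forall>\<sigma>\<in>Gal K. (\<forall>b\<in>SV. \<sigma> b = b) \<longrightarrow> (\<forall>x. act V \<sigma> x = x)"
    using Rep_Gal_stabiliser[OF V(1) K(3)] .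
  obtain SW where SW: "finite SW"
    "\<forall>\<sigma>\<in>Gal K. (\<forall>b\<in>SW. \<sigma> b = b) \<longrightarrow> (\<forall>x. act W \<sigma> x = x)"
    using Rep_Gal_stabiliser[OF W(1) K(3)] .
  have p0: "?p > 0" by (rule prime_gt_0_nat[OF p])
  obtain \<zeta> :: 'a where \<zeta>: "\<zeta> ^ ?p = 1" "\<zeta> \<noteq> 1"
    using exists_root_of_unity[OF prime_gt_1_nat[OF p] char_0[OF p0]] .
  note fD = f[unfolded rep_hom_def Rep_GalD(1)[OF V(1)] Rep_GalD(1)[OF W(1)]]
  \<comment> \<open>One finite set that detects both actions and, through the p-th roots of unity,
    the cyclotomic character.\<close>
  define B where "B = SV \<union> SW \<union> {z. z ^ ?p = 1}"
  have "rep_pair TYPE('p) (Gal K) (integral_closure_set \<iota>) ?p \<pi> r (scal V) BV (act V) (scal W) BW (act W)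
      f B \<zeta> ?\<chi>"
  proof (intro rep_pair.intro rep_pair_axioms.intro valued_galois_axioms BV BW refl)
    show "of_nat ?p = (0 :: 'f)" unfolding coefficients(1)[symmetric] by (rule of_nat_CHAR)
    show "f (x + y) = f x + f y" "f (scal V k x) = scal W k (f x)" for x y k using fD by blast+
    show "f (act V h x) = act W h (f x)" if "h \<in> H" for h x
    proof -
      have "h \<in> Gal (K_infinity K r)" using that Gal_K_infinity unfolding H_def by blast
      then show ?thesis using fD by blast
    qed
    show "finite B" unfolding B_def using SV(1) SW(1) finite_roots(1)[OF p0] by blast
    show "act V \<sigma> x = x" if "\<sigma> \<in> stab B" for \<sigma> x
      using SV(2) that unfolding stab_def B_def by blast
    show "act W \<sigma> x = x" if "\<sigma> \<in> stab B" for \<sigma> x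
      using SW(2) that unfolding stab_def B_def by blast
    show "z \<in> B" if "z ^ ?p = 1" for z unfolding B_def using that by blast
    show "\<zeta> ^ ?p = 1" "\<zeta> \<noteq> 1" by (fact \<zeta>)+
    show "\<exists>n. ?\<chi> g = of_nat n \<and> g \<zeta> = \<zeta> ^ n" if "g \<in> Gal K" for g
      by (rule cyclotomic_char_power[OF \<zeta> that])
  qed
  then interpret rep_pair "Gal K" "integral_closure_set \<iota>" ?p \<pi> r "scal V" BV "act V" "scal W" BW
    "act W" f B \<zeta> ?\<chi> "TYPE('p)" .
  have full: "V = V.sub UNIV" "W = W.sub UNIV" using Rep_Gal_eq[OF V(1)] Rep_Gal_eq[OF W(1)] .
  obtain n F where F: "composition_series (Gal K) (V.sub UNIV) n F"
    "\<And>i. i < n \<Longrightarrow> \<not> JH_factor (Gal K) (twist ?\<chi> (quot_rep (V.sub (F i)) (F (Suc i)))) (V.sub (F (Suc i)))"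
    using V(2) full(1) unfolding cyclotomic_free_def restrict_Rep_Gal[OF V(1)] by metis
  obtain m E where E: "composition_series (Gal K) (W.sub UNIV) m E"
    "\<And>i. i < m \<Longrightarrow> \<not> JH_factor (Gal K) (twist ?\<chi> (quot_rep (W.sub (E i)) (E (Suc i)))) (W.sub (E (Suc i)))"
    using W(2) full(2) unfolding cyclotomic_free_def restrict_Rep_Gal[OF W(1)] by metis
  have "f (act V g x) = act W g (f x)" if "g \<in> Gal K" for g x
    by (rule equivariant[OF F E that])
  then show ?thesis
    using fD unfolding rep_hom_def Rep_GalD(1)[OF V(1)] Rep_GalD(1)[OF W(1)] by blast
qed

end
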